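(* Let $\Omega\subset\mathbb{R}^n$ be a bounded, connected open set with $C^1$ boundary, let $\varphi\in\Phi_w(\Omega)$ satisfy (A0), let $\alpha=(\alpha_1,\alpha_2)\in\mathbb{R}^+\times\mathbb{R}^+$ and let $1<p\le\frac{n}{n-1}$. Let $H$ be a Hilbert space and let $K:L^p(\Omega)\to H$ be a bounded linear operator which is injective on the space $\mathcal{P}^1(\Omega)$ of affine functions on $\Omega$. Then for every $f\in H$ the minimum problem $$\min_{u\in L^p(\Omega)}\ \frac12\|Ku-f\|_H+TGV^{\varphi,2}_\alpha(u)$$ has a solution.
   Context: $\varphi\in\Phi_w(\Omega)$ means $\varphi:\Omega\times[0,\infty)\to[0,\infty]$ with: $x\mapsto\varphi(x,|f(x)|)$ measurable for every measurable $f$; $t\mapsto\varphi(x,t)$ non-decreasing; $\varphi(x,0)=\lim_{t\to0^+}\varphi(x,t)=0$, $\lim_{t\to\infty}\varphi(x,t)=\infty$ for every $x$; there is $L\ge1$ independent of $x$ with $\varphi(x,s)/s\le L\varphi(x,t)/t$ for $0<s\le t$. (A0): there is $\beta\in(0,1]$ with $\varphi(x,\beta)\le1\le\varphi(x,1/\beta)$ for all $x$. Conjugate $\varphi^*(x,t)=\sup_{s\ge0}(st-\varphi(x,s))$; $\|f\|_{\varphi^*}=\inf\{\lambda>0:\int_\Omega\varphi^*(x,|f|/\lambda)dx\le1\}$ ($|\cdot|$ Euclidean/Frobenius norm). $TGV^{\varphi,2}_\alpha(u)=\sup\{\int_\Omega u\,\mathrm{div}^2\psi\,dx:\psi\in C^2_c(\Omega;\mathbb{R}^{n\times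 n}_{\rm sym}),\|\psi\|_{\varphi^*}\le\alpha_1,\|\mathrm{div}\,\psi\|_{\varphi^*}\le\alpha_2\}$, with $(\mathrm{div}\,\psi)_i=\sum_j\partial_j\psi_{ij}$, $\mathrm{div}^2\psi=\sum_i\partial_{ii}\psi_{ii}+2\sum_{i<j}\partial_{ij}\psi_{ij}$. *)

theory Defs
  imports "HOL-Analysis.Analysis"
begin

definition partial_deriv :: "'n::finite \<Rightarrow> (real^'n \<Rightarrow> real) \<Rightarrow> real^'n \<Rightarrow> real" where
  "partial_deriv i f x = frechet_derivative f (at x) (axis i 1)"

definition C1_fun :: "(real^'n::finite \<Rightarrow> real) \<Rightarrow> bool" where
  "C1_fun f \<longleftrightarrow> (\<forall>x. f differentiable (at x)) \<and> (\<forall>i. continuous_on UNIV (partial_deriv i f))"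

definition C2_fun :: "(real^'n::finite \<Rightarrow> real) \<Rightarrow> bool" where
  "C2_fun f \<longleftrightarrow> C1_fun f \<and> (\<forall>i. C1_fun (partial_deriv i f))"

text \<open>Bounded open set whose boundary is locally, after a rigid motion, the graph of a
  C^1 function of the remaining n-1 coordinates, with the set lying above the graph.\<close>
definition C1_boundary :: "(real^'n::finite) set \<Rightarrow> bool" where
  "C1_boundary \<Omega> \<longleftrightarrow>
    (\<forall>x0\<in>frontier \<Omega>. \<exists>r>0. \<exists>T k. \<exists>\<gamma>::real^'n \<Rightarrow> real.
        orthogonal_transformation T \<and> C1_fun \<gamma> \<and>
        (\<forall>x y. (\<forall>i. i \<noteq> k \<longrightarrow> x $ i = y $ i) \<longrightarrow> \<gamma> x = \<gamma> y) \<and>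
        \<Omega> \<inter> ball x0 r = {x \<in> ball x0 r. T (x - x0) $ k > \<gamma> (T (x - x0))})"

definition Phi_w :: "(real^'n::finite) set \<Rightarrow> (real^'n \<Rightarrow> real \<Rightarrow> ennreal) \<Rightarrow> bool" where
  "Phi_w \<Omega> \<phi> \<longleftrightarrow>
     (\<forall>f::real^'n \<Rightarrow> real. f \<in> borel_measurable (lebesgue_on \<Omega>) \<longrightarrow>
          (\<lambda>x. \<phi> x \<bar>f x\<bar>) \<in> borel_measurable (lebesgue_on \<Omega>)) \<and>
     (\<forall>x\<in>\<Omega>. mono_on {0..} (\<phi> x)) \<and>
     (\<forall>x\<in>\<Omega>. \<phi> x 0 = 0 \<and> (\<phi> x \<longlongrightarrow> 0) (at_right 0)) \<and>
     (\<forall>x\<in>\<Omega>. (\<phi> x \<longlongrightarrow> \<infinity>) at_top) \<and>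
     (\<exists>L\<ge>1. \<forall>x\<in>\<Omega>. \<forall>s t. 0 < s \<and> s \<le> t \<longrightarrow>
          \<phi> x s / ennreal s \<le> ennreal L * \<phi> x t / ennreal t)"

definition A0 :: "(real^'n::finite) set \<Rightarrow> (real^'n \<Rightarrow> real \<Rightarrow> ennreal) \<Rightarrow> bool" where
  "A0 \<Omega> \<phi> \<longleftrightarrow> (\<exists>\<beta>. 0 < \<beta> \<and> \<beta> \<le> 1 \<and> (\<forall>x\<in>\<Omega>. \<phi> x \<beta> \<le> 1 \<and> 1 \<le> \<phi> x (1/\<beta>)))"

definition phi_conj :: "(real^'n::finite \<Rightarrow> real \<Rightarrow> ennreal) \<Rightarrow> real^'n \<Rightarrow> real \<Rightarrow> ereal" where
  "phi_conj \<phi> x t = (SUP s\<in>{0..}. ereal (s * t) - enn2ereal (\<phi> x s))"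

text \<open>Luxemburg norm w.r.t. phi^*; norm on real^'n^'n is the Frobenius norm.\<close>
definition lux_norm :: "(real^'n::finite \<Rightarrow> real \<Rightarrow> ennreal) \<Rightarrow> (real^'n) set
      \<Rightarrow> (real^'n \<Rightarrow> 'v::real_normed_vector) \<Rightarrow> ereal" where
  "lux_norm \<phi> \<Omega> g = Inf {ereal l | l. l > 0 \<and>
       (\<integral>\<^sup>+x. e2ennreal (phi_conj \<phi> x (norm (g x) / l)) \<partial>lebesgue_on \<Omega>) \<le> 1}"

definition admissible_field :: "(real^'n::finite) set \<Rightarrow> (real^'n \<Rightarrow> real^'n^'n) \<Rightarrow> bool" where
  "admissible_field \<Omega> \<psi> \<longleftrightarrow>
     (\<forall>i j. C2_fun (\<lambda>y. \<psi> y $ i $ j)) \<and>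
     (\<forall>x i j. \<psi> x $ i $ j = \<psi> x $ j $ i) \<and>
     compact (closure {x. \<psi> x \<noteq> 0}) \<and> closure {x. \<psi> x \<noteq> 0} \<subseteq> \<Omega>"

definition div_field :: "(real^'n::finite \<Rightarrow> real^'n^'n) \<Rightarrow> real^'n \<Rightarrow> real^'n" where
  "div_field \<psi> x = (\<chi> i. \<Sum>j\<in>UNIV. partial_deriv j (\<lambda>y. \<psi> y $ i $ j) x)"

definition div2_field :: "(real^('n::{finite,linorder}) \<Rightarrow> real^('n::{finite,linorder})^('n::{finite,linorder})) \<Rightarrow> real^('n::{finite,linorder}) \<Rightarrow> real" where
  "div2_field \<psi> x =
     (\<Sum>i\<in>UNIV. partial_deriv i (partial_deriv i (\<lambda>y. \<psi> y $ i $ i)) x) +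
     2 * (\<Sum>i\<in>UNIV. \<Sum>j\<in>{j. i < j}. partial_deriv i (partial_deriv j (\<lambda>y. \<psi> y $ i $ j)) x)"

definition TGV2 :: "(real^('n::{finite,linorder}) \<Rightarrow> real \<Rightarrow> ennreal) \<Rightarrow> (real^('n::{finite,linorder})) set
     \<Rightarrow> real \<Rightarrow> real \<Rightarrow> (real^('n::{finite,linorder}) \<Rightarrow> real) \<Rightarrow> ereal" where
  "TGV2 \<phi> \<Omega> \<alpha>1 \<alpha>2 u = Sup {ereal (LINT x|lebesgue_on \<Omega>. u x * div2_field \<psi> x) | \<psi>.
       admissible_field \<Omega> \<psi> \<and> lux_norm \<phi> \<Omega> \<psi> \<le> ereal \<alpha>1 \<and>
       lux_norm \<phi> \<Omega> (div_field \<psi>) \<le> ereal \<alpha>2}"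

definition Lp_space :: "real \<Rightarrow> (real^'n::finite) set \<Rightarrow> (real^'n \<Rightarrow> real) set" where
  "Lp_space p \<Omega> = {u. u \<in> borel_measurable (lebesgue_on \<Omega>) \<and>
                       integrable (lebesgue_on \<Omega>) (\<lambda>x. \<bar>u x\<bar> powr p)}"

definition Lp_norm :: "real \<Rightarrow> (real^'n::finite) set \<Rightarrow> (real^'n \<Rightarrow> real) \<Rightarrow> real" where
  "Lp_norm p \<Omega> u = (LINT x|lebesgue_on \<Omega>. \<bar>u x\<bar> powr p) powr (1/p)"

end

theory Submission
  imports Defs
begin

text \<open>
  By (A0), bounded fields are small in the Luxemburg norm, so testing TGV with fields
  \<open>\<eta> d \<otimes> d\<close> bounds the pairing of u with second directional derivatives of \<open>\<eta>\<close> by the sup norms of \<open>\<eta>\<close>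
  and of its derivative along d. For mollifications W of u this bounds the L1 norm of the first order Taylor
  remainders of W. Averaging over the base point shows that W is L1-close to a Taylor
  polynomial on an interior ball. The boundary being a C1 graph, a cone of directions
  points into the domain; along these directions the Taylor remainders transfer the estimate to a
  neighbourhood of a boundary point, also for derivatives in n independent directions, and
  Gagliardo's argument along these directions yields the exponent n/(n-1) without any extension
  operator. Mollifiers supported in the cone let the mollification tend to u, and
  connectedness glues the local affine functions. Hence TGV controls the distance of u to the affine
  functions in Lp, and injectivity of K on these makes sublevel sets bounded.
  Weak compactness is replaced by uniform convexity: in the nested convex
  sublevel sets near the infimum, elements of almost minimal norm form a Cauchy sequence,
  whose strong limit is a minimiser.
\<close>

section \<open>Line integrals and the Gagliardo--Nirenberg inequality\<close>

text \<open>TGV sees u only through fields with compact support in \<Omega> that are bounded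
  together with their divergence. For \<open>\<eta> d d^T\<close> the divergence is
  \<open>(dird d \<eta>) d\<close>, so among the first derivatives of \<eta> only the one along d
  has to be bounded. The Taylor kernel is made for this: two integrations along d undo two
  derivatives, so the test function and its derivative along d have bounds 1 and 2 that do not
  depend on the mollification scale. The price is a support condition: base point, segment and
  mollifier support must add up to a compact subset of \<Omega>. At a boundary point this forces
  segment and mollifier to point into one convex cone. There the two displacements add up to a cone
  displacement again, and to a strictly positive one, because the mollifier is centred off the
  origin. The same cone serves Gagliardo's argument: only forward half lines are used, and they stay
  in \<Omega> until a cutoff has vanished. All estimates are normalised to a pairing bound of 1;
  homogeneity restores the level of u at the end.\<close>

text \<open>Unlike \<^const>\<open>powr\<close>, this power satisfies \<open>0\<^sup>0 = 1\<close>, which the Hoelder inequality with zero weights needs.\<close>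

definition epow :: "ennreal \<Rightarrow> real \<Rightarrow> ennreal" where
  "epow x a = (if a = 0 then 1 else if x = \<infinity> then \<infinity> else ennreal (enn2real x powr a))"

lemma epow_0 [simp]: "epow x 0 = 1"
  by (simp add: epow_def)

lemma epow_1 [simp]: "epow x 1 = x"
  by (cases x) (auto simp: epow_def)

lemma epow_ennreal: "a \<noteq> 0 \<Longrightarrow> 0 \<le> r \<Longrightarrow> epow (ennreal r) a = ennreal (r powr a)"
  by (simp add: epow_def)

lemma epow_top [simp]: "a \<noteq> 0 \<Longrightarrow> epow top a = top"
  by (simp add: epow_def)

lemma epow_zero [simp]: "a \<noteq> 0 \<Longrightarrow> epow 0 a = 0"
  by (simp add: epow_def)

lemma epow_eq_0_iff: "epow x a = 0 \<longleftrightarrow> a \<noteq> 0 \<and> x = 0"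
  by (cases x) (auto simp: epow_def)

lemma epow_mono: "0 \<le> a \<Longrightarrow> x \<le> y \<Longrightarrow> epow x a \<le> epow y a"
  by (cases x; cases y) (auto simp: epow_def powr_mono2 top_unique)

lemma epow_add: "0 \<le> a \<Longrightarrow> 0 \<le> b \<Longrightarrow> epow x (a + b) = epow x a * epow x b"
  by (cases x) (auto simp: epow_def powr_add ennreal_mult ennreal_top_mult ennreal_mult_top)

lemma epow_mult:
  assumes "0 \<le> a"
  shows "epow (x * y) a = epow x a * epow y a"
proof (cases "x = 0 \<or> y = 0")
  case True
  then show ?thesis using assms by (cases "a = 0") auto
next
  case False
  show ?thesis
  proof (cases "a = 0")
    case True
    then show ?thesis by simp
  next
    case a: False
    show ?thesis
    proof (cases "x = \<infinity> \<or> y = \<infinity>")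
      case True
      then show ?thesis
        using False a by (auto simp: ennreal_mult_eq_top_iff epow_eq_0_iff ennreal_top_mult ennreal_mult_top)
    next
      case fin: False
      obtain r s where rs: "x = ennreal r" "y = ennreal s" "0 \<le> r" "0 \<le> s"
        using fin by (cases x; cases y) auto
      then show ?thesis using a
        by (simp add: epow_ennreal ennreal_mult[symmetric] powr_mult)
    qed
  qed
qed

lemma epow_epow: "epow (epow x a) b = epow x (a * b)"
  by (cases "a = 0"; cases "b = 0"; cases x) (auto simp: epow_def powr_powr)

lemma epow_prod_list: "0 \<le> a \<Longrightarrow> epow (prod_list (map f xs)) a = prod_list (map (\<lambda>x. epow (f x) a) xs)"
  by (induction xs) (auto simp: epow_mult epow_def[of 1])

lemma borel_measurable_epow [measurable]:
  assumes [measurable]: "f \<in> borel_measurable M"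
  shows "(\<lambda>x. epow (f x) a) \<in> borel_measurable M"
  unfolding epow_def by measurable

lemma epow_young:
  assumes "0 \<le> a" "0 \<le> b" "a + b = 1"
  shows "epow x a * epow y b \<le> ennreal a * x + ennreal b * y"
proof -
  consider "a = 0" | "b = 0" | "0 < a" "0 < b" using assms by linarith
  then show ?thesis
  proof cases
    case 3
    show ?thesis
    proof (cases "x = \<infinity> \<or> y = \<infinity>")
      case True
      then have "ennreal a * x + ennreal b * y = \<infinity>"
        using 3 by (auto simp: ennreal_mult_top)
      then show ?thesis by (metis infinity_ennreal_def top_greatest)
    next
      case fin: False
      obtain r s where rs: "x = ennreal r" "y = ennreal s" "0 \<le> r" "0 \<le> s"
        using fin by (cases x; cases y) auto
      have "r powr a * s powr b \<le> a * r + b * s"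
        using 3 rs Youngs_inequality_0[of a b r s] assms by (cases "r = 0 \<or> s = 0") auto
      then show ?thesis using 3 rs
        by (simp add: epow_ennreal ennreal_mult[symmetric] ennreal_plus[symmetric] del: ennreal_plus)
    qed
  qed (use assms in auto)
qed

lemma nn_integral_epow_Holder:
  assumes [measurable]: "f \<in> borel_measurable M" "g \<in> borel_measurable M"
    and ab: "0 \<le> a" "0 \<le> b" "a + b = 1"
  shows "(\<integral>\<^sup>+x. epow (f x) a * epow (g x) b \<partial>M) \<le> epow (\<integral>\<^sup>+x. f x \<partial>M) a * epow (\<integral>\<^sup>+x. g x \<partial>M) b"
    (is "?L \<le> epow ?A a * epow ?B b")
proof -
  consider "a = 0" | "b = 0" | "0 < a" "0 < b" using ab by linarith
  then show ?thesis
  proof cases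
    case 3
    show ?thesis
    proof (cases "?A = 0 \<or> ?B = 0")
      case True
      \<comment> \<open>Separate because the other integral may be infinite: the product of the
        right-hand factors is then no guide, but the integrand on the left vanishes almost
        everywhere.\<close>
      then have "AE x in M. f x = 0 \<or> g x = 0"
      proof
        assume "?A = 0"
        then have "AE x in M. f x = 0" by (simp add: nn_integral_0_iff_AE)
        then show ?thesis by eventually_elim simp
      next
        assume "?B = 0"
        then have "AE x in M. g x = 0" by (simp add: nn_integral_0_iff_AE)
        then show ?thesis by eventually_elim simp
      qed
      then have "AE x in M. epow (f x) a * epow (g x) b = 0"
        by eventually_elim (use 3 in auto)
      then have "?L = 0" by (simp add: nn_integral_0_iff_AE)
      then show ?thesis by simp
    next
      case nz: False
      show ?thesis
      proof (cases "?A = \<infinity> \<or> ?B = \<infinity>")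
        case True
        then have "epow ?A a * epow ?B b = \<infinity>"
          using nz 3 by (auto simp: epow_eq_0_iff ennreal_mult_top ennreal_top_mult)
        then show ?thesis by simp
      next
        case fin: False
        obtain r s where rs: "?A = ennreal r" "?B = ennreal s" "0 < r" "0 < s"
          using fin nz by (cases ?A; cases ?B) (auto simp: less_le)
        let ?C = "epow ?A a * epow ?B b"
        \<comment> \<open>After scaling both functions to integral one, Young's inequality
          integrates to a + b = 1.\<close>
        have eq: "f x = ?A * (ennreal (1/r) * f x)" "g x = ?B * (ennreal (1/s) * g x)" for x
          using rs by (simp_all add: mult.assoc[symmetric] ennreal_mult[symmetric])
        have "?L = (\<integral>\<^sup>+x. ?C * (epow (ennreal (1/r) * f x) a * epow (ennreal (1/s) * g x) b) \<partial>M)"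
          apply (rule nn_integral_cong)
          apply (subst eq(1), subst eq(2))
          by (simp add: epow_mult ab mult_ac)
        also have "\<dots> \<le> (\<integral>\<^sup>+x. ?C * (ennreal a * (ennreal (1/r) * f x) + ennreal b * (ennreal (1/s) * g x)) \<partial>M)"
          by (intro nn_integral_mono mult_left_mono epow_young) (use ab in auto)
        also have "\<dots> = ?C * (ennreal a * (ennreal (1/r) * ?A) + ennreal b * (ennreal (1/s) * ?B))"
          by (simp add: nn_integral_cmult nn_integral_add)
        also have "\<dots> = ?C"
          using rs 3 ab by (simp add: ennreal_mult[symmetric] ennreal_plus[symmetric] del: ennreal_plus)
        finally show ?thesis .
      qed
    qed
  qed (use ab in auto)
qed

text \<open>Split off the first weight w, divide the remaining weights by their sum s so that they
  add up to one again, and use the case of two functions with exponents w and s.\<close>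

lemma nn_integral_epow_Holder_list:
  assumes "\<And>f w. (f, w) \<in> set L \<Longrightarrow> f \<in> borel_measurable M \<and> 0 \<le> w"
    and "(\<Sum>(f, w)\<leftarrow>L. w) = 1"
  shows "(\<integral>\<^sup>+x. (\<Prod>(f, w)\<leftarrow>L. epow (f x) w) \<partial>M) \<le> (\<Prod>(f, w)\<leftarrow>L. epow (\<integral>\<^sup>+x. f x \<partial>M) w)"
  using assms
proof (induction "length L" arbitrary: L)
  case 0
  then show ?case by simp
next
  case (Suc n)
  then obtain f w L' where L: "L = (f, w) # L'" by (cases L) auto
  have [measurable]: "f \<in> borel_measurable M" and w: "0 \<le> w"
    using Suc.prems(1)[of f w] L by auto
  have L': "\<And>g v. (g, v) \<in> set L' \<Longrightarrow> g \<in> borel_measurable M \<and> 0 \<le> v"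
    using Suc.prems(1) L by auto
  define s where "s = (\<Sum>(g, v)\<leftarrow>L'. v)"
  have sw: "w + s = 1" using Suc.prems(2) L by (simp add: s_def)
  have s0: "0 \<le> s" unfolding s_def by (rule sum_list_nonneg) (use L' in auto)
  show ?case
  proof (cases "s = 0")
    case True
    \<comment> \<open>Division by s is impossible here, but nonnegative weights with sum zero all
      vanish and \<open>epow _ 0 = 1\<close> turns the remaining product into 1.\<close>
    have vz: "v = 0" if "(g, v) \<in> set L'" for g v
    proof -
      have "\<And>y. y \<in> set (map snd L') \<Longrightarrow> 0 \<le> y" using L' by auto
      then have "(sum_list (map snd L') = 0) = (\<forall>x\<in>set (map snd L'). x = 0)"
        by (rule sum_list_nonneg_eq_0_iff)
      then show ?thesis using True that by (force simp: s_def case_prod_beta')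
    qed
    have "(\<Prod>(g, v)\<leftarrow>L'. epow (h g) v) = 1" for h
    proof -
      have "map (\<lambda>(g, v). epow (h g) v) L' = map (\<lambda>_. 1) L'"
        by (rule map_cong) (auto dest: vz)
      then show ?thesis by (simp add: map_replicate_const)
    qed
    note 1 = this[of "\<lambda>g. g _"] this[of "\<lambda>g. \<integral>\<^sup>+x. g x \<partial>M"]
    show ?thesis unfolding L using True sw by (simp add: 1)
  next
    case False
    then have sp: "0 < s" using s0 by simp
    define L2 where "L2 = map (\<lambda>(g, v). (g, v / s)) L'"
    have sum2: "(\<Sum>(g, v)\<leftarrow>L2. v) = 1"
    proof -
      have "(\<Sum>(g, v)\<leftarrow>L2. v) = (\<Sum>(g, v)\<leftarrow>L'. v) / s" unfolding L2_def
        by (induction L') (auto simp: add_divide_distrib)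
      then show ?thesis using False by (simp add: s_def)
    qed
    have m2: "\<And>g v. (g, v) \<in> set L2 \<Longrightarrow> g \<in> borel_measurable M \<and> 0 \<le> v"
      using L' sp by (auto simp: L2_def)
    define h where "h x = (\<Prod>(g, v)\<leftarrow>L2. epow (g x) v)" for x
    have hm [measurable]: "h \<in> borel_measurable M"
    proof -
      have "(\<lambda>x. \<Prod>(g, v)\<leftarrow>L2. epow (g x) v) \<in> borel_measurable M"
        using m2
      proof (induction L2)
        case (Cons a L2)
        obtain g v where a: "a = (g, v)" by (cases a)
        have [measurable]: "g \<in> borel_measurable M" using Cons.prems[of g v] a by auto
        have [measurable]: "(\<lambda>x. \<Prod>(g, v)\<leftarrow>L2. epow (g x) v) \<in> borel_measurable M"
          by (rule Cons.IH) (use Cons.prems in auto)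
        show ?case unfolding a by simp
      qed simp
      then show ?thesis by (simp add: h_def[abs_def])
    qed
    have IH: "(\<integral>\<^sup>+x. h x \<partial>M) \<le> (\<Prod>(g, v)\<leftarrow>L2. epow (\<integral>\<^sup>+x. g x \<partial>M) v)"
      unfolding h_def by (rule Suc.hyps(1)) (use Suc.hyps(2) L L2_def m2 sum2 in auto)
    have unscale: "(\<Prod>(g, v)\<leftarrow>L'. epow (k g) v) = epow (\<Prod>(g, v)\<leftarrow>L2. epow (k g) v) s" for k
    proof -
      have "epow (\<Prod>(g, v)\<leftarrow>L2. epow (k g) v) s = (\<Prod>z\<leftarrow>L2. epow (case z of (g, v) \<Rightarrow> epow (k g) v) s)"
        by (rule epow_prod_list) (use sp in simp)
      also have "\<dots> = (\<Prod>(g, v)\<leftarrow>L'. epow (k g) v)"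
        unfolding L2_def map_map o_def
        by (rule arg_cong[where f=prod_list], rule map_cong) (use False in \<open>auto simp: epow_epow\<close>)
      finally show ?thesis by simp
    qed
    have "(\<integral>\<^sup>+x. (\<Prod>(f, w)\<leftarrow>L. epow (f x) w) \<partial>M) = (\<integral>\<^sup>+x. epow (f x) w * epow (h x) s \<partial>M)"
      unfolding L h_def by (simp add: unscale[of "\<lambda>g. g _"])
    also have "\<dots> \<le> epow (\<integral>\<^sup>+x. f x \<partial>M) w * epow (\<integral>\<^sup>+x. h x \<partial>M) s"
      by (rule nn_integral_epow_Holder) (use w s0 sw in auto)
    also have "\<dots> \<le> epow (\<integral>\<^sup>+x. f x \<partial>M) w * epow (\<Prod>(g, v)\<leftarrow>L2. epow (\<integral>\<^sup>+x. g x \<partial>M) v) s"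
      by (intro mult_left_mono epow_mono IH s0) auto
    also have "\<dots> = (\<Prod>(f, w)\<leftarrow>L. epow (\<integral>\<^sup>+x. f x \<partial>M) w)"
      unfolding L by (simp add: unscale)
    finally show ?thesis .
  qed
qed

section \<open>Iterated integrals along lines in prescribed directions\<close>

definition line_int :: "'a::euclidean_space \<Rightarrow> ('a \<Rightarrow> ennreal) \<Rightarrow> 'a \<Rightarrow> ennreal" where
  "line_int d F x = (\<integral>\<^sup>+t. F (x + t *\<^sub>R d) \<partial>lborel)"

text \<open>The head of the list is integrated innermost. Keeping the integrals iterated reduces a
  linear change of variables to one-dimensional translations, shears and scalings.\<close>

fun lines_int :: "'a::euclidean_space list \<Rightarrow> ('a \<Rightarrow> ennreal) \<Rightarrow> 'a \<Rightarrow> ennreal" where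
  "lines_int [] F = F"
| "lines_int (d # ds) F = lines_int ds (line_int d F)"

lemma measurable_line_int [measurable]:
  assumes [measurable]: "F \<in> borel_measurable borel"
  shows "line_int d F \<in> borel_measurable borel"
proof -
  have [measurable]: "(\<lambda>(x, t). F (x + t *\<^sub>R d)) \<in> borel_measurable (borel \<Otimes>\<^sub>M lborel)"
    by measurable
  show ?thesis unfolding line_int_def[abs_def] by measurable
qed

lemma line_int_mono: "(\<And>x. F x \<le> G x) \<Longrightarrow> line_int d F x \<le> line_int d G x"
  unfolding line_int_def by (intro nn_integral_mono) auto

lemma lines_int_mono: "(\<And>x. F x \<le> G x) \<Longrightarrow> lines_int ds F x \<le> lines_int ds G x"
proof (induction ds arbitrary: F G)
  case (Cons d ds)
  have "lines_int ds (line_int d F) x \<le> lines_int ds (line_int d G) x"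
    by (rule Cons.IH) (rule line_int_mono[OF Cons.prems])
  then show ?case by simp
qed simp

lemma line_int_commute:
  assumes [measurable]: "F \<in> borel_measurable borel"
  shows "line_int a (line_int b F) = line_int b (line_int a F)"
proof
  fix x
  have "line_int a (line_int b F) x = (\<integral>\<^sup>+t. \<integral>\<^sup>+s. F (x + t *\<^sub>R a + s *\<^sub>R b) \<partial>lborel \<partial>lborel)"
    by (simp add: line_int_def)
  also have "\<dots> = (\<integral>\<^sup>+s. \<integral>\<^sup>+t. F (x + t *\<^sub>R a + s *\<^sub>R b) \<partial>lborel \<partial>lborel)"
    by (rule lborel_pair.Fubini') measurable
  also have "\<dots> = line_int b (line_int a F) x"
    by (simp add: line_int_def add_ac)
  finally show "line_int a (line_int b F) x = line_int b (line_int a F) x" .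
qed

lemma line_int_shift: 
  assumes [measurable]: "F \<in> borel_measurable borel"
  shows "line_int d F (x + s *\<^sub>R d) = line_int d F x"
proof -
  have "line_int d F x = (\<integral>\<^sup>+t. F (x + t *\<^sub>R d) \<partial>distr lborel borel ((+) s))"
    by (simp add: line_int_def lborel_distr_plus)
  also have "\<dots> = (\<integral>\<^sup>+t. F (x + (s + t) *\<^sub>R d) \<partial>lborel)"
    by (subst nn_integral_distr) auto
  finally show ?thesis by (simp add: line_int_def algebra_simps)
qed

text \<open>Integrating along the first direction and applying Hoelder's inequality replaces F by its line integral,
  which drives the induction.\<close>

lemma grid_lines_inequality:
  assumes "F \<in> borel_measurable borel" "0 \<le> p" "(real (length ds) - 1) * p \<le> 1"
  shows "lines_int ds (\<lambda>x. epow (F x) (1 - (real (length ds) - 1) * p) * (\<Prod>d\<leftarrow>ds. epow (line_int d F x) p)) x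
    \<le> epow (lines_int ds F x) (1 + p)"
  using assms
proof (induction ds arbitrary: F)
  case Nil
  then show ?case by simp
next
  case (Cons d ds)
  note [measurable] = Cons.prems(1)
  have p: "0 \<le> p" "real (length ds) * p \<le> 1" using Cons.prems by auto
  define G where "G = line_int d F"
  have [measurable]: "G \<in> borel_measurable borel" by (simp add: G_def)
  let ?m = "real (length ds)"
  have mp: "(?m - 1) * p \<le> 1" using p by (simp add: algebra_simps)
  have step: "line_int d (\<lambda>x. epow (F x) (1 - ?m * p) * (\<Prod>e\<leftarrow>d # ds. epow (line_int e F x) p)) y
      \<le> epow (G y) (1 - (?m - 1) * p) * (\<Prod>e\<leftarrow>ds. epow (line_int e G y) p)" for y
  proof -
    \<comment> \<open>Hoelder weights along d: \<open>1 - m p\<close> for F and p for each of the m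
      remaining line integrals, in total one. The line integral along d itself is constant on the
      line and stays outside with exponent p.\<close>
    define L where "L = ((\<lambda>t. F (y + t *\<^sub>R d)), 1 - ?m * p) # map (\<lambda>e. ((\<lambda>t. line_int e F (y + t *\<^sub>R d)), p)) ds"
    have "line_int d (\<lambda>x. epow (F x) (1 - ?m * p) * (\<Prod>e\<leftarrow>d # ds. epow (line_int e F x) p)) y
       = (\<integral>\<^sup>+t. epow (G y) p * (\<Prod>(f, w)\<leftarrow>L. epow (f t) w) \<partial>lborel)"
      by (subst line_int_def, rule nn_integral_cong) (simp add: L_def line_int_shift G_def o_def mult_ac)
    also have "\<dots> = epow (G y) p * (\<integral>\<^sup>+t. (\<Prod>(f, w)\<leftarrow>L. epow (f t) w) \<partial>lborel)"
    proof (rule nn_integral_cmult)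
      have "(\<lambda>t. \<Prod>e\<leftarrow>ds. epow (line_int e F (y + t *\<^sub>R d)) p) \<in> borel_measurable lborel"
        by (induction ds) auto
      then show "(\<lambda>t. \<Prod>(f, w)\<leftarrow>L. epow (f t) w) \<in> borel_measurable lborel"
        by (simp add: L_def o_def)
    qed
    also have "\<dots> \<le> epow (G y) p * (\<Prod>(f, w)\<leftarrow>L. epow (\<integral>\<^sup>+t. f t \<partial>lborel) w)"
    proof (intro mult_left_mono nn_integral_epow_Holder_list)
      show "(\<Sum>(f, w)\<leftarrow>L. w) = 1"
        by (simp add: L_def o_def sum_list_triv)
    qed (use p in \<open>auto simp: L_def\<close>)
    \<comment> \<open>Integrated along d, F becomes another G; the exponents p and
      \<open>1 - m p\<close> add up to the one that the induction hypothesis expects for G and m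
      directions.\<close>
    also have "\<dots> = epow (G y) (p + (1 - ?m * p)) * (\<Prod>e\<leftarrow>ds. epow (line_int d (line_int e F) y) p)"
    proof -
      have "epow (G y) (p + (1 - ?m * p)) = epow (G y) p * epow (G y) (1 - ?m * p)"
        using p by (intro epow_add) auto
      moreover have "G y = (\<integral>\<^sup>+t. F (y + t *\<^sub>R d) \<partial>lborel)" by (simp only: G_def line_int_def)
      moreover have "line_int d (line_int e F) y = (\<integral>\<^sup>+t. line_int e F (y + t *\<^sub>R d) \<partial>lborel)" for e
        by (rule line_int_def)
      ultimately show ?thesis by (simp add: L_def o_def mult.assoc)
    qed
    also have "\<dots> = epow (G y) (1 - (?m - 1) * p) * (\<Prod>e\<leftarrow>ds. epow (line_int e G y) p)"
      by (simp add: G_def line_int_commute algebra_simps)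
    finally show ?thesis .
  qed
  have "lines_int (d # ds) (\<lambda>x. epow (F x) (1 - (real (length (d # ds)) - 1) * p) * (\<Prod>e\<leftarrow>d # ds. epow (line_int e F x) p)) x
    \<le> lines_int ds (\<lambda>y. epow (G y) (1 - (?m - 1) * p) * (\<Prod>e\<leftarrow>ds. epow (line_int e G y) p)) x"
    using step by (auto intro!: lines_int_mono)
  also have "\<dots> \<le> epow (lines_int ds G x) (1 + p)"
    by (rule Cons.IH) (use p mp in auto)
  finally show ?case by (simp add: G_def)
qed


section \<open>Change of variables for skew directions\<close>

lemma lines_int_distinct_Basis:
  fixes F :: "'a::euclidean_space \<Rightarrow> ennreal"
  assumes "F \<in> borel_measurable borel" "distinct ds"
  shows "lines_int ds F x = (\<integral>\<^sup>+f. F (x + (\<Sum>b\<in>set ds. f b *\<^sub>R b)) \<partial>(\<Pi>\<^sub>M b\<in>set ds. lborel))"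
  using assms
proof (induction ds arbitrary: F)
  case Nil
  then show ?case by (simp add: PiM_empty nn_integral_count_space_finite)
next
  case (Cons d ds)
  note [measurable] = Cons.prems(1)
  interpret product_sigma_finite "\<lambda>_. lborel" ..
  have "lines_int (d # ds) F x = (\<integral>\<^sup>+f. line_int d F (x + (\<Sum>b\<in>set ds. f b *\<^sub>R b)) \<partial>(\<Pi>\<^sub>M b\<in>set ds. lborel))"
    using Cons.IH[of "line_int d F"] Cons.prems by simp
  also have "\<dots> = (\<integral>\<^sup>+f. \<integral>\<^sup>+t. F (x + (\<Sum>b\<in>insert d (set ds). (f(d := t)) b *\<^sub>R b)) \<partial>lborel \<partial>(\<Pi>\<^sub>M b\<in>set ds. lborel))"
  proof -
    have "(\<Sum>b\<in>insert d (set ds). (f(d := t)) b *\<^sub>R b) = t *\<^sub>R d + (\<Sum>b\<in>set ds. f b *\<^sub>R b)" for f t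
    proof -
      have "(\<Sum>b\<in>set ds. (f(d := t)) b *\<^sub>R b) = (\<Sum>b\<in>set ds. f b *\<^sub>R b)"
        using Cons.prems by (intro sum.cong) auto
      then show ?thesis using Cons.prems by (subst sum.insert) auto
    qed
    then show ?thesis by (simp add: line_int_def add_ac)
  qed
  also have "\<dots> = (\<integral>\<^sup>+f. F (x + (\<Sum>b\<in>insert d (set ds). f b *\<^sub>R b)) \<partial>(\<Pi>\<^sub>M b\<in>insert d (set ds). lborel))"
    by (rule product_nn_integral_insert[symmetric]) (use Cons.prems in auto)
  finally show ?case by simp
qed

lemma lines_int_Basis:
  fixes F :: "'a::euclidean_space \<Rightarrow> ennreal"
  assumes [measurable]: "F \<in> borel_measurable borel" and "distinct ds" "set ds = Basis"
  shows "lines_int ds F 0 = (\<integral>\<^sup>+x. F x \<partial>lborel)"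
proof -
  have "lines_int ds F 0 = (\<integral>\<^sup>+f. F (\<Sum>b\<in>Basis. f b *\<^sub>R b) \<partial>(\<Pi>\<^sub>M b\<in>Basis. lborel))"
    using lines_int_distinct_Basis[of F ds 0] assms by simp
  also have "\<dots> = (\<integral>\<^sup>+x. F x \<partial>distr (\<Pi>\<^sub>M b\<in>Basis. lborel) borel (\<lambda>f. \<Sum>b\<in>Basis. f b *\<^sub>R b))"
    by (subst nn_integral_distr) auto
  finally show ?thesis by (simp only: lborel_eq[symmetric])
qed

text \<open>A column operation: after integration along a the function is invariant under
  translations by a, so a later direction matters only modulo a.\<close>

lemma line_int_shear:
  fixes F :: "'a::euclidean_space \<Rightarrow> ennreal"
  assumes [measurable]: "F \<in> borel_measurable borel"
  shows "line_int (b + s *\<^sub>R a) (line_int a F) = line_int b (line_int a F)"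
proof
  fix x
  have "line_int a F (x + t *\<^sub>R (b + s *\<^sub>R a)) = line_int a F (x + t *\<^sub>R b)" for t
    using line_int_shift[of F a "x + t *\<^sub>R b" "t * s"] by (simp add: algebra_simps)
  then show "line_int (b + s *\<^sub>R a) (line_int a F) x = line_int b (line_int a F) x"
    by (simp add: line_int_def[of _ "line_int a F"])
qed

lemma line_int_scale:
  assumes [measurable]: "F \<in> borel_measurable borel" and "k \<noteq> 0"
  shows "line_int (k *\<^sub>R d) F = (\<lambda>x. ennreal (1 / \<bar>k\<bar>) * line_int d F x)"
proof
  fix x
  have "line_int d F x = (\<integral>\<^sup>+t. F (x + t *\<^sub>R d) \<partial>density (distr lborel borel ((*) k)) (\<lambda>_. \<bar>k\<bar>))"
    using assms by (simp add: line_int_def lborel_distr_mult'[symmetric])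
  also have "\<dots> = ennreal \<bar>k\<bar> * line_int (k *\<^sub>R d) F x"
    by (subst nn_integral_density) (auto simp: nn_integral_distr nn_integral_cmult line_int_def mult_ac)
  finally show "line_int (k *\<^sub>R d) F x = ennreal (1 / \<bar>k\<bar>) * line_int d F x"
    using \<open>k \<noteq> 0\<close> by (simp add: mult.assoc[symmetric] ennreal_mult[symmetric])
qed

lemma line_int_cmult:
  assumes [measurable]: "F \<in> borel_measurable borel"
  shows "line_int d (\<lambda>x. k * F x) = (\<lambda>x. k * line_int d F x)"
  unfolding line_int_def by (auto intro!: nn_integral_cmult)

lemma lines_int_cmult:
  assumes "F \<in> borel_measurable borel"
  shows "lines_int ds (\<lambda>x. k * F x) = (\<lambda>x. k * lines_int ds F x)"
  using assms by (induction ds arbitrary: F) (auto simp: line_int_cmult)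

text \<open>The innermost integration along c removes the summand c from every later direction; what
  remains is a factor \<open>1 / \<bar>k\<bar>\<close> for each of them.\<close>

lemma lines_int_shear_all:
  fixes F :: "'a::euclidean_space \<Rightarrow> ennreal"
  assumes "F \<in> borel_measurable borel" "k \<noteq> 0"
  shows "lines_int (map (\<lambda>e. c + k *\<^sub>R e) es) (line_int c F)
    = (\<lambda>x. ennreal ((1 / \<bar>k\<bar>) ^ length es) * lines_int es (line_int c F) x)"
  using assms
proof (induction es arbitrary: F)
  case (Cons e es)
  note [measurable] = Cons.prems(1)
  have "line_int (c + k *\<^sub>R e) (line_int c F) = line_int (k *\<^sub>R e) (line_int c F)"
    using line_int_shear[of F "k *\<^sub>R e" 1 c] by (simp add: add_ac)
  also have "\<dots> = (\<lambda>x. ennreal (1 / \<bar>k\<bar>) * line_int c (line_int e F) x)"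
    unfolding line_int_commute[OF Cons.prems(1), of c e] using Cons.prems(2) by (intro line_int_scale) auto
  finally have "lines_int (map (\<lambda>e. c + k *\<^sub>R e) (e # es)) (line_int c F)
    = (\<lambda>x. ennreal (1 / \<bar>k\<bar>) * (ennreal ((1 / \<bar>k\<bar>) ^ length es) * lines_int es (line_int c (line_int e F)) x))"
    using Cons.IH[of "line_int e F"] Cons.prems by (simp add: lines_int_cmult)
  then show ?case
    by (simp add: mult.assoc[symmetric] ennreal_mult[symmetric] line_int_commute[OF Cons.prems(1), of c e])
qed simp

text \<open>The opposite column operation: the components of c in the directions of
  \<open>es\<close> disappear because these directions are integrated as well.\<close>

lemma lines_int_remove_components:
  fixes F :: "'a::euclidean_space \<Rightarrow> ennreal"
  assumes "F \<in> borel_measurable borel" "distinct es"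
  shows "lines_int es (line_int c F) = lines_int es (line_int (c - (\<Sum>e\<in>set es. s e *\<^sub>R e)) F)"
  using assms
proof (induction es arbitrary: F)
  case (Cons e es)
  note [measurable] = Cons.prems(1)
  let ?c = "c - (\<Sum>b\<in>set es. s b *\<^sub>R b)"
  have "lines_int (e # es) (line_int c F) = lines_int es (line_int c (line_int e F))"
    by (simp add: line_int_commute)
  also have "\<dots> = lines_int es (line_int ?c (line_int e F))"
    by (rule Cons.IH) (use Cons.prems in auto)
  also have "line_int ?c (line_int e F) = line_int (?c - s e *\<^sub>R e) (line_int e F)"
    using line_int_shear[of F ?c "- s e" e] by simp
  also have "?c - s e *\<^sub>R e = c - (\<Sum>b\<in>set (e # es). s b *\<^sub>R b)"
    using Cons.prems by simp
  also have "line_int \<dots> (line_int e F) = line_int e (line_int (c - (\<Sum>b\<in>set (e # es). s b *\<^sub>R b)) F)"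
    by (rule line_int_commute) simp
  finally show ?case by simp
qed simp

text \<open>The constant is the inverse modulus of the determinant of the matrix with columns c and
  \<open>c + k e\<close>; subtracting c from the other columns and then clearing c leaves a diagonal
  matrix.\<close>

lemma lines_int_skew_Basis:
  fixes F :: "'a::euclidean_space \<Rightarrow> ennreal"
  assumes [measurable]: "F \<in> borel_measurable borel" and "k \<noteq> 0" "b \<in> Basis" "c \<bullet> b \<noteq> 0"
    and es: "distinct es" "set es = Basis - {b}"
  shows "lines_int (c # map (\<lambda>e. c + k *\<^sub>R e) es) F 0
    = ennreal ((1 / \<bar>k\<bar>) ^ length es * (1 / \<bar>c \<bullet> b\<bar>)) * (\<integral>\<^sup>+x. F x \<partial>lborel)"
proof -
  have cb: "c - (\<Sum>e\<in>set es. (c \<bullet> e) *\<^sub>R e) = (c \<bullet> b) *\<^sub>R b"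
  proof -
    have "c = (\<Sum>e\<in>Basis. (c \<bullet> e) *\<^sub>R e)" by (simp add: euclidean_representation)
    also have "\<dots> = (c \<bullet> b) *\<^sub>R b + (\<Sum>e\<in>set es. (c \<bullet> e) *\<^sub>R e)"
      using es \<open>b \<in> Basis\<close> by (simp add: sum.remove)
    finally show ?thesis by (metis add_diff_cancel_right')
  qed
  have "lines_int (c # map (\<lambda>e. c + k *\<^sub>R e) es) F 0 
      = ennreal ((1 / \<bar>k\<bar>) ^ length es) * lines_int es (line_int ((c \<bullet> b) *\<^sub>R b) F) 0"
    using lines_int_shear_all[of F k c es] lines_int_remove_components[of F es c "\<lambda>e. c \<bullet> e"] es assms cb
    by simp
  also have "line_int ((c \<bullet> b) *\<^sub>R b) F = (\<lambda>x. ennreal (1 / \<bar>c \<bullet> b\<bar>) * line_int b F x)"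
    by (rule line_int_scale) (use assms in auto)
  also have "lines_int es \<dots> 0 = ennreal (1 / \<bar>c \<bullet> b\<bar>) * lines_int (b # es) F 0"
    by (simp add: lines_int_cmult)
  also have "lines_int (b # es) F 0 = (\<integral>\<^sup>+x. F x \<partial>lborel)"
    by (rule lines_int_Basis) (use es \<open>b \<in> Basis\<close> in auto)
  finally show ?thesis
    by (simp only: ennreal_mult[OF zero_le_power[OF divide_nonneg_nonneg] divide_nonneg_nonneg] abs_ge_zero zero_le_one mult.assoc)
qed

text \<open>The hypotheses ask for domination by line integrals instead of a compactly supported
  function and its gradient. In this form they accept the one-sided estimates available near the
  boundary, where only forward half lines stay in the domain.\<close>

lemma Gagliardo_Nirenberg_skew:
  fixes c b :: "'a::euclidean_space" and k :: real
  assumes "k \<noteq> 0" "b \<in> Basis" "c \<bullet> b \<noteq> 0" "2 \<le> DIM('a)"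
  obtains C where "0 \<le> C"
    "\<And>f F. f \<in> borel_measurable borel \<Longrightarrow> F \<in> borel_measurable borel \<Longrightarrow>
      (\<And>x. f x \<le> line_int c F x) \<Longrightarrow> 
      (\<And>e x. e \<in> Basis \<Longrightarrow> e \<noteq> b \<Longrightarrow> f x \<le> line_int (c + k *\<^sub>R e) F x) \<Longrightarrow>
      (\<integral>\<^sup>+x. epow (f x) (DIM('a) / (DIM('a) - 1)) \<partial>lborel)
        \<le> ennreal C * epow (\<integral>\<^sup>+x. F x \<partial>lborel) (DIM('a) / (DIM('a) - 1))"
proof -
  obtain es where es: "distinct es" "set es = Basis - {b}"
    using finite_distinct_list[of "Basis - {b}"] by auto
  have len: "length es = DIM('a) - 1"
    using es distinct_card[of es] assms by (simp add: card_Diff_singleton)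
  define ds where "ds = c # map (\<lambda>e. c + k *\<^sub>R e) es"
  have lends: "length ds = DIM('a)" using len assms by (simp add: ds_def)
  \<comment> \<open>This p makes the exponent of F in \<open>grid_lines_inequality\<close> zero, and
    n line integrals to the power p dominate f to the power n p = 1 + p = n/(n-1).\<close>
  define p where "p = 1 / (real DIM('a) - 1)"
  have p: "0 < p" "(real (length ds) - 1) * p = 1" "DIM('a) / (DIM('a) - 1) = 1 + p"
    using assms by (auto simp: p_def lends field_simps of_nat_diff)
  have q: "real (length ds) * p = 1 + p" using p(2) by (simp add: algebra_simps)
  define B where "B = (1 / \<bar>k\<bar>) ^ length es * (1 / \<bar>c \<bullet> b\<bar>)"
  have B: "0 < B" using assms by (simp add: B_def)
  have skew: "lines_int ds G 0 = ennreal B * (\<integral>\<^sup>+x. G x \<partial>lborel)" if "G \<in> borel_measurable borel" for G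
    unfolding ds_def B_def by (rule lines_int_skew_Basis) (use assms that es in auto)
  show thesis
  proof (rule that)
    show "0 \<le> 1 / B * B powr (1 + p)" using B by simp
    fix f F :: "'a \<Rightarrow> ennreal"
    assume [measurable]: "f \<in> borel_measurable borel" "F \<in> borel_measurable borel"
      and le1: "\<And>x. f x \<le> line_int c F x" 
      and le2: "\<And>e x. e \<in> Basis \<Longrightarrow> e \<noteq> b \<Longrightarrow> f x \<le> line_int (c + k *\<^sub>R e) F x"
    have le: "f x \<le> line_int d F x" if "d \<in> set ds" for d x
      using that le1 le2 es by (auto simp: ds_def)
    have pw: "epow (f x) (real (length xs) * p) \<le> (\<Prod>d\<leftarrow>xs. epow (line_int d F x) p)" if "set xs \<subseteq> set ds" for x xs
      using that
    proof (induction xs)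
      case (Cons a xs)
      have "epow (f x) (real (length (a # xs)) * p) = epow (f x) p * epow (f x) (real (length xs) * p)"
        using epow_add[of p "real (length xs) * p" "f x"] p by (simp add: algebra_simps)
      also have "\<dots> \<le> epow (line_int a F x) p * (\<Prod>d\<leftarrow>xs. epow (line_int d F x) p)"
        using Cons p le by (intro mult_mono epow_mono) auto
      finally show ?case by simp
    qed simp
    have "ennreal B * (\<integral>\<^sup>+x. epow (f x) (1 + p) \<partial>lborel) = lines_int ds (\<lambda>x. epow (f x) (1 + p)) 0"
      by (rule skew[symmetric]) simp
    also have "\<dots> \<le> lines_int ds (\<lambda>x. epow (F x) (1 - (real (length ds) - 1) * p) * (\<Prod>d\<leftarrow>ds. epow (line_int d F x) p)) 0"
      using pw[of ds] q p by (intro lines_int_mono) auto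
    also have "\<dots> \<le> epow (lines_int ds F 0) (1 + p)"
      by (rule grid_lines_inequality) (use p in auto)
    also have "\<dots> = epow (ennreal B * (\<integral>\<^sup>+x. F x \<partial>lborel)) (1 + p)"
      by (simp add: skew)
    also have "\<dots> = ennreal (B powr (1 + p)) * epow (\<integral>\<^sup>+x. F x \<partial>lborel) (1 + p)"
      using p B by (simp add: epow_mult epow_ennreal)
    \<comment> \<open>\<open>B\<close> is the inverse Jacobian: linear on the left, to the power 1 +
      p on the right.\<close>
    finally have "ennreal (1/B) * (ennreal B * (\<integral>\<^sup>+x. epow (f x) (1 + p) \<partial>lborel)) 
        \<le> ennreal (1/B) * (ennreal (B powr (1 + p)) * epow (\<integral>\<^sup>+x. F x \<partial>lborel) (1 + p))"
      by (rule mult_left_mono) simp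
    moreover have "ennreal (1/B) * ennreal B = 1" using B by (simp add: ennreal_mult[symmetric])
    ultimately show "(\<integral>\<^sup>+x. epow (f x) (DIM('a) / (DIM('a) - 1)) \<partial>lborel)
        \<le> ennreal (1 / B * B powr (1 + p)) * epow (\<integral>\<^sup>+x. F x \<partial>lborel) (DIM('a) / (DIM('a) - 1))"
      unfolding p(3) using B
      by (simp add: mult.assoc[symmetric] ennreal_mult[symmetric])
  qed
qed

section \<open>Directional derivatives and convolution\<close>

definition dird :: "real^'n::finite \<Rightarrow> (real^'n \<Rightarrow> real) \<Rightarrow> real^'n \<Rightarrow> real" where
  "dird v f x = (\<Sum>i\<in>UNIV. v $ i * partial_deriv i f x)"

definition dird2 :: "real^'n::finite \<Rightarrow> (real^'n \<Rightarrow> real) \<Rightarrow> real^'n \<Rightarrow> real" where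
  "dird2 v f x = (\<Sum>i\<in>UNIV. \<Sum>j\<in>UNIV. v $ i * v $ j * partial_deriv i (partial_deriv j f) x)"

lemma abs_integral_le_integral:
  fixes f g :: "'b \<Rightarrow> real"
  assumes "integrable M f" "integrable M g" "\<And>x. \<bar>f x\<bar> \<le> g x"
  shows "\<bar>LINT x|M. f x\<bar> \<le> (LINT x|M. g x)"
proof -
  have "\<bar>LINT x|M. f x\<bar> \<le> (LINT x|M. \<bar>f x\<bar>)"
    using integral_norm_bound[of M f] by simp
  also have "\<dots> \<le> (LINT x|M. g x)"
    by (rule integral_mono) (use assms in auto)
  finally show ?thesis .
qed

lemma partial_deriv_eqI:
  assumes "(f has_derivative D) (at x)"
  shows "partial_deriv i f x = D (axis i 1)"
  using frechet_derivative_at[OF assms] by (simp add: partial_deriv_def)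

lemma C1_fun_has_derivative:
  assumes "C1_fun f"
  shows "(f has_derivative (\<lambda>h. dird h f x)) (at x)"
proof -
  have d: "f differentiable (at x)" using assms by (simp add: C1_fun_def)
  then have D: "(f has_derivative frechet_derivative f (at x)) (at x)"
    by (simp add: frechet_derivative_works)
  have lin: "linear (frechet_derivative f (at x))"
    using has_derivative_linear[OF D] .
  have "frechet_derivative f (at x) h = dird h f x" for h
  proof -
    have "frechet_derivative f (at x) h = frechet_derivative f (at x) (\<Sum>i\<in>UNIV. h $ i *s axis i 1)"
      by (simp add: basis_expansion)
    also have "\<dots> = (\<Sum>i\<in>UNIV. h $ i * frechet_derivative f (at x) (axis i 1))"
      using lin by (simp add: linear_sum linear_cmul scalar_mult_eq_scaleR)
    finally show ?thesis by (simp add: dird_def partial_deriv_def)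
  qed
  then have "frechet_derivative f (at x) = (\<lambda>h. dird h f x)" by auto
  then show ?thesis using D by simp
qed

lemma sum_axis_1: "(\<Sum>j\<in>UNIV. axis i (1::real) $ j * g j) = g i"
proof -
  have "(\<Sum>j\<in>UNIV. axis i (1::real) $ j * g j) = (\<Sum>j\<in>UNIV. if j = i then g j else 0)"
    by (rule sum.cong) (auto simp: axis_def)
  then show ?thesis by simp
qed

lemma C1_funI:
  assumes D: "\<And>x. (f has_derivative (\<lambda>h. \<Sum>i\<in>UNIV. h $ i * g i x)) (at x)"
    and c: "\<And>i. continuous_on UNIV (g i)"
  shows "C1_fun f" "partial_deriv i f = g i"
proof -
  have p: "partial_deriv i f = g i" for i
    by (rule ext) (simp add: partial_deriv_eqI[OF D] sum_axis_1)
  show "partial_deriv i f = g i" by (rule p)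
  show "C1_fun f" unfolding C1_fun_def using D c by (auto simp: p differentiable_def)
qed

lemma C1_fun_continuous: "C1_fun f \<Longrightarrow> continuous_on S f"
  by (meson C1_fun_def continuous_at_imp_continuous_on differentiable_imp_continuous_within)

lemma dird_continuous: "C1_fun f \<Longrightarrow> continuous_on S (dird v f)"
  unfolding dird_def C1_fun_def
  by (intro continuous_intros) (meson continuous_on_subset subset_UNIV)

lemma dird_line_derivative:
  assumes "C1_fun f"
  shows "((\<lambda>t. f (z + t *\<^sub>R v)) has_real_derivative dird v f (z + t *\<^sub>R v)) (at t within T)"
proof -
  have "((\<lambda>t. f (z + t *\<^sub>R v)) has_derivative (\<lambda>h. dird (h *\<^sub>R v) f (z + t *\<^sub>R v))) (at t)"
    by (rule has_derivative_compose[of "\<lambda>t. z + t *\<^sub>R v" "\<lambda>h. h *\<^sub>R v" t UNIV f, OF _ C1_fun_has_derivative[OF assms]])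
      (auto intro!: derivative_eq_intros)
  moreover have "dird (h *\<^sub>R v) f x = dird v f x * h" for h x
    by (simp add: dird_def sum_distrib_left sum_distrib_right mult_ac)
  ultimately have "((\<lambda>t. f (z + t *\<^sub>R v)) has_real_derivative dird v f (z + t *\<^sub>R v)) (at t)"
    by (simp add: has_field_derivative_def)
  then show ?thesis by (rule has_field_derivative_at_within)
qed

definition C1c :: "(real^'n::finite \<Rightarrow> real) \<Rightarrow> bool" where
  "C1c f \<longleftrightarrow> C1_fun f \<and> bounded {x. f x \<noteq> 0}"

lemma partial_deriv_support:
  assumes "partial_deriv i f x \<noteq> 0"
  shows "x \<in> closure {x. f x \<noteq> 0}"
proof (rule ccontr)
  assume n: "x \<notin> closure {x. f x \<noteq> 0}"
  define U where "U = - closure {x. f x \<noteq> 0}"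
  have U: "open U" "x \<in> U" using n by (auto simp: U_def open_Compl)
  have z: "0 = f y" if "y \<in> U" for y
    using closure_subset[of "{x. f x \<noteq> 0}"] that by (auto simp: U_def)
  have "((\<lambda>_. 0::real) has_derivative (\<lambda>_. 0)) (at x)" by simp
  from has_derivative_transform_within_open[OF this U z]
  have "(f has_derivative (\<lambda>_. 0)) (at x)" .
  from partial_deriv_eqI[OF this] assms show False by simp
qed

lemma C1c_partial_bounded_support: "C1c f \<Longrightarrow> bounded {x. partial_deriv i f x \<noteq> 0}"
  by (rule bounded_subset[of "closure {x. f x \<noteq> 0}"])
    (auto simp: C1c_def intro: bounded_closure partial_deriv_support)

lemma bounded_support_uniform:
  fixes g :: "'a::euclidean_space \<Rightarrow> real"
  assumes c: "continuous_on UNIV g" and b: "bounded {x. g x \<noteq> 0}"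
  shows "\<exists>B>0. \<forall>x. \<bar>g x\<bar> \<le> B" and "uniformly_continuous_on UNIV g"
proof -
  obtain R where R: "\<And>x. g x \<noteq> 0 \<Longrightarrow> norm x \<le> R" using b by (auto simp: bounded_iff)
  have cc: "continuous_on (cball 0 (R + 1)) g" using c continuous_on_subset by blast
  have "bounded (g ` cball 0 (R + 1))"
    by (intro compact_imp_bounded compact_continuous_image cc) simp
  then obtain B where B: "B > 0" "\<And>x. x \<in> cball 0 (R + 1) \<Longrightarrow> \<bar>g x\<bar> \<le> B"
    by (auto simp: bounded_pos)
  have "\<bar>g x\<bar> \<le> B" for x
    using B R[of x] by (cases "g x = 0") auto
  then show "\<exists>B>0. \<forall>x. \<bar>g x\<bar> \<le> B" using B by blast
  \<comment> \<open>The margin 1 puts two points at distance below 1 into the same compact ball as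
    soon as g is nonzero at one of them.\<close>
  have uc: "uniformly_continuous_on (cball 0 (R + 1)) g"
    by (rule compact_uniformly_continuous[OF cc]) simp
  show "uniformly_continuous_on UNIV g"
    unfolding uniformly_continuous_on_def
  proof (intro allI impI)
    fix e :: real assume "e > 0"
    then obtain d where d: "d > 0" "\<And>x y. x \<in> cball 0 (R + 1) \<Longrightarrow> y \<in> cball 0 (R + 1) \<Longrightarrow> dist y x < d \<Longrightarrow> dist (g y) (g x) < e"
      using uc unfolding uniformly_continuous_on_def by metis
    show "\<exists>d>0. \<forall>x\<in>UNIV. \<forall>y\<in>UNIV. dist y x < d \<longrightarrow> dist (g y) (g x) < e"
    proof (intro exI[of _ "min d 1"] conjI ballI impI)
      show "min d 1 > 0" using d by simp
      fix x y :: 'a assume xy: "dist y x < min d 1"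
      show "dist (g y) (g x) < e"
      proof (cases "g x = 0 \<and> g y = 0")
        case True
        then show ?thesis using \<open>e > 0\<close> by simp
      next
        case False
        then have "norm x \<le> R \<or> norm y \<le> R" using R by blast
        moreover have "norm x \<le> norm y + dist y x" "norm y \<le> norm x + dist y x"
          using norm_triangle_ineq2[of x y] norm_triangle_ineq2[of y x] by (auto simp: dist_norm norm_minus_commute)
        ultimately have "norm x \<le> R + 1" "norm y \<le> R + 1" using xy by auto
        then show ?thesis using d xy by auto
      qed
    qed
  qed
qed

lemma C1c_partial_continuous: "C1c f \<Longrightarrow> continuous_on S (partial_deriv i f)"
  unfolding C1c_def C1_fun_def by (meson continuous_on_subset subset_UNIV)

lemma dird_bound: "\<bar>dird h f x\<bar> \<le> norm h * (\<Sum>i\<in>UNIV. \<bar>partial_deriv i f x\<bar>)"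
proof -
  have "\<bar>dird h f x\<bar> \<le> (\<Sum>i\<in>UNIV. \<bar>h $ i * partial_deriv i f x\<bar>)"
    unfolding dird_def by (rule sum_abs)
  also have "\<dots> \<le> (\<Sum>i\<in>UNIV. norm h * \<bar>partial_deriv i f x\<bar>)"
    by (intro sum_mono) (auto simp: abs_mult intro!: mult_right_mono component_le_norm_cart)
  finally show ?thesis by (simp add: sum_distrib_left)
qed

text \<open>The partial derivatives are uniformly continuous, so one radius d serves every base
  point z. This is what allows differentiation under the integral in \<open>convol_C1\<close>, where
  the base point \<open>y - q \<omega>\<close> ranges over the whole space.\<close>

lemma C1c_uniform_linearization:
  fixes f :: "real^'n::finite \<Rightarrow> real"
  assumes f: "C1c f" and "e > 0"
  shows "\<exists>d>0. \<forall>z s. norm s < d \<longrightarrow> \<bar>f (z + s) - f z - dird s f z\<bar> \<le> e * norm s"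
proof -
  let ?n = "real CARD('n)"
  have e': "e / ?n > 0" using \<open>e > 0\<close> by simp
  have "\<exists>d>0. \<forall>x y. dist y x < d \<longrightarrow> \<bar>partial_deriv i f y - partial_deriv i f x\<bar> < e / ?n" for i
    using bounded_support_uniform(2)[OF C1c_partial_continuous[OF f] C1c_partial_bounded_support[OF f], of i] e'
    unfolding uniformly_continuous_on_def dist_real_def by auto
  then obtain d where d: "\<And>i. d i > 0"
    "\<And>i x y. dist y x < d i \<Longrightarrow> \<bar>partial_deriv i f y - partial_deriv i f x\<bar> < e / ?n"
    by metis
  define D where "D = Min (range d)"
  have D: "D > 0" "\<And>i. D \<le> d i" using d by (auto simp: D_def)
  have "\<bar>f (z + s) - f z - dird s f z\<bar> \<le> e * norm s" if s: "norm s < D" for z s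
  proof -
    have "norm (f (z + s) - f z - dird (z + s - z) f z) \<le> norm (z + s - z) * e"
    proof (rule differentiable_bound_linearization[where f'="\<lambda>x h. dird h f x" and S="ball z D"])
      show "z + t *\<^sub>R (z + s - z) \<in> ball z D" if "t \<in> {0..1}" for t
      proof -
        have "norm (t *\<^sub>R s) \<le> norm s" using that by (simp add: mult_left_le_one_le)
        then show ?thesis using s by (simp add: dist_norm)
      qed
      show "(f has_derivative (\<lambda>h. dird h f x)) (at x within ball z D)" for x
        using C1_fun_has_derivative f by (auto simp: C1c_def intro: has_derivative_at_withinI)
      show "onorm ((\<lambda>h. dird h f x) - (\<lambda>h. dird h f z)) \<le> e" if "x \<in> ball z D" for x
        unfolding fun_diff_def
      proof (rule onorm_bound)
        fix h
        have "\<bar>dird h f x - dird h f z\<bar> = \<bar>\<Sum>i\<in>UNIV. h $ i * (partial_deriv i f x - partial_deriv i f z)\<bar>"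
          by (simp add: dird_def sum_subtractf right_diff_distrib)
        also have "\<dots> \<le> (\<Sum>i\<in>UNIV. \<bar>h $ i * (partial_deriv i f x - partial_deriv i f z)\<bar>)"
          by (rule sum_abs)
        also have "\<dots> \<le> (\<Sum>i\<in>(UNIV::'n set). norm h * (e / ?n))"
        proof (rule sum_mono)
          fix i
          have "\<bar>partial_deriv i f x - partial_deriv i f z\<bar> < e / ?n"
            using that D(2)[of i] by (intro d(2)) (auto simp: dist_commute)
          then show "\<bar>h $ i * (partial_deriv i f x - partial_deriv i f z)\<bar> \<le> norm h * (e / ?n)"
            unfolding abs_mult by (intro mult_mono component_le_norm_cart) auto
        qed
        also have "\<dots> = e * norm h" by simp
        finally show "norm (dird h f x - dird h f z) \<le> e * norm h" by simp
      qed (use \<open>e > 0\<close> in simp)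
    qed (use D in simp)
    then show ?thesis by (simp add: mult.commute)
  qed
  then show ?thesis using D by blast
qed

text \<open>The parameter space N and the location map q are kept general for two uses: the
  mollification, where the parameter is a point of space, and the Taylor test function, where it is
  a pair (x, t) located at x + t v.\<close>

definition convol :: "'b measure \<Rightarrow> ('b \<Rightarrow> real) \<Rightarrow> ('b \<Rightarrow> real^'n::finite) \<Rightarrow> (real^'n \<Rightarrow> real) \<Rightarrow> real^'n \<Rightarrow> real" where
  "convol N w q f y = (LINT \<omega>|N. w \<omega> * f (y - q \<omega>))"

lemma convol_integrable:
  fixes g :: "real^'n::finite \<Rightarrow> real"
  assumes w: "integrable N w" and [measurable]: "q \<in> borel_measurable N"
    and c: "continuous_on UNIV g" and b: "bounded {x. g x \<noteq> 0}"
  shows "integrable N (\<lambda>\<omega>. w \<omega> * g (y - q \<omega>))"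
proof -
  obtain B where B: "B > 0" "\<And>x. \<bar>g x\<bar> \<le> B" using bounded_support_uniform(1)[OF c b] by blast
  have [measurable]: "g \<in> borel_measurable borel" using c by (rule borel_measurable_continuous_onI)
  have [measurable]: "w \<in> borel_measurable N" using w by simp
  show ?thesis
  proof (rule Bochner_Integration.integrable_bound[where f="\<lambda>\<omega>. B * w \<omega>"])
    show "AE \<omega> in N. norm (w \<omega> * g (y - q \<omega>)) \<le> norm (B * w \<omega>)"
      using B by (auto simp: abs_mult mult.commute[of B] intro!: mult_left_mono)
  qed (use w in auto)
qed

lemma convol_continuous:
  fixes g :: "real^'n::finite \<Rightarrow> real"
  assumes w: "integrable N w" and [measurable]: "q \<in> borel_measurable N"
    and c: "continuous_on UNIV g" and b: "bounded {x. g x \<noteq> 0}"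
  shows "continuous_on UNIV (convol N w q g)"
  unfolding continuous_on_iff
proof (intro ballI allI impI)
  fix x :: "real^'n" and e :: real assume "e > 0"
  \<comment> \<open>The summand 1 keeps \<open>A\<close> positive and the final inequality strict
    even if w vanishes almost everywhere.\<close>
  define A where "A = (LINT \<omega>|N. \<bar>w \<omega>\<bar>) + 1"
  have A: "A > 0" by (auto simp: A_def intro!: add_nonneg_pos)
  then obtain d where d: "d > 0" "\<And>x y. dist y x < d \<Longrightarrow> \<bar>g y - g x\<bar> < e / A"
    using bounded_support_uniform(2)[OF c b] \<open>e > 0\<close> unfolding uniformly_continuous_on_def dist_real_def
    by (metis UNIV_I divide_pos_pos)
  show "\<exists>d>0. \<forall>x'\<in>UNIV. dist x' x < d \<longrightarrow> dist (convol N w q g x') (convol N w q g x) < e"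
  proof (intro exI conjI ballI impI)
    fix y assume y: "dist y x < d"
    note int = convol_integrable[OF w assms(2) c b]
    have "\<bar>convol N w q g y - convol N w q g x\<bar> = \<bar>LINT \<omega>|N. w \<omega> * (g (y - q \<omega>) - g (x - q \<omega>))\<bar>"
      unfolding convol_def by (subst Bochner_Integration.integral_diff[symmetric]) (auto simp: int right_diff_distrib)
    also have "\<dots> \<le> (LINT \<omega>|N. \<bar>w \<omega>\<bar> * (e / A))"
    proof (rule abs_integral_le_integral)
      show "integrable N (\<lambda>\<omega>. w \<omega> * (g (y - q \<omega>) - g (x - q \<omega>)))"
        by (simp add: right_diff_distrib int)
      show "integrable N (\<lambda>\<omega>. \<bar>w \<omega>\<bar> * (e / A))" using w by simp
      show "\<bar>w \<omega> * (g (y - q \<omega>) - g (x - q \<omega>))\<bar> \<le> \<bar>w \<omega>\<bar> * (e / A)" for \<omega>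
        unfolding abs_mult using d(2)[of "y - q \<omega>" "x - q \<omega>"] y
        by (intro mult_left_mono) (auto simp: dist_norm)
    qed
    also have "\<dots> = (A - 1) * (e / A)" by (simp add: A_def)
    also have "\<dots> < A * (e / A)" using A \<open>e > 0\<close> by (intro mult_strict_right_mono) auto
    finally show "dist (convol N w q g y) (convol N w q g x) < e" using A by (simp add: dist_real_def)
  qed (use d in auto)
qed

lemma convol_C1:
  fixes f :: "real^'n::finite \<Rightarrow> real"
  assumes w: "integrable N w" and [measurable]: "q \<in> borel_measurable N" and f: "C1c f"
  shows "C1_fun (convol N w q f)" "partial_deriv i (convol N w q f) = convol N w q (partial_deriv i f)"
proof -
  have fc: "continuous_on UNIV f" "bounded {x. f x \<noteq> 0}"
    using f by (auto simp: C1c_def C1_fun_continuous)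
  note intf = convol_integrable[OF w assms(2) fc]
  note pc = C1c_partial_continuous[OF f, of UNIV] C1c_partial_bounded_support[OF f]
  note intp = convol_integrable[OF w assms(2) pc]
  define A where "A = (LINT \<omega>|N. \<bar>w \<omega>\<bar>) + 1"
  have A: "A > 0" by (auto simp: A_def intro!: add_nonneg_pos)
  have D: "(convol N w q f has_derivative (\<lambda>h. \<Sum>i\<in>UNIV. h $ i * convol N w q (partial_deriv i f) y)) (at y)" for y
    unfolding has_derivative_at_alt
  proof (intro conjI allI impI)
    show "bounded_linear (\<lambda>h. \<Sum>i\<in>UNIV. h $ i * convol N w q (partial_deriv i f) y)"
      by (intro bounded_linear_sum bounded_linear_mult_left[THEN bounded_linear_compose] bounded_linear_vec_nth)
    fix e :: real assume "e > 0"
    then obtain d where d: "d > 0" "\<And>z s. norm s < d \<Longrightarrow> \<bar>f (z + s) - f z - dird s f z\<bar> \<le> e / A * norm s"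
      using C1c_uniform_linearization[OF f, of "e / A"] A by auto
    show "\<exists>d>0. \<forall>x. norm (x - y) < d \<longrightarrow>
        norm (convol N w q f x - convol N w q f y - (\<Sum>i\<in>UNIV. (x - y) $ i * convol N w q (partial_deriv i f) y)) \<le> e * norm (x - y)"
    proof (intro exI conjI allI impI)
      fix x assume x: "norm (x - y) < d"
      have intd: "integrable N (\<lambda>\<omega>. w \<omega> * dird (x - y) f (y - q \<omega>))"
        unfolding dird_def sum_distrib_left
      proof (intro Bochner_Integration.integrable_sum)
        fix i
        have "integrable N (\<lambda>\<omega>. (x - y) $ i * (w \<omega> * partial_deriv i f (y - q \<omega>)))"
          using intp[of i y] by (intro integrable_mult_right) auto
        then show "integrable N (\<lambda>\<omega>. w \<omega> * ((x - y) $ i * partial_deriv i f (y - q \<omega>)))"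
          by (simp only: mult.left_commute)
      qed
      have "(\<Sum>i\<in>UNIV. (x - y) $ i * convol N w q (partial_deriv i f) y) = (LINT \<omega>|N. w \<omega> * dird (x - y) f (y - q \<omega>))"
      proof -
        have "(LINT \<omega>|N. w \<omega> * dird (x - y) f (y - q \<omega>)) = (LINT \<omega>|N. (\<Sum>i\<in>UNIV. (x - y) $ i * (w \<omega> * partial_deriv i f (y - q \<omega>))))"
          by (simp add: dird_def sum_distrib_left mult_ac)
        also have "\<dots> = (\<Sum>i\<in>UNIV. LINT \<omega>|N. (x - y) $ i * (w \<omega> * partial_deriv i f (y - q \<omega>)))"
          by (rule Bochner_Integration.integral_sum) (use intp in simp)
        finally show ?thesis by (simp add: convol_def)
      qed
      then have "\<bar>convol N w q f x - convol N w q f y - (\<Sum>i\<in>UNIV. (x - y) $ i * convol N w q (partial_deriv i f) y)\<bar>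
         = \<bar>LINT \<omega>|N. w \<omega> * (f (x - q \<omega>) - f (y - q \<omega>) - dird (x - y) f (y - q \<omega>))\<bar>"
        unfolding convol_def using intf intd by (simp add: right_diff_distrib)
      also have "\<dots> \<le> (LINT \<omega>|N. \<bar>w \<omega>\<bar> * (e / A * norm (x - y)))"
      proof (rule abs_integral_le_integral)
        show "integrable N (\<lambda>\<omega>. w \<omega> * (f (x - q \<omega>) - f (y - q \<omega>) - dird (x - y) f (y - q \<omega>)))"
          using intf intd by (simp add: right_diff_distrib)
        show "integrable N (\<lambda>\<omega>. \<bar>w \<omega>\<bar> * (e / A * norm (x - y)))" using w by simp
        show "\<bar>w \<omega> * (f (x - q \<omega>) - f (y - q \<omega>) - dird (x - y) f (y - q \<omega>))\<bar> \<le> \<bar>w \<omega>\<bar> * (e / A * norm (x - y))" for \<omega>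
          unfolding abs_mult using d(2)[of "x - y" "y - q \<omega>"] x
          by (intro mult_left_mono) (auto simp: algebra_simps)
      qed
      also have "\<dots> = (A - 1) * (e / A * norm (x - y))" by (simp add: A_def)
      also have "\<dots> \<le> A * (e / A * norm (x - y))" using A \<open>e > 0\<close> by (intro mult_right_mono) auto
      finally show "norm (convol N w q f x - convol N w q f y - (\<Sum>i\<in>UNIV. (x - y) $ i * convol N w q (partial_deriv i f) y)) \<le> e * norm (x - y)"
        using A by simp
    qed (use d in auto)
  qed
  show "C1_fun (convol N w q f)" "partial_deriv i (convol N w q f) = convol N w q (partial_deriv i f)"
    using C1_funI[OF D convol_continuous[OF w assms(2) pc]] by blast+
qed

lemma convol_dird:
  fixes f :: "real^'n::finite \<Rightarrow> real"
  assumes w: "integrable N w" and q[measurable]: "q \<in> borel_measurable N" and f: "C1c f"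
  shows "dird v (convol N w q f) y = convol N w q (dird v f) y"
proof -
  note pc = C1c_partial_continuous[OF f, of UNIV] C1c_partial_bounded_support[OF f]
  note intp = convol_integrable[OF w q pc]
  have "convol N w q (dird v f) y = (LINT \<omega>|N. (\<Sum>i\<in>UNIV. v $ i * (w \<omega> * partial_deriv i f (y - q \<omega>))))"
    unfolding convol_def dird_def by (simp add: sum_distrib_left mult_ac)
  also have "\<dots> = (\<Sum>i\<in>UNIV. LINT \<omega>|N. v $ i * (w \<omega> * partial_deriv i f (y - q \<omega>)))"
    by (rule Bochner_Integration.integral_sum) (use intp in simp)
  also have "\<dots> = dird v (convol N w q f) y"
    unfolding dird_def convol_C1(2)[OF w q f] by (simp add: convol_def)
  finally show ?thesis by simp
qed

lemma dird_bounded_support: 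
  assumes "C1c f" shows "bounded {x. dird v f x \<noteq> 0}"
proof (rule bounded_subset)
  show "bounded (closure {x. f x \<noteq> 0})" using assms by (auto simp: C1c_def intro: bounded_closure)
  show "{x. dird v f x \<noteq> 0} \<subseteq> closure {x. f x \<noteq> 0}"
  proof
    fix x assume "x \<in> {x. dird v f x \<noteq> 0}"
    then obtain i where "v $ i * partial_deriv i f x \<noteq> 0"
      unfolding dird_def by (metis (mono_tags, lifting) mem_Collect_eq sum.neutral)
    then show "x \<in> closure {x. f x \<noteq> 0}" using partial_deriv_support[of i f x] by auto
  qed
qed

definition C2c :: "(real^'n::finite \<Rightarrow> real) \<Rightarrow> bool" where
  "C2c f \<longleftrightarrow> C2_fun f \<and> bounded {x. f x \<noteq> 0}"

lemma C2c_C1c: "C2c f \<Longrightarrow> C1c f"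
  by (simp add: C2c_def C1c_def C2_fun_def)

lemma C2c_partial_C1c: "C2c f \<Longrightarrow> C1c (partial_deriv i f)"
  using C1c_partial_bounded_support[OF C2c_C1c, of f i] by (simp add: C2c_def C1c_def C2_fun_def)

lemma C1_fun_dird: 
  assumes "C2c f" 
  shows "C1_fun (dird v f)" "partial_deriv i (dird v f) x = (\<Sum>j\<in>UNIV. v $ j * partial_deriv i (partial_deriv j f) x)"
proof -
  have "(dird v f has_derivative (\<lambda>h. \<Sum>j\<in>UNIV. v $ j * dird h (partial_deriv j f) x)) (at x)" for x
    unfolding dird_def[of v f, abs_def]
    by (rule has_derivative_sum, rule has_derivative_mult_right, rule C1_fun_has_derivative)
      (use assms in \<open>simp add: C2c_def C2_fun_def\<close>)
  then have D: "(dird v f has_derivative (\<lambda>h. \<Sum>i\<in>UNIV. h $ i * (\<Sum>j\<in>UNIV. v $ j * partial_deriv i (partial_deriv j f) x))) (at x)" for x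
    unfolding dird_def sum_distrib_left by (subst sum.swap) (simp add: mult_ac)
  have c: "continuous_on UNIV (\<lambda>x. \<Sum>j\<in>UNIV. v $ j * partial_deriv i (partial_deriv j f) x)" for i
    by (intro continuous_intros C1c_partial_continuous C2c_partial_C1c assms)
  show "C1_fun (dird v f)" by (rule C1_funI(1)[OF D c])
  show "partial_deriv i (dird v f) x = (\<Sum>j\<in>UNIV. v $ j * partial_deriv i (partial_deriv j f) x)"
    using C1_funI(2)[OF D c] by metis
qed

lemma C2c_dird_C1c: "C2c f \<Longrightarrow> C1c (dird v f)"
  using dird_bounded_support[OF C2c_C1c, of f v] C1_fun_dird(1) by (auto simp: C1c_def)

lemma dird2_eq_dird_dird: "C2c f \<Longrightarrow> dird2 v f x = dird v (dird v f) x"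
  unfolding dird2_def dird_def[of v "dird v f"] by (simp add: C1_fun_dird(2) sum_distrib_left mult_ac)

lemma convol_C2:
  fixes f :: "real^'n::finite \<Rightarrow> real"
  assumes w: "integrable N w" and q[measurable]: "q \<in> borel_measurable N" and f: "C2c f"
  shows "C2_fun (convol N w q f)"
    "partial_deriv i (partial_deriv j (convol N w q f)) = convol N w q (partial_deriv i (partial_deriv j f))"
    "dird2 v (convol N w q f) y = convol N w q (dird v (dird v f)) y"
proof -
  note p = convol_C1[OF w q C2c_C1c[OF f]] convol_C1[OF w q C2c_partial_C1c[OF f]]
  show "C2_fun (convol N w q f)" unfolding C2_fun_def by (simp add: p)
  show "partial_deriv i (partial_deriv j (convol N w q f)) = convol N w q (partial_deriv i (partial_deriv j f))" for i j
    by (simp add: p)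
  have "dird2 v (convol N w q f) y = (\<Sum>j\<in>UNIV. v $ j * dird v (convol N w q (partial_deriv j f)) y)"
    unfolding dird2_def dird_def sum_distrib_left by (subst sum.swap) (simp add: p mult_ac)
  also have "\<dots> = (\<Sum>j\<in>UNIV. v $ j * convol N w q (dird v (partial_deriv j f)) y)"
    by (simp add: convol_dird[OF w q C2c_partial_C1c[OF f]])
  also have "\<dots> = convol N w q (\<lambda>x. \<Sum>j\<in>UNIV. v $ j * dird v (partial_deriv j f) x) y"
  proof -
    have int: "integrable N (\<lambda>\<omega>. w \<omega> * dird v (partial_deriv j f) (y - q \<omega>))" for j
      by (rule convol_integrable[OF w q dird_continuous dird_bounded_support])
         (use C2c_partial_C1c[OF f] in \<open>auto simp: C1c_def\<close>)
    have "convol N w q (\<lambda>x. \<Sum>j\<in>UNIV. v $ j * dird v (partial_deriv j f) x) y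
       = (LINT \<omega>|N. (\<Sum>j\<in>UNIV. v $ j * (w \<omega> * dird v (partial_deriv j f) (y - q \<omega>))))"
      unfolding convol_def by (simp add: sum_distrib_left mult_ac)
    also have "\<dots> = (\<Sum>j\<in>UNIV. LINT \<omega>|N. v $ j * (w \<omega> * dird v (partial_deriv j f) (y - q \<omega>)))"
      by (rule Bochner_Integration.integral_sum) (use int in simp)
    finally show ?thesis by (simp add: convol_def)
  qed
  also have "(\<lambda>x. \<Sum>j\<in>UNIV. v $ j * dird v (partial_deriv j f) x) = dird v (dird v f)"
  proof
    fix x
    have "(\<Sum>j\<in>UNIV. v $ j * dird v (partial_deriv j f) x)
      = (\<Sum>j\<in>UNIV. \<Sum>i\<in>UNIV. v $ i * v $ j * partial_deriv i (partial_deriv j f) x)"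
      by (simp add: dird_def sum_distrib_left mult_ac)
    also have "\<dots> = dird2 v f x" unfolding dird2_def by (rule sum.swap)
    finally show "(\<Sum>j\<in>UNIV. v $ j * dird v (partial_deriv j f) x) = dird v (dird v f) x"
      by (simp add: dird2_eq_dird_dird[OF f])
  qed
  finally show "dird2 v (convol N w q f) y = convol N w q (dird v (dird v f)) y" .
qed

section \<open>Taylor remainders of mollified functions\<close>

lemma integrable_bounded_support:
  fixes f :: "'a::euclidean_space \<Rightarrow> real"
  assumes [measurable]: "f \<in> borel_measurable borel" and B: "\<And>x. \<bar>f x\<bar> \<le> B" and b: "bounded {x. f x \<noteq> 0}"
  shows "integrable lborel f"
proof -
  obtain R where R: "\<And>x. f x \<noteq> 0 \<Longrightarrow> norm x \<le> R" using b by (auto simp: bounded_iff)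
  show ?thesis
  proof (rule integrableI_bounded_set[where A="cball 0 R" and B=B])
    show "emeasure lborel (cball 0 R) < \<infinity>" by (rule emeasure_bounded_finite) simp
    show "AE x in lborel. x \<in> cball 0 R \<longrightarrow> norm (f x) \<le> B" using B by (intro AE_I2) simp
    show "AE x in lborel. x \<notin> cball 0 R \<longrightarrow> f x = 0" using R by (intro AE_I2) (metis mem_cball_0)
  qed simp_all
qed

lemma integrable_continuous_bounded_support:
  fixes g :: "'a::euclidean_space \<Rightarrow> real"
  assumes c: "continuous_on UNIV g" and b: "bounded {x. g x \<noteq> 0}"
  shows "integrable lborel g"
  using bounded_support_uniform(1)[OF c b] integrable_bounded_support[OF borel_measurable_continuous_onI[OF c] _ b]
  by blast

lemma lborel_distr_reflect:
  fixes y :: "'a::euclidean_space"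
  shows "distr lborel borel (\<lambda>x. y - x) = lborel"
  using lborel_affine[of "-1" y] by (simp add: density_1)

lemma integral_reflect:
  fixes f :: "'a::euclidean_space \<Rightarrow> real"
  assumes [measurable]: "f \<in> borel_measurable borel"
  shows "(LINT x|lborel. f (y - x)) = (LINT x|lborel. f x)"
proof -
  have "(LINT x|lborel. f x) = (LINT x|distr lborel borel (\<lambda>x. y - x). f x)" by (simp add: lborel_distr_reflect)
  also have "\<dots> = (LINT x|lborel. f (y - x))" by (rule integral_distr) auto
  finally show ?thesis by simp
qed

lemma integrable_reflect:
  fixes f :: "'a::euclidean_space \<Rightarrow> real"
  assumes f: "integrable lborel f"
  shows "integrable lborel (\<lambda>x. f (y - x))"
proof -
  have "integrable (distr lborel borel (\<lambda>x. y - x)) f" using f by (simp add: lborel_distr_reflect)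
  then show ?thesis by (rule integrable_distr[rotated]) auto
qed

lemma C1c_reflect:
  assumes f: "C1c f"
  shows "C1c (\<lambda>z. f (- z))" "dird v (\<lambda>z. f (- z)) z = - dird v f (- z)"
proof -
  have D: "((\<lambda>z. f (- z)) has_derivative (\<lambda>h. \<Sum>i\<in>UNIV. h $ i * (- partial_deriv i f (- z)))) (at z)" for z
  proof -
    have "((\<lambda>z. f (- z)) has_derivative (\<lambda>h. dird (- h) f (- z))) (at z)"
      by (rule has_derivative_compose[of uminus "\<lambda>h. - h" z UNIV f, OF _ C1_fun_has_derivative])
        (use f in \<open>auto simp: C1c_def intro!: derivative_eq_intros\<close>)
    then show ?thesis by (simp add: dird_def sum_negf)
  qed
  have c: "continuous_on UNIV (\<lambda>z. - partial_deriv i f (- z))" for i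
    by (rule continuous_on_minus, rule continuous_on_compose2[OF C1c_partial_continuous[OF f, of UNIV i]])
      (simp_all add: continuous_on_minus)
  obtain R where R: "\<And>x. f x \<noteq> 0 \<Longrightarrow> norm x \<le> R" using f by (auto simp: C1c_def bounded_iff)
  have "norm x \<le> R" if "f (- x) \<noteq> 0" for x using R[OF that] by simp
  then have "bounded {x. f (- x) \<noteq> 0}" unfolding bounded_iff by blast
  then show "C1c (\<lambda>z. f (- z))" using C1_funI(1)[OF D c] by (simp add: C1c_def)
  show "dird v (\<lambda>z. f (- z)) z = - dird v f (- z)"
    unfolding dird_def C1_funI(2)[OF D c] by (simp add: sum_negf)
qed

lemma dird_FTC:
  assumes f: "C1_fun f"
  shows "(LINT t|lborel. dird v f (z - t *\<^sub>R v) * indicator {0..1} t) = f z - f (z - v)"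
proof -
  have D: "((\<lambda>t. - f (z - t *\<^sub>R v)) has_real_derivative dird v f (z - t *\<^sub>R v)) (at t)" for t
  proof -
    have "((\<lambda>t. f (z + t *\<^sub>R (- v))) has_real_derivative dird (- v) f (z + t *\<^sub>R (- v))) (at t)"
      by (rule dird_line_derivative[OF f])
    then have "((\<lambda>t. - f (z + t *\<^sub>R (- v))) has_real_derivative - dird (- v) f (z + t *\<^sub>R (- v))) (at t)"
      by (rule DERIV_minus)
    then show ?thesis by (simp add: dird_def sum_negf)
  qed
  have "continuous_on UNIV (\<lambda>t. dird v f (z - t *\<^sub>R v))"
    by (rule continuous_on_compose2[OF dird_continuous[OF f, of UNIV]]) (auto intro!: continuous_intros)
  then have c: "isCont (\<lambda>t. dird v f (z - t *\<^sub>R v)) t" for t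
    by (simp add: continuous_on_eq_continuous_at)
  have "(LINT t|lborel. dird v f (z - t *\<^sub>R v) * indicator {0..1} t) = - f (z - 1 *\<^sub>R v) - (- f (z - 0 *\<^sub>R v))"
    by (rule integral_FTC_Icc_real[OF _ D c]) simp
  then show ?thesis by simp
qed

text \<open>Integration by parts: the weight 1 - t removes the boundary term at t = 1, and its own
  derivative produces the average of f over the segment. A second integration then turns this
  average of a derivative into a difference.\<close>

lemma dird_FTC_weighted:
  assumes f: "C1_fun f"
  shows "(LINT t|lborel. (1 - t) * dird v f (z - t *\<^sub>R v) * indicator {0..1} t)
    = f z - (LINT t|lborel. f (z - t *\<^sub>R v) * indicator {0..1} t)"
proof -
  have D0: "((\<lambda>t. f (z - t *\<^sub>R v)) has_real_derivative - dird v f (z - t *\<^sub>R v)) (at t)" for t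
  proof -
    have "((\<lambda>t. f (z + t *\<^sub>R (- v))) has_real_derivative dird (- v) f (z + t *\<^sub>R (- v))) (at t)"
      by (rule dird_line_derivative[OF f])
    then show ?thesis by (simp add: dird_def sum_negf)
  qed
  have D: "((\<lambda>t. - (1 - t) * f (z - t *\<^sub>R v)) has_real_derivative
      (1 - t) * dird v f (z - t *\<^sub>R v) + f (z - t *\<^sub>R v)) (at t)" for t
    by (rule derivative_eq_intros D0 refl | simp add: algebra_simps)+
  have "continuous_on UNIV (\<lambda>t. dird v f (z - t *\<^sub>R v))" 
    by (rule continuous_on_compose2[OF dird_continuous[OF f, of UNIV]]) (auto intro!: continuous_intros)
  moreover have c2: "continuous_on UNIV (\<lambda>t. f (z - t *\<^sub>R v))" 
    by (rule continuous_on_compose2[OF C1_fun_continuous[OF f, of UNIV]]) (auto intro!: continuous_intros)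
  ultimately have c: "isCont (\<lambda>t. (1 - t) * dird v f (z - t *\<^sub>R v) + f (z - t *\<^sub>R v)) t"
    and c3: "isCont (\<lambda>t. (1 - t) * dird v f (z - t *\<^sub>R v)) t" "isCont (\<lambda>t. f (z - t *\<^sub>R v)) t" for t
    by (auto simp: continuous_on_eq_continuous_at intro!: continuous_intros)
  have i: "integrable lborel (\<lambda>t. (1 - t) * dird v f (z - t *\<^sub>R v) * indicator {0..1} t)"
    "integrable lborel (\<lambda>t. f (z - t *\<^sub>R v) * indicator {0..1} t)"
    using c3 borel_integrable_atLeastAtMost[of 0 1] by (auto simp: indicator_def if_distrib cong: if_cong)
  have "(LINT t|lborel. ((1 - t) * dird v f (z - t *\<^sub>R v) + f (z - t *\<^sub>R v)) * indicator {0..1} t)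
     = - (1 - 1) * f (z - 1 *\<^sub>R v) - (- (1 - 0) * f (z - 0 *\<^sub>R v))"
    by (rule integral_FTC_Icc_real[OF _ D c]) simp
  then show ?thesis using i by (simp add: ring_distribs)
qed

text \<open>What remains of \<open>TGV \<le> const\<close> after testing with fields
  \<open>\<eta> v v^T\<close> and scaling u. The bound 2 on the derivative is the one the Taylor
  kernel delivers. Symmetry of the mixed partials belongs to the class because
  \<open>div2_field\<close> counts the upper triangle twice; the test functions inherit it from the
  mollifier.\<close>

definition tgv_dual_bound :: "(real^'n::finite) set \<Rightarrow> (real^'n \<Rightarrow> real) \<Rightarrow> bool" where
  "tgv_dual_bound \<Omega> u \<longleftrightarrow> (\<forall>v \<eta>. norm v \<le> 1 \<longrightarrow> C2c \<eta> \<longrightarrow>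
     (\<forall>i j. partial_deriv i (partial_deriv j \<eta>) = partial_deriv j (partial_deriv i \<eta>)) \<longrightarrow>
     closure {x. \<eta> x \<noteq> 0} \<subseteq> \<Omega> \<longrightarrow> (\<forall>x. \<bar>\<eta> x\<bar> \<le> 1) \<longrightarrow> (\<forall>x. \<bar>dird v \<eta> x\<bar> \<le> 2) \<longrightarrow>
     (LINT y|lborel. u y * dird2 v \<eta> y) \<le> 1)"

text \<open>By the substitution y = x + z this averages \<open>u (x + z)\<close> with weight
  \<open>\<rho> z\<close>: the support of \<rho> is the set of displacements at which u is
  inspected, so a mollifier supported in a cone looks into that cone.\<close>

definition mollify :: "(real^'n::finite \<Rightarrow> real) \<Rightarrow> (real^'n \<Rightarrow> real) \<Rightarrow> real^'n \<Rightarrow> real" where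
  "mollify \<rho> u x = (LINT y|lborel. u y * \<rho> (y - x))"

lemma mollify_eq_convol: "mollify \<rho> u = convol lborel u (\<lambda>y. y) (\<lambda>z. \<rho> (- z))"
  by (rule ext) (simp add: mollify_def convol_def)

lemma mollify_C1:
  assumes u: "integrable lborel u" and \<rho>: "C1c \<rho>"
  shows "C1_fun (mollify \<rho> u)" "dird v (mollify \<rho> u) x = - mollify (dird v \<rho>) u x"
proof -
  show "C1_fun (mollify \<rho> u)" unfolding mollify_eq_convol
    by (rule convol_C1(1)[OF u _ C1c_reflect(1)[OF \<rho>]]) simp
  have "dird v (mollify \<rho> u) x = convol lborel u (\<lambda>y. y) (dird v (\<lambda>z. \<rho> (- z))) x"
    unfolding mollify_eq_convol by (rule convol_dird[OF u _ C1c_reflect(1)[OF \<rho>]]) simp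
  also have "\<dots> = - mollify (dird v \<rho>) u x"
    by (simp add: convol_def mollify_def C1c_reflect(2)[OF \<rho>])
  finally show "dird v (mollify \<rho> u) x = - mollify (dird v \<rho>) u x" .
qed

definition taylor_rem :: "(real^'n::finite \<Rightarrow> real) \<Rightarrow> real^'n \<Rightarrow> real^'n \<Rightarrow> real" where
  "taylor_rem W x v = W (x + v) - W x - dird v W x"

definition is_mollifier :: "(real^'n::finite \<Rightarrow> real) \<Rightarrow> bool" where
  "is_mollifier \<rho> \<longleftrightarrow> C2c \<rho> \<and> (\<forall>i j. partial_deriv i (partial_deriv j \<rho>) = partial_deriv j (partial_deriv i \<rho>)) \<and>
     (\<forall>z. 0 \<le> \<rho> z) \<and> (LINT z|lborel. \<rho> z) = 1"

lemma pair_integrable_mult_bounded: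
  fixes u \<sigma> :: "real^'n::finite \<Rightarrow> real" and k :: "real^'n \<Rightarrow> real^'n \<Rightarrow> real"
  assumes u: "integrable lborel u" and \<sigma>: "integrable lborel \<sigma>"
    and [measurable]: "(\<lambda>(y, x). k y x) \<in> borel_measurable (borel \<Otimes>\<^sub>M borel)" and B: "\<And>y x. \<bar>k y x\<bar> \<le> B"
  shows "integrable (lborel \<Otimes>\<^sub>M lborel) (\<lambda>(y, x). u y * (\<sigma> x * k y x))"
proof -
  have [measurable]: "u \<in> borel_measurable borel" "\<sigma> \<in> borel_measurable borel"
    using borel_measurable_integrable[OF u] borel_measurable_integrable[OF \<sigma>] by auto
  have "integrable (lborel \<Otimes>\<^sub>M lborel) (\<lambda>(y, x). u y * \<sigma> x)"
  proof (rule lborel_pair.Fubini_integrable)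
    show "integrable lborel (\<lambda>y. LINT x|lborel. norm (case (y, x) of (y, x) \<Rightarrow> u y * \<sigma> x))"
      using u by (simp add: abs_mult)
    show "AE y in lborel. integrable lborel (\<lambda>x. case (y, x) of (y, x) \<Rightarrow> u y * \<sigma> x)"
      using \<sigma> by simp
  qed simp
  then have "integrable (lborel \<Otimes>\<^sub>M lborel) (\<lambda>z. B * (case z of (y, x) \<Rightarrow> u y * \<sigma> x))" by simp
  then show ?thesis
  proof (rule Bochner_Integration.integrable_bound)
    have "\<bar>u y * (\<sigma> x * k y x)\<bar> \<le> \<bar>B * (u y * \<sigma> x)\<bar>" for x y
    proof -
      have "\<bar>u y * (\<sigma> x * k y x)\<bar> = \<bar>u y * \<sigma> x\<bar> * \<bar>k y x\<bar>" by (simp add: abs_mult mult_ac)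
      also have "\<dots> \<le> \<bar>u y * \<sigma> x\<bar> * \<bar>B\<bar>" using B[of y x] by (intro mult_left_mono) auto
      finally show ?thesis by (simp add: abs_mult mult_ac)
    qed
    then show "AE z in lborel \<Otimes>\<^sub>M lborel. norm (case z of (y, x) \<Rightarrow> u y * (\<sigma> x * k y x)) \<le> norm (B * (case z of (y, x) \<Rightarrow> u y * \<sigma> x))"
      by (auto intro!: AE_I2)
  qed simp
qed


lemma taylor_rem_continuous:
  assumes "C1_fun W"
  shows "continuous_on UNIV (\<lambda>x. taylor_rem W x v)"
  unfolding taylor_rem_def
  by (intro continuous_intros dird_continuous[OF assms] C1_fun_continuous[OF assms]
      continuous_on_compose2[OF C1_fun_continuous[OF assms, of UNIV]]) auto

text \<open>Test function: the sign of the Taylor remainder convolved with the Taylor kernel, i.e. the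
  integral over t in [0,1] of (1 - t) \<rho>(\<cdot> - t v), whose second derivative along v represents the remainder.\<close>

lemma taylor_rem_L1_bound:
  fixes u \<rho> :: "real^'n::finite \<Rightarrow> real"
  assumes H: "tgv_dual_bound \<Omega> u" and u: "integrable lborel u" and moll: "is_mollifier \<rho>"
    and v: "norm v \<le> 1" and S[measurable]: "S \<in> sets borel" and bS: "bounded S"
    and K: "compact K" "K \<subseteq> \<Omega>"
    and SK: "\<And>x t z. x \<in> S \<Longrightarrow> 0 \<le> t \<Longrightarrow> t \<le> 1 \<Longrightarrow> \<rho> z \<noteq> 0 \<Longrightarrow> x + t *\<^sub>R v + z \<in> K"
  shows "(\<integral>\<^sup>+x. ennreal \<bar>taylor_rem (mollify \<rho> u) x v\<bar> * indicator S x \<partial>lborel) \<le> 1"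
proof -
  define W where "W = mollify \<rho> u"
  define T where "T x = taylor_rem W x v" for x
  have \<rho>2: "C2c \<rho>" and sym: "\<And>i j. partial_deriv i (partial_deriv j \<rho>) = partial_deriv j (partial_deriv i \<rho>)"
    and \<rho>0: "\<And>z. 0 \<le> \<rho> z" and \<rho>1: "(LINT z|lborel. \<rho> z) = 1"
    using moll by (auto simp: is_mollifier_def)
  have \<rho>c: "C1c \<rho>" by (rule C2c_C1c[OF \<rho>2])
  have cont\<rho>: "continuous_on UNIV \<rho>" and b\<rho>: "bounded {x. \<rho> x \<noteq> 0}"
    using \<rho>c by (auto simp: C1c_def C1_fun_continuous)
  have [measurable]: "\<rho> \<in> borel_measurable borel" by (rule borel_measurable_continuous_onI[OF cont\<rho>])
  have int\<rho>: "integrable lborel \<rho>" by (rule integrable_continuous_bounded_support[OF cont\<rho> b\<rho>])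
  define D where "D = dird v \<rho>"
  have Dc: "C1c D" unfolding D_def by (rule C2c_dird_C1c[OF \<rho>2])
  have contD: "continuous_on UNIV D" and bD: "bounded {x. D x \<noteq> 0}"
    using Dc by (auto simp: C1c_def C1_fun_continuous)
  have [measurable]: "u \<in> borel_measurable borel" using borel_measurable_integrable[OF u] by simp
  have WC1: "C1_fun W" unfolding W_def by (rule mollify_C1(1)[OF u \<rho>c])
  have contT: "continuous_on UNIV T" unfolding T_def[abs_def] by (rule taylor_rem_continuous[OF WC1])
  have [measurable]: "T \<in> borel_measurable borel" by (rule borel_measurable_continuous_onI[OF contT])
  \<comment> \<open>The dual function of the L1 norm on S: the product of \<sigma> and T is the
    modulus of T on S and zero elsewhere.\<close>
  define \<sigma> where "\<sigma> x = indicator S x * sgn (T x)" for x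
  have \<sigma>m[measurable]: "\<sigma> \<in> borel_measurable borel" unfolding \<sigma>_def by measurable
  have \<sigma>1: "\<bar>\<sigma> x\<bar> \<le> 1" for x by (auto simp: \<sigma>_def indicator_def sgn_real_def)
  have \<sigma>S: "x \<in> S" if "\<sigma> x \<noteq> 0" for x using that by (auto simp: \<sigma>_def indicator_def split: if_splits)
  have b\<sigma>: "bounded {x. \<sigma> x \<noteq> 0}" by (rule bounded_subset[OF bS]) (use \<sigma>S in auto)
  have int\<sigma>: "integrable lborel \<sigma>" by (rule integrable_bounded_support[OF \<sigma>m \<sigma>1 b\<sigma>])
  define N where "N = (lborel :: (real^'n) measure) \<Otimes>\<^sub>M (lborel :: real measure)"
  define w where "w z = \<sigma> (fst z) * (indicator {0..1} (snd z) * (1 - snd z))" for z :: "(real^'n) \<times> real"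
  define q where "q z = fst z + snd z *\<^sub>R v" for z :: "(real^'n) \<times> real"
  have [measurable]: "q \<in> borel_measurable N" unfolding q_def N_def by measurable
  have wm[measurable]: "w \<in> borel_measurable N" unfolding w_def N_def by measurable
  have w1: "\<bar>w z\<bar> \<le> indicator {0..1} (snd z)" for z
    using \<sigma>1[of "fst z"] by (auto simp: w_def indicator_def abs_mult intro: mult_le_one)
  have wint: "integrable N w"
    unfolding N_def lborel_prod
  proof (rule integrable_bounded_support)
    show "w \<in> borel_measurable borel" using wm by (simp add: N_def borel_prod lborel_prod)
    show "\<bar>w z\<bar> \<le> 1" for z by (rule order_trans[OF w1]) (simp add: indicator_def)
    show "bounded {z. w z \<noteq> 0}"
    proof (rule bounded_subset)
      show "bounded (S \<times> {0..1::real})" by (intro bounded_Times bS) simp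
      show "{z. w z \<noteq> 0} \<subseteq> S \<times> {0..1}"
        using \<sigma>S by (auto simp: w_def indicator_def split: if_splits)
    qed
  qed
  have fst_int: "convol N w q g y = (LINT x|lborel. \<sigma> x * (LINT t|lborel. (1 - t) * g (y - x - t *\<^sub>R v) * indicator {0..1} t))"
    if "continuous_on UNIV g" "bounded {x. g x \<noteq> 0}" for g y
  proof -
    have "integrable N (\<lambda>z. w z * g (y - q z))" by (rule convol_integrable[OF wint _ that]) simp
    then have "convol N w q g y = (LINT x|lborel. LINT t|lborel. w (x, t) * g (y - q (x, t)))"
      unfolding convol_def N_def by (subst lborel_pair.integral_fst'[symmetric]) auto
    also have "\<dots> = (LINT x|lborel. \<sigma> x * (LINT t|lborel. (1 - t) * g (y - x - t *\<^sub>R v) * indicator {0..1} t))"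
    proof (rule Bochner_Integration.integral_cong)
      fix x
      have "w (x, t) * g (y - q (x, t)) = \<sigma> x * ((1 - t) * g (y - x - t *\<^sub>R v) * indicator {0..1} t)" for t
        by (simp add: w_def q_def algebra_simps)
      then show "(LINT t|lborel. w (x, t) * g (y - q (x, t))) = \<sigma> x * (LINT t|lborel. (1 - t) * g (y - x - t *\<^sub>R v) * indicator {0..1} t)"
        by simp
    qed simp
    finally show ?thesis .
  qed
  \<comment> \<open>A dominating kernel of total mass one (\<open>hJ\<close>): it omits \<sigma> and
    the factor 1 - t, both at most one in modulus.\<close>
  define h where "h y z = indicator {0..1} (snd z) * \<rho> (y - fst z - snd z *\<^sub>R v)" for y and z :: "(real^'n) \<times> real"
  have hm[measurable]: "h y \<in> borel_measurable N" for y unfolding h_def N_def by measurable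
  have hint: "integrable N (h y)" for y
    unfolding N_def lborel_prod
  proof -
    obtain B where B: "\<And>x. \<bar>\<rho> x\<bar> \<le> B" using bounded_support_uniform(1)[OF cont\<rho> b\<rho>] by blast
    obtain R where R: "\<And>x. \<rho> x \<noteq> 0 \<Longrightarrow> norm x \<le> R" using b\<rho> by (auto simp: bounded_iff)
    show "integrable lborel (h y)"
    proof (rule integrable_bounded_support)
      show "h y \<in> borel_measurable borel" using hm by (simp add: N_def borel_prod lborel_prod)
      show "\<bar>h y z\<bar> \<le> \<bar>B\<bar>" for z using B[of "y - fst z - snd z *\<^sub>R v"] by (auto simp: h_def indicator_def)
      show "bounded {z. h y z \<noteq> 0}"
      proof (rule bounded_subset)
        show "bounded (cball y (R + 1) \<times> {0..1::real})" by (intro bounded_Times) simp_all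
        show "{z. h y z \<noteq> 0} \<subseteq> cball y (R + 1) \<times> {0..1}"
        proof
          fix z assume "z \<in> {z. h y z \<noteq> 0}"
          then have 1: "snd z \<in> {0..1}" and 2: "\<rho> (y - fst z - snd z *\<^sub>R v) \<noteq> 0"
            by (auto simp: h_def indicator_def split: if_splits)
          have "norm (snd z *\<^sub>R v) \<le> 1" using 1 v by (simp add: mult_le_one)
          moreover have "norm (y - fst z) \<le> norm (y - fst z - snd z *\<^sub>R v) + norm (snd z *\<^sub>R v)"
            by (metis diff_add_cancel norm_triangle_ineq)
          ultimately show "z \<in> cball y (R + 1) \<times> {0..1}"
            using R[OF 2] 1 by (cases z) (auto simp: dist_norm)
        qed
      qed
    qed
  qed
  have hJ: "(LINT z|N. h y z) = 1" for y
  proof -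
    have "integrable (lborel \<Otimes>\<^sub>M lborel) (\<lambda>(x, t). h y (x, t))" using hint[of y] by (simp add: N_def)
    then have "(LINT z|N. h y z) = (LINT t|lborel. LINT x|lborel. h y (x, t))"
      using lborel_pair.integral_snd[of "\<lambda>x t. h y (x, t)"] by (simp add: N_def)
    also have "\<dots> = (LINT t|lborel. indicator {0..1::real} t)"
    proof (rule Bochner_Integration.integral_cong)
      fix t :: real
      have "(LINT x|lborel. h y (x, t)) = indicator {0..1} t * (LINT x|lborel. \<rho> ((y - t *\<^sub>R v) - x))"
        by (simp add: h_def algebra_simps)
      also have "(LINT x|lborel. \<rho> ((y - t *\<^sub>R v) - x)) = 1" using integral_reflect[of \<rho> "y - t *\<^sub>R v"] \<rho>1 by simp
      finally show "(LINT x|lborel. h y (x, t)) = indicator {0..1} t" by simp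
    qed simp
    finally show ?thesis by simp
  qed
  define I where "I z = (LINT t|lborel. \<rho> (z - t *\<^sub>R v) * indicator {0..1} t)" for z
  have I_eq: "I (y - x) = (LINT t|lborel. h y (x, t))" for y x
    by (simp add: I_def h_def mult.commute)
  have I0: "0 \<le> I z" for z unfolding I_def by (rule integral_nonneg_AE) (use \<rho>0 in auto)
  have Iint: "integrable lborel (\<lambda>x. I (y - x))" for y
    unfolding I_eq using lborel_pair.integrable_fst'[OF hint[of y, unfolded N_def]] .
  have I1: "(LINT x|lborel. I (y - x)) = 1" for y
    unfolding I_eq using lborel_pair.integral_fst'[OF hint[of y, unfolded N_def]] hJ[of y] by (simp add: N_def)
  define \<Psi> where "\<Psi> = convol N w q \<rho>"
  have \<Psi>2: "C2_fun \<Psi>" unfolding \<Psi>_def by (rule convol_C2(1)[OF wint _ \<rho>2]) simp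
  have \<Psi>sym: "partial_deriv i (partial_deriv j \<Psi>) = partial_deriv j (partial_deriv i \<Psi>)" for i j
    unfolding \<Psi>_def using convol_C2(2)[OF wint _ \<rho>2, of q] sym by simp
  have supp: "{y. \<Psi> y \<noteq> 0} \<subseteq> K"
  proof
    fix y assume "y \<in> {y. \<Psi> y \<noteq> 0}"
    then have "\<Psi> y \<noteq> 0" by simp
    then obtain z where "w z * \<rho> (y - q z) \<noteq> 0"
      unfolding \<Psi>_def convol_def by (metis (mono_tags, lifting) Bochner_Integration.integral_cong Bochner_Integration.integral_zero)
    then have "fst z \<in> S" "0 \<le> snd z" "snd z \<le> 1" "\<rho> (y - q z) \<noteq> 0"
      using \<sigma>S by (auto simp: w_def indicator_def split: if_splits)
    from SK[OF this] show "y \<in> K" by (simp add: q_def)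
  qed
  have "closure {y. \<Psi> y \<noteq> 0} \<subseteq> K" by (rule closure_minimal[OF supp compact_imp_closed[OF K(1)]])
  then have cl: "closure {y. \<Psi> y \<noteq> 0} \<subseteq> \<Omega>" using K(2) by simp
  have \<Psi>C2c: "C2c \<Psi>" unfolding C2c_def using \<Psi>2 bounded_subset[OF compact_imp_bounded[OF K(1)] supp] by simp
  have \<Psi>1: "\<bar>\<Psi> y\<bar> \<le> 1" for y
  proof -
    have "\<bar>\<Psi> y\<bar> \<le> (LINT z|N. h y z)" unfolding \<Psi>_def convol_def
    proof (rule abs_integral_le_integral)
      show "integrable N (\<lambda>z. w z * \<rho> (y - q z))" by (rule convol_integrable[OF wint _ cont\<rho> b\<rho>]) simp
      show "\<bar>w z * \<rho> (y - q z)\<bar> \<le> h y z" for z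
        using w1[of z] \<rho>0[of "y - q z"] by (auto simp: abs_mult h_def q_def algebra_simps intro: mult_right_mono)
    qed (rule hint)
    then show ?thesis using hJ[of y] by simp
  qed
  \<comment> \<open>One derivative along v of the averaged kernel leaves \<rho> minus its segment
    average \<open>I\<close>. Both are probability densities in x, hence the bound 2, whatever the
    size of the support of \<rho>.\<close>
  have \<Psi>d: "\<bar>dird v \<Psi> y\<bar> \<le> 2" for y
  proof -
    have eq: "dird v \<Psi> y = (LINT x|lborel. \<sigma> x * (\<rho> (y - x) - I (y - x)))"
    proof -
      have "dird v \<Psi> y = convol N w q (dird v \<rho>) y" unfolding \<Psi>_def by (rule convol_dird[OF wint _ \<rho>c]) simp
      also have "\<dots> = (LINT x|lborel. \<sigma> x * (LINT t|lborel. (1 - t) * dird v \<rho> (y - x - t *\<^sub>R v) * indicator {0..1} t))"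
        by (rule fst_int) (use contD bD in \<open>auto simp: D_def\<close>)
      finally show ?thesis using dird_FTC_weighted[of \<rho>] \<rho>c by (simp add: C1c_def I_def)
    qed
    have i: "integrable lborel (\<lambda>x. \<rho> (y - x) + I (y - x))"
      by (intro Bochner_Integration.integrable_add Iint integrable_reflect[OF int\<rho>])
    have le: "\<bar>\<sigma> x * (\<rho> (y - x) - I (y - x))\<bar> \<le> \<rho> (y - x) + I (y - x)" for x
    proof -
      have "\<bar>\<sigma> x * (\<rho> (y - x) - I (y - x))\<bar> \<le> 1 * \<bar>\<rho> (y - x) - I (y - x)\<bar>"
        unfolding abs_mult by (intro mult_right_mono \<sigma>1) simp
      also have "\<dots> \<le> \<rho> (y - x) + I (y - x)" using \<rho>0[of "y - x"] I0[of "y - x"] by (simp add: abs_le_iff)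
      finally show ?thesis .
    qed
    have [measurable]: "(\<lambda>x. I (y - x)) \<in> borel_measurable lborel" using Iint[of y] by simp
    have "\<bar>dird v \<Psi> y\<bar> \<le> (LINT x|lborel. \<rho> (y - x) + I (y - x))"
      unfolding eq
    proof (rule abs_integral_le_integral)
      show "integrable lborel (\<lambda>x. \<sigma> x * (\<rho> (y - x) - I (y - x)))"
      proof (rule Bochner_Integration.integrable_bound[OF i])
        show "AE x in lborel. norm (\<sigma> x * (\<rho> (y - x) - I (y - x))) \<le> norm (\<rho> (y - x) + I (y - x))"
        proof (rule AE_I2)
          fix x show "norm (\<sigma> x * (\<rho> (y - x) - I (y - x))) \<le> norm (\<rho> (y - x) + I (y - x))"
            using le[of x] abs_ge_self[of "\<rho> (y - x) + I (y - x)"] unfolding real_norm_def by (rule order_trans)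
        qed
      qed measurable
    qed (use i le in auto)
    also have "\<dots> = 2"
      using integrable_reflect[OF int\<rho>, of y] Iint[of y] I1[of y] integral_reflect[of \<rho> y] \<rho>1 by simp
    finally show ?thesis .
  qed
  \<comment> \<open>The second derivative of the kernel along v, computed by two integrations.
    Paired with u, its three terms give the derivative of W along v with a minus sign,
    \<open>- W x\<close> and \<open>W (x + v)\<close>.\<close>
  define k where "k z = D z - \<rho> z + \<rho> (z - v)" for z
  have contk: "continuous_on UNIV k" unfolding k_def
    by (intro continuous_intros contD cont\<rho> continuous_on_compose2[OF cont\<rho>]) auto
  have [measurable]: "k \<in> borel_measurable borel" by (rule borel_measurable_continuous_onI[OF contk])
  obtain B where B: "\<And>z. \<bar>k z\<bar> \<le> B"
  proof -
    obtain B1 where B1: "\<And>z. \<bar>\<rho> z\<bar> \<le> B1" using bounded_support_uniform(1)[OF cont\<rho> b\<rho>] by blast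
    obtain B2 where B2: "\<And>z. \<bar>D z\<bar> \<le> B2" using bounded_support_uniform(1)[OF contD bD] by blast
    have "\<bar>k z\<bar> \<le> B2 + B1 + B1" for z
      using B1[of z] B1[of "z - v"] B2[of z] unfolding k_def by linarith
    then show thesis by (rule that)
  qed
  have d2: "dird2 v \<Psi> y = (LINT x|lborel. \<sigma> x * k (y - x))" for y
  proof -
    have "dird2 v \<Psi> y = convol N w q (dird v D) y"
      unfolding \<Psi>_def D_def by (rule convol_C2(3)[OF wint _ \<rho>2]) simp
    also have "\<dots> = (LINT x|lborel. \<sigma> x * (LINT t|lborel. (1 - t) * dird v D (y - x - t *\<^sub>R v) * indicator {0..1} t))"
      by (rule fst_int) (use Dc dird_bounded_support[OF Dc] in \<open>auto simp: C1c_def dird_continuous\<close>)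
    moreover have "(LINT t|lborel. (1 - t) * dird v D (z - t *\<^sub>R v) * indicator {0..1} t) = k z" for z
      using dird_FTC_weighted[of D v z] dird_FTC[of \<rho> v z] Dc \<rho>c by (simp add: C1c_def k_def D_def)
    ultimately show ?thesis by simp
  qed
  have le1: "(LINT y|lborel. u y * dird2 v \<Psi> y) \<le> 1"
    using H v \<Psi>C2c \<Psi>sym cl \<Psi>1 \<Psi>d unfolding tgv_dual_bound_def by blast
  have Tk: "(LINT y|lborel. u y * k (y - x)) = T x" for x
  proof -
    have iu: "integrable lborel (\<lambda>y. u y * g (y - x))" if g: "continuous_on UNIV g" "bounded {x. g x \<noteq> 0}" for g x
    proof -
      obtain Bg where Bg: "\<And>z. \<bar>g z\<bar> \<le> Bg" using bounded_support_uniform(1)[OF g] by blast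
      have [measurable]: "g \<in> borel_measurable borel" using g by (intro borel_measurable_continuous_onI)
      show ?thesis
      proof (rule Bochner_Integration.integrable_bound[of _ "\<lambda>y. Bg * u y"])
        have "\<bar>u y\<bar> * \<bar>g (y - x)\<bar> \<le> \<bar>u y\<bar> * \<bar>Bg\<bar>" for y
          using Bg[of "y - x"] by (intro mult_left_mono) auto
        then show "AE y in lborel. norm (u y * g (y - x)) \<le> norm (Bg * u y)"
          by (simp add: abs_mult mult.commute)
      qed (use u in auto)
    qed
    have "(LINT y|lborel. u y * k (y - x)) = (LINT y|lborel. u y * D (y - x) - u y * \<rho> (y - x) + u y * \<rho> (y - (x + v)))"
      by (simp add: k_def algebra_simps)
    also have "\<dots> = mollify D u x - mollify \<rho> u x + mollify \<rho> u (x + v)"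
      unfolding mollify_def using iu[OF contD bD, of x] iu[OF cont\<rho> b\<rho>, of x] iu[OF cont\<rho> b\<rho>, of "x + v"] by simp
    also have "\<dots> = T x"
      unfolding T_def taylor_rem_def W_def D_def mollify_C1(2)[OF u \<rho>c] by simp
    finally show ?thesis .
  qed
  have "(LINT y|lborel. u y * dird2 v \<Psi> y) = (LINT y|lborel. LINT x|lborel. u y * (\<sigma> x * k (y - x)))"
    by (simp add: d2)
  also have "\<dots> = (LINT x|lborel. LINT y|lborel. u y * (\<sigma> x * k (y - x)))"
  proof (rule lborel_pair.Fubini_integral[symmetric])
    show "integrable (lborel \<Otimes>\<^sub>M lborel) (\<lambda>(y, x). u y * (\<sigma> x * k (y - x)))"
      by (rule pair_integrable_mult_bounded[OF u int\<sigma>, of "\<lambda>y x. k (y - x)" B]) (use B in simp_all)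
  qed
  also have "\<dots> = (LINT x|lborel. \<sigma> x * T x)"
  proof (rule Bochner_Integration.integral_cong)
    fix x
    have "(LINT y|lborel. u y * (\<sigma> x * k (y - x))) = (LINT y|lborel. \<sigma> x * (u y * k (y - x)))"
      by (simp add: mult_ac)
    then show "(LINT y|lborel. u y * (\<sigma> x * k (y - x))) = \<sigma> x * T x" by (simp add: Tk)
  qed simp
  also have "\<dots> = (LINT x|lborel. \<bar>T x\<bar> * indicator S x)"
    by (rule Bochner_Integration.integral_cong) (auto simp: \<sigma>_def indicator_def sgn_real_def)
  finally have le2: "(LINT x|lborel. \<bar>T x\<bar> * indicator S x) \<le> 1" using le1 by simp
  \<comment> \<open>A Bochner integral of a non-integrable function is 0 by convention, so
    integrability has to be settled before passing to the nonnegative integral; T is continuous and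
    S bounded.\<close>
  have Tint: "integrable lborel (\<lambda>x. \<bar>T x\<bar> * indicator S x)"
  proof -
    have "bounded (T ` closure S)"
      using bS by (intro compact_imp_bounded compact_continuous_image continuous_on_subset[OF contT]) auto
    then obtain BT where BT: "\<And>x. x \<in> closure S \<Longrightarrow> \<bar>T x\<bar> \<le> BT" by (auto simp: bounded_iff)
    show ?thesis
    proof (rule integrable_bounded_support)
      show "\<bar>\<bar>T x\<bar> * indicator S x\<bar> \<le> \<bar>BT\<bar>" for x
        using BT[of x] closure_subset[of S] by (auto simp: indicator_def)
      show "bounded {x. \<bar>T x\<bar> * indicator S x \<noteq> 0}"
        by (rule bounded_subset[OF bS]) (auto simp: indicator_def split: if_splits)
    qed measurable
  qed
  have "(\<integral>\<^sup>+x. ennreal \<bar>T x\<bar> * indicator S x \<partial>lborel) = (\<integral>\<^sup>+x. ennreal (\<bar>T x\<bar> * indicator S x) \<partial>lborel)"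
    by (rule nn_integral_cong) (auto simp: indicator_def)
  also have "\<dots> = ennreal (LINT x|lborel. \<bar>T x\<bar> * indicator S x)"
    by (rule nn_integral_eq_integral[OF Tint]) auto
  also have "\<dots> \<le> 1" using le2 by simp
  finally show ?thesis by (simp add: T_def W_def)
qed

section \<open>Mollifiers\<close>

lemma max_zero_power_derivative:
  "((\<lambda>t::real. max 0 t ^ (k + 2)) has_real_derivative real (k + 2) * max 0 t ^ (k + 1)) (at t)"
proof -
  consider "t > 0" | "t < 0" | "t = 0" by linarith
  then show ?thesis
  proof cases
    case 1
    have "((\<lambda>t::real. t ^ (k + 2)) has_real_derivative real (k + 2) * t ^ (k + 1)) (at t)"
      by (rule derivative_eq_intros refl | simp)+
    then have "((\<lambda>t::real. max 0 t ^ (k + 2)) has_real_derivative real (k + 2) * t ^ (k + 1)) (at t)"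
      by (rule has_field_derivative_transform_within_open[of _ _ _ "{0<..}"]) (use 1 in auto)
    then show ?thesis using 1 by simp
  next
    case 2
    have "((\<lambda>t::real. 0) has_real_derivative 0) (at t)" by simp
    then have "((\<lambda>t::real. max 0 t ^ (k + 2)) has_real_derivative 0) (at t)"
      by (rule has_field_derivative_transform_within_open[of _ _ _ "{..<0}"]) (use 2 in auto)
    then show ?thesis using 2 by simp
  next
    case 3
    have "((\<lambda>h. max 0 h ^ (k + 2) / h) \<longlongrightarrow> 0) (at (0::real))"
    proof (rule Lim_null_comparison)
      have "norm (max 0 h ^ (k + 2) / h) \<le> \<bar>h\<bar> ^ (k + 1)" for h :: real
      proof (cases "h > 0")
        case False
        then have "max 0 h ^ (k + 2) / h = 0" by simp
        moreover have "0 \<le> \<bar>h\<bar> ^ (k + 1)" by (rule zero_le_power) simp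
        ultimately show ?thesis by (simp only: norm_zero)
      qed simp
      then show "\<forall>\<^sub>F h in at (0::real). norm (max 0 h ^ (k + 2) / h) \<le> \<bar>h\<bar> ^ (k + 1)" by simp
      have "((\<lambda>h::real. \<bar>h\<bar> ^ (k + 1)) \<longlongrightarrow> \<bar>0\<bar> ^ (k + 1)) (at 0)"
        by (intro tendsto_intros)
      then show "((\<lambda>h::real. \<bar>h\<bar> ^ (k + 1)) \<longlongrightarrow> 0) (at 0)" by simp
    qed
    then show ?thesis using 3 by (simp add: DERIV_def)
  qed
qed

definition bump_base :: "real^'n::finite \<Rightarrow> real \<Rightarrow> real^'n \<Rightarrow> real" where
  "bump_base p s z = max 0 (s\<^sup>2 - (z - p) \<bullet> (z - p))"

text \<open>The cube of the positive part of a quadratic: among the integer powers, three is the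
  first that is twice continuously differentiable across the sphere.\<close>

definition bump :: "real \<Rightarrow> real^'n::finite \<Rightarrow> real \<Rightarrow> real^'n \<Rightarrow> real" where
  "bump a p s z = a * bump_base p s z ^ 3"

lemma continuous_bump_base: "continuous_on UNIV (bump_base p s)"
  unfolding bump_base_def by (intro continuous_intros)

lemma bump_base_power_derivative:
  "((\<lambda>z. bump_base p s z ^ (k + 2)) has_derivative
     (\<lambda>h. real (k + 2) * bump_base p s z ^ (k + 1) * (-2 * ((z - p) \<bullet> h)))) (at z)"
proof -
  have "((\<lambda>z. s\<^sup>2 - (z - p) \<bullet> (z - p)) has_derivative (\<lambda>h. -2 * ((z - p) \<bullet> h))) (at z)"
    by (rule derivative_eq_intros refl | simp add: inner_commute)+
  from has_derivative_compose[OF this, of "\<lambda>t. max 0 t ^ (k + 2)"] max_zero_power_derivative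
  show ?thesis unfolding has_field_derivative_def bump_base_def by blast
qed

lemma bump_deriv:
  fixes p :: "real^'n::finite"
  shows "C1_fun (bump a p s)" 
    "partial_deriv i (bump a p s) = (\<lambda>z. -6 * a * (z - p) $ i * bump_base p s z ^ 2)"
proof -
  have D: "(bump a p s has_derivative (\<lambda>h. \<Sum>i\<in>UNIV. h $ i * (-6 * a * (z - p) $ i * bump_base p s z ^ 2))) (at z)" for z :: "real^'n"
  proof -
    have "(bump a p s has_derivative (\<lambda>h. a * (real (1 + 2) * bump_base p s z ^ (1 + 1) * (-2 * ((z - p) \<bullet> h))))) (at z)"
      unfolding bump_def[abs_def] using has_derivative_mult_right[OF bump_base_power_derivative[of p s 1 z], of a]
      by (simp add: numeral_3_eq_3)
    moreover have "a * (real (1 + 2) * bump_base p s z ^ (1 + 1) * (-2 * ((z - p) \<bullet> h)))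
      = (\<Sum>i\<in>UNIV. h $ i * (-6 * a * (z - p) $ i * bump_base p s z ^ 2))" for h
      unfolding inner_vec_def sum_distrib_left by (rule sum.cong) (simp_all add: algebra_simps power2_eq_square)
    ultimately show ?thesis by simp
  qed
  have c: "continuous_on UNIV (\<lambda>z. -6 * a * (z - p) $ i * bump_base p s z ^ 2)" for i
    by (intro continuous_intros continuous_bump_base)
  show "C1_fun (bump a p s)" by (rule C1_funI(1)[OF D c])
  show "partial_deriv i (bump a p s) = (\<lambda>z. -6 * a * (z - p) $ i * bump_base p s z ^ 2)"
    by (rule C1_funI(2)[OF D c])
qed

lemma bump_deriv2:
  fixes p :: "real^'n::finite"
  shows "C1_fun (partial_deriv i (bump a p s))"
    "partial_deriv j (partial_deriv i (bump a p s)) =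
      (\<lambda>z. (if i = j then -6 * a * bump_base p s z ^ 2 else 0) + 24 * a * (z - p) $ i * (z - p) $ j * bump_base p s z)"
proof -
  let ?g = "\<lambda>j z. (if i = j then -6 * a * bump_base p s z ^ 2 else 0) + 24 * a * (z - p) $ i * (z - p) $ j * bump_base p s z"
  have D: "(partial_deriv i (bump a p s) has_derivative (\<lambda>h. \<Sum>j\<in>UNIV. h $ j * ?g j z)) (at z)" for z
  proof -
    have "((\<lambda>z. -6 * a * (z - p) $ i) has_derivative (\<lambda>h. -6 * a * h $ i)) (at z)"
      by (rule derivative_eq_intros refl bounded_linear.has_derivative[OF bounded_linear_vec_nth] | simp)+
    then have "((\<lambda>z. -6 * a * (z - p) $ i * bump_base p s z ^ (0 + 2)) has_derivative
       (\<lambda>h. -6 * a * (z - p) $ i * (real (0 + 2) * bump_base p s z ^ (0 + 1) * (-2 * ((z - p) \<bullet> h))) +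
          -6 * a * h $ i * bump_base p s z ^ (0 + 2))) (at z)"
      by (rule has_derivative_mult[OF _ bump_base_power_derivative])
    moreover have "-6 * a * (z - p) $ i * (real (0 + 2) * bump_base p s z ^ (0 + 1) * (-2 * ((z - p) \<bullet> h))) +
          -6 * a * h $ i * bump_base p s z ^ (0 + 2) = (\<Sum>j\<in>UNIV. h $ j * ?g j z)" for h
    proof -
      have "(\<Sum>j\<in>UNIV. h $ j * ?g j z) = (\<Sum>j\<in>UNIV. if i = j then h $ j * (-6 * a * bump_base p s z ^ 2) else 0)
        + (\<Sum>j\<in>UNIV. h $ j * (24 * a * (z - p) $ i * (z - p) $ j * bump_base p s z))"
        unfolding sum.distrib[symmetric] by (rule sum.cong) (auto simp: algebra_simps)
      also have "\<dots> = h $ i * (-6 * a * bump_base p s z ^ 2) + 24 * a * (z - p) $ i * bump_base p s z * ((z - p) \<bullet> h)"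
        by (simp add: inner_vec_def sum_distrib_left sum_distrib_right mult_ac)
      finally show ?thesis by (simp only:) (simp add: power2_eq_square)
    qed
    ultimately show ?thesis unfolding bump_deriv(2) by (simp add: power2_eq_square)
  qed
  have c: "continuous_on UNIV (?g j)" for j
    by (cases "i = j") (auto intro!: continuous_intros continuous_bump_base)
  show "C1_fun (partial_deriv i (bump a p s))" by (rule C1_funI(1)[OF D c])
  show "partial_deriv j (partial_deriv i (bump a p s)) = ?g j" by (rule C1_funI(2)[OF D c])
qed

lemma bump_nonzero_imp: "s > 0 \<Longrightarrow> bump a p s z \<noteq> 0 \<Longrightarrow> dist p z < s"
proof -
  assume s: "s > 0" and "bump a p s z \<noteq> 0"
  then have "(norm (z - p))\<^sup>2 < s\<^sup>2"
    by (auto simp: bump_def bump_base_def max_def power2_norm_eq_inner split: if_splits)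
  then have "norm (z - p) < s" using s by (simp add: power2_less_imp_less)
  then show "dist p z < s" by (simp add: dist_norm norm_minus_commute)
qed

lemma bump_C2c: "s > 0 \<Longrightarrow> C2c (bump a p s)"
proof -
  assume s: "s > 0"
  have "bounded {z. bump a p s z \<noteq> 0}"
    by (rule bounded_subset[of "ball p s"]) (use bump_nonzero_imp[OF s] in auto)
  then show ?thesis by (simp add: C2c_def C2_fun_def bump_deriv(1) bump_deriv2(1))
qed

text \<open>The centre p is free because the mollifiers used at the boundary must lie inside a cone
  and hence away from the origin.\<close>

lemma mollifier_exists:
  fixes p :: "real^'n::finite"
  assumes s: "s > 0"
  shows "\<exists>\<rho>. is_mollifier \<rho> \<and> (\<forall>z. \<rho> z \<noteq> 0 \<longrightarrow> z \<in> ball p s)"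
proof -
  define c where "c = (LINT z|lborel. bump 1 p s z)"
  have C: "C1c (bump 1 p s)" by (rule C2c_C1c[OF bump_C2c[OF s]])
  have int: "integrable lborel (bump 1 p s)"
    using C by (intro integrable_continuous_bounded_support) (auto simp: C1c_def C1_fun_continuous)
  \<comment> \<open>Normalisation needs a positive integral: on the ball of half the radius the
    quadratic is at least three quarters of the squared radius.\<close>
  have "0 < (3/4 * s\<^sup>2) ^ 3 * measure lborel (ball p (s/2))"
    using s by (simp add: content_ball_pos)
  also have "\<dots> = (LINT z|lborel. (3/4 * s\<^sup>2) ^ 3 * indicator (ball p (s/2)) z)"
    by simp
  also have "\<dots> \<le> c" unfolding c_def
  proof (rule integral_mono)
    show "integrable lborel (\<lambda>z. (3/4 * s\<^sup>2) ^ 3 * indicator (ball p (s/2)) z)"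
      by (intro integrable_mult_right integrable_real_indicator emeasure_bounded_finite) auto
    show "integrable lborel (bump 1 p s)" by (rule int)
    fix z
    show "(3/4 * s\<^sup>2) ^ 3 * indicator (ball p (s/2)) z \<le> bump 1 p s z"
    proof (cases "z \<in> ball p (s/2)")
      case True
      then have "norm (z - p) \<le> s/2" by (simp add: dist_norm norm_minus_commute)
      then have "(norm (z - p))\<^sup>2 \<le> (s/2)\<^sup>2" by (intro power_mono) auto
      then have "3/4 * s\<^sup>2 \<le> bump_base p s z"
        unfolding bump_base_def power2_norm_eq_inner power_divide by (intro max.coboundedI2) simp
      then show ?thesis using True by (auto simp: bump_def intro!: power_mono)
    qed (simp add: bump_def bump_base_def)
  qed
  finally have c: "0 < c" .
  have "bump (1/c) p s z = 1/c * bump 1 p s z" for z by (simp add: bump_def)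
  then have "(LINT z|lborel. bump (1/c) p s z) = 1"
    using c by (simp add: c_def[symmetric])
  moreover have "0 \<le> bump (1/c) p s z" for z using c by (simp add: bump_def bump_base_def)
  moreover have "partial_deriv i (partial_deriv j (bump (1/c) p s)) = partial_deriv j (partial_deriv i (bump (1/c) p s))" for i j
    by (cases "i = j") (auto simp: bump_deriv2(2) fun_eq_iff algebra_simps)
  ultimately have "is_mollifier (bump (1/c) p s)"
    unfolding is_mollifier_def by (auto simp: bump_C2c[OF s])
  then show ?thesis using bump_nonzero_imp[OF s] by auto
qed

section \<open>Translations in L1 and convergence of mollifications\<close>

lemma integral_shift:
  fixes f :: "'a::euclidean_space \<Rightarrow> real"
  assumes [measurable]: "f \<in> borel_measurable borel"
  shows "(LINT x|lborel. f (x + z)) = (LINT x|lborel. f x)"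
proof -
  have "(LINT x|lborel. f x) = (LINT x|distr lborel borel ((+) z). f x)" by (simp add: lborel_distr_plus)
  also have "\<dots> = (LINT x|lborel. f (z + x))" by (rule integral_distr) auto
  finally show ?thesis by (simp add: add.commute)
qed

lemma integrable_shift:
  fixes f :: "'a::euclidean_space \<Rightarrow> real"
  assumes f: "integrable lborel f"
  shows "integrable lborel (\<lambda>x. f (x + z))"
proof -
  have "integrable (distr lborel borel ((+) z)) f" using f by (simp add: lborel_distr_plus)
  then have "integrable lborel (\<lambda>x. f (z + x))" by (rule integrable_distr[rotated]) auto
  then show ?thesis by (simp add: add.commute)
qed

lemma nn_integral_shift:
  fixes f :: "'a::euclidean_space \<Rightarrow> ennreal"
  assumes [measurable]: "f \<in> borel_measurable borel"
  shows "(\<integral>\<^sup>+x. f (x + z) \<partial>lborel) = (\<integral>\<^sup>+x. f x \<partial>lborel)"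
proof -
  have "(\<integral>\<^sup>+x. f x \<partial>lborel) = (\<integral>\<^sup>+x. f x \<partial>distr lborel borel ((+) z))" by (simp add: lborel_distr_plus)
  also have "\<dots> = (\<integral>\<^sup>+x. f (z + x) \<partial>lborel)" by (rule nn_integral_distr) auto
  finally show ?thesis by (simp add: add.commute)
qed

text \<open>Inner regularity is applied to Lebesgue measure cut down to A, which is finite. The open
  set U approximates K, not A, and may fail to contain A; for translating indicators this
  suffices.\<close>

lemma finite_measure_compact_open_approx:
  fixes A :: "'a::euclidean_space set"
  assumes A[measurable]: "A \<in> sets borel" and fin: "emeasure lborel A < \<infinity>" and e: "e > 0"
  obtains K U where "compact K" "open U" "K \<subseteq> A" "K \<subseteq> U" "emeasure lborel U < \<infinity>"
    "measure lborel A < measure lborel K + e" "measure lborel U < measure lborel K + e"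
proof -
  define M where "M = density lborel (indicator A :: 'a \<Rightarrow> ennreal)"
  have sb: "sets M = sets borel" by (simp add: M_def)
  have eM: "emeasure M B = emeasure lborel (A \<inter> B)" if "B \<in> sets borel" for B
    unfolding M_def using that by (subst emeasure_density) (auto simp: nn_integral_indicator[symmetric] indicator_inter_arith simp del: nn_integral_indicator)
  have "emeasure M (space M) \<noteq> \<infinity>" using fin eM[of UNIV] by (simp add: M_def)
  from inner_regular[OF sb this A]
  have sup: "emeasure lborel A = (SUP K\<in>{K. K \<subseteq> A \<and> compact K}. emeasure M K)" using eM[OF A] by simp
  have "\<exists>K\<in>{K. K \<subseteq> A \<and> compact K}. emeasure lborel A < emeasure M K + ennreal e"
    by (rule SUP_approx_ennreal[OF _ _ sup]) (use e fin in auto)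
  then obtain K where K: "K \<subseteq> A" "compact K" "emeasure lborel A < emeasure M K + ennreal e" by auto
  have Kb[measurable]: "K \<in> sets borel" using K by (simp add: compact_imp_closed)
  have "emeasure M K = emeasure lborel K" using eM[OF Kb] K(1) by (simp add: inf.absorb2)
  with K(3) have K3: "emeasure lborel A < emeasure lborel K + ennreal e" by simp
  have fK: "emeasure lborel K < \<infinity>" using K(2) by (intro emeasure_bounded_finite compact_imp_bounded)
  obtain U where U: "open U" "K \<subseteq> U" "emeasure lborel (U - K) < ennreal e"
    using outer_regular_lborel[OF Kb e] by metis
  have [measurable]: "U \<in> sets borel" using U by simp
  have "emeasure lborel U = emeasure lborel K + emeasure lborel (U - K)"
    using U(2) by (subst plus_emeasure) (auto simp: Un_absorb1)
  also have "\<dots> < emeasure lborel K + ennreal e"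
    using U(3) fK by (simp add: ennreal_add_left_cancel_less)
  finally have U3: "emeasure lborel U < emeasure lborel K + ennreal e" .
  then have fU: "emeasure lborel U < \<infinity>" using fK by (metis top.not_eq_extremum infinity_ennreal_def order_less_imp_not_less)
  have cv: "emeasure lborel B = ennreal (measure lborel B)" if "emeasure lborel B < \<infinity>" for B :: "'a set"
    using that by (simp add: emeasure_eq_ennreal_measure)
  show thesis
  proof (rule that)
    show "measure lborel A < measure lborel K + e" "measure lborel U < measure lborel K + e"
      using K3 U3 cv[OF fin] cv[OF fK] cv[OF fU] e
      by (simp_all add: ennreal_plus[symmetric] ennreal_less_iff del: ennreal_plus)
  qed (use K U fU in auto)
qed

text \<open>Induction over integrable functions. Only indicators need an argument: a short
  translation of the compact K stays in the open U, so the indicator changes only where one of the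
  two points lies in A - K or in U - K.\<close>

lemma translation_L1_continuous:
  fixes f :: "'a::euclidean_space \<Rightarrow> real"
  assumes "integrable lborel f"
  shows "\<forall>e>0. \<exists>d>0. \<forall>z. norm z < d \<longrightarrow> (LINT x|lborel. \<bar>f (x + z) - f x\<bar>) < e"
  using assms
proof (induction rule: integrable_induct)
  case (base A c)
  have A[measurable]: "A \<in> sets borel" using base by simp
  show ?case
  proof (intro allI impI)
    fix e :: real assume e: "e > 0"
    \<comment> \<open>The two translates of g contribute at most four times \<open>e'\<close>; the
      factor 5 and the summand 1 make the final inequality strict, also for c = 0.\<close>
    define e' where "e' = e / (5 * (\<bar>c\<bar> + 1))"
    have e': "e' > 0" using e by (simp add: e'_def add_nonneg_pos)
    obtain K U where K: "compact K" "K \<subseteq> A" "measure lborel A < measure lborel K + e'"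
      and U: "open U" "K \<subseteq> U" "emeasure lborel U < \<infinity>" "measure lborel U < measure lborel K + e'"
      using finite_measure_compact_open_approx[OF A _ e'] base by (metis infinity_ennreal_def)
    have [measurable]: "K \<in> sets borel" "U \<in> sets borel" using K U by (auto simp: compact_imp_closed)
    have fK: "emeasure lborel K < \<infinity>" using K by (intro emeasure_bounded_finite compact_imp_bounded)
    obtain d where d: "d > 0" "(\<Union>x\<in>K. ball x d) \<subseteq> U"
      using compact_subset_open_imp_ball_epsilon_subset[OF K(1) U(1,2)] by blast
    define g where "g x = (indicator A x - indicator K x) + (indicator U x - indicator K x :: real)" for x
    have ig: "integrable lborel g" unfolding g_def
      by (intro Bochner_Integration.integrable_add Bochner_Integration.integrable_diff integrable_real_indicator)
        (use base fK U in auto)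
    have "(LINT x|lborel. g x) = (measure lborel A - measure lborel K) + (measure lborel U - measure lborel K)"
      unfolding g_def using base fK U by simp
    then have g2: "(LINT x|lborel. g x) \<le> 2 * e'" using K U by simp
    show "\<exists>d>0. \<forall>z. norm z < d \<longrightarrow> (LINT x|lborel. \<bar>indicat_real A (x + z) *\<^sub>R c - indicat_real A x *\<^sub>R c\<bar>) < e"
    proof (intro exI conjI allI impI)
      fix z :: 'a assume z: "norm z < d"
      have pt: "\<bar>indicat_real A (x + z) *\<^sub>R c - indicat_real A x *\<^sub>R c\<bar> \<le> \<bar>c\<bar> * (g (x + z) + g x)" for x
      proof -
        have "x \<in> ball (x + z) d" "x + z \<in> ball x d" using z by (auto simp: dist_norm)
        then have xU: "x + z \<in> K \<Longrightarrow> x \<in> U" and xzU: "x \<in> K \<Longrightarrow> x + z \<in> U"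
          using d(2) by blast+
        have "\<bar>indicat_real A (x + z) - indicat_real A x\<bar> \<le> g (x + z) + g x"
          using xU xzU K(2) U(2) by (auto simp: g_def indicator_def)
        then have "\<bar>c\<bar> * \<bar>indicat_real A (x + z) - indicat_real A x\<bar> \<le> \<bar>c\<bar> * (g (x + z) + g x)"
          by (intro mult_left_mono) auto
        moreover have "\<bar>indicat_real A (x + z) *\<^sub>R c - indicat_real A x *\<^sub>R c\<bar> = \<bar>c\<bar> * \<bar>indicat_real A (x + z) - indicat_real A x\<bar>"
          by (simp add: abs_mult[symmetric] algebra_simps)
        ultimately show ?thesis by simp
      qed
      have gm: "g \<in> borel_measurable borel" using ig borel_measurable_integrable by fastforce
      have i2: "integrable lborel (\<lambda>x. \<bar>c\<bar> * (g (x + z) + g x))"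
        using ig integrable_shift[OF ig] by simp
      have "(LINT x|lborel. \<bar>indicat_real A (x + z) *\<^sub>R c - indicat_real A x *\<^sub>R c\<bar>) \<le> (LINT x|lborel. \<bar>c\<bar> * (g (x + z) + g x))"
        by (rule integral_mono'[OF i2 pt]) (use pt in \<open>auto intro: order_trans[OF abs_ge_zero]\<close>)
      also have "\<dots> = \<bar>c\<bar> * (2 * (LINT x|lborel. g x))"
        using ig integrable_shift[OF ig] integral_shift[OF gm] by simp
      also have "\<dots> \<le> \<bar>c\<bar> * (2 * (2 * e'))" using g2 by (intro mult_left_mono) auto
      also have "\<dots> < (\<bar>c\<bar> + 1) * (5 * e')" using e' by (simp add: algebra_simps add_nonneg_pos)
      also have "\<dots> = e" by (simp add: e'_def field_simps add_nonneg_eq_0_iff)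
      finally show "(LINT x|lborel. \<bar>indicat_real A (x + z) *\<^sub>R c - indicat_real A x *\<^sub>R c\<bar>) < e" .
    qed (use d in simp)
  qed
next
  case (add f g)
  show ?case
  proof (intro allI impI)
    fix e :: real assume "e > 0"
    then have e2: "e/2 > 0" by simp
    obtain d1 where d1: "d1 > 0" "\<And>z. norm z < d1 \<Longrightarrow> (LINT x|lborel. \<bar>f (x + z) - f x\<bar>) < e/2" using add e2 by blast
    obtain d2 where d2: "d2 > 0" "\<And>z. norm z < d2 \<Longrightarrow> (LINT x|lborel. \<bar>g (x + z) - g x\<bar>) < e/2" using add e2 by blast
    show "\<exists>d>0. \<forall>z. norm z < d \<longrightarrow> (LINT x|lborel. \<bar>f (x + z) + g (x + z) - (f x + g x)\<bar>) < e"
    proof (intro exI[of _ "min d1 d2"] conjI allI impI)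
      fix z :: 'a assume z: "norm z < min d1 d2"
      have i: "integrable lborel (\<lambda>x. \<bar>f (x + z) - f x\<bar>)" "integrable lborel (\<lambda>x. \<bar>g (x + z) - g x\<bar>)"
        by (intro integrable_abs Bochner_Integration.integrable_diff integrable_shift add.hyps)+
      have "(LINT x|lborel. \<bar>f (x + z) + g (x + z) - (f x + g x)\<bar>) \<le> (LINT x|lborel. \<bar>f (x + z) - f x\<bar> + \<bar>g (x + z) - g x\<bar>)"
        by (rule integral_mono') (use i in auto)
      also have "\<dots> < e" using d1(2)[of z] d2(2)[of z] z i by simp
      finally show "(LINT x|lborel. \<bar>f (x + z) + g (x + z) - (f x + g x)\<bar>) < e" .
    qed (use d1 d2 in auto)
  qed
next
  case (lim f s)
  show ?case
  proof (intro allI impI)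
    fix e :: real assume e: "e > 0"
    have "(\<lambda>i. LINT x|lborel. norm (s i x - f x)) \<longlonglongrightarrow> (LINT x|(lborel :: 'a measure). 0)"
    \<comment> \<open>The approximating functions satisfy
      \<open>norm (s i x) \<le> 2 * norm (f x)\<close>, which explains the dominating function with
      factor 3.\<close>
    proof (rule integral_dominated_convergence[where w="\<lambda>x. 3 * norm (f x)"])
      show "AE x in lborel. (\<lambda>i. norm (s i x - f x)) \<longlonglongrightarrow> 0"
      proof (rule AE_I2)
        fix x assume "x \<in> space (lborel :: 'a measure)"
        then have "(\<lambda>i. s i x) \<longlonglongrightarrow> f x" using lim by blast
        then have "(\<lambda>i. norm (s i x - f x)) \<longlonglongrightarrow> norm (f x - f x)" by (intro tendsto_intros)
        then show "(\<lambda>i. norm (s i x - f x)) \<longlonglongrightarrow> 0" by simp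
      qed
      show "AE x in lborel. norm (norm (s i x - f x)) \<le> 3 * norm (f x)" for i
      proof (rule AE_I2)
        fix x assume "x \<in> space (lborel :: 'a measure)"
        then have "norm (s i x) \<le> 2 * norm (f x)" using lim by blast
        then show "norm (norm (s i x - f x)) \<le> 3 * norm (f x)" by simp
      qed
    qed (use lim borel_measurable_integrable in auto)
    then have "\<forall>\<^sub>F i in sequentially. (LINT x|lborel. norm (s i x - f x)) < e/4"
      using e by (intro order_tendstoD) auto
    then obtain i where i: "(LINT x|lborel. \<bar>s i x - f x\<bar>) < e/4"
      by (auto simp: eventually_sequentially)
    obtain d where d: "d > 0" "\<And>z. norm z < d \<Longrightarrow> (LINT x|lborel. \<bar>s i (x + z) - s i x\<bar>) < e/4"
      using lim.IH[of i] e by (meson divide_pos_pos zero_less_numeral)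
    show "\<exists>d>0. \<forall>z. norm z < d \<longrightarrow> (LINT x|lborel. \<bar>f (x + z) - f x\<bar>) < e"
    proof (intro exI[of _ d] conjI allI impI)
      fix z :: 'a assume z: "norm z < d"
      have si: "integrable lborel (s i)" "integrable lborel f" using lim by auto
      have i1: "integrable lborel (\<lambda>x. \<bar>s i x - f x\<bar>)" using si by simp
      have i2: "integrable lborel (\<lambda>x. \<bar>s i (x + z) - f (x + z)\<bar>)" using integrable_shift[OF i1] .
      have i3: "integrable lborel (\<lambda>x. \<bar>s i (x + z) - s i x\<bar>)" by (intro integrable_abs Bochner_Integration.integrable_diff integrable_shift si)
      have eq: "(LINT x|lborel. \<bar>s i (x + z) - f (x + z)\<bar>) = (LINT x|lborel. \<bar>s i x - f x\<bar>)"
        by (rule integral_shift) (use borel_measurable_integrable[OF i1] in simp)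
      have "(LINT x|lborel. \<bar>f (x + z) - f x\<bar>)
        \<le> (LINT x|lborel. \<bar>s i (x + z) - f (x + z)\<bar> + \<bar>s i (x + z) - s i x\<bar> + \<bar>s i x - f x\<bar>)"
        by (rule integral_mono') (use i1 i2 i3 in auto)
      also have "\<dots> < e" using d(2)[OF z] i eq i1 i2 i3 e by simp
      finally show "(LINT x|lborel. \<bar>f (x + z) - f x\<bar>) < e" .
    qed (use d in simp)
  qed
qed

text \<open>The error at x is the average of \<open>u (x + z) - u x\<close> with weight \<rho>, so
  Tonelli bounds its L1 norm by an average of translation errors. Only displacements z in the
  support count; they may all point into a cone.\<close>

lemma mollify_L1_close:
  fixes u :: "real^'n::finite \<Rightarrow> real"
  assumes u: "integrable lborel u" and moll: "is_mollifier \<rho>"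
    and supp: "\<And>z. \<rho> z \<noteq> 0 \<Longrightarrow> (LINT x|lborel. \<bar>u (x + z) - u x\<bar>) \<le> e" and "0 \<le> e"
  shows "(\<integral>\<^sup>+x. ennreal \<bar>mollify \<rho> u x - u x\<bar> \<partial>lborel) \<le> ennreal e"
proof -
  have \<rho>c: "C1c \<rho>" and \<rho>0: "\<And>z. 0 \<le> \<rho> z" and \<rho>1: "(LINT z|lborel. \<rho> z) = 1"
    using moll by (auto simp: is_mollifier_def C2c_C1c)
  have cont\<rho>: "continuous_on UNIV \<rho>" and b\<rho>: "bounded {x. \<rho> x \<noteq> 0}"
    using \<rho>c by (auto simp: C1c_def C1_fun_continuous)
  have [measurable]: "\<rho> \<in> borel_measurable borel" by (rule borel_measurable_continuous_onI[OF cont\<rho>])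
  have int\<rho>: "integrable lborel \<rho>" by (rule integrable_continuous_bounded_support[OF cont\<rho> b\<rho>])
  have [measurable]: "u \<in> borel_measurable borel" using borel_measurable_integrable[OF u] by simp
  obtain B where B: "\<And>z. \<bar>\<rho> z\<bar> \<le> B" using bounded_support_uniform(1)[OF cont\<rho> b\<rho>] by blast
  have pt: "ennreal \<bar>mollify \<rho> u x - u x\<bar> \<le> (\<integral>\<^sup>+z. ennreal (\<bar>u (x + z) - u x\<bar> * \<rho> z) \<partial>lborel)" for x
  proof -
    have i1: "integrable lborel (\<lambda>z. u (x + z) * \<rho> z)"
    proof (rule Bochner_Integration.integrable_bound)
      show "integrable lborel (\<lambda>z. B * u (x + z))" using integrable_shift[OF u, of x] by (simp add: add.commute)
      have "\<bar>u (x + z)\<bar> * \<bar>\<rho> z\<bar> \<le> \<bar>u (x + z)\<bar> * \<bar>B\<bar>" for z using B[of z] by (intro mult_left_mono) auto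
      then show "AE z in lborel. norm (u (x + z) * \<rho> z) \<le> norm (B * u (x + z))" by (simp add: abs_mult mult.commute)
    qed simp
    have i2: "integrable lborel (\<lambda>z. u x * \<rho> z)" using int\<rho> by simp
    have "mollify \<rho> u x = (LINT z|lborel. u (z + x) * \<rho> ((z + x) - x))"
      unfolding mollify_def by (rule integral_shift[symmetric]) measurable
    then have "mollify \<rho> u x - u x = (LINT z|lborel. u (x + z) * \<rho> z) - (LINT z|lborel. u x * \<rho> z)"
      using \<rho>1 by (simp add: add.commute)
    also have "\<dots> = (LINT z|lborel. (u (x + z) - u x) * \<rho> z)"
      using i1 i2 by (simp add: left_diff_distrib)
    finally have "ennreal \<bar>mollify \<rho> u x - u x\<bar> = ennreal (norm (LINT z|lborel. (u (x + z) - u x) * \<rho> z))" by simp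
    also have "\<dots> \<le> (\<integral>\<^sup>+z. ennreal (norm ((u (x + z) - u x) * \<rho> z)) \<partial>lborel)"
      using i1 i2 by (intro integral_norm_bound_ennreal) (simp add: left_diff_distrib)
    finally show ?thesis using \<rho>0 by (simp add: abs_mult)
  qed
  have "(\<integral>\<^sup>+x. ennreal \<bar>mollify \<rho> u x - u x\<bar> \<partial>lborel)
      \<le> (\<integral>\<^sup>+x. \<integral>\<^sup>+z. ennreal (\<bar>u (x + z) - u x\<bar> * \<rho> z) \<partial>lborel \<partial>lborel)"
    by (intro nn_integral_mono pt)
  also have "\<dots> = (\<integral>\<^sup>+z. \<integral>\<^sup>+x. ennreal (\<bar>u (x + z) - u x\<bar> * \<rho> z) \<partial>lborel \<partial>lborel)"
    by (rule lborel_pair.Fubini') measurable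
  also have "\<dots> \<le> (\<integral>\<^sup>+z. ennreal e * ennreal (\<rho> z) \<partial>lborel)"
  proof (rule nn_integral_mono)
    fix z :: "real^'n"
    have "(\<integral>\<^sup>+x. ennreal (\<bar>u (x + z) - u x\<bar> * \<rho> z) \<partial>lborel) = ennreal (\<rho> z) * (\<integral>\<^sup>+x. ennreal \<bar>u (x + z) - u x\<bar> \<partial>lborel)"
      using \<rho>0 by (subst nn_integral_cmult[symmetric]) (auto simp: ennreal_mult mult.commute)
    also have "(\<integral>\<^sup>+x. ennreal \<bar>u (x + z) - u x\<bar> \<partial>lborel) = ennreal (LINT x|lborel. \<bar>u (x + z) - u x\<bar>)"
      using u integrable_shift[OF u] by (intro nn_integral_eq_integral) auto
    also have "ennreal (\<rho> z) * \<dots> \<le> ennreal e * ennreal (\<rho> z)"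
      using supp[of z] by (cases "\<rho> z = 0") (auto simp: mult.commute[of "ennreal e"] intro!: mult_left_mono ennreal_leI)
    finally show "(\<integral>\<^sup>+x. ennreal (\<bar>u (x + z) - u x\<bar> * \<rho> z) \<partial>lborel) \<le> ennreal e * ennreal (\<rho> z)" .
  qed
  also have "\<dots> = ennreal e * ennreal (LINT z|lborel. \<rho> z)"
    using int\<rho> \<rho>0 by (simp add: nn_integral_cmult nn_integral_eq_integral)
  finally show ?thesis using \<rho>1 by simp
qed

text \<open>Quantitative form of the fact that an affine function vanishing on an open set is zero:
  the L1 norm over U controls first the slope, by comparing two translates, then the value at a
  centre, then the constant term. It serves to bound approximating affine functions, to glue them
  and to get uniqueness of coefficients.\<close>

lemma affine_coeff_bound:
  fixes U :: "(real^'n::finite) set"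
  assumes "open U" "U \<noteq> {}"
  obtains C where "C > 0"
    "\<And>c b m. 0 \<le> m \<Longrightarrow> (\<integral>\<^sup>+x. ennreal \<bar>c + b \<bullet> x\<bar> * indicator U x \<partial>lborel) \<le> ennreal m \<Longrightarrow> \<bar>c\<bar> + norm b \<le> C * m"
proof -
  obtain x0 r where x0: "r > 0" "ball x0 r \<subseteq> U" using assms by (meson ex_in_conv openE)
  have [measurable]: "U \<in> sets borel" using assms by simp
  define Q where "Q = ball x0 (r/2)"
  define V where "V = measure lborel Q"
  have V: "V > 0" using x0 by (simp add: V_def Q_def content_ball_pos)
  have eV: "emeasure lborel Q = ennreal V"
    using emeasure_bounded_finite[of Q] by (simp add: V_def Q_def emeasure_eq_ennreal_measure)
  have [measurable]: "Q \<in> sets borel" by (simp add: Q_def)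
  define C where "C = (1 + r + norm x0) * (4 / (r * V)) + 1 / V"
  have "C > 0" using x0 V by (auto simp: C_def intro!: add_nonneg_pos)
  moreover have "\<bar>c\<bar> + norm b \<le> C * m" if m: "0 \<le> m" and le: "(\<integral>\<^sup>+x. ennreal \<bar>c + b \<bullet> x\<bar> * indicator U x \<partial>lborel) \<le> ennreal m" for c b m
  proof -
    define l where "l x = c + b \<bullet> x" for x
    have [measurable]: "l \<in> borel_measurable borel" unfolding l_def by measurable
    \<comment> \<open>A shift of length r/2 along b: it raises the affine function by
      \<open>norm b * (r/2)\<close> and keeps the half ball \<open>Q\<close> inside U. For b = 0
      division by zero yields w = 0, and the identity still holds.\<close>
    define w where "w = (r / 2 / norm b) *\<^sub>R b"
    have bw: "b \<bullet> w = norm b * (r/2)"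
      by (cases "b = 0") (auto simp: w_def dot_square_norm power2_eq_square)
    have nw: "norm w \<le> r/2" using x0 by (cases "b = 0") (auto simp: w_def)
    have QU: "x \<in> U" "x + w \<in> U" if "x \<in> Q" for x
    proof -
      have "dist x0 x < r/2" using that by (simp add: Q_def)
      moreover have "dist x0 (x + w) \<le> dist x0 x + norm w"
        by (metis dist_norm norm_triangle_ineq4 diff_diff_eq)
      ultimately show "x \<in> U" "x + w \<in> U" using x0 nw by (auto intro!: subsetD[OF x0(2)])
    qed
    have l1: "(\<integral>\<^sup>+x. ennreal \<bar>l x\<bar> * indicator Q x \<partial>lborel) \<le> ennreal m"
      by (rule order_trans[OF nn_integral_mono le]) (auto simp: l_def indicator_def QU)
    have l2: "(\<integral>\<^sup>+x. ennreal \<bar>l (x + w)\<bar> * indicator Q x \<partial>lborel) \<le> ennreal m"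
    proof -
      have "(\<integral>\<^sup>+x. ennreal \<bar>l (x + w)\<bar> * indicator Q x \<partial>lborel) \<le> (\<integral>\<^sup>+x. ennreal \<bar>l (x + w)\<bar> * indicator U (x + w) \<partial>lborel)"
        by (intro nn_integral_mono) (auto simp: indicator_def QU)
      also have "\<dots> = (\<integral>\<^sup>+x. ennreal \<bar>l x\<bar> * indicator U x \<partial>lborel)"
        by (rule nn_integral_shift) measurable
      finally show ?thesis using le by (simp add: l_def)
    qed
    have "ennreal (norm b * (r/2) * V) = (\<integral>\<^sup>+x. ennreal (norm b * (r/2)) * indicator Q x \<partial>lborel)"
      using x0 V by (subst nn_integral_cmult) (simp_all add: eV ennreal_mult[symmetric])
    also have "\<dots> \<le> (\<integral>\<^sup>+x. ennreal \<bar>l x\<bar> * indicator Q x + ennreal \<bar>l (x + w)\<bar> * indicator Q x \<partial>lborel)"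
    proof (rule nn_integral_mono)
      fix x
      have "norm b * (r/2) \<le> \<bar>l x\<bar> + \<bar>l (x + w)\<bar>"
      proof -
        have "l (x + w) = l x + norm b * (r/2)" using bw by (simp add: l_def inner_add_right)
        then show ?thesis by linarith
      qed
      then have "ennreal (norm b * (r/2)) \<le> ennreal \<bar>l x\<bar> + ennreal \<bar>l (x + w)\<bar>"
        by (simp add: ennreal_plus[symmetric] ennreal_leI del: ennreal_plus)
      then show "ennreal (norm b * (r/2)) * indicator Q x \<le> ennreal \<bar>l x\<bar> * indicator Q x + ennreal \<bar>l (x + w)\<bar> * indicator Q x"
        by (auto simp: indicator_def)
    qed
    also have "\<dots> \<le> ennreal m + ennreal m"
      by (subst nn_integral_add) (auto intro!: add_mono l1 l2)
    finally have "norm b * (r/2) * V \<le> 2 * m" using m by (simp add: ennreal_plus[symmetric] del: ennreal_plus)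
    then have b4: "norm b \<le> 4 / (r * V) * m" using x0 V by (simp add: field_simps)
    \<comment> \<open>The slope being bounded, the value at the centre differs from all values on
      \<open>Q\<close> by at most \<open>norm b * r\<close>, so averaging over \<open>Q\<close>
      bounds it.\<close>
    have "ennreal (\<bar>l x0\<bar> * V) = (\<integral>\<^sup>+x. ennreal \<bar>l x0\<bar> * indicator Q x \<partial>lborel)"
      using V by (simp add: nn_integral_cmult eV ennreal_mult)
    also have "\<dots> \<le> (\<integral>\<^sup>+x. ennreal \<bar>l x\<bar> * indicator Q x + ennreal (norm b * r) * indicator Q x \<partial>lborel)"
    proof (rule nn_integral_mono)
      fix x
      show "ennreal \<bar>l x0\<bar> * indicator Q x \<le> ennreal \<bar>l x\<bar> * indicator Q x + ennreal (norm b * r) * indicator Q x"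
      proof (cases "x \<in> Q")
        case True
        then have "norm (x0 - x) \<le> r" using x0 by (simp add: Q_def dist_norm)
        then have "\<bar>b \<bullet> (x0 - x)\<bar> \<le> norm b * r"
          using Cauchy_Schwarz_ineq2[of b "x0 - x"] by (meson mult_left_mono norm_ge_zero order_trans)
        then have "\<bar>l x0\<bar> \<le> \<bar>l x\<bar> + norm b * r" by (simp add: l_def inner_diff_right)
        then show ?thesis using True x0
          by (simp add: ennreal_plus[symmetric] ennreal_leI del: ennreal_plus)
      qed simp
    qed
    also have "\<dots> \<le> ennreal m + ennreal (norm b * r * V)"
      using l1 x0 V by (subst nn_integral_add) (auto simp: nn_integral_cmult eV ennreal_mult intro!: add_mono)
    finally have "\<bar>l x0\<bar> * V \<le> m + norm b * r * V" using m x0 V by (simp add: ennreal_plus[symmetric] del: ennreal_plus)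
    then have "\<bar>l x0\<bar> \<le> 1 / V * m + norm b * r" using V by (simp add: field_simps)
    moreover have "\<bar>c\<bar> \<le> \<bar>l x0\<bar> + norm b * norm x0"
      using Cauchy_Schwarz_ineq2[of b x0] by (simp add: l_def)
    ultimately have "\<bar>c\<bar> + norm b \<le> 1 / V * m + norm b * (1 + r + norm x0)" by (simp add: algebra_simps)
    also have "\<dots> \<le> 1 / V * m + 4 / (r * V) * m * (1 + r + norm x0)"
      using b4 x0 by (intro add_left_mono mult_right_mono) auto
    also have "\<dots> = C * m" by (simp add: C_def algebra_simps)
    finally show ?thesis .
  qed
  ultimately show thesis by (rule that)
qed

section \<open>Affine approximation near a point satisfying a cone condition\<close>

lemma dird_eq_inner: "dird v f x = (\<chi> i. partial_deriv i f x) \<bullet> v"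
  by (simp add: dird_def inner_vec_def mult.commute)

lemma dird_scaleR: "dird (k *\<^sub>R v) f x = k * dird v f x"
  by (simp add: dird_def sum_distrib_left mult_ac)

lemma minus_affine_C1:
  fixes W :: "real^'n::finite \<Rightarrow> real"
  assumes W: "C1_fun W"
  shows "C1_fun (\<lambda>x. W x - (c + b \<bullet> x))"
    "dird v (\<lambda>x. W x - (c + b \<bullet> x)) x = dird v W x - b \<bullet> v"
    "taylor_rem (\<lambda>x. W x - (c + b \<bullet> x)) x v = taylor_rem W x v"
proof -
  have D: "((\<lambda>x. W x - (c + b \<bullet> x)) has_derivative (\<lambda>h. \<Sum>i\<in>UNIV. h $ i * (partial_deriv i W x - b $ i))) (at x)" for x
  proof -
    have "((\<lambda>x. W x - (c + b \<bullet> x)) has_derivative (\<lambda>h. dird h W x - b \<bullet> h)) (at x)"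
      by (rule derivative_eq_intros C1_fun_has_derivative[OF W] refl | simp)+
    then show ?thesis by (simp add: dird_def inner_vec_def right_diff_distrib sum_subtractf mult.commute)
  qed
  have cont: "continuous_on UNIV (\<lambda>x. partial_deriv i W x - b $ i)" for i
    using W by (intro continuous_intros) (simp add: C1_fun_def)
  show "C1_fun (\<lambda>x. W x - (c + b \<bullet> x))" by (rule C1_funI(1)[OF D cont])
  show d: "dird v (\<lambda>x. W x - (c + b \<bullet> x)) x = dird v W x - b \<bullet> v" for x v
    unfolding dird_def C1_funI(2)[OF D cont] 
    by (simp add: inner_vec_def right_diff_distrib sum_subtractf mult.commute)
  show "taylor_rem (\<lambda>x. W x - (c + b \<bullet> x)) x v = taylor_rem W x v"
    by (simp add: taylor_rem_def d inner_add_right)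
qed

text \<open>The affine function is the Taylor polynomial of W at a point chosen by averaging.\<close>

lemma affine_approx_of_taylor_rem:
  fixes x1 :: "real^'n::finite" and s s' :: real
  assumes s: "0 < s'" "s' < s"
  obtains C where "0 \<le> C"
    "\<And>W. C1_fun W \<Longrightarrow>
      (\<And>v. norm v < s \<Longrightarrow> (\<integral>\<^sup>+x. ennreal \<bar>taylor_rem W x v\<bar> * indicator (ball x1 s') x \<partial>lborel) \<le> 1) \<Longrightarrow>
      \<exists>c b. (\<integral>\<^sup>+x. ennreal \<bar>W x - (c + b \<bullet> x)\<bar> * indicator (ball x1 (s - s')) x \<partial>lborel) \<le> ennreal C"
proof -
  define V1 where "V1 = measure lborel (ball (0::real^'n) s)"
  define V2 where "V2 = measure lborel (ball x1 s')"
  have V: "V1 > 0" "V2 > 0" using s by (auto simp: V1_def V2_def content_ball_pos)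
  have eV1: "emeasure lborel (ball (0::real^'n) s) = ennreal V1" and eV2: "emeasure lborel (ball x1 s') = ennreal V2"
    unfolding V1_def V2_def by (intro emeasure_eq_ennreal_measure; use emeasure_bounded_finite[OF bounded_ball] in \<open>metis infinity_ennreal_def less_irrefl\<close>)+
  \<comment> \<open>\<open>V1 / V2\<close> bounds the mean over the base points of the remainder
    integrated in v. Twice this value is not exceeded at some base point, which becomes the centre
    of expansion.\<close>
  define C where "C = 2 * V1 / V2"
  have C: "0 \<le> C" using V by (simp add: C_def)
  moreover have "\<exists>c b. (\<integral>\<^sup>+x. ennreal \<bar>W x - (c + b \<bullet> x)\<bar> * indicator (ball x1 (s - s')) x \<partial>lborel) \<le> ennreal C"
    if W: "C1_fun W" and T: "\<And>v. norm v < s \<Longrightarrow> (\<integral>\<^sup>+x. ennreal \<bar>taylor_rem W x v\<bar> * indicator (ball x1 s') x \<partial>lborel) \<le> 1" for W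
  proof -
    have [measurable]: "ball z t \<in> sets borel" for z :: "real^'n" and t by simp
    have pc: "continuous_on UNIV (partial_deriv i W)" for i using W by (simp add: C1_fun_def)
    have "continuous_on UNIV (\<lambda>z. taylor_rem W (fst z) (snd z))"
      unfolding taylor_rem_def dird_def
      by (intro continuous_intros continuous_on_compose2[OF C1_fun_continuous[OF W, of UNIV]] continuous_on_compose2[OF pc]) auto
    then have "(\<lambda>z. taylor_rem W (fst z) (snd z)) \<in> borel_measurable borel"
      by (rule borel_measurable_continuous_onI)
    then have Tm[measurable]: "(\<lambda>(x, v). taylor_rem W x v) \<in> borel_measurable (borel \<Otimes>\<^sub>M borel)"
      by (simp add: borel_prod case_prod_beta')
    define q where "q x = (\<integral>\<^sup>+v. ennreal \<bar>taylor_rem W x v\<bar> * indicator (ball 0 s) v \<partial>lborel)" for x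
    have [measurable]: "q \<in> borel_measurable borel"
    proof -
      have [measurable]: "(\<lambda>(x, v). ennreal \<bar>taylor_rem W x v\<bar> * indicator (ball 0 s) v) \<in> borel_measurable (borel \<Otimes>\<^sub>M lborel)"
        by measurable
      show ?thesis unfolding q_def by measurable
    qed
    have "(\<integral>\<^sup>+x. q x * indicator (ball x1 s') x \<partial>lborel)
       = (\<integral>\<^sup>+x. \<integral>\<^sup>+v. ennreal \<bar>taylor_rem W x v\<bar> * indicator (ball 0 s) v * indicator (ball x1 s') x \<partial>lborel \<partial>lborel)"
      unfolding q_def by (intro nn_integral_cong nn_integral_multc[symmetric]) measurable
    also have "\<dots> = (\<integral>\<^sup>+v. \<integral>\<^sup>+x. ennreal \<bar>taylor_rem W x v\<bar> * indicator (ball 0 s) v * indicator (ball x1 s') x \<partial>lborel \<partial>lborel)"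
      by (rule lborel_pair.Fubini') measurable
    also have "\<dots> \<le> (\<integral>\<^sup>+v. indicator (ball (0::real^'n) s) v \<partial>lborel)"
    proof (rule nn_integral_mono)
      fix v :: "real^'n"
      show "(\<integral>\<^sup>+x. ennreal \<bar>taylor_rem W x v\<bar> * indicator (ball 0 s) v * indicator (ball x1 s') x \<partial>lborel) \<le> indicator (ball 0 s) v"
        using T[of v] by (cases "norm v < s") auto
    qed
    also have "\<dots> = ennreal V1" by (simp add: eV1)
    finally have le: "(\<integral>\<^sup>+x. q x * indicator (ball x1 s') x \<partial>lborel) \<le> ennreal V1" .
    have "\<exists>x\<in>ball x1 s'. q x \<le> ennreal C"
    proof (rule ccontr)
      assume "\<not> ?thesis"
      then have gt: "ennreal C \<le> q x" if "x \<in> ball x1 s'" for x using that by force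
      have "ennreal (2 * V1) = (\<integral>\<^sup>+x. ennreal C * indicator (ball x1 s') x \<partial>lborel)"
        using V C by (subst nn_integral_cmult) (simp_all add: eV2 ennreal_mult[symmetric] C_def)
      also have "\<dots> \<le> (\<integral>\<^sup>+x. q x * indicator (ball x1 s') x \<partial>lborel)"
        by (intro nn_integral_mono) (auto simp: indicator_def gt)
      also note le
      finally show False using V by simp
    qed
    then obtain y where y: "y \<in> ball x1 s'" "q y \<le> ennreal C" by blast
    define b where "b = (\<chi> i. partial_deriv i W y)"
    define c where "c = W y - b \<bullet> y"
    have Tb: "taylor_rem W y v = W (y + v) - (c + b \<bullet> (y + v))" for v
      by (simp add: taylor_rem_def dird_eq_inner c_def b_def inner_add_right)
    define f where "f x = ennreal \<bar>W x - (c + b \<bullet> x)\<bar> * indicator (ball y s) x" for x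
    have [measurable]: "W \<in> borel_measurable borel" by (rule borel_measurable_continuous_onI[OF C1_fun_continuous[OF W]])
    have "(\<integral>\<^sup>+x. ennreal \<bar>W x - (c + b \<bullet> x)\<bar> * indicator (ball x1 (s - s')) x \<partial>lborel) \<le> (\<integral>\<^sup>+x. f x \<partial>lborel)"
    proof (rule nn_integral_mono)
      fix x
      have "x \<in> ball y s" if "x \<in> ball x1 (s - s')"
      proof -
        have "dist y x \<le> dist x1 y + dist x1 x" by (rule dist_triangle3)
        then show ?thesis using that y by simp
      qed
      then show "ennreal \<bar>W x - (c + b \<bullet> x)\<bar> * indicator (ball x1 (s - s')) x \<le> f x"
        by (auto simp: f_def indicator_def)
    qed
    also have "\<dots> = (\<integral>\<^sup>+v. f (v + y) \<partial>lborel)"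
      unfolding f_def by (rule nn_integral_shift[symmetric]) measurable
    also have "\<dots> = q y"
      unfolding q_def f_def Tb by (rule nn_integral_cong) (auto simp: indicator_def dist_norm add.commute)
    also note y(2)
    finally show ?thesis by blast
  qed
  ultimately show thesis by (rule that)
qed

text \<open>In the combination of the remainders for v and l v below, the derivative terms cancel, so that g
  on G is controlled by g on two translates of G.\<close>

lemma taylor_rem_transfer:
  fixes g :: "real^'n::finite \<Rightarrow> real"
  assumes g: "C1_fun g" and [measurable]: "G \<in> sets borel" "Q \<in> sets borel" and l: "1 < l" and A: "0 \<le> A"
    and GQ: "\<And>x. x \<in> G \<Longrightarrow> x + v \<in> Q" "\<And>x. x \<in> G \<Longrightarrow> x + l *\<^sub>R v \<in> Q"
    and gQ: "(\<integral>\<^sup>+x. ennreal \<bar>g x\<bar> * indicator Q x \<partial>lborel) \<le> ennreal A"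
    and T1: "(\<integral>\<^sup>+x. ennreal \<bar>taylor_rem g x v\<bar> * indicator G x \<partial>lborel) \<le> 1"
    and T2: "(\<integral>\<^sup>+x. ennreal \<bar>taylor_rem g x (l *\<^sub>R v)\<bar> * indicator G x \<partial>lborel) \<le> 1"
  shows "(\<integral>\<^sup>+x. ennreal \<bar>g x\<bar> * indicator G x \<partial>lborel) \<le> ennreal ((1 + l) * (A + 1) / (l - 1))"
    and "(\<integral>\<^sup>+x. ennreal \<bar>dird v g x\<bar> * indicator G x \<partial>lborel) \<le> ennreal (A + (1 + l) * (A + 1) / (l - 1) + 1)"
proof -
  have [measurable]: "g \<in> borel_measurable borel" by (rule borel_measurable_continuous_onI[OF C1_fun_continuous[OF g]])
  have [measurable]: "dird w g \<in> borel_measurable borel" for w by (rule borel_measurable_continuous_onI[OF dird_continuous[OF g]])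
  have [measurable]: "(\<lambda>x. taylor_rem g x w) \<in> borel_measurable borel" for w
    by (rule borel_measurable_continuous_onI[OF taylor_rem_continuous[OF g]])
  have sh: "(\<integral>\<^sup>+x. ennreal \<bar>g (x + w)\<bar> * indicator G x \<partial>lborel) \<le> ennreal A" if "\<And>x. x \<in> G \<Longrightarrow> x + w \<in> Q" for w
  proof -
    have "(\<integral>\<^sup>+x. ennreal \<bar>g (x + w)\<bar> * indicator G x \<partial>lborel) \<le> (\<integral>\<^sup>+x. ennreal \<bar>g (x + w)\<bar> * indicator Q (x + w) \<partial>lborel)"
      by (intro nn_integral_mono) (auto simp: indicator_def that)
    also have "\<dots> = (\<integral>\<^sup>+x. ennreal \<bar>g x\<bar> * indicator Q x \<partial>lborel)"
      by (rule nn_integral_shift) measurable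
    finally show ?thesis using gQ by simp
  qed
  define q where "q f = (\<integral>\<^sup>+x. ennreal \<bar>f x\<bar> * indicator G x \<partial>lborel)" for f :: "real^'n \<Rightarrow> real"
  have sub: "q f \<le> q f1 + q f2"
    if [measurable]: "f1 \<in> borel_measurable borel" "f2 \<in> borel_measurable borel"
      and le: "\<And>x. \<bar>f x\<bar> \<le> \<bar>f1 x\<bar> + \<bar>f2 x\<bar>" for f f1 f2
  proof -
    have "q f \<le> (\<integral>\<^sup>+x. ennreal \<bar>f1 x\<bar> * indicator G x + ennreal \<bar>f2 x\<bar> * indicator G x \<partial>lborel)"
      unfolding q_def
    proof (rule nn_integral_mono)
      fix x
      have "ennreal \<bar>f x\<bar> \<le> ennreal \<bar>f1 x\<bar> + ennreal \<bar>f2 x\<bar>"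
        using le[of x] by (simp add: ennreal_plus[symmetric] ennreal_leI del: ennreal_plus)
      then show "ennreal \<bar>f x\<bar> * indicator G x \<le> ennreal \<bar>f1 x\<bar> * indicator G x + ennreal \<bar>f2 x\<bar> * indicator G x"
        by (auto simp: indicator_def)
    qed
    also have "\<dots> = q f1 + q f2" unfolding q_def by (rule nn_integral_add) measurable
    finally show ?thesis .
  qed
  have sc: "q (\<lambda>x. k * f x) = ennreal \<bar>k\<bar> * q f" if [measurable]: "f \<in> borel_measurable borel" for k f
    unfolding q_def by (subst nn_integral_cmult[symmetric]) (auto simp: abs_mult ennreal_mult mult_ac)
  have q1: "q (\<lambda>x. g (x + v)) \<le> ennreal A" "q (\<lambda>x. g (x + l *\<^sub>R v)) \<le> ennreal A"
    "q (\<lambda>x. taylor_rem g x v) \<le> ennreal 1" "q (\<lambda>x. taylor_rem g x (l *\<^sub>R v)) \<le> ennreal 1"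
    unfolding q_def using sh[OF GQ(1)] sh[OF GQ(2)] T1 T2 by auto
  have id: "(l - 1) * g x = l * g (x + v) - g (x + l *\<^sub>R v) + taylor_rem g x (l *\<^sub>R v) - l * taylor_rem g x v" for x
    by (simp add: taylor_rem_def dird_scaleR algebra_simps)
  let ?a = "\<lambda>x. l * g (x + v)" and ?b = "\<lambda>x. g (x + l *\<^sub>R v)" and ?c = "\<lambda>x. taylor_rem g x (l *\<^sub>R v)"
    and ?d = "\<lambda>x. l * taylor_rem g x v"
  have "q (\<lambda>x. (l - 1) * g x) \<le> q (\<lambda>x. ?a x - ?b x + ?c x) + q ?d"
    by (rule sub) (auto simp: id)
  also have "q (\<lambda>x. ?a x - ?b x + ?c x) \<le> q (\<lambda>x. ?a x - ?b x) + q ?c" by (rule sub) auto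
  also have "q (\<lambda>x. ?a x - ?b x) \<le> q ?a + q ?b" by (rule sub) auto
  finally have "ennreal (l - 1) * q g \<le> q ?a + q ?b + q ?c + q ?d" using l by (simp add: sc add_right_mono)
  also have "\<dots> \<le> ennreal l * ennreal A + ennreal A + ennreal 1 + ennreal l * ennreal 1"
  proof (intro add_mono q1)
    show "q ?a \<le> ennreal l * ennreal A" using l q1(1) by (simp add: sc mult_left_mono)
    show "q ?d \<le> ennreal l * ennreal 1" using l q1(3) mult_left_mono[OF q1(3), of "ennreal l"] by (simp add: sc)
  qed
  also have "\<dots> = ennreal (l * A + A + 1 + l)"
    using l A by (simp add: ennreal_mult[symmetric] ennreal_plus[symmetric] del: ennreal_plus ennreal_1)
  also have "l * A + A + 1 + l = (1 + l) * (A + 1)" by (simp add: algebra_simps)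
  finally have "ennreal (1 / (l - 1)) * (ennreal (l - 1) * q g) \<le> ennreal (1 / (l - 1)) * ennreal ((1 + l) * (A + 1))"
    by (rule mult_left_mono) simp
  then have qg: "q g \<le> ennreal ((1 + l) * (A + 1) / (l - 1))"
    using l A by (simp add: mult.assoc[symmetric] ennreal_mult[symmetric])
  then show "(\<integral>\<^sup>+x. ennreal \<bar>g x\<bar> * indicator G x \<partial>lborel) \<le> ennreal ((1 + l) * (A + 1) / (l - 1))"
    by (simp add: q_def)
  have "q (dird v g) \<le> q (\<lambda>x. g (x + v) - g x) + q (\<lambda>x. taylor_rem g x v)"
    by (rule sub) (auto simp: taylor_rem_def)
  also have "q (\<lambda>x. g (x + v) - g x) \<le> q (\<lambda>x. g (x + v)) + q g" by (rule sub) auto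
  finally have "q (dird v g) \<le> q (\<lambda>x. g (x + v)) + q g + q (\<lambda>x. taylor_rem g x v)" by (simp add: add_right_mono)
  also have "\<dots> \<le> ennreal A + ennreal ((1 + l) * (A + 1) / (l - 1)) + ennreal 1"
    by (intro add_mono q1 qg)
  finally show "(\<integral>\<^sup>+x. ennreal \<bar>dird v g x\<bar> * indicator G x \<partial>lborel) \<le> ennreal (A + (1 + l) * (A + 1) / (l - 1) + 1)"
    using l A by (simp add: q_def ennreal_plus[symmetric] del: ennreal_plus ennreal_1)
qed


lemma mult_C1:
  fixes f g :: "real^'n::finite \<Rightarrow> real"
  assumes f: "C1_fun f" and g: "C1_fun g"
  shows "C1_fun (\<lambda>x. f x * g x)" "dird v (\<lambda>x. f x * g x) x = f x * dird v g x + g x * dird v f x"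
proof -
  have D: "((\<lambda>x. f x * g x) has_derivative (\<lambda>h. \<Sum>i\<in>UNIV. h $ i * (f x * partial_deriv i g x + g x * partial_deriv i f x))) (at x)" for x
  proof -
    have "((\<lambda>x. f x * g x) has_derivative (\<lambda>h. f x * dird h g x + dird h f x * g x)) (at x)"
      by (rule has_derivative_mult[OF C1_fun_has_derivative[OF f] C1_fun_has_derivative[OF g]])
    moreover have "f x * dird h g x + dird h f x * g x = (\<Sum>i\<in>UNIV. h $ i * (f x * partial_deriv i g x + g x * partial_deriv i f x))" for h
      unfolding dird_def sum_distrib_left sum_distrib_right sum.distrib[symmetric]
      by (rule sum.cong) (simp_all add: algebra_simps)
    ultimately show ?thesis by simp
  qed
  have c: "continuous_on UNIV (\<lambda>x. f x * partial_deriv i g x + g x * partial_deriv i f x)" for i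
  proof -
    have "continuous_on UNIV f" "continuous_on UNIV g" by (intro C1_fun_continuous f g)+
    moreover have "continuous_on UNIV (partial_deriv i f)" "continuous_on UNIV (partial_deriv i g)"
      using f g by (auto simp: C1_fun_def)
    ultimately show ?thesis by (intro continuous_intros)
  qed
  show "C1_fun (\<lambda>x. f x * g x)" by (rule C1_funI(1)[OF D c])
  show "dird v (\<lambda>x. f x * g x) x = f x * dird v g x + g x * dird v f x"
    unfolding dird_def C1_funI(2)[OF D c] sum_distrib_left sum.distrib[symmetric]
    by (rule sum.cong) (simp_all add: algebra_simps)
qed

lemma powr_le_1_plus_powr:
  fixes t :: real
  assumes "0 \<le> t" "0 \<le> p" "p \<le> q"
  shows "t powr p \<le> 1 + t powr q"
proof (cases "t \<le> 1")
  case True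
  then have "t powr p \<le> 1 powr p" using assms by (intro powr_mono2) auto
  moreover have "0 \<le> t powr q" by simp
  ultimately show ?thesis unfolding powr_one_eq_one by linarith
next
  case False
  then have "t powr p \<le> t powr q" using assms by (intro powr_mono) auto
  then show ?thesis by simp
qed

text \<open>After a cutoff in the ball, f(x) is the integral of its derivative along the forward
  half line in direction c + w. That half line stays in \<Omega> as long as it is in the ball, and
  beyond the ball the cutoff vanishes, so the derivative on G alone dominates f. Directions of this
  kind form a basis, which is what Gagliardo's argument requires.\<close>

lemma cone_patch_Sobolev:
  fixes \<Omega> :: "(real^'n::finite) set" and x0 c :: "real^'n" and \<delta> r \<rho> \<kappa> p A B :: real
  assumes \<Omega>: "open \<Omega>" and c: "norm c = 1/2" and \<kappa>: "0 < \<kappa>" "\<kappa> < \<delta>" "\<kappa> \<le> 1/4" and \<rho>: "0 < \<rho>" "\<rho> \<le> r"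
    and cone: "\<And>x z t. x \<in> \<Omega> \<inter> ball x0 r \<Longrightarrow> norm z < \<delta> \<Longrightarrow> 0 \<le> t \<Longrightarrow> x + t *\<^sub>R (c + z) \<in> ball x0 r \<Longrightarrow> x + t *\<^sub>R (c + z) \<in> \<Omega>"
    and p: "1 < p" "CARD('n) \<ge> 2 \<longrightarrow> p \<le> real CARD('n) / (real CARD('n) - 1)"
    and AB: "0 \<le> A" "0 \<le> B"
  obtains C where "0 \<le> C" 
    "\<And>g. C1_fun g \<Longrightarrow> (\<integral>\<^sup>+x. ennreal \<bar>g x\<bar> * indicator (\<Omega> \<inter> ball x0 \<rho>) x \<partial>lborel) \<le> ennreal A \<Longrightarrow>
      (\<And>w. norm w \<le> \<kappa> \<Longrightarrow> (\<integral>\<^sup>+x. ennreal \<bar>dird (c + w) g x\<bar> * indicator (\<Omega> \<inter> ball x0 \<rho>) x \<partial>lborel) \<le> ennreal B) \<Longrightarrow>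
      (\<integral>\<^sup>+x. ennreal (\<bar>g x\<bar> powr p) * indicator (\<Omega> \<inter> ball x0 (\<rho>/2)) x \<partial>lborel) \<le> ennreal C"
proof -
  define G where "G = \<Omega> \<inter> ball x0 \<rho>"
  have [measurable]: "G \<in> sets borel" using \<Omega> by (auto simp: G_def)
  \<comment> \<open>The coordinate direction omitted in the basis made of c and
    \<open>c + \<kappa> e\<close>; \<open>c \<bullet> b \<noteq> 0\<close> makes these vectors
    independent.\<close>
  obtain b where b: "b \<in> Basis" "c \<bullet> b \<noteq> 0"
    using c euclidean_all_zero_iff[of c] by force
  define \<theta> where "\<theta> = bump 1 x0 \<rho>"
  have \<theta>c: "C1c \<theta>" unfolding \<theta>_def by (rule C2c_C1c[OF bump_C2c[OF \<rho>(1)]])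
  have \<theta>C1: "C1_fun \<theta>" using \<theta>c by (simp add: C1c_def)
  obtain B1 where B1: "B1 > 0" "\<And>x. \<bar>\<theta> x\<bar> \<le> B1"
    using bounded_support_uniform(1)[of \<theta>] \<theta>c by (auto simp: C1c_def C1_fun_continuous)
  have "\<exists>M>0. \<forall>x. \<bar>partial_deriv i \<theta> x\<bar> \<le> M" for i
    by (rule bounded_support_uniform(1)[OF C1c_partial_continuous[OF \<theta>c] C1c_partial_bounded_support[OF \<theta>c]])
  then obtain M where M: "\<And>i. M i > 0" "\<And>i x. \<bar>partial_deriv i \<theta> x\<bar> \<le> M i" by metis
  define B2 where "B2 = (\<Sum>i\<in>UNIV. M i)"
  have B20: "0 \<le> B2" unfolding B2_def using M by (intro sum_nonneg) (simp add: less_imp_le)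
  have B2: "\<bar>dird (c + w) \<theta> x\<bar> \<le> B2" if "norm w \<le> \<kappa>" for w x
  proof -
    have "norm (c + w) \<le> 1" using norm_triangle_ineq[of c w] c that \<kappa> by simp
    moreover have "(\<Sum>i\<in>UNIV. \<bar>partial_deriv i \<theta> x\<bar>) \<le> B2" unfolding B2_def by (intro sum_mono M)
    ultimately have "norm (c + w) * (\<Sum>i\<in>UNIV. \<bar>partial_deriv i \<theta> x\<bar>) \<le> 1 * B2"
      by (intro mult_mono) (auto intro: sum_nonneg)
    then show ?thesis using dird_bound[of "c + w" \<theta> x] by simp
  qed
  define Ws where "Ws = insert 0 ((\<lambda>e. \<kappa> *\<^sub>R e) ` (Basis :: (real^'n) set))"
  have Ws: "finite Ws" "\<And>w. w \<in> Ws \<Longrightarrow> norm w \<le> \<kappa>" using \<kappa> by (auto simp: Ws_def)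
  define E where "E = real (card Ws) * (B1 * B + B2 * A)"
  have E: "0 \<le> E" using B1 B20 AB by (simp add: E_def)
  \<comment> \<open>Lower bound of the cutoff on the ball of half the radius, where g can be
    recovered from the product f.\<close>
  define \<theta>0 where "\<theta>0 = (3/4 * \<rho>\<^sup>2) ^ 3"
  have \<theta>0: "\<theta>0 > 0" using \<rho> by (simp add: \<theta>0_def)
  have \<theta>0le: "\<theta>0 \<le> \<theta> x" if "x \<in> ball x0 (\<rho>/2)" for x
  proof -
    have "norm (x - x0) \<le> \<rho>/2" using that by (simp add: dist_norm norm_minus_commute)
    then have "(norm (x - x0))\<^sup>2 \<le> (\<rho>/2)\<^sup>2" by (intro power_mono) auto
    then have "3/4 * \<rho>\<^sup>2 \<le> bump_base x0 \<rho> x"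
      unfolding bump_base_def power2_norm_eq_inner power_divide by (intro max.coboundedI2) simp
    then show ?thesis unfolding \<theta>_def \<theta>0_def bump_def by (simp add: power_mono)
  qed
  have key: "\<exists>f F. C1_fun f \<and> F \<in> borel_measurable borel \<and> (\<integral>\<^sup>+x. F x \<partial>lborel) \<le> ennreal E \<and>
      (\<forall>w\<in>Ws. \<forall>x. ennreal \<bar>f x\<bar> * indicator G x \<le> line_int (c + w) F x) \<and>
      (\<forall>x\<in>ball x0 (\<rho>/2). \<bar>g x\<bar> \<le> \<bar>f x\<bar> / \<theta>0)"
    if g: "C1_fun g" and gA: "(\<integral>\<^sup>+x. ennreal \<bar>g x\<bar> * indicator G x \<partial>lborel) \<le> ennreal A"
      and gB: "\<And>w. norm w \<le> \<kappa> \<Longrightarrow> (\<integral>\<^sup>+x. ennreal \<bar>dird (c + w) g x\<bar> * indicator G x \<partial>lborel) \<le> ennreal B" for g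
  proof -
    have [measurable]: "g \<in> borel_measurable borel" by (rule borel_measurable_continuous_onI[OF C1_fun_continuous[OF g]])
    have [measurable]: "dird w g \<in> borel_measurable borel" for w by (rule borel_measurable_continuous_onI[OF dird_continuous[OF g]])
    define f where "f x = \<theta> x * g x" for x
    have f: "C1_fun f" unfolding f_def by (rule mult_C1(1)[OF \<theta>C1 g])
    have df: "dird v f x = \<theta> x * dird v g x + g x * dird v \<theta> x" for v x
      unfolding f_def by (rule mult_C1(2)[OF \<theta>C1 g])
    have dfc: "continuous_on UNIV (dird v f)" for v by (rule dird_continuous[OF f])
    have [measurable]: "dird w f \<in> borel_measurable borel" for w by (rule borel_measurable_continuous_onI[OF dfc])
    have out: "f y = 0" "dird v f y = 0" if "y \<notin> ball x0 \<rho>" for y v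
    proof -
      have "\<rho> \<le> norm (y - x0)" using that by (simp add: dist_norm norm_minus_commute)
      then have "\<rho>\<^sup>2 \<le> (norm (y - x0))\<^sup>2" using \<rho> by (intro power_mono) auto
      then have z: "bump_base x0 \<rho> y = 0" by (simp add: bump_base_def power2_norm_eq_inner)
      then show "f y = 0" by (simp add: f_def \<theta>_def bump_def)
      have "dird v \<theta> y = 0" unfolding dird_def \<theta>_def bump_deriv(2) using z by simp
      then show "dird v f y = 0" unfolding df using z by (simp add: \<theta>_def bump_def)
    qed
    define F where "F x = (\<Sum>w\<in>Ws. ennreal \<bar>dird (c + w) f x\<bar> * indicator G x)" for x
    have Fm[measurable]: "F \<in> borel_measurable borel" unfolding F_def by measurable
    have one: "(\<integral>\<^sup>+x. ennreal \<bar>dird (c + w) f x\<bar> * indicator G x \<partial>lborel) \<le> ennreal (B1 * B + B2 * A)" if w: "norm w \<le> \<kappa>" for w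
    proof -
      have "(\<integral>\<^sup>+x. ennreal \<bar>dird (c + w) f x\<bar> * indicator G x \<partial>lborel)
        \<le> (\<integral>\<^sup>+x. ennreal B1 * (ennreal \<bar>dird (c + w) g x\<bar> * indicator G x) + ennreal B2 * (ennreal \<bar>g x\<bar> * indicator G x) \<partial>lborel)"
      proof (rule nn_integral_mono)
        fix x
        have "\<bar>dird (c + w) f x\<bar> \<le> \<bar>\<theta> x\<bar> * \<bar>dird (c + w) g x\<bar> + \<bar>dird (c + w) \<theta> x\<bar> * \<bar>g x\<bar>"
          unfolding df by (rule order_trans[OF abs_triangle_ineq]) (simp add: abs_mult mult.commute)
        also have "\<dots> \<le> B1 * \<bar>dird (c + w) g x\<bar> + B2 * \<bar>g x\<bar>"
          by (intro add_mono mult_right_mono B1 B2 w) auto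
        finally have "ennreal \<bar>dird (c + w) f x\<bar> \<le> ennreal (B1 * \<bar>dird (c + w) g x\<bar> + B2 * \<bar>g x\<bar>)" by (rule ennreal_leI)
        also have "\<dots> = ennreal B1 * ennreal \<bar>dird (c + w) g x\<bar> + ennreal B2 * ennreal \<bar>g x\<bar>"
          using B1 B20 by (simp add: ennreal_mult)
        finally show "ennreal \<bar>dird (c + w) f x\<bar> * indicator G x \<le> ennreal B1 * (ennreal \<bar>dird (c + w) g x\<bar> * indicator G x) + ennreal B2 * (ennreal \<bar>g x\<bar> * indicator G x)"
          by (auto simp: indicator_def)
      qed
      also have "\<dots> = ennreal B1 * (\<integral>\<^sup>+x. ennreal \<bar>dird (c + w) g x\<bar> * indicator G x \<partial>lborel) + ennreal B2 * (\<integral>\<^sup>+x. ennreal \<bar>g x\<bar> * indicator G x \<partial>lborel)"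
        by (simp add: nn_integral_add nn_integral_cmult)
      also have "\<dots> \<le> ennreal B1 * ennreal B + ennreal B2 * ennreal A"
        by (intro add_mono mult_left_mono gA gB w) auto
      also have "\<dots> = ennreal (B1 * B + B2 * A)" using B1 B20 AB by (simp add: ennreal_mult)
      finally show ?thesis .
    qed
    have "(\<integral>\<^sup>+x. F x \<partial>lborel) = (\<Sum>w\<in>Ws. \<integral>\<^sup>+x. ennreal \<bar>dird (c + w) f x\<bar> * indicator G x \<partial>lborel)"
      unfolding F_def by (rule nn_integral_sum) measurable
    also have "\<dots> \<le> (\<Sum>w\<in>Ws. ennreal (B1 * B + B2 * A))" by (intro sum_mono one Ws)
    also have "\<dots> = ennreal E" using B1 B20 AB by (simp add: E_def ennreal_mult ennreal_of_nat_eq_real_of_nat)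
    finally have FE: "(\<integral>\<^sup>+x. F x \<partial>lborel) \<le> ennreal E" .
    have line: "ennreal \<bar>f x\<bar> * indicator G x \<le> line_int (c + w) F x" if w: "w \<in> Ws" for w x
    proof (cases "x \<in> G")
      case True
      let ?d = "c + w"
      have nd: "norm ?d \<ge> 1/4"
        using norm_triangle_ineq2[of c "- w"] c Ws(2)[OF w] \<kappa> by simp
      \<comment> \<open>\<open>norm (c + w)\<close> is at least 1/4, so after time 8 \<rho> the
        point has moved by 2 \<rho> and has left the ball in which it started.\<close>
      define \<tau> where "\<tau> = 8 * \<rho>"
      have \<tau>: "0 \<le> \<tau>" using \<rho> by (simp add: \<tau>_def)
      have "\<rho> \<le> dist x0 (x + \<tau> *\<^sub>R ?d)"
      proof -
        have "norm (\<tau> *\<^sub>R ?d) \<ge> 2 * \<rho>" using mult_left_mono[OF nd \<tau>] \<tau> by (simp add: \<tau>_def)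
        moreover have "norm (\<tau> *\<^sub>R ?d) \<le> dist x0 (x + \<tau> *\<^sub>R ?d) + dist x0 x"
          using norm_triangle_ineq4[of "x + \<tau> *\<^sub>R ?d - x0" "x - x0"] by (simp add: dist_norm norm_minus_commute)
        moreover have "dist x0 x < \<rho>" using True by (simp add: G_def)
        ultimately show ?thesis by linarith
      qed
      then have f\<tau>: "f (x + \<tau> *\<^sub>R ?d) = 0" using out(1) by simp
      have D: "((\<lambda>t. f (x + t *\<^sub>R ?d)) has_real_derivative dird ?d f (x + t *\<^sub>R ?d)) (at t)" for t
        by (rule dird_line_derivative[OF f])
      have "continuous_on UNIV (\<lambda>t. dird ?d f (x + t *\<^sub>R ?d))"
        by (rule continuous_on_compose2[OF dfc]) (auto intro!: continuous_intros)
      then have cont: "isCont (\<lambda>t. dird ?d f (x + t *\<^sub>R ?d)) t" for t by (simp add: continuous_on_eq_continuous_at)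
      have hb: "has_bochner_integral lborel (\<lambda>t. dird ?d f (x + t *\<^sub>R ?d) * indicator {0..\<tau>} t) (f (x + \<tau> *\<^sub>R ?d) - f (x + 0 *\<^sub>R ?d))"
        by (rule has_bochner_integral_FTC_Icc_real[OF \<tau> D cont])
      have "ennreal \<bar>f x\<bar> = ennreal (norm (LINT t|lborel. dird ?d f (x + t *\<^sub>R ?d) * indicator {0..\<tau>} t))"
        using has_bochner_integral_integral_eq[OF hb] f\<tau> by simp
      also have "\<dots> \<le> (\<integral>\<^sup>+t. ennreal (norm (dird ?d f (x + t *\<^sub>R ?d) * indicator {0..\<tau>} t)) \<partial>lborel)"
        by (rule integral_norm_bound_ennreal) (use hb in \<open>simp add: has_bochner_integral_iff\<close>)
      also have "\<dots> \<le> (\<integral>\<^sup>+t. F (x + t *\<^sub>R ?d) \<partial>lborel)"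
      proof (rule nn_integral_mono)
        fix t
        show "ennreal (norm (dird ?d f (x + t *\<^sub>R ?d) * indicator {0..\<tau>} t)) \<le> F (x + t *\<^sub>R ?d)"
        proof (cases "t \<in> {0..\<tau>} \<and> dird ?d f (x + t *\<^sub>R ?d) \<noteq> 0")
          case t: True
          \<comment> \<open>The derivative vanishes outside the ball, so only points in it count,
            and those belong to \<Omega> by the cone condition.\<close>
          then have yb: "x + t *\<^sub>R ?d \<in> ball x0 \<rho>" using out(2) by blast
          then have yr: "x + t *\<^sub>R ?d \<in> ball x0 r" using \<rho> by auto
          have "x \<in> \<Omega> \<inter> ball x0 r" using True \<rho> by (auto simp: G_def)
          then have "x + t *\<^sub>R ?d \<in> \<Omega>"
            using t yr Ws(2)[OF w] \<kappa> by (intro cone) auto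
          then have yG: "x + t *\<^sub>R ?d \<in> G" using yb by (simp add: G_def)
          have "ennreal \<bar>dird ?d f (x + t *\<^sub>R ?d)\<bar> * indicator G (x + t *\<^sub>R ?d) \<le> F (x + t *\<^sub>R ?d)"
            unfolding F_def by (rule member_le_sum[OF w]) (use Ws in auto)
          then show ?thesis using yG t by simp
        qed auto
      qed
      finally show ?thesis using True by (simp add: line_int_def)
    qed simp
    have gf: "\<bar>g x\<bar> \<le> \<bar>f x\<bar> / \<theta>0" if "x \<in> ball x0 (\<rho>/2)" for x
    proof -
      have "\<theta>0 * \<bar>g x\<bar> \<le> \<bar>f x\<bar>" unfolding f_def abs_mult
        using \<theta>0le[OF that] \<theta>0 by (intro mult_right_mono) auto
      then show ?thesis using \<theta>0 by (simp add: field_simps)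
    qed
    show ?thesis using f Fm FE line gf by blast
  qed
  have ballfin: "emeasure lborel (ball x0 \<rho>) = ennreal (measure lborel (ball x0 \<rho>))"
    by (intro emeasure_eq_ennreal_measure) (use emeasure_bounded_finite[OF bounded_ball] in \<open>metis infinity_ennreal_def less_irrefl\<close>)
  let ?V = "measure lborel (ball x0 \<rho>)"
  have V0: "0 \<le> ?V" by simp
  show thesis
  proof (cases "CARD('n) \<ge> 2")
    case True
    let ?q = "real CARD('n) / (real CARD('n) - 1)"
    have q: "p \<le> ?q" "0 < ?q" using p True by auto
    have qn: "?q \<noteq> 0" using q(2) by (rule less_imp_neq[symmetric])
    have k0: "\<kappa> \<noteq> 0" and d2: "2 \<le> DIM(real^'n)" using \<kappa> True by auto
    have rd: "real (CARD('n) - 1) = real CARD('n) - 1" using True by (simp add: of_nat_diff)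
    have "\<exists>C0\<ge>0. \<forall>f F. f \<in> borel_measurable borel \<longrightarrow> F \<in> borel_measurable borel \<longrightarrow>
      (\<forall>x. f x \<le> line_int c F x) \<longrightarrow> (\<forall>e\<in>Basis. \<forall>x. e \<noteq> b \<longrightarrow> f x \<le> line_int (c + \<kappa> *\<^sub>R e) F x) \<longrightarrow>
      (\<integral>\<^sup>+x. epow (f x) ?q \<partial>lborel) \<le> ennreal C0 * epow (\<integral>\<^sup>+x. F x \<partial>lborel) ?q"
      by (rule Gagliardo_Nirenberg_skew[OF k0 b d2, unfolded DIM_cart DIM_real mult_1_right rd])
        (intro exI conjI allI impI, assumption, blast)
    then obtain C0 where C0: "0 \<le> C0" and GN: "\<And>f F. f \<in> borel_measurable borel \<Longrightarrow> F \<in> borel_measurable borel \<Longrightarrow>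
      (\<And>x. f x \<le> line_int c F x) \<Longrightarrow> 
      (\<And>e x. e \<in> Basis \<Longrightarrow> f x \<le> line_int (c + \<kappa> *\<^sub>R e) F x) \<Longrightarrow>
      (\<integral>\<^sup>+x. epow (f x) ?q \<partial>lborel) \<le> ennreal C0 * epow (\<integral>\<^sup>+x. F x \<partial>lborel) ?q"
      by blast
    define C where "C = (1/\<theta>0) powr p * (?V + C0 * E powr ?q)"
    show thesis
    proof (rule that[of C])
      show "0 \<le> C" using C0 by (simp add: C_def)
      fix g assume g: "C1_fun g" "(\<integral>\<^sup>+x. ennreal \<bar>g x\<bar> * indicator (\<Omega> \<inter> ball x0 \<rho>) x \<partial>lborel) \<le> ennreal A"
        "\<And>w. norm w \<le> \<kappa> \<Longrightarrow> (\<integral>\<^sup>+x. ennreal \<bar>dird (c + w) g x\<bar> * indicator (\<Omega> \<inter> ball x0 \<rho>) x \<partial>lborel) \<le> ennreal B"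
      from key[OF this[folded G_def]] obtain f F where f: "C1_fun f" and Fm: "F \<in> borel_measurable borel"
        and FE: "(\<integral>\<^sup>+x. F x \<partial>lborel) \<le> ennreal E"
        and line: "\<And>w x. w \<in> Ws \<Longrightarrow> ennreal \<bar>f x\<bar> * indicator G x \<le> line_int (c + w) F x"
        and gf: "\<And>x. x \<in> ball x0 (\<rho>/2) \<Longrightarrow> \<bar>g x\<bar> \<le> \<bar>f x\<bar> / \<theta>0" by blast
      have [measurable]: "f \<in> borel_measurable borel" by (rule borel_measurable_continuous_onI[OF C1_fun_continuous[OF f]])
      have l1: "ennreal \<bar>f x\<bar> * indicator G x \<le> line_int c F x" for x using line[of 0 x] by (simp add: Ws_def)
      have l2: "ennreal \<bar>f x\<bar> * indicator G x \<le> line_int (c + \<kappa> *\<^sub>R e) F x" if "e \<in> Basis" for e x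
        by (rule line) (use that in \<open>auto simp: Ws_def\<close>)
      have "(\<integral>\<^sup>+x. epow (ennreal \<bar>f x\<bar> * indicator G x) ?q \<partial>lborel) \<le> ennreal C0 * epow (\<integral>\<^sup>+x. F x \<partial>lborel) ?q"
        by (rule GN[OF _ Fm l1 l2]) auto
      also have "\<dots> \<le> ennreal C0 * epow (ennreal E) ?q"
        using q FE by (intro mult_left_mono epow_mono) auto
      also have "\<dots> = ennreal (C0 * E powr ?q)" unfolding epow_ennreal[OF qn E] using C0 by (simp add: ennreal_mult)
      finally have I: "(\<integral>\<^sup>+x. epow (ennreal \<bar>f x\<bar> * indicator G x) ?q \<partial>lborel) \<le> ennreal (C0 * E powr ?q)" .
      have "(\<integral>\<^sup>+x. ennreal (\<bar>g x\<bar> powr p) * indicator (\<Omega> \<inter> ball x0 (\<rho>/2)) x \<partial>lborel)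
        \<le> (\<integral>\<^sup>+x. ennreal ((1/\<theta>0) powr p) * (indicator (ball x0 \<rho>) x + epow (ennreal \<bar>f x\<bar> * indicator G x) ?q) \<partial>lborel)"
      proof (rule nn_integral_mono)
        fix x
        show "ennreal (\<bar>g x\<bar> powr p) * indicator (\<Omega> \<inter> ball x0 (\<rho>/2)) x
          \<le> ennreal ((1/\<theta>0) powr p) * (indicator (ball x0 \<rho>) x + epow (ennreal \<bar>f x\<bar> * indicator G x) ?q)"
        proof (cases "x \<in> \<Omega> \<inter> ball x0 (\<rho>/2)")
          case True
          then have xG: "x \<in> G" "x \<in> ball x0 \<rho>" using \<rho> by (auto simp: G_def)
          have "\<bar>g x\<bar> powr p \<le> (1/\<theta>0 * \<bar>f x\<bar>) powr p"
            using gf[of x] True p by (intro powr_mono2) auto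
          also have "\<dots> = (1/\<theta>0) powr p * \<bar>f x\<bar> powr p" using \<theta>0 by (simp add: powr_mult powr_divide)
          also have "\<dots> \<le> (1/\<theta>0) powr p * (1 + \<bar>f x\<bar> powr ?q)"
            using p q by (intro mult_left_mono powr_le_1_plus_powr) auto
          finally have "ennreal (\<bar>g x\<bar> powr p) \<le> ennreal ((1/\<theta>0) powr p * (1 + \<bar>f x\<bar> powr ?q))" by (rule ennreal_leI)
          also have "\<dots> = ennreal ((1/\<theta>0) powr p) * (1 + epow (ennreal \<bar>f x\<bar>) ?q)"
            unfolding epow_ennreal[OF qn abs_ge_zero] by (simp add: ennreal_mult)
          finally show ?thesis using True xG by simp
        qed simp
      qed
      also have "\<dots> = ennreal ((1/\<theta>0) powr p) * (emeasure lborel (ball x0 \<rho>) + (\<integral>\<^sup>+x. epow (ennreal \<bar>f x\<bar> * indicator G x) ?q \<partial>lborel))"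
      proof -
        have [measurable]: "ball x0 \<rho> \<in> sets borel" by simp
        have m: "(\<lambda>x. epow (ennreal \<bar>f x\<bar> * indicator G x) ?q) \<in> borel_measurable lborel"
          "indicator (ball x0 \<rho>) \<in> borel_measurable lborel" by measurable
        show ?thesis
          by (subst nn_integral_cmult[OF borel_measurable_add[OF m(2) m(1)]], subst nn_integral_add[OF m(2) m(1)]) simp
      qed
      also have "\<dots> \<le> ennreal ((1/\<theta>0) powr p) * (ennreal ?V + ennreal (C0 * E powr ?q))"
        unfolding ballfin by (intro mult_left_mono add_left_mono I) auto
      also have "\<dots> = ennreal C" using C0 by (simp add: C_def ennreal_mult)
      finally show "(\<integral>\<^sup>+x. ennreal (\<bar>g x\<bar> powr p) * indicator (\<Omega> \<inter> ball x0 (\<rho>/2)) x \<partial>lborel) \<le> ennreal C" .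
    qed
  next
    case False
    then have card1: "CARD('n) = 1" using card_gt_0_iff[of "UNIV::'n set"] by (simp del: zero_less_card_finite)
    have Basis1: "(Basis :: (real^'n) set) = {b}"
    proof -
      have "card (Basis :: (real^'n) set) = 1" using card1 by simp
      then obtain z where "(Basis :: (real^'n) set) = {z}" by (rule card_1_singletonE)
      then show ?thesis using b(1) by (metis singletonD)
    qed
    define C where "C = ?V * (1/\<theta>0 * (1 / \<bar>c \<bullet> b\<bar> * E)) powr p"
    show thesis
    proof (rule that[of C])
      show "0 \<le> C" by (simp add: C_def)
      fix g assume g: "C1_fun g" "(\<integral>\<^sup>+x. ennreal \<bar>g x\<bar> * indicator (\<Omega> \<inter> ball x0 \<rho>) x \<partial>lborel) \<le> ennreal A"
        "\<And>w. norm w \<le> \<kappa> \<Longrightarrow> (\<integral>\<^sup>+x. ennreal \<bar>dird (c + w) g x\<bar> * indicator (\<Omega> \<inter> ball x0 \<rho>) x \<partial>lborel) \<le> ennreal B"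
      from key[OF this[folded G_def]] obtain f F where f: "C1_fun f" and Fm: "F \<in> borel_measurable borel"
        and FE: "(\<integral>\<^sup>+x. F x \<partial>lborel) \<le> ennreal E"
        and line: "\<And>w x. w \<in> Ws \<Longrightarrow> ennreal \<bar>f x\<bar> * indicator G x \<le> line_int (c + w) F x"
        and gf: "\<And>x. x \<in> ball x0 (\<rho>/2) \<Longrightarrow> \<bar>g x\<bar> \<le> \<bar>f x\<bar> / \<theta>0" by blast
      \<comment> \<open>In dimension one every point lies on the line through 0 in direction c, so
        this line integral is a multiple of the full integral: f is bounded on G, and every p is
        covered.\<close>
      have li: "line_int c F x \<le> ennreal (1 / \<bar>c \<bullet> b\<bar> * E)" for x
      proof -
        have rep: "y = (y \<bullet> b) *\<^sub>R b" for y
          using euclidean_representation[of y] unfolding Basis1 by simp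
        have "0 + (x \<bullet> b / (c \<bullet> b)) *\<^sub>R c = (x \<bullet> b / (c \<bullet> b)) *\<^sub>R ((c \<bullet> b) *\<^sub>R b)"
          using rep[of c] by simp
        also have "\<dots> = x" using b(2) rep[of x] by simp
        finally have "x = 0 + (x \<bullet> b / (c \<bullet> b)) *\<^sub>R c" by simp
        then have "line_int c F x = line_int c F 0" using line_int_shift[OF Fm] by metis
        also have "\<dots> = lines_int (c # map (\<lambda>e. c + \<kappa> *\<^sub>R e) []) F 0" by simp
        also have "\<dots> = ennreal ((1 / \<bar>\<kappa>\<bar>) ^ length ([] :: (real^'n) list) * (1 / \<bar>c \<bullet> b\<bar>)) * (\<integral>\<^sup>+x. F x \<partial>lborel)"
          by (rule lines_int_skew_Basis[OF Fm _ b]) (use \<kappa> Basis1 in auto)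
        also have "\<dots> \<le> ennreal (1 / \<bar>c \<bullet> b\<bar>) * ennreal E" using FE by (simp add: mult_left_mono)
        also have "\<dots> = ennreal (1 / \<bar>c \<bullet> b\<bar> * E)" using E by (intro ennreal_mult[symmetric]) auto
        finally show ?thesis .
      qed
      have fb: "\<bar>f x\<bar> \<le> 1 / \<bar>c \<bullet> b\<bar> * E" if "x \<in> G" for x
      proof -
        have "ennreal \<bar>f x\<bar> \<le> ennreal (1 / \<bar>c \<bullet> b\<bar> * E)"
          using order_trans[OF line[of 0 x], of "ennreal (1 / \<bar>c \<bullet> b\<bar> * E)"] li that by (simp add: Ws_def)
        then show ?thesis using E by (subst (asm) ennreal_le_iff) auto
      qed
      have "(\<integral>\<^sup>+x. ennreal (\<bar>g x\<bar> powr p) * indicator (\<Omega> \<inter> ball x0 (\<rho>/2)) x \<partial>lborel)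
        \<le> (\<integral>\<^sup>+x. ennreal ((1/\<theta>0 * (1 / \<bar>c \<bullet> b\<bar> * E)) powr p) * indicator (ball x0 \<rho>) x \<partial>lborel)"
      proof (rule nn_integral_mono)
        fix x
        show "ennreal (\<bar>g x\<bar> powr p) * indicator (\<Omega> \<inter> ball x0 (\<rho>/2)) x \<le> ennreal ((1/\<theta>0 * (1 / \<bar>c \<bullet> b\<bar> * E)) powr p) * indicator (ball x0 \<rho>) x"
        proof (cases "x \<in> \<Omega> \<inter> ball x0 (\<rho>/2)")
          case True
          then have xG: "x \<in> G" "x \<in> ball x0 \<rho>" using \<rho> by (auto simp: G_def)
          have "\<bar>g x\<bar> \<le> 1/\<theta>0 * \<bar>f x\<bar>" using gf[of x] True by simp
          also have "\<dots> \<le> 1/\<theta>0 * (1 / \<bar>c \<bullet> b\<bar> * E)" using fb[OF xG(1)] \<theta>0 by (intro mult_left_mono) auto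
          finally have "\<bar>g x\<bar> powr p \<le> (1/\<theta>0 * (1 / \<bar>c \<bullet> b\<bar> * E)) powr p" using p by (intro powr_mono2) auto
          then show ?thesis using True xG by (simp add: ennreal_leI)
        qed simp
      qed
      also have "\<dots> = ennreal C"
        unfolding C_def by (subst nn_integral_cmult_indicator) (simp_all add: ballfin ennreal_mult mult.commute)
      finally show "(\<integral>\<^sup>+x. ennreal (\<bar>g x\<bar> powr p) * indicator (\<Omega> \<inter> ball x0 (\<rho>/2)) x \<partial>lborel) \<le> ennreal C" .
    qed
  qed
qed


text \<open>Start and end point lie in the same ball, which limits the step, so t needs no bound of
  its own. At an interior point any direction qualifies once the ball lies in \<Omega>; interior and
  boundary points can therefore be treated alike.\<close>

definition cone_at :: "(real^'n::finite) set \<Rightarrow> real^'n \<Rightarrow> real^'n \<Rightarrow> real \<Rightarrow> real \<Rightarrow> bool" where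
  "cone_at \<Omega> x0 c \<delta> r \<longleftrightarrow> (\<forall>x z t. x \<in> \<Omega> \<inter> ball x0 r \<longrightarrow> norm z < \<delta> \<longrightarrow> 0 \<le> t \<longrightarrow>
     x + t *\<^sub>R (c + z) \<in> ball x0 r \<longrightarrow> x + t *\<^sub>R (c + z) \<in> \<Omega>)"

lemma norm_inverse_scale_less: "0 < t \<Longrightarrow> norm v < t * a \<Longrightarrow> norm ((1/t) *\<^sub>R v) < a"
  for v :: "'a::real_normed_vector"
  by (simp add: pos_divide_less_eq mult.commute)

text \<open>Replace x by a nearby point of \<Omega> and absorb the difference into z. This uses that
  the cone is open and that t is strictly positive: a positive step takes even a boundary point into
  \<Omega>.\<close>

lemma cone_at_closure:
  assumes cone: "cone_at \<Omega> x0 c \<delta> r" and x: "x \<in> closure \<Omega>" "x \<in> ball x0 r" and z: "norm z < \<delta>" and t: "0 < t"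
    and y: "x + t *\<^sub>R (c + z) \<in> ball x0 r"
  shows "x + t *\<^sub>R (c + z) \<in> \<Omega>"
proof -
  define e where "e = min (r - dist x0 x) (t * (\<delta> - norm z))"
  have e: "e > 0" using x z t by (simp add: e_def)
  then obtain x' where x': "x' \<in> \<Omega>" "dist x' x < e" using x(1) by (auto simp: closure_approachable)
  define z' where "z' = z + (1/t) *\<^sub>R (x - x')"
  have eq: "x + t *\<^sub>R (c + z) = x' + t *\<^sub>R (c + z')" using t by (simp add: z'_def algebra_simps)
  have "norm (x - x') < t * (\<delta> - norm z)" using x'(2) by (simp add: e_def dist_norm norm_minus_commute)
  then have "norm ((1/t) *\<^sub>R (x - x')) < \<delta> - norm z" by (rule norm_inverse_scale_less[OF t])
  then have "norm z' < \<delta>" unfolding z'_def using norm_triangle_ineq[of z "(1/t) *\<^sub>R (x - x')"] by linarith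
  moreover have "x' \<in> ball x0 r"
    using x'(2) dist_triangle[of x0 x' x] by (simp add: e_def dist_commute)
  ultimately show ?thesis using cone x'(1) t y unfolding eq cone_at_def by auto
qed

text \<open>The cone contains a ball around \<open>x1 = x0 + h c\<close> of radius
  \<open>R = h \<delta>\<close>, even if x0 is a boundary point. There W is compared with an affine
  function, and the steps \<open>h (c + w)\<close> and \<open>l h (c + w)\<close> carry the
  comparison back to G; subtracting an affine function changes no Taylor remainder. The constants do
  not depend on u, m or \<epsilon>, which makes the passage to the limit possible.\<close>

lemma patch_mollified:
  fixes \<Omega> :: "(real^'n::finite) set" and x0 c :: "real^'n"
  assumes \<Omega>: "open \<Omega>" and x0: "x0 \<in> closure \<Omega>" and c: "norm c = 1/2" and \<delta>: "0 < \<delta>" "\<delta> \<le> 1/2" and r: "0 < r" "r \<le> 1"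
    and cone: "cone_at \<Omega> x0 c \<delta> r"
    and p: "1 < p" "CARD('n) \<ge> 2 \<longrightarrow> p \<le> real CARD('n) / (real CARD('n) - 1)"
  shows "\<exists>C\<ge>0. \<exists>\<rho>>0. \<exists>\<epsilon>0>0. \<forall>u m \<epsilon>. integrable lborel u \<longrightarrow> tgv_dual_bound \<Omega> u \<longrightarrow> is_mollifier m \<longrightarrow>
      0 < \<epsilon> \<longrightarrow> \<epsilon> \<le> \<epsilon>0 \<longrightarrow> (\<forall>z. m z \<noteq> 0 \<longrightarrow> z \<in> ball (\<epsilon> *\<^sub>R c) (\<epsilon> * \<delta> / 2)) \<longrightarrow>
      (\<exists>a b. (\<integral>\<^sup>+x. ennreal (\<bar>mollify m u x - (a + b \<bullet> x)\<bar> powr p) * indicator (\<Omega> \<inter> ball x0 \<rho>) x \<partial>lborel) \<le> ennreal C)"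
proof -
  \<comment> \<open>Room in the ball of radius r for a base point near x0, a step of length up to 2
    h and the mollifier: \<open>\<rho> + 2 h + \<epsilon> < r\<close>.\<close>
  define h where "h = r / 4"
  define R where "R = h * \<delta>"
  define x1 where "x1 = x0 + h *\<^sub>R c"
  define \<rho> where "\<rho> = R / 16"
  define l where "l = 1 + \<delta> / 16"
  define \<kappa> where "\<kappa> = \<delta> / 16"
  define G where "G = \<Omega> \<inter> ball x0 \<rho>"
  have h: "0 < h" using r by (simp add: h_def)
  have R: "0 < R" "R \<le> h / 2" using h \<delta> by (auto simp: R_def)
  have \<rho>0: "0 < \<rho>" "\<rho> \<le> r" "\<rho> \<le> h / 32" using R h by (auto simp: \<rho>_def h_def)
  have l: "1 < l" "l \<le> 2" using \<delta> by (auto simp: l_def)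
  have \<kappa>: "0 < \<kappa>" "\<kappa> < \<delta>" "\<kappa> \<le> 1/4" using \<delta> by (auto simp: \<kappa>_def)
  have x0b: "x0 \<in> ball x0 r" using r by simp
  have cw: "norm (c + w) \<le> 1" if "norm w \<le> \<delta>" for w
    using norm_triangle_ineq[of c w] c \<delta> that by linarith
  \<comment> \<open>A point of this ball is x0 plus h times a vector c + z with
    \<open>norm z < \<delta>\<close>.\<close>
  have ballO: "y \<in> \<Omega>" if "dist x1 y < R" for y
  proof -
    define z where "z = (1/h) *\<^sub>R (y - x1)"
    have y: "y = x0 + h *\<^sub>R (c + z)" using h by (simp add: z_def x1_def algebra_simps)
    have z: "norm z < \<delta>" unfolding z_def
      by (rule norm_inverse_scale_less[OF h]) (use that in \<open>simp add: R_def dist_norm norm_minus_commute\<close>)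
    have "dist x0 y \<le> h * 1"
      unfolding y using cw[of z] z h by (simp add: dist_norm mult_left_mono)
    then have "y \<in> ball x0 r" using r by (simp add: h_def)
    then show ?thesis unfolding y by (intro cone_at_closure[OF cone x0 x0b z h])
  qed
  have R16: "0 < R/16" "R/16 < R/4" using R by auto
  have "\<exists>C1\<ge>0. \<forall>W. C1_fun W \<longrightarrow>
      (\<forall>v. norm v < R/4 \<longrightarrow> (\<integral>\<^sup>+x. ennreal \<bar>taylor_rem W x v\<bar> * indicator (ball x1 (R/16)) x \<partial>lborel) \<le> 1) \<longrightarrow>
      (\<exists>c b. (\<integral>\<^sup>+x. ennreal \<bar>W x - (c + b \<bullet> x)\<bar> * indicator (ball x1 (R/4 - R/16)) x \<partial>lborel) \<le> ennreal C1)"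
    by (rule affine_approx_of_taylor_rem[OF R16, of x1]) (rule exI, rule conjI, assumption, blast)
  then obtain C1 where C1: "0 \<le> C1" and aff: "\<And>W. C1_fun W \<Longrightarrow>
      (\<And>v. norm v < R/4 \<Longrightarrow> (\<integral>\<^sup>+x. ennreal \<bar>taylor_rem W x v\<bar> * indicator (ball x1 (R/16)) x \<partial>lborel) \<le> 1) \<Longrightarrow>
      \<exists>c b. (\<integral>\<^sup>+x. ennreal \<bar>W x - (c + b \<bullet> x)\<bar> * indicator (ball x1 (R/4 - R/16)) x \<partial>lborel) \<le> ennreal C1"
    by blast
  \<comment> \<open>\<open>A\<close> and \<open>B\<close> come from
    \<open>taylor_rem_transfer\<close>; in \<open>B\<close> the division by h turns the derivative
    along \<open>h (c + w)\<close> into the one along c + w.\<close>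
  define A where "A = (1 + l) * (C1 + 1) / (l - 1)"
  define B where "B = (C1 + A + 1) / h"
  have AB: "0 \<le> A" "0 \<le> B" using l C1 h by (auto simp: A_def B_def)
  have cone': "\<And>x z t. x \<in> \<Omega> \<inter> ball x0 r \<Longrightarrow> norm z < \<delta> \<Longrightarrow> 0 \<le> t \<Longrightarrow> x + t *\<^sub>R (c + z) \<in> ball x0 r \<Longrightarrow> x + t *\<^sub>R (c + z) \<in> \<Omega>"
    using cone by (auto simp: cone_at_def)
  have "\<exists>C\<ge>0. \<forall>g. C1_fun g \<longrightarrow> (\<integral>\<^sup>+x. ennreal \<bar>g x\<bar> * indicator (\<Omega> \<inter> ball x0 \<rho>) x \<partial>lborel) \<le> ennreal A \<longrightarrow>
      (\<forall>w. norm w \<le> \<kappa> \<longrightarrow> (\<integral>\<^sup>+x. ennreal \<bar>dird (c + w) g x\<bar> * indicator (\<Omega> \<inter> ball x0 \<rho>) x \<partial>lborel) \<le> ennreal B) \<longrightarrow>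
      (\<integral>\<^sup>+x. ennreal (\<bar>g x\<bar> powr p) * indicator (\<Omega> \<inter> ball x0 (\<rho>/2)) x \<partial>lborel) \<le> ennreal C"
    by (rule cone_patch_Sobolev[OF \<Omega> c \<kappa> \<rho>0(1,2) cone' p AB]) (assumption+, rule exI, rule conjI, assumption, blast)
  then obtain C where C: "0 \<le> C" and sob: "\<And>g. C1_fun g \<Longrightarrow> (\<integral>\<^sup>+x. ennreal \<bar>g x\<bar> * indicator (\<Omega> \<inter> ball x0 \<rho>) x \<partial>lborel) \<le> ennreal A \<Longrightarrow>
      (\<And>w. norm w \<le> \<kappa> \<Longrightarrow> (\<integral>\<^sup>+x. ennreal \<bar>dird (c + w) g x\<bar> * indicator (\<Omega> \<inter> ball x0 \<rho>) x \<partial>lborel) \<le> ennreal B) \<Longrightarrow>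
      (\<integral>\<^sup>+x. ennreal (\<bar>g x\<bar> powr p) * indicator (\<Omega> \<inter> ball x0 (\<rho>/2)) x \<partial>lborel) \<le> ennreal C"
    by blast
  show ?thesis
  proof (rule exI[of _ C], rule conjI[OF C], rule exI[of _ "\<rho>/2"], rule conjI, use \<rho>0 in simp,
      rule exI[of _ "R/4"], rule conjI, use R in simp, intro allI impI)
    fix u m :: "real^'n \<Rightarrow> real" and \<epsilon> :: real
    assume u: "integrable lborel u" and H: "tgv_dual_bound \<Omega> u" and m: "is_mollifier m" and \<epsilon>: "0 < \<epsilon>" "\<epsilon> \<le> R/4"
      and supp0: "\<forall>z. m z \<noteq> 0 \<longrightarrow> z \<in> ball (\<epsilon> *\<^sub>R c) (\<epsilon> * \<delta> / 2)"
    have supp: "z \<in> ball (\<epsilon> *\<^sub>R c) (\<epsilon> * \<delta> / 2)" if "m z \<noteq> 0" for z using supp0 that by blast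
    \<comment> \<open>The mollifier ball has only half the opening of the cone, so its closure still
      consists of vectors \<open>\<epsilon> (c + z')\<close> with
      \<open>norm z' < \<delta>\<close>.\<close>
    have supp': "\<exists>z'. norm z' < \<delta> \<and> z = \<epsilon> *\<^sub>R (c + z')" if "z \<in> cball (\<epsilon> *\<^sub>R c) (\<epsilon> * \<delta> / 2)" for z
    proof (intro exI conjI)
      let ?z = "(1/\<epsilon>) *\<^sub>R (z - \<epsilon> *\<^sub>R c)"
      have "norm (z - \<epsilon> *\<^sub>R c) \<le> \<epsilon> * \<delta> / 2" using that by (simp add: dist_norm norm_minus_commute)
      also have "\<dots> < \<epsilon> * \<delta>" using \<epsilon> \<delta> by simp
      finally show "norm ?z < \<delta>" by (rule norm_inverse_scale_less[OF \<epsilon>(1)])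
      show "z = \<epsilon> *\<^sub>R (c + ?z)" using \<epsilon> by (simp add: algebra_simps)
    qed
    have znorm: "norm z \<le> \<epsilon>" if zc: "z \<in> cball (\<epsilon> *\<^sub>R c) (\<epsilon> * \<delta> / 2)" for z
    proof -
      obtain z' where "norm z' < \<delta>" "z = \<epsilon> *\<^sub>R (c + z')" using supp'[OF zc] by blast
      then show ?thesis using cw[of z'] \<epsilon> by (simp add: mult_left_le)
    qed
    define W where "W = mollify m u"
    have mc: "C1c m" using m by (simp add: is_mollifier_def C2c_C1c)
    have W: "C1_fun W" unfolding W_def by (rule mollify_C1(1)[OF u mc])
    have T1: "(\<integral>\<^sup>+x. ennreal \<bar>taylor_rem W x v\<bar> * indicator (ball x1 (R/16)) x \<partial>lborel) \<le> 1" if v: "norm v < R/4" for v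
      unfolding W_def
    \<comment> \<open>Base point, segment and mollifier contribute at most R/16, R/4 and R/4; the
      sum is below 3R/4, so the support stays well inside the ball of radius R.\<close>
    proof (rule taylor_rem_L1_bound[OF H u m, where K="cball x1 (3 * R / 4)"])
      show "norm v \<le> 1" using v R r by (simp add: h_def)
      show "cball x1 (3 * R / 4) \<subseteq> \<Omega>" using ballO R by (auto simp: subset_iff)
      fix x z :: "real^'n" and t :: real assume x: "x \<in> ball x1 (R/16)" and t: "0 \<le> t" "t \<le> 1" and z: "m z \<noteq> 0"
      have "norm z \<le> \<epsilon>" using supp[OF z] by (intro znorm) auto
      moreover have "norm (t *\<^sub>R v) \<le> R/4"
      proof -
        have "t * norm v \<le> 1 * norm v" using t by (intro mult_right_mono) auto
        then show ?thesis using v t by simp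
      qed
      moreover have "dist x1 (x + t *\<^sub>R v + z) \<le> dist x1 x + norm (t *\<^sub>R v) + norm z"
      proof -
        have eq: "x1 - (x + t *\<^sub>R v + z) = (x1 - x) - t *\<^sub>R v - z" by simp
        show ?thesis unfolding dist_norm eq
          using norm_triangle_ineq4[of "(x1 - x) - t *\<^sub>R v" z] norm_triangle_ineq4[of "x1 - x" "t *\<^sub>R v"] by linarith
      qed
      ultimately show "x + t *\<^sub>R v + z \<in> cball x1 (3 * R / 4)" using x \<epsilon> by simp
    qed auto
    have T2: "(\<integral>\<^sup>+x. ennreal \<bar>taylor_rem W x (k *\<^sub>R (h *\<^sub>R (c + w)))\<bar> * indicator G x \<partial>lborel) \<le> 1"
      if k: "0 \<le> k" "k \<le> 2" and w: "norm w \<le> \<kappa>" for k w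
    proof -
      let ?v = "k *\<^sub>R (h *\<^sub>R (c + w))"
      \<comment> \<open>A sum of three compact sets containing every point the test field can see. G
        may touch the boundary, hence its closure has to be moved into \<Omega>.\<close>
      define K where "K = {x + y | x y. x \<in> {x + y | x y. x \<in> closure G \<and> y \<in> (\<lambda>t. t *\<^sub>R ?v) ` {0..1}} \<and> y \<in> cball (\<epsilon> *\<^sub>R c) (\<epsilon> * \<delta> / 2)}"
      have Gb: "bounded G" by (rule bounded_subset[of "ball x0 \<rho>"]) (auto simp: G_def)
      have cG: "compact (closure G)" using Gb by (simp add: compact_closure)
      have cI: "compact ((\<lambda>t. t *\<^sub>R ?v) ` {0..1::real})" by (intro compact_continuous_image continuous_intros) simp
      have Kc: "compact K" unfolding K_def by (rule compact_sums[OF compact_sums[OF cG cI] compact_cball])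
      have w\<delta>: "norm w < \<delta>" "norm w \<le> \<delta>" using w \<kappa> by auto
      have nv: "norm ?v \<le> 2 * h"
      proof -
        have "k * (h * norm (c + w)) \<le> 2 * (h * 1)" using k h cw[OF w\<delta>(2)] by (intro mult_mono mult_nonneg_nonneg) auto
        then show ?thesis using k h by simp
      qed
      have KO: "K \<subseteq> \<Omega>"
      proof
        fix y assume "y \<in> K"
        then obtain x t z where x: "x \<in> closure G" and t: "0 \<le> t" "t \<le> 1" and z: "z \<in> cball (\<epsilon> *\<^sub>R c) (\<epsilon> * \<delta> / 2)"
          and y: "y = x + t *\<^sub>R ?v + z" unfolding K_def by auto
        have xcl: "x \<in> closure \<Omega>" using x closure_mono[of G \<Omega>] by (auto simp: G_def)
        have "closure G \<subseteq> cball x0 \<rho>" by (rule closure_minimal) (auto simp: G_def)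
        then have xb: "dist x0 x \<le> \<rho>" using x by auto
        obtain z' where z': "norm z' < \<delta>" "z = \<epsilon> *\<^sub>R (c + z')" using supp'[OF z] by blast
        \<comment> \<open>Segment and mollifier merged into one displacement
          \<open>s (c + z'')\<close>, where \<open>z''\<close> is a weighted mean of w and
          \<open>z'\<close> and so inside the cone opening. The summand \<epsilon>, due to the
          off-centre mollifier, keeps s positive at t = 0; this is what makes
          \<open>cone_at_closure\<close> applicable.\<close>
        define s where "s = t * k * h + \<epsilon>"
        have s: "0 < s" using t k h \<epsilon> by (simp add: s_def add_nonneg_pos)
        define z'' where "z'' = (1/s) *\<^sub>R ((t * k * h) *\<^sub>R w + \<epsilon> *\<^sub>R z')"
        have sz: "s *\<^sub>R z'' = (t * k * h) *\<^sub>R w + \<epsilon> *\<^sub>R z'" using s by (simp add: z''_def)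
        have yeq: "y = x + s *\<^sub>R (c + z'')"
          unfolding y z'(2) scaleR_add_right[of s] sz by (simp add: s_def algebra_simps)
        have "norm ((t * k * h) *\<^sub>R w + \<epsilon> *\<^sub>R z') \<le> (t * k * h) * norm w + \<epsilon> * norm z'"
          using norm_triangle_ineq[of "(t * k * h) *\<^sub>R w" "\<epsilon> *\<^sub>R z'"] t k h \<epsilon> by simp
        also have "\<dots> < (t * k * h) * \<delta> + \<epsilon> * \<delta>"
          using t k h \<epsilon> w\<delta> z' by (intro add_le_less_mono mult_left_mono mult_strict_left_mono) auto
        finally have "norm z'' < \<delta>" unfolding z''_def by (intro norm_inverse_scale_less[OF s]) (simp add: s_def algebra_simps)
        moreover have "y \<in> ball x0 r"
        proof -
          have "norm (t *\<^sub>R ?v) \<le> 2 * h"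
          proof -
            have "t * norm ?v \<le> 1 * norm ?v" using t by (intro mult_right_mono) auto
            then show ?thesis using nv t unfolding norm_scaleR[of t] by simp
          qed
          moreover have "norm z \<le> \<epsilon>" by (rule znorm[OF z])
          moreover have "dist x0 y \<le> dist x0 x + norm (t *\<^sub>R ?v) + norm z"
          proof -
            have eq: "x0 - y = (x0 - x) - t *\<^sub>R ?v - z" by (simp add: y)
            show ?thesis unfolding dist_norm eq
              using norm_triangle_ineq4[of "(x0 - x) - t *\<^sub>R ?v" z] norm_triangle_ineq4[of "x0 - x" "t *\<^sub>R ?v"] by linarith
          qed
          ultimately have "dist x0 y \<le> \<rho> + 2 * h + \<epsilon>" using xb by linarith
          also have "\<dots> < r" using \<rho>0 \<epsilon> R h by (simp add: h_def)
          finally show ?thesis by simp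
        qed
        moreover have "x \<in> ball x0 r" using xb \<rho>0 h by (simp add: h_def)
        ultimately show "y \<in> \<Omega>" unfolding yeq by (intro cone_at_closure[OF cone xcl _ _ s]) auto
      qed
      show ?thesis unfolding W_def
      proof (rule taylor_rem_L1_bound[OF H u m _ _ Gb Kc KO])
        show "norm ?v \<le> 1" using nv r by (simp add: h_def)
        show "G \<in> sets borel" using \<Omega> by (auto simp: G_def)
        fix x z :: "real^'n" and t :: real assume "x \<in> G" "0 \<le> t" "t \<le> 1" "m z \<noteq> 0"
        then show "x + t *\<^sub>R ?v + z \<in> K" unfolding K_def using closure_subset[of G] supp[of z] by fastforce
      qed
    qed
    obtain a b where ab: "(\<integral>\<^sup>+x. ennreal \<bar>W x - (a + b \<bullet> x)\<bar> * indicator (ball x1 (R/4 - R/16)) x \<partial>lborel) \<le> ennreal C1"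
      using aff[OF W T1] by blast
    define g where "g x = W x - (a + b \<bullet> x)" for x
    have g: "C1_fun g" unfolding g_def by (rule minus_affine_C1(1)[OF W])
    have Tg: "taylor_rem g x v = taylor_rem W x v" for x v unfolding g_def by (rule minus_affine_C1(3)[OF W])
    \<comment> \<open>The distance to x1 splits into x - x0, h w and (k - 1) h (c + w). The choices
      of \<rho>, \<kappa> and l make each part at most R/16, the first strictly less.\<close>
    have near: "x + k *\<^sub>R (h *\<^sub>R (c + w)) \<in> ball x1 (R/4 - R/16)" if x: "x \<in> G" and w: "norm w \<le> \<kappa>" and k: "k = 1 \<or> k = l" for x k w
    proof -
      have "dist x0 x < R/16" using x by (simp add: G_def \<rho>_def)
      moreover have "norm (h *\<^sub>R w) \<le> R/16" using w h by (simp add: \<kappa>_def R_def field_simps)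
      moreover have "norm ((k - 1) *\<^sub>R (h *\<^sub>R (c + w))) \<le> R/16"
      proof -
        have "norm w \<le> \<delta>" using w \<kappa> by simp
        then have "\<bar>k - 1\<bar> * (h * norm (c + w)) \<le> \<delta>/16 * (h * 1)"
          using k \<delta> h cw[of w] by (intro mult_mono) (auto simp: l_def)
        moreover have "norm ((k - 1) *\<^sub>R (h *\<^sub>R (c + w))) = \<bar>k - 1\<bar> * (h * norm (c + w))"
          unfolding norm_scaleR using h by simp
        moreover have "\<delta>/16 * (h * 1) = R/16" by (simp add: R_def)
        ultimately show ?thesis by linarith
      qed
      moreover have "dist x1 (x + k *\<^sub>R (h *\<^sub>R (c + w))) \<le> dist x0 x + norm (h *\<^sub>R w) + norm ((k - 1) *\<^sub>R (h *\<^sub>R (c + w)))"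
      proof -
        have eq: "x1 - (x + k *\<^sub>R (h *\<^sub>R (c + w))) = (x0 - x) - h *\<^sub>R w - (k - 1) *\<^sub>R (h *\<^sub>R (c + w))"
          by (simp add: x1_def algebra_simps)
        show ?thesis unfolding dist_norm eq
          using norm_triangle_ineq4[of "(x0 - x) - h *\<^sub>R w" "(k - 1) *\<^sub>R (h *\<^sub>R (c + w))"] norm_triangle_ineq4[of "x0 - x" "h *\<^sub>R w"] by linarith
      qed
      ultimately show ?thesis by simp
    qed
    have tr: "(\<integral>\<^sup>+x. ennreal \<bar>g x\<bar> * indicator G x \<partial>lborel) \<le> ennreal A"
       "(\<integral>\<^sup>+x. ennreal \<bar>dird (h *\<^sub>R (c + w)) g x\<bar> * indicator G x \<partial>lborel) \<le> ennreal (C1 + A + 1)" if w: "norm w \<le> \<kappa>" for w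
    proof -
      have 1: "G \<in> sets borel" using \<Omega> by (auto simp: G_def)
      have 2: "ball x1 (R/4 - R/16) \<in> sets borel" by simp
      have 3: "x + h *\<^sub>R (c + w) \<in> ball x1 (R/4 - R/16)" if "x \<in> G" for x using near[OF that w, of 1] by simp
      have 4: "x + l *\<^sub>R (h *\<^sub>R (c + w)) \<in> ball x1 (R/4 - R/16)" if "x \<in> G" for x using near[OF that w, of l] by simp
      have 5: "(\<integral>\<^sup>+x. ennreal \<bar>taylor_rem g x (h *\<^sub>R (c + w))\<bar> * indicator G x \<partial>lborel) \<le> 1" using T2[of 1 w] w Tg by simp
      have 6: "(\<integral>\<^sup>+x. ennreal \<bar>taylor_rem g x (l *\<^sub>R (h *\<^sub>R (c + w)))\<bar> * indicator G x \<partial>lborel) \<le> 1" using T2[of l w] w Tg l by simp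
      note tt = taylor_rem_transfer[OF g 1 2 l(1) C1 3 4 ab[folded g_def] 5 6]
      show "(\<integral>\<^sup>+x. ennreal \<bar>g x\<bar> * indicator G x \<partial>lborel) \<le> ennreal A" using tt(1) by (simp add: A_def)
      show "(\<integral>\<^sup>+x. ennreal \<bar>dird (h *\<^sub>R (c + w)) g x\<bar> * indicator G x \<partial>lborel) \<le> ennreal (C1 + A + 1)" using tt(2) by (simp add: A_def)
    qed
    have "(\<integral>\<^sup>+x. ennreal (\<bar>g x\<bar> powr p) * indicator (\<Omega> \<inter> ball x0 (\<rho>/2)) x \<partial>lborel) \<le> ennreal C"
    proof (rule sob[OF g])
      show "(\<integral>\<^sup>+x. ennreal \<bar>g x\<bar> * indicator (\<Omega> \<inter> ball x0 \<rho>) x \<partial>lborel) \<le> ennreal A"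
        using tr(1)[of 0] \<kappa> by (simp add: G_def)
      fix w :: "real^'n" assume w: "norm w \<le> \<kappa>"
      have [measurable]: "G \<in> sets borel" using \<Omega> by (auto simp: G_def)
      have [measurable]: "dird v g \<in> borel_measurable borel" for v by (rule borel_measurable_continuous_onI[OF dird_continuous[OF g]])
      have "(\<integral>\<^sup>+x. ennreal \<bar>dird (c + w) g x\<bar> * indicator G x \<partial>lborel)
         = (\<integral>\<^sup>+x. ennreal (1/h) * (ennreal \<bar>dird (h *\<^sub>R (c + w)) g x\<bar> * indicator G x) \<partial>lborel)"
        using h by (intro nn_integral_cong) (simp add: dird_scaleR abs_mult mult.assoc[symmetric] ennreal_mult[symmetric])
      also have "\<dots> = ennreal (1/h) * (\<integral>\<^sup>+x. ennreal \<bar>dird (h *\<^sub>R (c + w)) g x\<bar> * indicator G x \<partial>lborel)"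
        by (rule nn_integral_cmult) measurable
      also have "\<dots> \<le> ennreal (1/h) * ennreal (C1 + A + 1)" by (intro mult_left_mono tr(2)[OF w]) simp
      also have "\<dots> = ennreal B" using h C1 AB by (simp add: B_def ennreal_mult[symmetric] del: ennreal_plus)
      finally show "(\<integral>\<^sup>+x. ennreal \<bar>dird (c + w) g x\<bar> * indicator (\<Omega> \<inter> ball x0 \<rho>) x \<partial>lborel) \<le> ennreal B" by (simp add: G_def)
    qed
    then show "\<exists>a b. (\<integral>\<^sup>+x. ennreal (\<bar>mollify m u x - (a + b \<bullet> x)\<bar> powr p) * indicator (\<Omega> \<inter> ball x0 (\<rho>/2)) x \<partial>lborel) \<le> ennreal C"
      unfolding g_def W_def by blast
  qed
qed

section \<open>Poincare inequality modulo affine functions\<close>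

text \<open>The affine function may depend on u, the constant may not. No seminorm appears on the
  right because \<open>tgv_dual_bound\<close> has normalised it to one.\<close>

definition tgv_poincare :: "(real^'n::finite) set \<Rightarrow> real \<Rightarrow> (real^'n) set \<Rightarrow> bool" where
  "tgv_poincare \<Omega> p U \<longleftrightarrow> (\<exists>C\<ge>0. \<forall>u. integrable lborel u \<longrightarrow> tgv_dual_bound \<Omega> u \<longrightarrow>
     (\<exists>a b. (\<integral>\<^sup>+x. ennreal (\<bar>u x - (a + b \<bullet> x)\<bar> powr p) * indicator U x \<partial>lborel) \<le> ennreal C))"

lemma ennreal_abs_le_powr:
  assumes "1 \<le> p"
  shows "ennreal \<bar>t\<bar> \<le> 1 + ennreal (\<bar>t\<bar> powr p)"
proof -
  have "\<bar>t\<bar> powr 1 \<le> 1 + \<bar>t\<bar> powr p" by (rule powr_le_1_plus_powr) (use assms in auto)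
  then have "\<bar>t\<bar> \<le> 1 + \<bar>t\<bar> powr p" by simp
  then have "ennreal \<bar>t\<bar> \<le> ennreal (1 + \<bar>t\<bar> powr p)" by (rule ennreal_leI)
  then show ?thesis by simp
qed

text \<open>Mollifiers shrinking inside the cone give estimates with one constant. The affine
  functions are bounded because W stays bounded in L1, so a subsequence of their coefficients
  converges, and Fatou's lemma carries the Lp bound over to u.\<close>

lemma patch_estimate:
  fixes \<Omega> :: "(real^'n::finite) set" and x0 c :: "real^'n"
  assumes \<Omega>: "open \<Omega>" and x0: "x0 \<in> closure \<Omega>" and c: "norm c = 1/2" and \<delta>: "0 < \<delta>" "\<delta> \<le> 1/2" and r: "0 < r" "r \<le> 1"
    and cone: "cone_at \<Omega> x0 c \<delta> r"
    and p: "1 < p" "CARD('n) \<ge> 2 \<longrightarrow> p \<le> real CARD('n) / (real CARD('n) - 1)"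
  shows "\<exists>\<rho>>0. tgv_poincare \<Omega> p (\<Omega> \<inter> ball x0 \<rho>)"
proof -
  from patch_mollified[OF \<Omega> x0 c \<delta> r cone p]
  obtain C \<rho> \<epsilon>0 where C: "0 \<le> C" "0 < \<rho>" "0 < \<epsilon>0" and
    pm: "\<And>u m \<epsilon>. integrable lborel u \<Longrightarrow> tgv_dual_bound \<Omega> u \<Longrightarrow> is_mollifier m \<Longrightarrow> 0 < \<epsilon> \<Longrightarrow> \<epsilon> \<le> \<epsilon>0 \<Longrightarrow>
      (\<forall>z. m z \<noteq> 0 \<longrightarrow> z \<in> ball (\<epsilon> *\<^sub>R c) (\<epsilon> * \<delta> / 2)) \<Longrightarrow>
      \<exists>a b. (\<integral>\<^sup>+x. ennreal (\<bar>mollify m u x - (a + b \<bullet> x)\<bar> powr p) * indicator (\<Omega> \<inter> ball x0 \<rho>) x \<partial>lborel) \<le> ennreal C"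
    by blast
  define G where "G = \<Omega> \<inter> ball x0 \<rho>"
  have Go: "open G" using \<Omega> by (auto simp: G_def)
  have [measurable]: "G \<in> sets borel" using Go by simp
  have Gne: "G \<noteq> {}"
  proof -
    obtain y where "y \<in> \<Omega>" "dist y x0 < \<rho>" using x0 C(2) by (auto simp: closure_approachable)
    then show ?thesis by (auto simp: G_def dist_commute)
  qed
  have Gfin: "emeasure lborel G < \<infinity>"
    by (rule emeasure_bounded_finite) (auto simp: G_def intro: bounded_subset[OF bounded_ball])
  have "tgv_poincare \<Omega> p G"
    unfolding tgv_poincare_def
  proof (rule exI[of _ C], rule conjI[OF C(1)], intro allI impI)
    fix u assume u: "integrable lborel u" and H: "tgv_dual_bound \<Omega> u"
    have [measurable]: "u \<in> borel_measurable borel" using borel_measurable_integrable[OF u] by simp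
    define P where "P n m a b \<longleftrightarrow> is_mollifier m \<and>
       (\<integral>\<^sup>+x. ennreal \<bar>mollify m u x - u x\<bar> \<partial>lborel) \<le> ennreal (1 / real (Suc n)) \<and>
       (\<integral>\<^sup>+x. ennreal (\<bar>mollify m u x - (a + b \<bullet> x)\<bar> powr p) * indicator G x \<partial>lborel) \<le> ennreal C" for n m a b
    have "\<exists>m a b. P n m a b" for n
    proof -
      obtain d where d: "d > 0" "\<And>z. norm z < d \<Longrightarrow> (LINT x|lborel. \<bar>u (x + z) - u x\<bar>) < 1 / real (Suc n)"
        using translation_L1_continuous[OF u] by (metis divide_pos_pos of_nat_0_less_iff zero_less_Suc zero_less_one)
      \<comment> \<open>A vector in the mollifier's support is shorter than \<epsilon>, so
        \<epsilon> below d makes all its translation errors small.\<close>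
      define \<epsilon> where "\<epsilon> = min \<epsilon>0 d"
      have \<epsilon>: "0 < \<epsilon>" "\<epsilon> \<le> \<epsilon>0" "\<epsilon> \<le> d" using C d by (auto simp: \<epsilon>_def)
      have "0 < \<epsilon> * \<delta> / 2" using \<epsilon> \<delta> by simp
      from mollifier_exists[OF this, of "\<epsilon> *\<^sub>R c"] obtain m where m: "is_mollifier m" "\<forall>z. m z \<noteq> 0 \<longrightarrow> z \<in> ball (\<epsilon> *\<^sub>R c) (\<epsilon> * \<delta> / 2)"
        by blast
      have "(LINT x|lborel. \<bar>u (x + z) - u x\<bar>) \<le> 1 / real (Suc n)" if "m z \<noteq> 0" for z
      proof -
        have "norm (z - \<epsilon> *\<^sub>R c) < \<epsilon> * \<delta> / 2" using m(2) that by (simp add: dist_norm norm_minus_commute)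
        also have "\<dots> \<le> \<epsilon> * (1/2)" using \<epsilon> \<delta> by simp
        finally have "norm (z - \<epsilon> *\<^sub>R c) < \<epsilon> * (1/2)" .
        moreover have "norm (\<epsilon> *\<^sub>R c) = \<epsilon> * (1/2)" using c \<epsilon> by simp
        moreover have "norm z \<le> norm (z - \<epsilon> *\<^sub>R c) + norm (\<epsilon> *\<^sub>R c)" by (metis diff_add_cancel norm_triangle_ineq)
        ultimately have "norm z < d" using \<epsilon> by linarith
        from d(2)[OF this] show ?thesis by simp
      qed
      then have "(\<integral>\<^sup>+x. ennreal \<bar>mollify m u x - u x\<bar> \<partial>lborel) \<le> ennreal (1 / real (Suc n))"
        by (rule mollify_L1_close[OF u m(1)]) simp_all
      moreover obtain a b where "(\<integral>\<^sup>+x. ennreal (\<bar>mollify m u x - (a + b \<bullet> x)\<bar> powr p) * indicator G x \<partial>lborel) \<le> ennreal C"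
        using pm[OF u H m(1) \<epsilon>(1,2) m(2)] unfolding G_def by blast
      ultimately show ?thesis unfolding P_def using m(1) by (intro exI conjI)
    qed
    then obtain m a b where "\<And>n. P n (m n) (a n) (b n)" by metis
    then have m: "\<And>n. is_mollifier (m n)"
      and L1: "\<And>n. (\<integral>\<^sup>+x. ennreal \<bar>mollify (m n) u x - u x\<bar> \<partial>lborel) \<le> ennreal (1 / real (Suc n))"
      and ab: "\<And>n. (\<integral>\<^sup>+x. ennreal (\<bar>mollify (m n) u x - (a n + b n \<bullet> x)\<bar> powr p) * indicator G x \<partial>lborel) \<le> ennreal C"
      unfolding P_def by blast+
    define W where "W n = mollify (m n) u" for n
    have Wm[measurable]: "W n \<in> borel_measurable borel" for n
      unfolding W_def using m[of n] by (intro borel_measurable_continuous_onI C1_fun_continuous mollify_C1(1)[OF u])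
        (auto simp: is_mollifier_def C2c_C1c)
    have Wint: "integrable lborel (\<lambda>x. W n x - u x)" for n
    proof (rule integrableI_bounded)
      have "(\<integral>\<^sup>+x. ennreal (norm (W n x - u x)) \<partial>lborel) \<le> ennreal (1 / real (Suc n))" using L1[of n] by (simp add: W_def)
      then show "(\<integral>\<^sup>+x. ennreal (norm (W n x - u x)) \<partial>lborel) < \<infinity>"
        by (metis ennreal_less_top infinity_ennreal_def order_le_less_trans)
    qed measurable
    have WL1: "(LINT x|lborel. norm (W n x - u x)) \<le> 1 / real (Suc n)" for n
    proof -
      have "ennreal (LINT x|lborel. norm (W n x - u x)) = (\<integral>\<^sup>+x. ennreal (norm (W n x - u x)) \<partial>lborel)"
        using Wint[of n] by (intro nn_integral_eq_integral[symmetric]) auto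
      also have "\<dots> \<le> ennreal (1 / real (Suc n))" using L1[of n] by (simp add: W_def)
      finally show ?thesis by (subst (asm) ennreal_le_iff) auto
    qed
    \<comment> \<open>The triangle inequality through W and u, with \<open>t \<le> 1 + t^p\<close>
      trading the Lp bound for an L1 bound on the finite measure set G.\<close>
    define M where "M = measure lborel G + C + 1 + (LINT x|lborel. \<bar>u x\<bar>)"
    have M0: "0 \<le> M" using C by (auto simp: M_def intro!: add_nonneg_nonneg)
    have affM: "(\<integral>\<^sup>+x. ennreal \<bar>a n + b n \<bullet> x\<bar> * indicator G x \<partial>lborel) \<le> ennreal M" for n
    proof -
      have "(\<integral>\<^sup>+x. ennreal \<bar>a n + b n \<bullet> x\<bar> * indicator G x \<partial>lborel)
        \<le> (\<integral>\<^sup>+x. indicator G x + ennreal (\<bar>W n x - (a n + b n \<bullet> x)\<bar> powr p) * indicator G x + ennreal \<bar>W n x - u x\<bar> + ennreal \<bar>u x\<bar> \<partial>lborel)"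
      proof (rule nn_integral_mono)
        fix x
        have "ennreal \<bar>a n + b n \<bullet> x\<bar> \<le> ennreal (\<bar>W n x - (a n + b n \<bullet> x)\<bar> + \<bar>W n x - u x\<bar> + \<bar>u x\<bar>)"
          by (rule ennreal_leI) linarith
        also have "\<dots> = ennreal \<bar>W n x - (a n + b n \<bullet> x)\<bar> + ennreal \<bar>W n x - u x\<bar> + ennreal \<bar>u x\<bar>" by simp
        also have "\<dots> \<le> (1 + ennreal (\<bar>W n x - (a n + b n \<bullet> x)\<bar> powr p)) + ennreal \<bar>W n x - u x\<bar> + ennreal \<bar>u x\<bar>"
          using p by (intro add_mono ennreal_abs_le_powr) auto
        finally show "ennreal \<bar>a n + b n \<bullet> x\<bar> * indicator G x
          \<le> indicator G x + ennreal (\<bar>W n x - (a n + b n \<bullet> x)\<bar> powr p) * indicator G x + ennreal \<bar>W n x - u x\<bar> + ennreal \<bar>u x\<bar>"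
          by (auto simp: indicator_def)
      qed
      also have "\<dots> = emeasure lborel G + (\<integral>\<^sup>+x. ennreal (\<bar>W n x - (a n + b n \<bullet> x)\<bar> powr p) * indicator G x \<partial>lborel)
         + (\<integral>\<^sup>+x. ennreal \<bar>W n x - u x\<bar> \<partial>lborel) + (\<integral>\<^sup>+x. ennreal \<bar>u x\<bar> \<partial>lborel)"
        by (simp add: nn_integral_add)
      also have "\<dots> \<le> ennreal (measure lborel G) + ennreal C + ennreal 1 + ennreal (LINT x|lborel. \<bar>u x\<bar>)"
      proof (intro add_mono)
        show "emeasure lborel G \<le> ennreal (measure lborel G)" using Gfin by (simp add: emeasure_eq_ennreal_measure)
        show "(\<integral>\<^sup>+x. ennreal (\<bar>W n x - (a n + b n \<bullet> x)\<bar> powr p) * indicator G x \<partial>lborel) \<le> ennreal C" using ab[of n] by (simp add: W_def)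
        show "(\<integral>\<^sup>+x. ennreal \<bar>W n x - u x\<bar> \<partial>lborel) \<le> ennreal 1"
          by (rule order_trans[OF L1[of n, folded W_def]]) (auto intro!: ennreal_leI simp: field_simps)
        show "(\<integral>\<^sup>+x. ennreal \<bar>u x\<bar> \<partial>lborel) \<le> ennreal (LINT x|lborel. \<bar>u x\<bar>)"
          using u by (subst nn_integral_eq_integral) auto
      qed
      also have "\<dots> = ennreal M" using C by (simp add: M_def del: ennreal_1 add: ennreal_plus[symmetric] del: ennreal_plus)
      finally show ?thesis .
    qed
    obtain C' where C': "C' > 0" "\<And>c b m. 0 \<le> m \<Longrightarrow> (\<integral>\<^sup>+x. ennreal \<bar>c + b \<bullet> x\<bar> * indicator G x \<partial>lborel) \<le> ennreal m \<Longrightarrow> \<bar>c\<bar> + norm b \<le> C' * m"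
      using affine_coeff_bound[OF Go Gne] by metis
    have bnd: "\<bar>a n\<bar> + norm (b n) \<le> C' * M" for n by (rule C'(2)[OF M0 affM])
    have "bounded (range (\<lambda>n. (a n, b n)))"
    proof (rule boundedI)
      fix y assume "y \<in> range (\<lambda>n. (a n, b n))"
      then obtain n where "y = (a n, b n)" by auto
      then show "norm y \<le> C' * M" using norm_Pair_le[of "a n" "b n"] bnd[of n] by simp
    qed
    then obtain l r1 where r1: "strict_mono r1" "((\<lambda>n. (a n, b n)) \<circ> r1) \<longlonglongrightarrow> l"
      using bounded_imp_convergent_subsequence by blast
    have "(\<lambda>n. LINT x|lborel. norm (W (r1 n) x - u x)) \<longlonglongrightarrow> 0"
    proof (rule tendsto_sandwich[OF _ _ tendsto_const])
      have "(\<lambda>n. 1 / real (Suc n)) \<longlonglongrightarrow> 0" by (rule LIMSEQ_Suc[OF lim_1_over_n])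
      then show "(\<lambda>n. 1 / real (Suc (r1 n))) \<longlonglongrightarrow> 0" using LIMSEQ_subseq_LIMSEQ[OF _ r1(1)] by (auto simp: o_def)
    qed (use WL1 in auto)
    from tendsto_L1_AE_subseq[OF Wint this] obtain r2 where r2: "strict_mono r2" "AE x in lborel. (\<lambda>n. W (r1 (r2 n)) x - u x) \<longlonglongrightarrow> 0"
      by blast
    \<comment> \<open>\<open>r1\<close> makes the coefficients converge, the further subsequence
      \<open>r2\<close> makes W converge almost everywhere.\<close>
    define k where "k n = r1 (r2 n)" for n
    have lk: "(\<lambda>n. (a (k n), b (k n))) \<longlonglongrightarrow> l"
      using LIMSEQ_subseq_LIMSEQ[OF r1(2) r2(1)] by (simp add: o_def k_def)
    have al: "(\<lambda>n. a (k n)) \<longlonglongrightarrow> fst l" and bl: "(\<lambda>n. b (k n)) \<longlonglongrightarrow> snd l"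
      using tendsto_fst[OF lk] tendsto_snd[OF lk] by simp_all
    have "AE x in lborel. ennreal (\<bar>u x - (fst l + snd l \<bullet> x)\<bar> powr p) * indicator G x
       = liminf (\<lambda>n. ennreal (\<bar>W (k n) x - (a (k n) + b (k n) \<bullet> x)\<bar> powr p) * indicator G x)"
      using r2(2)
    proof eventually_elim
      fix x assume "(\<lambda>n. W (r1 (r2 n)) x - u x) \<longlonglongrightarrow> 0"
      then have "(\<lambda>n. W (k n) x) \<longlonglongrightarrow> u x" unfolding k_def by (simp add: LIM_zero_iff)
      then have "(\<lambda>n. \<bar>W (k n) x - (a (k n) + b (k n) \<bullet> x)\<bar>) \<longlonglongrightarrow> \<bar>u x - (fst l + snd l \<bullet> x)\<bar>"
        by (intro tendsto_intros al bl)
      then have "(\<lambda>n. \<bar>W (k n) x - (a (k n) + b (k n) \<bullet> x)\<bar> powr p) \<longlonglongrightarrow> \<bar>u x - (fst l + snd l \<bullet> x)\<bar> powr p"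
        using p by (intro tendsto_powr') auto
      then have "(\<lambda>n. ennreal (\<bar>W (k n) x - (a (k n) + b (k n) \<bullet> x)\<bar> powr p)) \<longlonglongrightarrow> ennreal (\<bar>u x - (fst l + snd l \<bullet> x)\<bar> powr p)"
        by (rule tendsto_ennrealI)
      then have "(\<lambda>n. ennreal (\<bar>W (k n) x - (a (k n) + b (k n) \<bullet> x)\<bar> powr p) * indicator G x) \<longlonglongrightarrow> ennreal (\<bar>u x - (fst l + snd l \<bullet> x)\<bar> powr p) * indicator G x"
        by (cases "x \<in> G") auto
      then show "ennreal (\<bar>u x - (fst l + snd l \<bullet> x)\<bar> powr p) * indicator G x
       = liminf (\<lambda>n. ennreal (\<bar>W (k n) x - (a (k n) + b (k n) \<bullet> x)\<bar> powr p) * indicator G x)"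
        by (intro lim_imp_Liminf[symmetric]) auto
    qed
    then have "(\<integral>\<^sup>+x. ennreal (\<bar>u x - (fst l + snd l \<bullet> x)\<bar> powr p) * indicator G x \<partial>lborel)
      = (\<integral>\<^sup>+x. liminf (\<lambda>n. ennreal (\<bar>W (k n) x - (a (k n) + b (k n) \<bullet> x)\<bar> powr p) * indicator G x) \<partial>lborel)"
      by (rule nn_integral_cong_AE)
    also have "\<dots> \<le> liminf (\<lambda>n. \<integral>\<^sup>+x. ennreal (\<bar>W (k n) x - (a (k n) + b (k n) \<bullet> x)\<bar> powr p) * indicator G x \<partial>lborel)"
      by (rule nn_integral_liminf) measurable
    also have "\<dots> \<le> liminf (\<lambda>n::nat. ennreal C)"
      using ab by (intro Liminf_mono) (auto simp: W_def)
    also have "\<dots> = ennreal C" by (simp add: Liminf_const)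
    finally show "\<exists>a b. (\<integral>\<^sup>+x. ennreal (\<bar>u x - (a + b \<bullet> x)\<bar> powr p) * indicator G x \<partial>lborel) \<le> ennreal C"
      by (intro exI)
  qed
  then show ?thesis using C(2) unfolding G_def by (intro exI conjI)
qed

section \<open>Gluing local estimates along overlaps\<close>

lemma add_powr_le:
  fixes s t :: real
  assumes "0 \<le> s" "0 \<le> t" "0 \<le> p"
  shows "(s + t) powr p \<le> 2 powr p * (s powr p + t powr p)"
proof -
  have "(s + t) powr p \<le> (2 * max s t) powr p" using assms by (intro powr_mono2) auto
  also have "\<dots> = 2 powr p * max s t powr p" using assms by (simp add: powr_mult)
  also have "\<dots> \<le> 2 powr p * (s powr p + t powr p)" by (intro mult_left_mono) (auto simp: max_def)
  finally show ?thesis .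
qed

text \<open>On the open overlap both affine functions are close to u, hence to each other, and
  \<open>affine_coeff_bound\<close> makes their coefficients close. They are then close on all of
  the bounded set V, so the affine function of U serves the union.\<close>

lemma tgv_poincare_Un:
  fixes U V :: "(real^'n::finite) set"
  assumes U: "open U" "bounded U" "tgv_poincare \<Omega> p U" and V: "open V" "bounded V" "tgv_poincare \<Omega> p V"
    and ne: "U \<inter> V \<noteq> {}" and p: "1 < p"
  shows "tgv_poincare \<Omega> p (U \<union> V)"
proof -
  obtain C1 where C1: "C1 \<ge> 0" "\<And>u. integrable lborel u \<Longrightarrow> tgv_dual_bound \<Omega> u \<Longrightarrow>
     \<exists>a b. (\<integral>\<^sup>+x. ennreal (\<bar>u x - (a + b \<bullet> x)\<bar> powr p) * indicator U x \<partial>lborel) \<le> ennreal C1"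
    using U(3) by (auto simp: tgv_poincare_def)
  obtain C2 where C2: "C2 \<ge> 0" "\<And>u. integrable lborel u \<Longrightarrow> tgv_dual_bound \<Omega> u \<Longrightarrow>
     \<exists>a b. (\<integral>\<^sup>+x. ennreal (\<bar>u x - (a + b \<bullet> x)\<bar> powr p) * indicator V x \<partial>lborel) \<le> ennreal C2"
    using V(3) by (auto simp: tgv_poincare_def)
  have [measurable]: "U \<in> sets borel" "V \<in> sets borel" using U V by auto
  define D where "D = U \<inter> V"
  have D: "open D" "D \<noteq> {}" "bounded D" using U V ne by (auto simp: D_def)
  have [measurable]: "D \<in> sets borel" using D by simp
  have fin: "emeasure lborel B = ennreal (measure lborel B)" if "bounded B" for B :: "(real^'n) set"
    using emeasure_bounded_finite[OF that] by (simp add: emeasure_eq_ennreal_measure)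
  obtain C' where C': "C' > 0" "\<And>c b m. 0 \<le> m \<Longrightarrow> (\<integral>\<^sup>+x. ennreal \<bar>c + b \<bullet> x\<bar> * indicator D x \<partial>lborel) \<le> ennreal m \<Longrightarrow> \<bar>c\<bar> + norm b \<le> C' * m"
    using affine_coeff_bound[OF D(1,2)] by metis
  obtain R where R: "R > 0" "\<And>x. x \<in> V \<Longrightarrow> norm x \<le> R" using V(2) by (auto simp: bounded_pos)
  define m where "m = 2 * measure lborel D + C1 + C2"
  have m: "0 \<le> m" using C1 C2 by (simp add: m_def)
  \<comment> \<open>Supremum bound on V for the difference of the two affine functions, from the
    coefficient bound \<open>C' * m\<close>.\<close>
  define B where "B = C' * m * (1 + R)"
  have B: "0 \<le> B" using C' m R by (simp add: B_def)
  define C where "C = C1 + 2 powr p * (C2 + B powr p * measure lborel V)"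
  have "\<exists>a b. (\<integral>\<^sup>+x. ennreal (\<bar>u x - (a + b \<bullet> x)\<bar> powr p) * indicator (U \<union> V) x \<partial>lborel) \<le> ennreal C"
    if u: "integrable lborel u" and H: "tgv_dual_bound \<Omega> u" for u
  proof -
    have [measurable]: "u \<in> borel_measurable borel" using borel_measurable_integrable[OF u] by simp
    obtain a1 b1 where 1: "(\<integral>\<^sup>+x. ennreal (\<bar>u x - (a1 + b1 \<bullet> x)\<bar> powr p) * indicator U x \<partial>lborel) \<le> ennreal C1"
      using C1(2)[OF u H] by blast
    obtain a2 b2 where 2: "(\<integral>\<^sup>+x. ennreal (\<bar>u x - (a2 + b2 \<bullet> x)\<bar> powr p) * indicator V x \<partial>lborel) \<le> ennreal C2"
      using C2(2)[OF u H] by blast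
    define e1 where "e1 x = u x - (a1 + b1 \<bullet> x)" for x
    define e2 where "e2 x = u x - (a2 + b2 \<bullet> x)" for x
    have [measurable]: "e1 \<in> borel_measurable borel" "e2 \<in> borel_measurable borel" unfolding e1_def e2_def by measurable
    have diff: "(a1 - a2) + (b1 - b2) \<bullet> x = e2 x - e1 x" for x by (simp add: e1_def e2_def inner_diff_left)
    have "(\<integral>\<^sup>+x. ennreal \<bar>(a1 - a2) + (b1 - b2) \<bullet> x\<bar> * indicator D x \<partial>lborel)
      \<le> (\<integral>\<^sup>+x. 2 * indicator D x + ennreal (\<bar>e1 x\<bar> powr p) * indicator U x + ennreal (\<bar>e2 x\<bar> powr p) * indicator V x \<partial>lborel)"
    proof (rule nn_integral_mono)
      fix x
      have "ennreal \<bar>(a1 - a2) + (b1 - b2) \<bullet> x\<bar> \<le> ennreal (\<bar>e1 x\<bar> + \<bar>e2 x\<bar>)"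
        unfolding diff by (rule ennreal_leI) linarith
      also have "\<dots> = ennreal \<bar>e1 x\<bar> + ennreal \<bar>e2 x\<bar>" by simp
      also have "\<dots> \<le> (1 + ennreal (\<bar>e1 x\<bar> powr p)) + (1 + ennreal (\<bar>e2 x\<bar> powr p))"
        using p by (intro add_mono ennreal_abs_le_powr) auto
      also have "\<dots> = 2 + ennreal (\<bar>e1 x\<bar> powr p) + ennreal (\<bar>e2 x\<bar> powr p)" by (simp add: ac_simps)
      finally show "ennreal \<bar>(a1 - a2) + (b1 - b2) \<bullet> x\<bar> * indicator D x
        \<le> 2 * indicator D x + ennreal (\<bar>e1 x\<bar> powr p) * indicator U x + ennreal (\<bar>e2 x\<bar> powr p) * indicator V x"
        by (auto simp: indicator_def D_def)
    qed
    also have "\<dots> = 2 * emeasure lborel D + (\<integral>\<^sup>+x. ennreal (\<bar>e1 x\<bar> powr p) * indicator U x \<partial>lborel) + (\<integral>\<^sup>+x. ennreal (\<bar>e2 x\<bar> powr p) * indicator V x \<partial>lborel)"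
      by (simp add: nn_integral_add nn_integral_cmult)
    also have "\<dots> \<le> ennreal (2 * measure lborel D) + ennreal C1 + ennreal C2"
      using 1 2 by (intro add_mono) (auto simp: fin[OF D(3)] e1_def e2_def ennreal_mult)
    also have "\<dots> = ennreal m" using C1 C2 by (simp add: m_def)
    finally have co: "\<bar>a1 - a2\<bar> + norm (b1 - b2) \<le> C' * m" by (rule C'(2)[OF m])
    have dB: "\<bar>e2 x - e1 x\<bar> \<le> B" if "x \<in> V" for x
    proof -
      have "\<bar>e2 x - e1 x\<bar> \<le> \<bar>a1 - a2\<bar> + norm (b1 - b2) * norm x"
        unfolding diff[symmetric] using Cauchy_Schwarz_ineq2[of "b1 - b2" x] by linarith
      also have "\<dots> \<le> C' * m + C' * m * R"
        using co R(2)[OF that] R(1) by (intro add_mono mult_mono) (auto intro: order_trans[OF _ co])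
      finally show ?thesis by (simp add: B_def algebra_simps)
    qed
    have "(\<integral>\<^sup>+x. ennreal (\<bar>e1 x\<bar> powr p) * indicator (U \<union> V) x \<partial>lborel)
      \<le> (\<integral>\<^sup>+x. ennreal (\<bar>e1 x\<bar> powr p) * indicator U x + ennreal (2 powr p) * (ennreal (\<bar>e2 x\<bar> powr p) * indicator V x + ennreal (B powr p) * indicator V x) \<partial>lborel)"
    proof (rule nn_integral_mono)
      fix x
      have "ennreal (\<bar>e1 x\<bar> powr p) \<le> ennreal (2 powr p) * (ennreal (\<bar>e2 x\<bar> powr p) + ennreal (B powr p))" if "x \<in> V"
      proof -
        have "\<bar>e1 x\<bar> powr p \<le> (\<bar>e2 x\<bar> + B) powr p"
          using dB[OF that] p by (intro powr_mono2) auto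
        also have "\<dots> \<le> 2 powr p * (\<bar>e2 x\<bar> powr p + B powr p)" by (rule add_powr_le) (use B p in auto)
        finally have "ennreal (\<bar>e1 x\<bar> powr p) \<le> ennreal (2 powr p * (\<bar>e2 x\<bar> powr p + B powr p))" by (rule ennreal_leI)
        then show ?thesis by (simp add: ennreal_mult)
      qed
      then show "ennreal (\<bar>e1 x\<bar> powr p) * indicator (U \<union> V) x
        \<le> ennreal (\<bar>e1 x\<bar> powr p) * indicator U x + ennreal (2 powr p) * (ennreal (\<bar>e2 x\<bar> powr p) * indicator V x + ennreal (B powr p) * indicator V x)"
        by (auto simp: indicator_def)
    qed
    also have "\<dots> = (\<integral>\<^sup>+x. ennreal (\<bar>e1 x\<bar> powr p) * indicator U x \<partial>lborel)
       + ennreal (2 powr p) * ((\<integral>\<^sup>+x. ennreal (\<bar>e2 x\<bar> powr p) * indicator V x \<partial>lborel) + ennreal (B powr p) * emeasure lborel V)"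
      by (simp add: nn_integral_add nn_integral_cmult)
    also have "\<dots> \<le> ennreal C1 + ennreal (2 powr p) * (ennreal C2 + ennreal (B powr p) * ennreal (measure lborel V))"
      using 1 2 by (intro add_mono mult_left_mono) (auto simp: fin[OF V(2)] e1_def e2_def)
    also have "\<dots> = ennreal C" using C1 C2 by (simp add: C_def ennreal_mult)
    finally show ?thesis unfolding e1_def by blast
  qed
  moreover have "0 \<le> C" using C1 C2 by (simp add: C_def)
  ultimately show ?thesis unfolding tgv_poincare_def by blast
qed

text \<open>Take a subfamily of maximal size that satisfies the estimate. If members were left over,
  the two unions would be an open cover of the connected set, so they would meet and one more member
  could be glued on.\<close>

lemma tgv_poincare_connected_Union:
  fixes F :: "(real^'n::finite) set set"
  assumes fin: "finite F" and ne: "F \<noteq> {}" and conn: "connected (\<Union>F)" and p: "1 < p"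
    and F: "\<And>V. V \<in> F \<Longrightarrow> open V \<and> bounded V \<and> V \<noteq> {} \<and> tgv_poincare \<Omega> p V"
  shows "tgv_poincare \<Omega> p (\<Union>F)"
proof -
  define S where "S = {W. W \<subseteq> F \<and> W \<noteq> {} \<and> tgv_poincare \<Omega> p (\<Union>W)}"
  obtain V0 where V0: "V0 \<in> F" using ne by blast
  have "{V0} \<in> S" using V0 F by (simp add: S_def)
  moreover have finS: "finite S" by (rule finite_subset[of _ "Pow F"]) (auto simp: S_def fin)
  moreover have "S \<noteq> {}" using calculation by blast
  ultimately obtain W where W: "W \<in> S" "Max (card ` S) = card W" using obtains_MAX[of S card] by blast
  have max: "card W' \<le> card W" if "W' \<in> S" for W'
    using that finS W(2) by (metis Max_ge finite_imageI image_eqI)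
  have WF: "W \<subseteq> F" "W \<noteq> {}" "tgv_poincare \<Omega> p (\<Union>W)" using W(1) by (auto simp: S_def)
  have "W = F"
  proof (rule ccontr)
    assume "W \<noteq> F"
    then have ne': "F - W \<noteq> {}" using WF by blast
    have o: "open (\<Union>W)" "open (\<Union>(F - W))" using F WF by (auto intro!: open_Union)
    have "\<Union>W \<inter> \<Union>F \<noteq> {}" "\<Union>(F - W) \<inter> \<Union>F \<noteq> {}" using WF ne' F by blast+
    moreover have "\<Union>F \<subseteq> \<Union>W \<union> \<Union>(F - W)" by blast
    ultimately have "\<Union>W \<inter> \<Union>(F - W) \<inter> \<Union>F \<noteq> {}" using conn o unfolding connected_def by blast
    then obtain V where V: "V \<in> F - W" "\<Union>W \<inter> V \<noteq> {}" by blast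
    have "bounded (\<Union>W)" using F WF finite_subset[OF WF(1) fin] by (intro bounded_Union) auto
    then have "tgv_poincare \<Omega> p (\<Union>W \<union> V)"
      using V F[of V] WF o p by (intro tgv_poincare_Un) auto
    moreover have "\<Union>(insert V W) = \<Union>W \<union> V" by auto
    ultimately have "insert V W \<in> S" using V WF by (auto simp: S_def)
    from max[OF this] show False using V finite_subset[OF WF(1) fin] by auto
  qed
  then show ?thesis using WF by simp
qed


section \<open>Cones at boundary and interior points\<close>

lemma C1_fun_Lipschitz_cball:
  fixes f :: "real^'n::finite \<Rightarrow> real"
  assumes f: "C1_fun f"
  obtains L where "0 \<le> L" "\<And>x y. x \<in> cball 0 R \<Longrightarrow> y \<in> cball 0 R \<Longrightarrow> \<bar>f x - f y\<bar> \<le> L * norm (x - y)"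
proof -
  have "\<exists>B>0. \<forall>x\<in>cball 0 R. \<bar>partial_deriv i f x\<bar> \<le> B" for i
  proof -
    have "continuous_on (cball 0 R) (partial_deriv i f)"
      using f unfolding C1_fun_def by (meson continuous_on_subset subset_UNIV)
    then have "bounded (partial_deriv i f ` cball 0 R)"
      by (intro compact_imp_bounded compact_continuous_image) auto
    then show ?thesis by (auto simp: bounded_pos)
  qed
  then obtain B where B: "\<And>i. B i > 0" "\<And>i x. x \<in> cball 0 R \<Longrightarrow> \<bar>partial_deriv i f x\<bar> \<le> B i" by metis
  define L where "L = (\<Sum>i\<in>UNIV. B i)"
  have L: "0 \<le> L" unfolding L_def using B by (intro sum_nonneg) (simp add: less_imp_le)
  show thesis
  proof (rule that[OF L])
    fix x y :: "real^'n" assume xy: "x \<in> cball 0 R" "y \<in> cball 0 R"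
    have "norm (f x - f y) \<le> L * norm (x - y)"
    proof (rule differentiable_bound[of "cball 0 R" f "\<lambda>x h. dird h f x"])
      show "(f has_derivative (\<lambda>h. dird h f z)) (at z within cball 0 R)" for z
        using C1_fun_has_derivative[OF f] by (rule has_derivative_at_withinI)
      show "onorm (\<lambda>h. dird h f z) \<le> L" if "z \<in> cball 0 R" for z
      proof (rule onorm_bound[OF L])
        fix h
        have "\<bar>dird h f z\<bar> \<le> norm h * (\<Sum>i\<in>UNIV. \<bar>partial_deriv i f z\<bar>)" by (rule dird_bound)
        also have "\<dots> \<le> norm h * L" unfolding L_def using B(2)[OF that] by (intro mult_left_mono sum_mono) auto
        finally show "norm (dird h f z) \<le> L * norm h" by (simp add: mult.commute)
      qed
    qed (use xy in simp_all)
    then show "\<bar>f x - f y\<bar> \<le> L * norm (x - y)" by simp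
  qed
qed

text \<open>The axis c points upwards in the graph coordinates. A step t (c + z) gains height at
  least t/2 - t \<delta>, while \<gamma> grows by at most L t \<delta>, since it ignores the k-th
  coordinate; a small \<delta> keeps the point above the graph.\<close>

lemma C1_boundary_cone_at:
  fixes \<Omega> :: "(real^'n::finite) set"
  assumes bd: "C1_boundary \<Omega>" and x0: "x0 \<in> frontier \<Omega>"
  obtains c \<delta> r where "norm c = 1/2" "0 < \<delta>" "\<delta> \<le> 1/2" "0 < r" "r \<le> 1" "cone_at \<Omega> x0 c \<delta> r"
proof -
  define Q where "Q r T k \<gamma> \<longleftrightarrow> orthogonal_transformation T \<and> C1_fun \<gamma> \<and>
        (\<forall>x y. (\<forall>i. i \<noteq> k \<longrightarrow> x $ i = y $ i) \<longrightarrow> \<gamma> x = \<gamma> y) \<and>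
        \<Omega> \<inter> ball x0 r = {x \<in> ball x0 r. T (x - x0) $ k > \<gamma> (T (x - x0))}" for r T k and \<gamma> :: "real^'n \<Rightarrow> real"
  have "\<exists>r>0. \<exists>T k \<gamma>. Q r T k \<gamma>"
    using bd[unfolded C1_boundary_def, rule_format, OF x0] unfolding Q_def .
  then obtain r0 T k \<gamma> where r0: "r0 > 0" and Q: "Q r0 T k \<gamma>" by blast
  have T: "orthogonal_transformation T" and \<gamma>: "C1_fun \<gamma>"
    and ind0: "\<forall>x y. (\<forall>i. i \<noteq> k \<longrightarrow> x $ i = y $ i) \<longrightarrow> \<gamma> x = \<gamma> y"
    and \<Omega>eq: "\<Omega> \<inter> ball x0 r0 = {x \<in> ball x0 r0. T (x - x0) $ k > \<gamma> (T (x - x0))}"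
    using Q unfolding Q_def by simp_all
  have ind: "\<And>x y. (\<forall>i. i \<noteq> k \<longrightarrow> x $ i = y $ i) \<Longrightarrow> \<gamma> x = \<gamma> y" using ind0 by blast
  have lin: "linear T" and nT: "\<And>x. norm (T x) = norm x"
    using T by (auto simp: orthogonal_transformation)
  obtain e where e: "T e = axis k 1" using orthogonal_transformation_surj[OF T] by (metis surjD)
  have ne: "norm e = 1" using nT[of e] e by simp
  define c where "c = (1/2) *\<^sub>R e"
  define r where "r = min r0 1"
  \<comment> \<open>Radius 5 covers all arguments: X has norm below 1, and two points of a ball of
    radius at most 1 force \<open>t \<le> 8\<close>, so \<open>t *\<^sub>R Z\<close> has norm at
    most 2.\<close>
  obtain L where L: "0 \<le> L" "\<And>x y. x \<in> cball 0 5 \<Longrightarrow> y \<in> cball 0 5 \<Longrightarrow> \<bar>\<gamma> x - \<gamma> y\<bar> \<le> L * norm (x - y)"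
    using C1_fun_Lipschitz_cball[OF \<gamma>, of 5] by blast
  \<comment> \<open>Ensures \<open>\<delta> * (1 + L) \<le> 1/2\<close>, the balance of gained
    height against slope, and \<open>\<delta> \<le> 1/4\<close>, which bounds
    \<open>norm (c + z)\<close> from below.\<close>
  define \<delta> where "\<delta> = 1 / (2 * (2 + L))"
  have \<delta>: "0 < \<delta>" "\<delta> \<le> 1/4" "\<delta> * (1 + L) \<le> 1/2" using L by (auto simp: \<delta>_def field_simps)
  have c: "norm c = 1/2" using ne by (simp add: c_def)
  have mem: "x \<in> \<Omega> \<longleftrightarrow> T (x - x0) $ k > \<gamma> (T (x - x0))" if "x \<in> ball x0 r" for x
    using \<Omega>eq that by (auto simp: r_def set_eq_iff)
  have "cone_at \<Omega> x0 c \<delta> r"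
    unfolding cone_at_def
  proof (intro allI impI)
    fix x z t assume x: "x \<in> \<Omega> \<inter> ball x0 r" and z: "norm z < \<delta>" and t: "0 \<le> t" and y: "x + t *\<^sub>R (c + z) \<in> ball x0 r"
    define X where "X = T (x - x0)"
    define Z where "Z = T z"
    have nZ: "norm Z < \<delta>" using z nT by (simp add: Z_def)
    have Ty: "T (x + t *\<^sub>R (c + z) - x0) = X + (t / 2) *\<^sub>R axis k 1 + t *\<^sub>R Z"
    proof -
      have "x + t *\<^sub>R (c + z) - x0 = (x - x0) + (t/2) *\<^sub>R e + t *\<^sub>R z" by (simp add: c_def algebra_simps)
      then show ?thesis unfolding X_def Z_def e[symmetric] by (simp only: linear_add[OF lin] linear_cmul[OF lin])
    qed
    have "\<gamma> (X + (t / 2) *\<^sub>R axis k 1 + t *\<^sub>R Z) = \<gamma> (X + t *\<^sub>R Z)"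
      by (rule ind) (auto simp: axis_def)
    moreover have "\<bar>\<gamma> (X + t *\<^sub>R Z) - \<gamma> X\<bar> \<le> L * norm (X + t *\<^sub>R Z - X)"
    proof (rule L(2))
      have nX: "norm X < 1" using x nT by (auto simp: X_def r_def dist_norm norm_minus_commute)
      have "norm (c + z) \<ge> 1/4" using norm_triangle_ineq2[of c "- z"] c z \<delta> by simp
      then have "t * (1/4) \<le> norm (t *\<^sub>R (c + z))" unfolding norm_scaleR abs_of_nonneg[OF t] by (rule mult_left_mono[OF _ t])
      also have "\<dots> \<le> dist x0 (x + t *\<^sub>R (c + z)) + dist x0 x"
        using norm_triangle_ineq4[of "x + t *\<^sub>R (c + z) - x0" "x - x0"] by (simp add: dist_norm norm_minus_commute)
      also have "\<dots> \<le> 2" using x y by (simp add: r_def)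
      finally have t8: "t \<le> 8" by simp
      have "norm (t *\<^sub>R Z) \<le> 8 * (1/4)" unfolding norm_scaleR using t t8 nZ \<delta> by (intro mult_mono) auto
      then have "norm (X + t *\<^sub>R Z) \<le> 5" using norm_triangle_ineq[of X "t *\<^sub>R Z"] nX by linarith
      then show "X + t *\<^sub>R Z \<in> cball 0 5" by simp
      show "X \<in> cball 0 5" using nX by simp
    qed
    moreover have "L * norm (X + t *\<^sub>R Z - X) \<le> L * (t * \<delta>)"
      using nZ t L by (intro mult_left_mono) (auto intro!: mult_left_mono)
    moreover have "(X + (t / 2) *\<^sub>R axis k 1 + t *\<^sub>R Z) $ k \<ge> X $ k + t / 2 - t * \<delta>"
    proof -
      have "\<bar>Z $ k\<bar> \<le> \<delta>" using component_le_norm_cart[of Z k] nZ by linarith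
      then have "t * (- \<delta>) \<le> t * Z $ k" using t by (intro mult_left_mono) auto
      then show ?thesis by simp
    qed
    moreover have "X $ k > \<gamma> X" using mem[of x] x by (auto simp: X_def)
    moreover have "t * (\<delta> * (1 + L)) \<le> t * (1/2)" using \<delta>(3) t by (intro mult_left_mono) auto
    then have "t * \<delta> + L * (t * \<delta>) \<le> t / 2" by (simp add: algebra_simps)
    ultimately have "(X + (t / 2) *\<^sub>R axis k 1 + t *\<^sub>R Z) $ k > \<gamma> (X + (t / 2) *\<^sub>R axis k 1 + t *\<^sub>R Z)"
      by linarith
    then show "x + t *\<^sub>R (c + z) \<in> \<Omega>" using mem[OF y] Ty by simp
  qed
  moreover have "\<delta> \<le> 1/2" "0 < r" "r \<le> 1" using \<delta> r0 by (auto simp: r_def)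
  ultimately show thesis using that[OF c \<delta>(1)] by blast
qed

lemma interior_cone_at:
  fixes \<Omega> :: "(real^'n::finite) set"
  assumes "open \<Omega>" and x0: "x0 \<in> \<Omega>"
  obtains c \<delta> r where "norm c = 1/2" "0 < \<delta>" "\<delta> \<le> 1/2" "0 < r" "r \<le> 1" "cone_at \<Omega> x0 c \<delta> r"
proof -
  obtain r0 where r0: "r0 > 0" "ball x0 r0 \<subseteq> \<Omega>" using assms openE by blast
  obtain k :: 'n where True by simp
  have "cone_at \<Omega> x0 ((1/2) *\<^sub>R axis k 1) (1/2) (min r0 1)"
    unfolding cone_at_def using r0(2) by (auto simp: subset_iff)
  then show thesis using that[of "(1/2) *\<^sub>R axis k 1" "1/2" "min r0 1"] r0 by auto
qed

text \<open>Compactness is used on the closure, so that boundary patches belong to the cover and the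
  estimate reaches up to the boundary.\<close>

proposition tgv_poincare_domain:
  fixes \<Omega> :: "(real^'n::finite) set"
  assumes \<Omega>: "open \<Omega>" "bounded \<Omega>" "connected \<Omega>" "C1_boundary \<Omega>"
    and p: "1 < p" "CARD('n) \<ge> 2 \<longrightarrow> p \<le> real CARD('n) / (real CARD('n) - 1)"
  shows "tgv_poincare \<Omega> p \<Omega>"
proof (cases "\<Omega> = {}")
  case True
  then show ?thesis unfolding tgv_poincare_def by (auto intro!: exI[of _ 0])
next
  case False
  have "\<exists>\<rho>>0. tgv_poincare \<Omega> p (\<Omega> \<inter> ball x \<rho>)" if x: "x \<in> closure \<Omega>" for x
  proof -
    obtain c \<delta> r where "norm c = 1/2" "0 < \<delta>" "\<delta> \<le> 1/2" "0 < r" "r \<le> 1" "cone_at \<Omega> x c \<delta> r"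
    proof (cases "x \<in> \<Omega>")
      case True
      then show thesis using interior_cone_at[OF \<Omega>(1)] that by metis
    next
      case False
      then have "x \<in> frontier \<Omega>" using x \<Omega>(1) by (simp add: frontier_def interior_open)
      then show thesis using C1_boundary_cone_at[OF \<Omega>(4)] that by metis
    qed
    then show ?thesis using patch_estimate[OF \<Omega>(1) x _ _ _ _ _ _ p] by blast
  qed
  then obtain \<rho> where \<rho>: "\<And>x. x \<in> closure \<Omega> \<Longrightarrow> \<rho> x > 0 \<and> tgv_poincare \<Omega> p (\<Omega> \<inter> ball x (\<rho> x))" by metis
  have cpt: "compact (closure \<Omega>)" using \<Omega>(2) by (simp add: compact_closure)
  have cov: "closure \<Omega> \<subseteq> (\<Union>x\<in>closure \<Omega>. ball x (\<rho> x))"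
  proof
    fix x assume x: "x \<in> closure \<Omega>"
    then have "x \<in> ball x (\<rho> x)" using \<rho>[OF x] by simp
    then show "x \<in> (\<Union>x\<in>closure \<Omega>. ball x (\<rho> x))" using x by (rule UN_I[rotated])
  qed
  obtain D where D: "D \<subseteq> closure \<Omega>" "finite D" "closure \<Omega> \<subseteq> (\<Union>x\<in>D. ball x (\<rho> x))"
    by (rule compactE_image[OF cpt _ cov]) auto
  \<comment> \<open>Empty patches are removed: in the gluing lemma every member must be able to meet
    the rest.\<close>
  define F where "F = (\<lambda>x. \<Omega> \<inter> ball x (\<rho> x)) ` D - {{}}"
  have UF: "\<Union>F = \<Omega>"
  proof
    show "\<Union>F \<subseteq> \<Omega>" by (auto simp: F_def)
    show "\<Omega> \<subseteq> \<Union>F"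
    proof
      fix x assume x: "x \<in> \<Omega>"
      then obtain y where "y \<in> D" "x \<in> ball y (\<rho> y)" using D(3) closure_subset[of \<Omega>] by blast
      then show "x \<in> \<Union>F" using x unfolding F_def by blast
    qed
  qed
  have "tgv_poincare \<Omega> p (\<Union>F)"
  proof (rule tgv_poincare_connected_Union[OF _ _ _ p(1)])
    show "finite F" using D by (simp add: F_def)
    show "F \<noteq> {}" using UF False by auto
    show "connected (\<Union>F)" using UF \<Omega> by simp
    fix V assume "V \<in> F"
    then obtain x where x: "x \<in> D" "V = \<Omega> \<inter> ball x (\<rho> x)" "V \<noteq> {}" by (auto simp: F_def)
    show "open V \<and> bounded V \<and> V \<noteq> {} \<and> tgv_poincare \<Omega> p V"
      using x D \<rho>[of x] \<Omega> by (auto intro: bounded_subset[OF bounded_ball])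
  qed
  then show ?thesis by (simp add: UF)
qed

section \<open>Test fields of rank one\<close>

text \<open>For s up to 1/\<beta> the product s t is at most t/\<beta>. For larger s, (A0) and the
  almost monotone quotient give \<phi>(x,s) \<ge> s \<beta>/L \<ge> s t. So the conjugate is small
  for small t, uniformly in x.\<close>

lemma phi_conj_small:
  assumes Phi: "Phi_w \<Omega> \<phi>" and A0: "A0 \<Omega> \<phi>"
  obtains L \<beta> where "1 \<le> L" "0 < \<beta>" "\<And>x t. x \<in> \<Omega> \<Longrightarrow> 0 \<le> t \<Longrightarrow> t \<le> \<beta> / L \<Longrightarrow> phi_conj \<phi> x t \<le> ereal (t / \<beta>)"
proof -
  obtain L where L: "L \<ge> 1" "\<And>x s t. x \<in> \<Omega> \<Longrightarrow> 0 < s \<Longrightarrow> s \<le> t \<Longrightarrow> \<phi> x s / ennreal s \<le> ennreal L * \<phi> x t / ennreal t"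
    using Phi unfolding Phi_w_def by metis
  obtain \<beta> where \<beta>: "0 < \<beta>" "\<And>x. x \<in> \<Omega> \<Longrightarrow> 1 \<le> \<phi> x (1/\<beta>)"
    using A0 unfolding A0_def by metis
  have "phi_conj \<phi> x t \<le> ereal (t / \<beta>)" if x: "x \<in> \<Omega>" and t: "0 \<le> t" "t \<le> \<beta> / L" for x t
    unfolding phi_conj_def
  proof (rule SUP_least)
    fix s :: real assume "s \<in> {0..}"
    then have s: "0 \<le> s" by simp
    show "ereal (s * t) - enn2ereal (\<phi> x s) \<le> ereal (t / \<beta>)"
    proof (cases "\<phi> x s")
      case top
      then show ?thesis by simp
    next
      case (real f)
      have "s * t - f \<le> t / \<beta>"
      proof (cases "s \<le> 1 / \<beta>")
        case True
        then have "s * t \<le> 1 / \<beta> * t" using t by (intro mult_right_mono) auto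
        then show ?thesis using real by simp
      next
        case False
        then have s1: "1 / \<beta> \<le> s" "0 < s" using \<beta> by (auto intro: less_trans[of 0 "1/\<beta>"])
        have "ennreal \<beta> = 1 / ennreal (1/\<beta>)" using \<beta> by (simp add: divide_ennreal flip: ennreal_1)
        also have "\<dots> \<le> \<phi> x (1/\<beta>) / ennreal (1/\<beta>)" by (rule divide_right_mono_ennreal[OF \<beta>(2)[OF x]])
        also have "\<dots> \<le> ennreal L * \<phi> x s / ennreal s" by (rule L(2)[OF x _ s1(1)]) (use \<beta> in simp)
        also have "\<dots> = ennreal (L * f / s)"
          unfolding real(2) using L(1) real s1 by (simp add: ennreal_mult[symmetric] divide_ennreal)
        finally have "\<beta> \<le> L * f / s" using L(1) real s1 by (subst (asm) ennreal_le_iff) auto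
        then have "s * \<beta> \<le> L * f" using s1 by (simp add: field_simps)
        then have "s * (\<beta> / L) \<le> f" using L(1) by (simp add: field_simps)
        moreover have "s * t \<le> s * (\<beta> / L)" using t s by (intro mult_left_mono) auto
        moreover have "0 \<le> t / \<beta>" using t \<beta> by simp
        ultimately show ?thesis by linarith
      qed
      then show ?thesis using real by (simp add: enn2ereal_ennreal)
    qed
  qed
  then show thesis using that[OF L(1) \<beta>(1)] by blast
qed

lemma lux_norm_le_of_bounded:
  fixes \<Omega> :: "(real^'n::finite) set"
  assumes Phi: "Phi_w \<Omega> \<phi>" and A0: "A0 \<Omega> \<phi>" and \<Omega>: "open \<Omega>" "bounded \<Omega>" and \<alpha>: "\<alpha> > 0"
  shows "\<exists>\<theta>>0. \<forall>g :: real^'n \<Rightarrow> 'v::real_normed_vector. (\<forall>x. norm (g x) \<le> \<theta>) \<longrightarrow> lux_norm \<phi> \<Omega> g \<le> ereal \<alpha>"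
proof -
  obtain L \<beta> where L: "1 \<le> L" "0 < \<beta>" and pc: "\<And>x t. x \<in> \<Omega> \<Longrightarrow> 0 \<le> t \<Longrightarrow> t \<le> \<beta> / L \<Longrightarrow> phi_conj \<phi> x t \<le> ereal (t / \<beta>)"
    using phi_conj_small[OF Phi A0] by blast
  define V where "V = measure lebesgue \<Omega>"
  have \<Omega>m: "\<Omega> \<in> sets lebesgue" "\<Omega> \<in> lmeasurable" using \<Omega> by (auto simp: lmeasurable_open bounded_set_imp_lmeasurable)
  have eV: "emeasure (lebesgue_on \<Omega>) \<Omega> = ennreal V"
    using \<Omega>m by (simp add: emeasure_restrict_space V_def emeasure_eq_measure2)
  have V: "0 \<le> V" by (simp add: V_def)
  \<comment> \<open>The first bound keeps \<open>norm (g x) / \<alpha>\<close> in the range of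
    \<open>phi_conj_small\<close>; the second makes the modular at most V/(V+1), where the 1 also
    covers V = 0.\<close>
  define \<theta> where "\<theta> = min (\<alpha> * \<beta> / L) (\<alpha> * \<beta> / (V + 1))"
  have \<theta>: "0 < \<theta>" "\<theta> \<le> \<alpha> * \<beta> / L" "\<theta> \<le> \<alpha> * \<beta> / (V + 1)" using \<alpha> L V by (auto simp: \<theta>_def intro!: divide_pos_pos)
  have "lux_norm \<phi> \<Omega> g \<le> ereal \<alpha>" if g: "\<forall>x. norm (g x) \<le> \<theta>" for g :: "real^'n \<Rightarrow> 'v"
  proof -
    have "(\<integral>\<^sup>+x. e2ennreal (phi_conj \<phi> x (norm (g x) / \<alpha>)) \<partial>lebesgue_on \<Omega>) \<le> (\<integral>\<^sup>+x. ennreal (\<theta> / \<alpha> / \<beta>) \<partial>lebesgue_on \<Omega>)"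
    proof (rule nn_integral_mono)
      fix x assume "x \<in> space (lebesgue_on \<Omega>)"
      then have x: "x \<in> \<Omega>" by simp
      have le: "norm (g x) / \<alpha> \<le> \<theta> / \<alpha>" using g \<alpha> by (intro divide_right_mono) auto
      also have "\<dots> \<le> \<beta> / L" using \<theta>(2) \<alpha> L by (simp add: field_simps)
      finally have "phi_conj \<phi> x (norm (g x) / \<alpha>) \<le> ereal (norm (g x) / \<alpha> / \<beta>)"
        using \<alpha> by (intro pc[OF x]) auto
      also have "\<dots> \<le> ereal (\<theta> / \<alpha> / \<beta>)" unfolding ereal_less_eq by (rule divide_right_mono[OF le]) (use L in simp)
      finally have "e2ennreal (phi_conj \<phi> x (norm (g x) / \<alpha>)) \<le> e2ennreal (ereal (\<theta> / \<alpha> / \<beta>))" by (rule e2ennreal_mono)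
      then show "e2ennreal (phi_conj \<phi> x (norm (g x) / \<alpha>)) \<le> ennreal (\<theta> / \<alpha> / \<beta>)" by (simp add: ennreal_def)
    qed
    also have "\<dots> = ennreal (\<theta> / \<alpha> / \<beta> * V)"
      using \<theta> \<alpha> L V by (simp add: eV ennreal_mult[symmetric])
    also have "\<dots> \<le> 1"
    proof -
      have "\<theta> / \<alpha> / \<beta> \<le> 1 / (V + 1)" using \<theta>(3) \<alpha> L V by (simp add: field_simps)
      then have "\<theta> / \<alpha> / \<beta> * V \<le> 1 / (V + 1) * V" using V by (rule mult_right_mono)
      also have "\<dots> \<le> 1" using V by (simp add: field_simps)
      finally show ?thesis by simp
    qed
    finally show ?thesis unfolding lux_norm_def using \<alpha> by (intro Inf_lower) auto
  qed
  then show ?thesis using \<theta>(1) by blast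
qed

lemma partial_deriv_cmult:
  assumes "C1_fun f"
  shows "C1_fun (\<lambda>y. a * f y)" "partial_deriv i (\<lambda>y. a * f y) = (\<lambda>y. a * partial_deriv i f y)"
proof -
  have D: "((\<lambda>y. a * f y) has_derivative (\<lambda>h. \<Sum>i\<in>UNIV. h $ i * (a * partial_deriv i f y))) (at y)" for y
    using has_derivative_mult_right[OF C1_fun_has_derivative[OF assms, of y], of a]
    by (simp add: dird_def sum_distrib_left mult_ac)
  have c: "continuous_on UNIV (\<lambda>y. a * partial_deriv i f y)" for i
    using assms by (intro continuous_intros) (simp add: C1_fun_def)
  show "C1_fun (\<lambda>y. a * f y)" by (rule C1_funI(1)[OF D c])
  show "partial_deriv i (\<lambda>y. a * f y) = (\<lambda>y. a * partial_deriv i f y)" by (rule C1_funI(2)[OF D c])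
qed

lemma C2_fun_cmult:
  assumes "C2_fun f"
  shows "C2_fun (\<lambda>y. a * f y)"
    "partial_deriv i (partial_deriv j (\<lambda>y. a * f y)) = (\<lambda>y. a * partial_deriv i (partial_deriv j f) y)"
  using assms by (auto simp: C2_fun_def partial_deriv_cmult)

text \<open>Matches the full double sum in \<open>dird2\<close> with the diagonal and doubled upper
  triangle in \<open>div2_field\<close>.\<close>

lemma sum_symmetric_split:
  fixes f :: "'n::{finite,linorder} \<Rightarrow> 'n \<Rightarrow> real"
  assumes sym: "\<And>i j. f i j = f j i"
  shows "(\<Sum>i\<in>UNIV. \<Sum>j\<in>UNIV. f i j) = (\<Sum>i\<in>UNIV. f i i) + 2 * (\<Sum>i\<in>UNIV. \<Sum>j\<in>{j. i < j}. f i j)"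
proof -
  have split: "(\<Sum>j\<in>UNIV. f i j) = f i i + (\<Sum>j\<in>{j. i < j}. f i j) + (\<Sum>j\<in>{j. j < i}. f i j)" for i
  proof -
    have "(UNIV :: 'n set) = insert i ({j. i < j} \<union> {j. j < i})" by auto
    then have "(\<Sum>j\<in>UNIV. f i j) = (\<Sum>j\<in>insert i ({j. i < j} \<union> {j. j < i}). f i j)" by simp
    also have "\<dots> = f i i + (\<Sum>j\<in>{j. i < j} \<union> {j. j < i}. f i j)" by (subst sum.insert) auto
    also have "(\<Sum>j\<in>{j. i < j} \<union> {j. j < i}. f i j) = (\<Sum>j\<in>{j. i < j}. f i j) + (\<Sum>j\<in>{j. j < i}. f i j)"
      by (rule sum.union_disjoint) auto
    finally show ?thesis by simp
  qed
  have "(\<Sum>i\<in>UNIV. \<Sum>j\<in>{j. j < i}. f i j) = (\<Sum>i\<in>UNIV. \<Sum>j\<in>{j\<in>UNIV. j < i}. f i j)" by simp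
  also have "\<dots> = (\<Sum>j\<in>UNIV. \<Sum>i\<in>{i\<in>UNIV. j < i}. f i j)"
    by (rule sum.swap_restrict) auto
  also have "\<dots> = (\<Sum>i\<in>UNIV. \<Sum>j\<in>{j. i < j}. f i j)" using sym by simp
  finally show ?thesis by (simp add: split sum.distrib)
qed

lemma norm_outer: "norm ((\<chi> i j. k * (v $ i * v $ j)) :: real^'n^'n::finite) = \<bar>k\<bar> * (norm v)\<^sup>2"
proof -
  have row: "norm ((\<chi> j. k * (v $ i * v $ j)) :: real^'n) = \<bar>k\<bar> * norm v * \<bar>v $ i\<bar>" for i
  proof -
    have "((\<chi> j. k * (v $ i * v $ j)) :: real^'n) = (k * v $ i) *\<^sub>R v" by (simp add: vec_eq_iff)
    then show ?thesis by (simp add: abs_mult mult_ac)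
  qed
  have "norm ((\<chi> i j. k * (v $ i * v $ j)) :: real^'n^'n) = L2_set (\<lambda>i. \<bar>k\<bar> * norm v * \<bar>v $ i\<bar>) UNIV"
    by (simp add: norm_vec_def[of "\<chi> i j. k * (v $ i * v $ j)"] row)
  also have "\<dots> = \<bar>k\<bar> * norm v * L2_set (\<lambda>i. \<bar>v $ i\<bar>) UNIV"
    by (rule L2_set_right_distrib[symmetric]) simp
  also have "L2_set (\<lambda>i. \<bar>v $ i\<bar>) UNIV = norm v" by (simp add: norm_vec_def)
  finally show ?thesis by (simp add: power2_eq_square)
qed

text \<open>TGV is defined with Lebesgue measurable functions on \<Omega>, whereas convolution and
  Fubini are done with Borel functions on the whole space. The representative, extended by zero,
  connects the two.\<close>

lemma lebesgue_on_borel_representative: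
  fixes u :: "real^'n::finite \<Rightarrow> real"
  assumes \<Omega>: "open \<Omega>" and u: "u \<in> borel_measurable (lebesgue_on \<Omega>)"
  obtains w where "w \<in> borel_measurable borel" "\<And>x. x \<notin> \<Omega> \<Longrightarrow> w x = 0" "AE x in lebesgue. x \<in> \<Omega> \<longrightarrow> u x = w x"
proof -
  have \<Omega>m: "\<Omega> \<in> sets lebesgue" using \<Omega> by simp
  have "(\<lambda>x. indicator \<Omega> x *\<^sub>R u x) \<in> borel_measurable lebesgue"
    using u \<Omega>m by (subst (asm) borel_measurable_restrict_space_iff) auto
  then have "(\<lambda>x. indicator \<Omega> x * u x) \<in> borel_measurable (completion lborel)" by simp
  from completion_ex_borel_measurable_real[OF this]
  obtain g where g: "g \<in> borel_measurable lborel" "AE x in lborel. indicator \<Omega> x * u x = g x" by blast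
  show thesis
  proof (rule that[of "\<lambda>x. indicator \<Omega> x * g x"])
    show "(\<lambda>x. indicator \<Omega> x * g x) \<in> borel_measurable borel" using g(1) \<Omega> by simp
    show "\<And>x. x \<notin> \<Omega> \<Longrightarrow> indicator \<Omega> x * g x = 0" by simp
    have "AE x in lebesgue. indicator \<Omega> x * u x = g x" using g(2) by (rule AE_completion)
    then show "AE x in lebesgue. x \<in> \<Omega> \<longrightarrow> u x = indicator \<Omega> x * g x" by eventually_elim auto
  qed
qed

lemma integral_lebesgue_on_representative:
  fixes f g :: "real^'n::finite \<Rightarrow> real"
  assumes \<Omega>: "open \<Omega>" and g: "g \<in> borel_measurable borel" "\<And>x. x \<notin> \<Omega> \<Longrightarrow> g x = 0"
    and eq: "AE x in lebesgue. x \<in> \<Omega> \<longrightarrow> f x = g x"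
    and f: "f \<in> borel_measurable (lebesgue_on \<Omega>)"
  shows "(LINT x|lebesgue_on \<Omega>. f x) = (LINT x|lborel. g x)"
    "integrable (lebesgue_on \<Omega>) f \<longleftrightarrow> integrable lborel g"
proof -
  have \<Omega>m: "\<Omega> \<in> sets lebesgue" using \<Omega> by simp
  have fi: "(\<lambda>x. indicator \<Omega> x *\<^sub>R f x) \<in> borel_measurable lebesgue"
    using f \<Omega>m by (subst (asm) borel_measurable_restrict_space_iff) auto
  have g': "g \<in> borel_measurable lborel" using g by simp
  then have gl: "g \<in> borel_measurable lebesgue" by (rule measurable_completion)
  have ae: "AE x in lebesgue. indicator \<Omega> x *\<^sub>R f x = g x"
    using eq by eventually_elim (auto simp: indicator_def g(2))
  have "(LINT x|lebesgue_on \<Omega>. f x) = (LINT x|lebesgue. indicator \<Omega> x *\<^sub>R f x)"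
    using \<Omega>m by (subst integral_restrict_space) auto
  also have "\<dots> = (LINT x|lebesgue. g x)" by (rule integral_cong_AE[OF fi gl ae])
  also have "\<dots> = (LINT x|lborel. g x)" by (rule integral_completion[OF g'])
  finally show "(LINT x|lebesgue_on \<Omega>. f x) = (LINT x|lborel. g x)" .
  have "integrable (lebesgue_on \<Omega>) f \<longleftrightarrow> integrable lebesgue (\<lambda>x. indicator \<Omega> x *\<^sub>R f x)"
    using \<Omega>m by (subst integrable_restrict_space) auto
  also have "\<dots> \<longleftrightarrow> integrable lebesgue g" by (rule integrable_cong_AE[OF fi gl ae])
  also have "\<dots> \<longleftrightarrow> integrable lborel g" using integrable_completion[OF g'] by simp
  finally show "integrable (lebesgue_on \<Omega>) f \<longleftrightarrow> integrable lborel g" .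
qed

text \<open>The pairing is linear in u, so a level M of TGV becomes the level 1 for
  \<open>\<theta> / M * w\<close>. The factor \<theta> is the size a rank one field may have under
  both Luxemburg constraints, and it is independent of u.\<close>

lemma tgv_dual_bound_of_TGV2:
  fixes \<Omega> :: "((real, 'n::{finite,linorder}) vec) set"
  assumes Phi: "Phi_w \<Omega> \<phi>" and A0: "A0 \<Omega> \<phi>" and \<Omega>: "open \<Omega>" "bounded \<Omega>" and \<alpha>: "\<alpha>1 > 0" "\<alpha>2 > 0"
  shows "\<exists>\<theta>>0. \<forall>u w M. M > 0 \<longrightarrow> u \<in> borel_measurable (lebesgue_on \<Omega>) \<longrightarrow> TGV2 \<phi> \<Omega> \<alpha>1 \<alpha>2 u \<le> ereal M \<longrightarrow>
    w \<in> borel_measurable borel \<longrightarrow> (\<forall>x. x \<notin> \<Omega> \<longrightarrow> w x = 0) \<longrightarrow> (AE x in lebesgue. x \<in> \<Omega> \<longrightarrow> u x = w x) \<longrightarrow>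
    tgv_dual_bound \<Omega> (\<lambda>x. \<theta> / M * w x)"
proof -
  obtain \<theta>1 where \<theta>1: "\<theta>1 > 0" "\<And>g :: (real, 'n) vec \<Rightarrow> ((real, 'n) vec, 'n) vec. (\<forall>x. norm (g x) \<le> \<theta>1) \<Longrightarrow> lux_norm \<phi> \<Omega> g \<le> ereal \<alpha>1"
    using lux_norm_le_of_bounded[OF Phi A0 \<Omega> \<alpha>(1), where 'v="((real, 'n) vec, 'n) vec"] by blast
  obtain \<theta>2 where \<theta>2: "\<theta>2 > 0" "\<And>g :: (real, 'n) vec \<Rightarrow> (real, 'n) vec. (\<forall>x. norm (g x) \<le> \<theta>2) \<Longrightarrow> lux_norm \<phi> \<Omega> g \<le> ereal \<alpha>2"
    using lux_norm_le_of_bounded[OF Phi A0 \<Omega> \<alpha>(2), where 'v="(real, 'n) vec"] by blast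
  \<comment> \<open>Half of \<open>\<theta>2\<close>, because the derivative of \<eta> along v is
    only bounded by 2.\<close>
  define \<theta> where "\<theta> = min \<theta>1 (\<theta>2 / 2)"
  have \<theta>: "0 < \<theta>" "\<theta> \<le> \<theta>1" "2 * \<theta> \<le> \<theta>2" using \<theta>1 \<theta>2 by (auto simp: \<theta>_def)
  have "tgv_dual_bound \<Omega> (\<lambda>x. \<theta> / M * w x)"
    if M: "M > 0" and u: "u \<in> borel_measurable (lebesgue_on \<Omega>)" and TV: "TGV2 \<phi> \<Omega> \<alpha>1 \<alpha>2 u \<le> ereal M"
      and w: "w \<in> borel_measurable borel" "\<forall>x. x \<notin> \<Omega> \<longrightarrow> w x = 0" "AE x in lebesgue. x \<in> \<Omega> \<longrightarrow> u x = w x" for u w M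
    unfolding tgv_dual_bound_def
  proof (intro allI impI)
    fix v :: "(real, 'n) vec" and \<eta> :: "(real, 'n) vec \<Rightarrow> real"
    assume v: "norm v \<le> 1" and \<eta>: "C2c \<eta>" and sym: "\<forall>i j. partial_deriv i (partial_deriv j \<eta>) = partial_deriv j (partial_deriv i \<eta>)"
      and cl: "closure {x. \<eta> x \<noteq> 0} \<subseteq> \<Omega>" and \<eta>1: "\<forall>x. \<bar>\<eta> x\<bar> \<le> 1" and d\<eta>: "\<forall>x. \<bar>dird v \<eta> x\<bar> \<le> 2"
    have \<eta>2: "C2_fun \<eta>" and \<eta>C1: "C1_fun \<eta>" using \<eta> by (auto simp: C2c_def C2_fun_def)
    define \<psi> :: "(real, 'n) vec \<Rightarrow> ((real, 'n) vec, 'n) vec" where "\<psi> y = (\<chi> i j. (\<theta> * \<eta> y) * (v $ i * v $ j))" for y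
    have comp: "(\<lambda>y. \<psi> y $ i $ j) = (\<lambda>y. (\<theta> * (v $ i * v $ j)) * \<eta> y)" for i j
      by (rule ext) (simp add: \<psi>_def mult_ac)
    have supp: "{x. \<psi> x \<noteq> 0} \<subseteq> {x. \<eta> x \<noteq> 0}" by (auto simp: \<psi>_def vec_eq_iff)
    have adm: "admissible_field \<Omega> \<psi>"
      unfolding admissible_field_def
    proof (intro conjI allI)
      show "C2_fun (\<lambda>y. \<psi> y $ i $ j)" for i j unfolding comp by (rule C2_fun_cmult(1)[OF \<eta>2])
      show "\<psi> x $ i $ j = \<psi> x $ j $ i" for x i j by (simp add: \<psi>_def)
      have "bounded {x. \<psi> x \<noteq> 0}" using \<eta> supp by (auto simp: C2c_def intro: bounded_subset)
      then show "compact (closure {x. \<psi> x \<noteq> 0})" by (simp add: compact_closure)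
      show "closure {x. \<psi> x \<noteq> 0} \<subseteq> \<Omega>" using closure_mono[OF supp] cl by blast
    qed
    have l1: "lux_norm \<phi> \<Omega> \<psi> \<le> ereal \<alpha>1"
    proof (rule \<theta>1(2), rule allI)
      fix x
      have "norm (\<psi> x) = \<bar>\<theta> * \<eta> x\<bar> * (norm v)\<^sup>2" unfolding \<psi>_def by (rule norm_outer)
      also have "\<dots> \<le> (\<theta> * 1) * 1\<^sup>2"
        using \<eta>1 v \<theta>(1) by (intro mult_mono power_mono) (auto simp: abs_mult)
      finally show "norm (\<psi> x) \<le> \<theta>1" using \<theta> by simp
    qed
    have div: "div_field \<psi> x = (\<theta> * dird v \<eta> x) *\<^sub>R v" for x
      unfolding div_field_def comp partial_deriv_cmult(2)[OF \<eta>C1]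
      by (simp add: vec_eq_iff dird_def sum_distrib_left sum_distrib_right mult_ac)
    have l2: "lux_norm \<phi> \<Omega> (div_field \<psi>) \<le> ereal \<alpha>2"
    proof (rule \<theta>2(2), rule allI)
      fix x
      have "norm (div_field \<psi> x) = \<bar>\<theta> * dird v \<eta> x\<bar> * norm v" by (simp add: div)
      also have "\<dots> \<le> (\<theta> * 2) * 1"
        using d\<eta> v \<theta>(1) by (intro mult_mono) (auto simp: abs_mult)
      finally show "norm (div_field \<psi> x) \<le> \<theta>2" using \<theta> by simp
    qed
    have div2: "div2_field \<psi> x = \<theta> * dird2 v \<eta> x" for x
    proof -
      have "dird2 v \<eta> x = (\<Sum>i\<in>UNIV. v $ i * v $ i * partial_deriv i (partial_deriv i \<eta>) x)
         + 2 * (\<Sum>i\<in>UNIV. \<Sum>j\<in>{j. i < j}. v $ i * v $ j * partial_deriv i (partial_deriv j \<eta>) x)"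
        unfolding dird2_def by (rule sum_symmetric_split) (use sym in \<open>metis mult.commute\<close>)
      then show ?thesis
        unfolding div2_field_def comp C2_fun_cmult(2)[OF \<eta>2]
        by (simp add: sum_distrib_left distrib_left mult_ac)
    qed
    have "ereal (LINT x|lebesgue_on \<Omega>. u x * div2_field \<psi> x) \<le> TGV2 \<phi> \<Omega> \<alpha>1 \<alpha>2 u"
      unfolding TGV2_def by (rule Sup_upper) (use adm l1 l2 in blast)
    also note TV
    finally have le: "(LINT x|lebesgue_on \<Omega>. u x * div2_field \<psi> x) \<le> M" by simp
    have d2c: "continuous_on UNIV (dird2 v \<eta>)"
      using dird_continuous[OF C1_fun_dird(1)[OF \<eta>]] dird2_eq_dird_dird[OF \<eta>] by (simp cong: continuous_on_cong)
    then have d2m[measurable]: "dird2 v \<eta> \<in> borel_measurable borel" by (rule borel_measurable_continuous_onI)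
    have "(LINT x|lebesgue_on \<Omega>. u x * div2_field \<psi> x) = (LINT x|lborel. w x * (\<theta> * dird2 v \<eta> x))"
    proof (rule integral_lebesgue_on_representative(1)[OF \<Omega>(1)])
      show "(\<lambda>x. w x * (\<theta> * dird2 v \<eta> x)) \<in> borel_measurable borel" using w(1) by measurable
      show "AE x in lebesgue. x \<in> \<Omega> \<longrightarrow> u x * div2_field \<psi> x = w x * (\<theta> * dird2 v \<eta> x)"
        using w(3) by eventually_elim (simp add: div2)
      have "(\<lambda>x. \<theta> * dird2 v \<eta> x) \<in> borel_measurable (lebesgue_on \<Omega>)"
        using d2c \<Omega>(1) by (intro borel_measurable_times borel_measurable_const)
          (auto intro!: continuous_imp_measurable_on_sets_lebesgue intro: continuous_on_subset)
      then show "(\<lambda>x. u x * div2_field \<psi> x) \<in> borel_measurable (lebesgue_on \<Omega>)"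
        unfolding div2 by (rule borel_measurable_times[OF u])
    qed (use w(2) in auto)
    also have "\<dots> = \<theta> * (LINT x|lborel. w x * dird2 v \<eta> x)" by (simp add: mult.left_commute)
    finally have "\<theta> * (LINT x|lborel. w x * dird2 v \<eta> x) \<le> M" using le by simp
    then have "\<theta> / M * (LINT x|lborel. w x * dird2 v \<eta> x) \<le> 1" using M by (simp add: field_simps)
    moreover have "(LINT x|lborel. \<theta> / M * w x * dird2 v \<eta> x) = \<theta> / M * (LINT x|lborel. w x * dird2 v \<eta> x)"
      by (simp add: mult.assoc)
    ultimately show "(LINT y|lborel. \<theta> / M * w y * dird2 v \<eta> y) \<le> 1" by (simp only:)
  qed
  then show ?thesis using \<theta>(1) by (intro exI[of _ \<theta>] conjI allI impI)
qed

section \<open>Uniform convexity and completeness of Lp\<close>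

text \<open>The mean value theorem on the two halves of the interval; they have equal length and the
  derivative of the power is strictly increasing.\<close>

lemma powr_midpoint_strict:
  fixes s t p :: real
  assumes p: "1 < p" and st: "0 \<le> s" "s < t"
  shows "((s + t) / 2) powr p < (s powr p + t powr p) / 2"
proof -
  define m where "m = (s + t) / 2"
  have m: "s < m" "m < t" using st by (auto simp: m_def)
  have cont: "continuous_on {a..b} (\<lambda>x. x powr p)" if "0 \<le> a" for a b :: real
    using p that by (intro continuous_on_powr' continuous_intros) auto
  have der: "((\<lambda>x. x powr p) has_real_derivative p * x powr (p - 1)) (at x)" if "0 < x" for x
    by (rule has_real_derivative_powr[OF that])
  have "\<exists>z. s < z \<and> z < m \<and> m powr p - s powr p = (m - s) * (p * z powr (p - 1))"
  proof -
    obtain l z where "s < z" "z < m" "((\<lambda>x. x powr p) has_real_derivative l) (at z)" "m powr p - s powr p = (m - s) * l"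
      using MVT[OF m(1) cont[OF st(1)]] der st by (meson le_less_trans real_differentiable_def)
    moreover have "l = p * z powr (p - 1)" using DERIV_unique[OF calculation(3) der] st calculation(1) by simp
    ultimately show ?thesis by blast
  qed
  then obtain z where z: "s < z" "z < m" "m powr p - s powr p = (m - s) * (p * z powr (p - 1))" by blast
  have "\<exists>y. m < y \<and> y < t \<and> t powr p - m powr p = (t - m) * (p * y powr (p - 1))"
  proof -
    have m0: "0 \<le> m" using st m by simp
    obtain l y where "m < y" "y < t" "((\<lambda>x. x powr p) has_real_derivative l) (at y)" "t powr p - m powr p = (t - m) * l"
      using MVT[OF m(2) cont[OF m0]] der m0 by (meson le_less_trans real_differentiable_def)
    moreover have "l = p * y powr (p - 1)" using DERIV_unique[OF calculation(3) der] m0 calculation(1) by simp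
    ultimately show ?thesis by blast
  qed
  then obtain y where y: "m < y" "y < t" "t powr p - m powr p = (t - m) * (p * y powr (p - 1))" by blast
  have "z powr (p - 1) < y powr (p - 1)" using z y p st by (intro powr_less_mono2) auto
  then have "(m - s) * (p * z powr (p - 1)) < (m - s) * (p * y powr (p - 1))"
    using m p by (intro mult_strict_left_mono) auto
  moreover have "t - m = m - s" by (simp add: m_def field_simps)
  ultimately have "m powr p - s powr p < t powr p - m powr p" using z(3) y(3) by simp
  then show ?thesis by (simp add: m_def)
qed

lemma powr_abs_midpoint:
  fixes a b p :: real
  assumes p: "1 < p"
  shows "\<bar>(a + b) / 2\<bar> powr p \<le> (\<bar>a\<bar> powr p + \<bar>b\<bar> powr p) / 2"
    and "a \<noteq> b \<Longrightarrow> \<bar>(a + b) / 2\<bar> powr p < (\<bar>a\<bar> powr p + \<bar>b\<bar> powr p) / 2"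
proof -
  have le: "\<bar>(a + b) / 2\<bar> powr p \<le> ((\<bar>a\<bar> + \<bar>b\<bar>) / 2) powr p" using p by (intro powr_mono2) auto
  show lt: "\<bar>(a + b) / 2\<bar> powr p < (\<bar>a\<bar> powr p + \<bar>b\<bar> powr p) / 2" if "a \<noteq> b"
  proof -
    consider "\<bar>a\<bar> < \<bar>b\<bar>" | "\<bar>b\<bar> < \<bar>a\<bar>" | "\<bar>a\<bar> = \<bar>b\<bar>" by linarith
    then show ?thesis
    proof cases
      case 1
      then show ?thesis using powr_midpoint_strict[OF p, of "\<bar>a\<bar>" "\<bar>b\<bar>"] le by simp
    next
      case 2
      then show ?thesis using powr_midpoint_strict[OF p, of "\<bar>b\<bar>" "\<bar>a\<bar>"] le by (simp add: add.commute)
    next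
      case 3
      then have "a + b = 0" "a \<noteq> 0" "b \<noteq> 0" using that by (auto simp: abs_if split: if_splits)
      then show ?thesis by (simp add: add_pos_pos)
    qed
  qed
  show "\<bar>(a + b) / 2\<bar> powr p \<le> (\<bar>a\<bar> powr p + \<bar>b\<bar> powr p) / 2"
    using lt by (cases "a = b") (auto intro: less_imp_le)
qed

text \<open>All terms are homogeneous of degree p, so it suffices to look at the unit sphere of the
  plane. Where the e-term does not already suffice, a and b are distinct, and compactness bounds the
  convexity defect away from zero. This covers all p > 1 at once.\<close>

lemma powr_uniform_convexity:
  fixes p e :: real
  assumes p: "1 < p" and e: "0 < e"
  shows "\<exists>C\<ge>0. \<forall>a b. \<bar>a - b\<bar> powr p \<le> e * (\<bar>a\<bar> powr p + \<bar>b\<bar> powr p)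
     + C * ((\<bar>a\<bar> powr p + \<bar>b\<bar> powr p) / 2 - \<bar>(a + b) / 2\<bar> powr p)"
proof -
  define N where "N z = \<bar>fst z\<bar> powr p + \<bar>snd z\<bar> powr p" for z :: "real \<times> real"
  define D where "D z = N z / 2 - \<bar>(fst z + snd z) / 2\<bar> powr p" for z :: "real \<times> real"
  define A where "A z = \<bar>fst z - snd z\<bar> powr p" for z :: "real \<times> real"
  have cN: "continuous_on UNIV N" and cD: "continuous_on UNIV D" and cA: "continuous_on UNIV A"
    unfolding N_def D_def A_def using p by (intro continuous_intros continuous_on_powr'; simp)+
  have D0: "0 \<le> D z" for z using powr_abs_midpoint(1)[OF p, of "fst z" "snd z"] by (simp add: D_def N_def)
  \<comment> \<open>The part of the sphere where the first term alone may fail; closed, and free of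
    points with equal coordinates.\<close>
  define S where "S = {z \<in> sphere 0 1. e * N z \<le> A z}"
  have "compact S"
  proof -
    have "S = sphere 0 1 \<inter> {z. 0 \<le> A z - e * N z}" by (auto simp: S_def)
    moreover have "closed {z. 0 \<le> A z - e * N z}"
      by (intro closed_Collect_le continuous_intros cA cN)
    ultimately show ?thesis by (metis compact_Int_closed compact_sphere)
  qed
  have Dpos: "0 < D z" if "z \<in> S" for z
  proof -
    have "z \<noteq> 0" using that by (auto simp: S_def)
    then have "fst z \<noteq> 0 \<or> snd z \<noteq> 0" by (metis prod_eq_iff fst_zero snd_zero)
    then have "0 < N z" by (auto simp: N_def add_pos_nonneg add_nonneg_pos)
    then have "0 < A z" using that e by (auto simp: S_def intro: less_le_trans[of 0 "e * N z"])
    then have "fst z \<noteq> snd z" by (auto simp: A_def)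
    then show ?thesis using powr_abs_midpoint(2)[OF p] by (simp add: D_def N_def)
  qed
  have "\<exists>C\<ge>0. \<forall>z\<in>S. A z \<le> C * D z"
  proof (cases "S = {}")
    case True
    then show ?thesis by auto
  next
    case False
    obtain z0 where z0: "z0 \<in> S" "\<And>z. z \<in> S \<Longrightarrow> D z0 \<le> D z"
      using continuous_attains_inf[OF \<open>compact S\<close> False continuous_on_subset[OF cD]] by blast
    obtain z1 where z1: "z1 \<in> S" "\<And>z. z \<in> S \<Longrightarrow> A z \<le> A z1"
      using continuous_attains_sup[OF \<open>compact S\<close> False continuous_on_subset[OF cA]] by blast
    have A0: "0 \<le> A z1" by (simp add: A_def)
    show ?thesis
    \<comment> \<open>Largest left-hand side over smallest convexity defect on S.\<close>
    proof (intro exI[of _ "A z1 / D z0"] conjI ballI)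
      show "0 \<le> A z1 / D z0" using A0 Dpos[OF z0(1)] by simp
      fix z assume z: "z \<in> S"
      have "A z \<le> A z1" by (rule z1(2)[OF z])
      also have "\<dots> = A z1 / D z0 * D z0" using Dpos[OF z0(1)] by simp
      also have "\<dots> \<le> A z1 / D z0 * D z" using A0 Dpos[OF z0(1)] z0(2)[OF z] by (intro mult_left_mono) auto
      finally show "A z \<le> A z1 / D z0 * D z" .
    qed
  qed
  then obtain C where C: "C \<ge> 0" "\<And>z. z \<in> S \<Longrightarrow> A z \<le> C * D z" by blast
  have sph: "A z \<le> e * N z + C * D z" if "norm z = 1" for z
  proof (cases "z \<in> S")
    case True
    then show ?thesis using C(2)[OF True] e by (auto simp: N_def intro: add_increasing)
  next
    case False
    then have "A z \<le> e * N z" using that by (auto simp: S_def)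
    then show ?thesis using C(1) D0[of z] by (simp add: add_increasing2)
  qed
  have hom: "N (k *\<^sub>R z) = k powr p * N z" "D (k *\<^sub>R z) = k powr p * D z" "A (k *\<^sub>R z) = k powr p * A z" if k: "0 \<le> k" for k z
  proof -
    have *: "\<bar>k * x\<bar> powr p = k powr p * \<bar>x\<bar> powr p" for x using k by (simp add: abs_mult powr_mult)
    show N: "N (k *\<^sub>R z) = k powr p * N z" by (simp add: N_def * distrib_left)
    have "(fst (k *\<^sub>R z) + snd (k *\<^sub>R z)) / 2 = k * ((fst z + snd z) / 2)" by (simp add: distrib_left)
    then show "D (k *\<^sub>R z) = k powr p * D z" unfolding D_def N by (simp only: *) (simp add: algebra_simps)
    have "fst (k *\<^sub>R z) - snd (k *\<^sub>R z) = k * (fst z - snd z)" by (simp add: right_diff_distrib)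
    then show "A (k *\<^sub>R z) = k powr p * A z" unfolding A_def by (simp only: *)
  qed
  have "A z \<le> e * N z + C * D z" for z
  proof (cases "z = 0")
    case True
    then show ?thesis using p by (simp add: A_def N_def D_def)
  next
    case False
    let ?k = "norm z" and ?z = "(1 / norm z) *\<^sub>R z"
    have z: "z = ?k *\<^sub>R ?z" "norm ?z = 1" using False by auto
    have "?k powr p * A ?z \<le> ?k powr p * (e * N ?z + C * D ?z)" by (intro mult_left_mono sph z(2)) simp
    then have "A (?k *\<^sub>R ?z) \<le> e * N (?k *\<^sub>R ?z) + C * D (?k *\<^sub>R ?z)"
      unfolding hom[OF norm_ge_zero] by (simp add: algebra_simps)
    then show ?thesis using z(1) by simp
  qed
  from this[of "(_, _)"] show ?thesis using C(1) unfolding A_def N_def D_def by auto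
qed

section \<open>Energies and completeness in Lp over a finite measure\<close>

locale Lp_finite = finite_measure M for M :: "'a measure" +
  fixes p :: real
  assumes p: "1 < p"
begin

definition Lp :: "('a \<Rightarrow> real) set" where
  "Lp = {u. u \<in> borel_measurable M \<and> integrable M (\<lambda>x. \<bar>u x\<bar> powr p)}"

text \<open>The p-th power of the norm: pointwise inequalities integrate to it directly, and the
  factor \<open>2 powr p\<close> in \<open>Lp_add\<close> takes the place of the triangle
  inequality.\<close>

definition En :: "('a \<Rightarrow> real) \<Rightarrow> real" where
  "En u = (LINT x|M. \<bar>u x\<bar> powr p)"

lemma LpD: "u \<in> Lp \<Longrightarrow> u \<in> borel_measurable M" "u \<in> Lp \<Longrightarrow> integrable M (\<lambda>x. \<bar>u x\<bar> powr p)"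
  by (auto simp: Lp_def)

lemma En_nonneg: "0 \<le> En u"
  unfolding En_def by (rule integral_nonneg_AE) simp

lemma Lp_scale:
  assumes u: "u \<in> Lp"
  shows "(\<lambda>x. a * u x) \<in> Lp" "En (\<lambda>x. a * u x) = \<bar>a\<bar> powr p * En u"
proof -
  have eq: "\<bar>a * u x\<bar> powr p = \<bar>a\<bar> powr p * \<bar>u x\<bar> powr p" for x by (simp add: abs_mult powr_mult)
  show "(\<lambda>x. a * u x) \<in> Lp" using LpD[OF u] by (auto simp: Lp_def eq)
  show "En (\<lambda>x. a * u x) = \<bar>a\<bar> powr p * En u" unfolding En_def eq by simp
qed

lemma Lp_add:
  assumes u: "u \<in> Lp" and v: "v \<in> Lp"
  shows "(\<lambda>x. u x + v x) \<in> Lp" "En (\<lambda>x. u x + v x) \<le> 2 powr p * (En u + En v)"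
proof -
  note [measurable] = LpD(1)[OF u] LpD(1)[OF v]
  have le: "\<bar>u x + v x\<bar> powr p \<le> 2 powr p * (\<bar>u x\<bar> powr p + \<bar>v x\<bar> powr p)" for x
  proof -
    have "\<bar>u x + v x\<bar> powr p \<le> (\<bar>u x\<bar> + \<bar>v x\<bar>) powr p" using p by (intro powr_mono2) auto
    also have "\<dots> \<le> 2 powr p * (\<bar>u x\<bar> powr p + \<bar>v x\<bar> powr p)" using p by (intro add_powr_le) auto
    finally show ?thesis .
  qed
  have i: "integrable M (\<lambda>x. 2 powr p * (\<bar>u x\<bar> powr p + \<bar>v x\<bar> powr p))" using LpD(2)[OF u] LpD(2)[OF v] by simp
  have i2: "integrable M (\<lambda>x. \<bar>u x + v x\<bar> powr p)"
  proof (rule Bochner_Integration.integrable_bound[OF i])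
    show "AE x in M. norm (\<bar>u x + v x\<bar> powr p) \<le> norm (2 powr p * (\<bar>u x\<bar> powr p + \<bar>v x\<bar> powr p))"
      using le by (intro AE_I2) (auto intro: order_trans[OF _ abs_ge_self])
  qed measurable
  show "(\<lambda>x. u x + v x) \<in> Lp" using i2 by (simp add: Lp_def)
  have "En (\<lambda>x. u x + v x) \<le> (LINT x|M. 2 powr p * (\<bar>u x\<bar> powr p + \<bar>v x\<bar> powr p))"
    unfolding En_def by (rule integral_mono[OF i2 i le])
  also have "\<dots> = 2 powr p * (En u + En v)" using LpD(2)[OF u] LpD(2)[OF v] by (simp add: En_def)
  finally show "En (\<lambda>x. u x + v x) \<le> 2 powr p * (En u + En v)" .
qed

lemma Lp_lincomb: "u \<in> Lp \<Longrightarrow> v \<in> Lp \<Longrightarrow> (\<lambda>x. a * u x + b * v x) \<in> Lp"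
  by (intro Lp_add Lp_scale)

lemma Lp_diff: "u \<in> Lp \<Longrightarrow> v \<in> Lp \<Longrightarrow> (\<lambda>x. u x - v x) \<in> Lp"
  using Lp_lincomb[of u v 1 "-1"] by simp

lemma Lp_bounded:
  assumes [measurable]: "u \<in> borel_measurable M" and B: "\<And>x. x \<in> space M \<Longrightarrow> \<bar>u x\<bar> \<le> B"
  shows "u \<in> Lp" "En u \<le> B powr p * measure M (space M)"
proof -
  have le: "\<bar>u x\<bar> powr p \<le> B powr p" if "x \<in> space M" for x using B[OF that] p by (intro powr_mono2) auto
  have i: "integrable M (\<lambda>x. \<bar>u x\<bar> powr p)"
    by (rule integrable_const_bound[where B="B powr p"]) (use le in auto)
  then show "u \<in> Lp" by (simp add: Lp_def)
  have "En u \<le> (LINT x|M. B powr p)" unfolding En_def by (rule integral_mono[OF i]) (use le in auto)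
  then show "En u \<le> B powr p * measure M (space M)" by (simp add: mult.commute)
qed

lemma Lp_integrable:
  assumes u: "u \<in> Lp"
  shows "integrable M u"
proof (rule Bochner_Integration.integrable_bound)
  show "integrable M (\<lambda>x. 1 + \<bar>u x\<bar> powr p)" using LpD(2)[OF u] by simp
  show "AE x in M. norm (u x) \<le> norm (1 + \<bar>u x\<bar> powr p)"
  proof (rule AE_I2)
    fix x
    have "\<bar>u x\<bar> powr 1 \<le> 1 + \<bar>u x\<bar> powr p" by (rule powr_le_1_plus_powr) (use p in auto)
    then show "norm (u x) \<le> norm (1 + \<bar>u x\<bar> powr p)" by simp
  qed
qed (rule LpD(1)[OF u])

text \<open>Where the modulus exceeds e it is at most \<open>e powr (1 - p)\<close> times its p-th
  power. Choosing e first and then making the energy small gives small L1 norms.\<close>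

lemma L1_le_En:
  assumes u: "u \<in> Lp" and e: "0 < e"
  shows "(LINT x|M. \<bar>u x\<bar>) \<le> e * measure M (space M) + e powr (1 - p) * En u"
proof -
  have le: "\<bar>u x\<bar> \<le> e + e powr (1 - p) * \<bar>u x\<bar> powr p" for x
  proof (cases "\<bar>u x\<bar> \<le> e")
    case True
    moreover have "0 \<le> e powr (1 - p) * \<bar>u x\<bar> powr p" by simp
    ultimately show ?thesis by linarith
  next
    case False
    then have pos: "0 < \<bar>u x\<bar>" using e by linarith
    then have "\<bar>u x\<bar> = \<bar>u x\<bar> powr (1 - p) * \<bar>u x\<bar> powr p" by (simp add: powr_add[symmetric])
    also have "\<dots> \<le> e powr (1 - p) * \<bar>u x\<bar> powr p"
      using False e p by (intro mult_right_mono powr_mono2') auto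
    finally show ?thesis using e by linarith
  qed
  have "(LINT x|M. \<bar>u x\<bar>) \<le> (LINT x|M. e + e powr (1 - p) * \<bar>u x\<bar> powr p)"
    by (rule integral_mono) (use Lp_integrable[OF u] LpD(2)[OF u] le in auto)
  also have "\<dots> = e * measure M (space M) + e powr (1 - p) * En u"
    using LpD(2)[OF u] by (simp add: En_def mult.commute)
  finally show ?thesis .
qed

text \<open>The minimal energies of the shrinking sets increase and stay bounded, so they converge.
  Two almost minimal elements far along the sequence have a midpoint of almost the same energy, and
  uniform convexity forces them together.\<close>

lemma nested_midpoint_convex_Cauchy:
  fixes S :: "nat \<Rightarrow> ('a \<Rightarrow> real) set"
  assumes S: "\<And>k. S k \<subseteq> Lp" "\<And>k. S k \<noteq> {}" "\<And>j k. j \<le> k \<Longrightarrow> S k \<subseteq> S j"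
    and mid: "\<And>k u v. u \<in> S k \<Longrightarrow> v \<in> S k \<Longrightarrow> (\<lambda>x. 1/2 * u x + 1/2 * v x) \<in> S k"
    and B: "\<And>u. u \<in> S 0 \<Longrightarrow> En u \<le> B"
  shows "\<exists>v. (\<forall>k. v k \<in> S k) \<and> (\<forall>e>0. \<exists>N. \<forall>i\<ge>N. \<forall>j\<ge>N. En (\<lambda>x. v i x - v j x) \<le> e)"
proof -
  define d where "d k = Inf (En ` S k)" for k
  have bdd: "bdd_below (En ` S k)" for k using En_nonneg by (auto intro: bdd_belowI[of _ 0])
  have dle: "d k \<le> En u" if "u \<in> S k" for k u unfolding d_def using that bdd by (intro cInf_lower) auto
  have dB: "d k \<le> B" for k
  proof -
    obtain u where "u \<in> S k" using S(2) by blast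
    moreover then have "En u \<le> B" using S(3)[of 0 k] B by auto
    ultimately show ?thesis using dle[of u k] by simp
  qed
  have d0: "0 \<le> d k" for k unfolding d_def using S(2) En_nonneg by (intro cInf_greatest) auto
  have mono: "d j \<le> d k" if "j \<le> k" for j k
    unfolding d_def using S(2,3) that bdd by (intro cInf_superset_mono image_mono) auto
  have "\<exists>u\<in>S k. En u < d k + 1 / real (Suc k)" for k
    using cInf_lessD[of "En ` S k" "d k + 1 / real (Suc k)"] S(2) by (auto simp: d_def)
  then obtain v where v: "\<And>k. v k \<in> S k" "\<And>k. En (v k) < d k + 1 / real (Suc k)" by metis
  define D where "D = Sup (range d)"
  have bddA: "bdd_above (range d)" using dB by (auto intro: bdd_aboveI[of _ B])
  have dD: "d k \<le> D" for k unfolding D_def using bddA by (intro cSup_upper) auto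
  have B0: "0 \<le> B" using d0[of 0] dB[of 0] by linarith
  have DB: "D \<le> B" unfolding D_def using dB by (intro cSup_least) auto
  have "\<exists>N. \<forall>i\<ge>N. \<forall>j\<ge>N. En (\<lambda>x. v i x - v j x) \<le> e" if e: "e > 0" for e
  proof -
    \<comment> \<open>Half of e for each term: the energies sum to at most 2 (B + 1), which fixes
      \<open>e'\<close>. The constant \<open>C\<close> depends on \<open>e'\<close>, so t is chosen
      only after it.\<close>
    define e' where "e' = e / (4 * (B + 1))"
    have e': "0 < e'" using e B0 by (simp add: e'_def)
    obtain C where C: "C \<ge> 0" "\<And>a b. \<bar>a - b\<bar> powr p \<le> e' * (\<bar>a\<bar> powr p + \<bar>b\<bar> powr p)
     + C * ((\<bar>a\<bar> powr p + \<bar>b\<bar> powr p) / 2 - \<bar>(a + b) / 2\<bar> powr p)"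
      using powr_uniform_convexity[OF p e'] by blast
    define t where "t = min 1 (e / (4 * (C + 1)))"
    have t: "0 < t" "t \<le> 1" using e C by (simp_all add: t_def)
    have Ct: "(C + 1) * (2 * t) \<le> e / 2"
    proof -
      have "(C + 1) * (2 * t) \<le> (C + 1) * (2 * (e / (4 * (C + 1))))" using C by (intro mult_left_mono) (auto simp: t_def)
      also have "\<dots> = e / 2" using C by (simp add: field_simps)
      finally show ?thesis .
    qed
    obtain N1 where N1: "D - t < d N1"
    proof -
      have "\<exists>y\<in>range d. D - t < y" unfolding D_def using t bddA by (subst less_cSup_iff[symmetric]) auto
      then show thesis using that by auto
    qed
    obtain N2 where N2: "1 / real (Suc N2) < t" using t nat_approx_posE by blast
    define N where "N = max N1 N2"
    have dN: "D - t < d N" using N1 mono[of N1 N] by (simp add: N_def)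
    have inv: "1 / real (Suc i) \<le> t" if "i \<ge> N" for i
    proof -
      have "1 / real (Suc i) \<le> 1 / real (Suc N2)" using that by (intro divide_left_mono) (auto simp: N_def)
      then show ?thesis using N2 by linarith
    qed
    have "En (\<lambda>x. v i x - v j x) \<le> e" if ij: "i \<ge> N" "j \<ge> N" for i j
    proof -
      have vN: "v i \<in> S N" "v j \<in> S N" using v(1) S(3) ij by blast+
      have vL: "v i \<in> Lp" "v j \<in> Lp" using vN S(1) by blast+
      \<comment> \<open>The midpoint belongs to \<open>S N\<close>, so its energy is above D - t,
        while both end points have energy at most D + t; the defect is at most 2 t.\<close>
      have midN: "(\<lambda>x. 1/2 * v i x + 1/2 * v j x) \<in> S N" by (rule mid[OF vN])
      then have midL: "(\<lambda>x. 1/2 * v i x + 1/2 * v j x) \<in> Lp" using S(1) by blast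
      have Emid: "d N \<le> En (\<lambda>x. (v i x + v j x) / 2)" using dle[OF midN] by (simp add: add_divide_distrib)
      have im: "integrable M (\<lambda>x. \<bar>(v i x + v j x) / 2\<bar> powr p)" using LpD(2)[OF midL] by (simp add: add_divide_distrib)
      have Ei: "En (v k) \<le> D + t" if "k \<ge> N" for k using v(2)[of k] dD[of k] inv[OF that] by linarith
      have "En (\<lambda>x. v i x - v j x) \<le> (LINT x|M. e' * (\<bar>v i x\<bar> powr p + \<bar>v j x\<bar> powr p)
          + C * ((\<bar>v i x\<bar> powr p + \<bar>v j x\<bar> powr p) / 2 - \<bar>(v i x + v j x) / 2\<bar> powr p))"
        unfolding En_def
        by (rule integral_mono) (use C(2) LpD(2)[OF Lp_diff[OF vL]] LpD(2)[OF vL(1)] LpD(2)[OF vL(2)] im in auto)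
      also have "\<dots> = e' * (En (v i) + En (v j)) + C * ((En (v i) + En (v j)) / 2 - En (\<lambda>x. (v i x + v j x) / 2))"
        using LpD(2)[OF vL(1)] LpD(2)[OF vL(2)] im by (simp add: En_def)
      also have "\<dots> \<le> e' * (2 * (B + t)) + C * (2 * t)"
      proof (intro add_mono mult_left_mono)
        show "En (v i) + En (v j) \<le> 2 * (B + t)" using Ei ij DB by (smt (verit))
        have "En (v i) \<le> D + t" "En (v j) \<le> D + t" using Ei ij by auto
        then show "(En (v i) + En (v j)) / 2 - En (\<lambda>x. (v i x + v j x) / 2) \<le> 2 * t" using Emid dN by (simp add: field_simps)
      qed (use e' C in auto)
      finally have fin: "En (\<lambda>x. v i x - v j x) \<le> e' * (2 * (B + t)) + C * (2 * t)" .
      have "e' * (2 * (B + t)) \<le> e' * (2 * (B + 1))" using e' t by (intro mult_left_mono) auto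
      also have "\<dots> = e / 2" using B0 by (simp add: e'_def field_simps)
      finally have "e' * (2 * (B + t)) \<le> e / 2" .
      moreover have "C * (2 * t) \<le> (C + 1) * (2 * t)" using t by (intro mult_right_mono) auto
      ultimately show ?thesis using fin Ct by linarith
    qed
    then show ?thesis by blast
  qed
  then show ?thesis using v(1) by blast
qed

text \<open>Small energies give small L1 distances on a finite measure, hence an almost everywhere
  convergent subsequence. Fatou's lemma applied to the differences transfers the Cauchy estimate to
  the limit.\<close>

lemma Lp_complete:
  assumes v: "\<And>k. v k \<in> Lp"
    and Cauchy: "\<And>e. e > 0 \<Longrightarrow> \<exists>N. \<forall>i\<ge>N. \<forall>j\<ge>N. En (\<lambda>x. v i x - v j x) \<le> e"
  shows "\<exists>w\<in>Lp. (\<lambda>k. En (\<lambda>x. v k x - w x)) \<longlonglongrightarrow> 0"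
proof -
  note vm[measurable] = LpD(1)[OF v]
  have L1: "\<exists>N. \<forall>i\<ge>N. \<forall>j\<ge>N. (LINT x|M. norm (v i x - v j x)) < e" if e: "e > 0" for e
  proof -
    define m where "m = measure M (space M) + 1"
    have m: "0 < m" "measure M (space M) \<le> m" by (auto simp: m_def intro: add_nonneg_pos)
    define e1 where "e1 = e / (4 * m)"
    have e1: "0 < e1" "e1 * measure M (space M) \<le> e / 4"
    proof -
      show "0 < e1" using e m by (simp add: e1_def)
      have "e1 * measure M (space M) \<le> e1 * m" using \<open>0 < e1\<close> m by simp
      also have "\<dots> = e / 4" using m by (simp add: e1_def)
      finally show "e1 * measure M (space M) \<le> e / 4" .
    qed
    define e2 where "e2 = e / 4 / e1 powr (1 - p)"
    have e2: "0 < e2" using e e1 by (simp add: e2_def)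
    obtain N where N: "\<And>i j. i \<ge> N \<Longrightarrow> j \<ge> N \<Longrightarrow> En (\<lambda>x. v i x - v j x) \<le> e2" using Cauchy[OF e2] by blast
    have "(LINT x|M. norm (v i x - v j x)) < e" if ij: "i \<ge> N" "j \<ge> N" for i j
    proof -
      have "(LINT x|M. \<bar>v i x - v j x\<bar>) \<le> e1 * measure M (space M) + e1 powr (1 - p) * En (\<lambda>x. v i x - v j x)"
        by (rule L1_le_En[OF Lp_diff[OF v v] e1(1)])
      also have "\<dots> \<le> e / 4 + e1 powr (1 - p) * e2" using N[OF ij] by (intro add_mono e1(2) mult_left_mono) auto
      also have "\<dots> = e / 2" using e1 by (simp add: e2_def)
      also have "\<dots> < e" using e by simp
      finally show ?thesis by simp
    qed
    then show ?thesis by blast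
  qed
  have int: "\<And>n. integrable M (v n)" by (rule Lp_integrable[OF v])
  obtain r where r: "strict_mono r" "AE x in M. Cauchy (\<lambda>i. v (r i) x)"
    by (rule cauchy_L1_AE_cauchy_subseq[OF int L1])
  \<comment> \<open>Where the subsequence diverges, \<open>lim\<close> has an unspecified value;
    this happens only on a null set and leaves w measurable.\<close>
  define w where "w x = lim (\<lambda>i. v (r i) x)" for x
  have [measurable]: "w \<in> borel_measurable M" unfolding w_def by measurable
  have lim: "AE x in M. (\<lambda>i. v (r i) x) \<longlonglongrightarrow> w x"
    using r(2) by eventually_elim (simp add: w_def Cauchy_convergent_iff convergent_LIMSEQ_iff)
  have est: "(\<integral>\<^sup>+x. ennreal (\<bar>v k x - w x\<bar> powr p) \<partial>M) \<le> ennreal e"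
    if N: "\<forall>i\<ge>N. \<forall>j\<ge>N. En (\<lambda>x. v i x - v j x) \<le> e" and k: "k \<ge> N" for e N k
  proof -
    have "(\<integral>\<^sup>+x. ennreal (\<bar>v k x - w x\<bar> powr p) \<partial>M) = (\<integral>\<^sup>+x. liminf (\<lambda>i. ennreal (\<bar>v k x - v (r i) x\<bar> powr p)) \<partial>M)"
    proof (rule nn_integral_cong_AE)
      show "AE x in M. ennreal (\<bar>v k x - w x\<bar> powr p) = liminf (\<lambda>i. ennreal (\<bar>v k x - v (r i) x\<bar> powr p))"
        using lim
      proof eventually_elim
        fix x assume "(\<lambda>i. v (r i) x) \<longlonglongrightarrow> w x"
        then have "(\<lambda>i. \<bar>v k x - v (r i) x\<bar>) \<longlonglongrightarrow> \<bar>v k x - w x\<bar>" by (intro tendsto_intros)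
        then have "(\<lambda>i. \<bar>v k x - v (r i) x\<bar> powr p) \<longlonglongrightarrow> \<bar>v k x - w x\<bar> powr p" using p by (intro tendsto_powr') auto
        then have "(\<lambda>i. ennreal (\<bar>v k x - v (r i) x\<bar> powr p)) \<longlonglongrightarrow> ennreal (\<bar>v k x - w x\<bar> powr p)" by (rule tendsto_ennrealI)
        then show "ennreal (\<bar>v k x - w x\<bar> powr p) = liminf (\<lambda>i. ennreal (\<bar>v k x - v (r i) x\<bar> powr p))"
          by (intro lim_imp_Liminf[symmetric]) auto
      qed
    qed
    also have "\<dots> \<le> liminf (\<lambda>i. \<integral>\<^sup>+x. ennreal (\<bar>v k x - v (r i) x\<bar> powr p) \<partial>M)"
      by (rule nn_integral_liminf) measurable
    also have "\<dots> \<le> liminf (\<lambda>i::nat. ennreal e)"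
    proof (rule Liminf_mono)
      have "(\<integral>\<^sup>+x. ennreal (\<bar>v k x - v (r i) x\<bar> powr p) \<partial>M) \<le> ennreal e" if "i \<ge> N" for i
      proof -
        have "r i \<ge> N" using seq_suble[OF r(1), of i] that by linarith
        then have "En (\<lambda>x. v k x - v (r i) x) \<le> e" using N k by blast
        moreover have "(\<integral>\<^sup>+x. ennreal (\<bar>v k x - v (r i) x\<bar> powr p) \<partial>M) = ennreal (En (\<lambda>x. v k x - v (r i) x))"
          unfolding En_def using LpD(2)[OF Lp_diff[OF v v]] by (intro nn_integral_eq_integral) auto
        ultimately show ?thesis by (simp add: ennreal_leI)
      qed
      then show "\<forall>\<^sub>F i in sequentially. (\<integral>\<^sup>+x. ennreal (\<bar>v k x - v (r i) x\<bar> powr p) \<partial>M) \<le> ennreal e"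
        by (auto simp: eventually_sequentially)
    qed
    also have "\<dots> = ennreal e" by (simp add: Liminf_const)
    finally show ?thesis .
  qed
  have diffL: "(\<lambda>x. v k x - w x) \<in> Lp" "En (\<lambda>x. v k x - w x) \<le> e"
    if N: "\<forall>i\<ge>N. \<forall>j\<ge>N. En (\<lambda>x. v i x - v j x) \<le> e" and k: "k \<ge> N" and e: "0 \<le> e" for e N k
  proof -
    have int: "integrable M (\<lambda>x. \<bar>v k x - w x\<bar> powr p)"
    proof (rule integrableI_bounded)
      have "(\<integral>\<^sup>+x. ennreal (norm (\<bar>v k x - w x\<bar> powr p)) \<partial>M) \<le> ennreal e" using est[OF N k] by simp
      then show "(\<integral>\<^sup>+x. ennreal (norm (\<bar>v k x - w x\<bar> powr p)) \<partial>M) < \<infinity>"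
        by (metis ennreal_less_top infinity_ennreal_def order_le_less_trans)
    qed measurable
    then show "(\<lambda>x. v k x - w x) \<in> Lp" by (simp add: Lp_def)
    have "ennreal (En (\<lambda>x. v k x - w x)) = (\<integral>\<^sup>+x. ennreal (\<bar>v k x - w x\<bar> powr p) \<partial>M)"
      unfolding En_def using int by (intro nn_integral_eq_integral[symmetric]) auto
    also have "\<dots> \<le> ennreal e" by (rule est[OF N k])
    finally show "En (\<lambda>x. v k x - w x) \<le> e" using e by (subst (asm) ennreal_le_iff) auto
  qed
  obtain N1 where N1: "\<forall>i\<ge>N1. \<forall>j\<ge>N1. En (\<lambda>x. v i x - v j x) \<le> 1" using Cauchy[of 1] by auto
  have "w \<in> Lp" using Lp_diff[OF v[of N1] diffL(1)[OF N1 order_refl]] by simp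
  moreover have "(\<lambda>k. En (\<lambda>x. v k x - w x)) \<longlonglongrightarrow> 0"
  proof (rule LIMSEQ_I)
    fix e :: real assume "e > 0"
    then obtain N where N: "\<forall>i\<ge>N. \<forall>j\<ge>N. En (\<lambda>x. v i x - v j x) \<le> e/2" using Cauchy[of "e/2"] by auto
    have "norm (En (\<lambda>x. v k x - w x) - 0) < e" if "k \<ge> N" for k
      using diffL(2)[OF N that] En_nonneg[of "\<lambda>x. v k x - w x"] \<open>e > 0\<close> by simp
    then show "\<exists>N. \<forall>k\<ge>N. norm (En (\<lambda>x. v k x - w x) - 0) < e" by blast
  qed
  ultimately show ?thesis by blast
qed

end

section \<open>Existence of a minimiser\<close>

text \<open>Compactness of the unit sphere; used for the map that sends the coefficients of an
  affine function to its image under K.\<close>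

lemma injective_linear_bounded_below:
  fixes f :: "'a::euclidean_space \<Rightarrow> 'b::real_normed_vector"
  assumes lin: "linear f" and inj: "\<And>x. f x = 0 \<Longrightarrow> x = 0"
  obtains k where "k > 0" "\<And>x. k * norm x \<le> norm (f x)"
proof -
  have bl: "bounded_linear f" using lin by (simp add: linear_conv_bounded_linear)
  have cont: "continuous_on (sphere 0 1) (\<lambda>x. norm (f x))"
    by (intro continuous_on_norm linear_continuous_on bl)
  have ne: "sphere 0 1 \<noteq> ({} :: 'a set)" using SOME_Basis norm_Basis[OF SOME_Basis] by (metis empty_iff mem_sphere_0)
  obtain x0 where x0: "x0 \<in> sphere 0 1" "\<And>x. x \<in> sphere 0 1 \<Longrightarrow> norm (f x0) \<le> norm (f x)"
    using continuous_attains_inf[OF compact_sphere ne cont] by blast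
  define k where "k = norm (f x0)"
  have "k > 0" using inj[of x0] x0(1) by (auto simp: k_def)
  moreover have "k * norm x \<le> norm (f x)" for x
  proof (cases "x = 0")
    case False
    let ?y = "(1 / norm x) *\<^sub>R x"
    have "norm (f ?y) = norm (f x) / norm x" using lin by (simp add: linear_cmul)
    moreover have "k \<le> norm (f ?y)" unfolding k_def by (rule x0(2)) (use False in simp)
    ultimately have "k \<le> norm (f x) / norm x" by simp
    then show ?thesis using False by (simp add: pos_le_divide_eq)
  qed (use linear_0[OF lin] in simp)
  ultimately show thesis by (rule that)
qed

text \<open>For n = 1 the exponent n/(n-1) is infinite, so p is bounded above only from dimension
  two on. Functions stand for themselves instead of their classes; linearity and boundedness make K
  agree on functions that are equal almost everywhere.\<close>

theorem theorem4p10: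
  fixes \<Omega> :: "((real, 'n::{finite,linorder}) vec) set"
    and \<phi> :: "(real, 'n) vec \<Rightarrow> real \<Rightarrow> ennreal"
    and \<alpha>1 \<alpha>2 p :: real
    and K :: "((real, 'n) vec \<Rightarrow> real) \<Rightarrow> 'h::{real_inner,complete_space}"
    and f :: 'h
  assumes "open \<Omega>" and "bounded \<Omega>" and "connected \<Omega>" and "C1_boundary \<Omega>"
    and "Phi_w \<Omega> \<phi>" and "A0 \<Omega> \<phi>"
    and "\<alpha>1 > 0" and "\<alpha>2 > 0"
    and "1 < p" and "card (UNIV :: 'n set) \<ge> 2 \<Longrightarrow> p \<le> real (card (UNIV :: 'n set)) / (real (card (UNIV :: 'n set)) - 1)"
    and K_linear: "\<And>u v a b. u \<in> Lp_space p \<Omega> \<Longrightarrow> v \<in> Lp_space p \<Omega> \<Longrightarrow>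
                     K (\<lambda>x. a * u x + b * v x) = a *\<^sub>R K u + b *\<^sub>R K v"
    and K_bounded: "\<exists>C. \<forall>u\<in>Lp_space p \<Omega>. norm (K u) \<le> C * Lp_norm p \<Omega> u"
    and K_inj_affine: "\<And>c b c' b'. K (\<lambda>x. c + b \<bullet> x) = K (\<lambda>x. c' + b' \<bullet> x) \<Longrightarrow>
                     (\<forall>x\<in>\<Omega>. c + b \<bullet> x = c' + b' \<bullet> x)"
  shows "\<exists>u\<in>Lp_space p \<Omega>. \<forall>v\<in>Lp_space p \<Omega>.
           ereal (1/2 * norm (K u - f)) + TGV2 \<phi> \<Omega> \<alpha>1 \<alpha>2 u
             \<le> ereal (1/2 * norm (K v - f)) + TGV2 \<phi> \<Omega> \<alpha>1 \<alpha>2 v"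
proof -
  note \<Omega> = \<open>open \<Omega>\<close> \<open>bounded \<Omega>\<close> and Phi = \<open>Phi_w \<Omega> \<phi>\<close> and A0 = \<open>A0 \<Omega> \<phi>\<close> and p1 = \<open>1 < p\<close>
    and \<alpha> = \<open>\<alpha>1 > 0\<close> \<open>\<alpha>2 > 0\<close>
  have \<Omega>m: "\<Omega> \<in> lmeasurable" "\<Omega> \<in> sets lebesgue" using \<Omega> by (auto simp: bounded_set_imp_lmeasurable)
  have fm: "finite_measure (lebesgue_on \<Omega>)"
    by (rule finite_measureI) (use \<Omega>m in \<open>simp add: emeasure_restrict_space emeasure_eq_measure2\<close>)
  interpret Lp_finite "lebesgue_on \<Omega>" p
    by (intro Lp_finite.intro Lp_finite_axioms.intro fm p1)
  have Lp_eq: "Lp_space p \<Omega> = Lp" by (simp add: Lp_space_def Lp_def)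
  note K_lin = K_linear[unfolded Lp_eq]
  obtain CK where CK: "0 \<le> CK" "\<And>u. u \<in> Lp \<Longrightarrow> norm (K u) \<le> CK * En u powr (1/p)"
  proof -
    obtain C where "\<And>u. u \<in> Lp \<Longrightarrow> norm (K u) \<le> C * En u powr (1/p)"
      using K_bounded by (auto simp: Lp_eq Lp_norm_def En_def)
    then have "norm (K u) \<le> \<bar>C\<bar> * En u powr (1/p)" if "u \<in> Lp" for u
      using that by (meson abs_ge_self mult_right_mono order_trans powr_ge_zero)
    then show thesis using that[of "\<bar>C\<bar>"] by simp
  qed
  have K_diff: "K (\<lambda>x. u x - v x) = K u - K v" if "u \<in> Lp" "v \<in> Lp" for u v
    using K_lin[OF that, of 1 "-1"] by simp
  have K_scale: "K (\<lambda>x. a * u x) = a *\<^sub>R K u" if "u \<in> Lp" for a u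
    using K_lin[OF that that, of a 0] by simp
  obtain R where R: "R > 0" "\<And>x. x \<in> \<Omega> \<Longrightarrow> norm x \<le> R" using \<Omega>(2) by (auto simp: bounded_pos)
  have aff_meas: "(\<lambda>x. c + b \<bullet> x) \<in> borel_measurable (lebesgue_on \<Omega>)" for c :: real and b :: "(real, 'n) vec"
    by (rule continuous_imp_measurable_on_sets_lebesgue[OF _ \<Omega>m(2)]) (intro continuous_intros)
  have aff_bound: "\<bar>c + b \<bullet> x\<bar> \<le> (\<bar>c\<bar> + norm b) * (1 + R)" if "x \<in> \<Omega>" for c b x
  proof -
    have "\<bar>c + b \<bullet> x\<bar> \<le> \<bar>c\<bar> + norm b * norm x" using Cauchy_Schwarz_ineq2[of b x] by linarith
    also have "\<dots> \<le> \<bar>c\<bar> * (1 + R) + norm b * (1 + R)"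
      using R(2)[OF that] R(1) by (intro add_mono mult_left_mono) (auto simp: mult_le_cancel_left1)
    finally show ?thesis by (simp add: distrib_right)
  qed
  have affL: "(\<lambda>x. c + b \<bullet> x) \<in> Lp" "En (\<lambda>x. c + b \<bullet> x) \<le> ((\<bar>c\<bar> + norm b) * (1 + R)) powr p * measure (lebesgue_on \<Omega>) (space (lebesgue_on \<Omega>))" for c b
    using Lp_bounded[OF aff_meas[of c b], of "(\<bar>c\<bar> + norm b) * (1 + R)"] aff_bound by auto

  define Adm where "Adm \<psi> \<longleftrightarrow> admissible_field \<Omega> \<psi> \<and> lux_norm \<phi> \<Omega> \<psi> \<le> ereal \<alpha>1 \<and> lux_norm \<phi> \<Omega> (div_field \<psi>) \<le> ereal \<alpha>2" for \<psi>
  define I where "I u \<psi> = (LINT x|lebesgue_on \<Omega>. u x * div2_field \<psi> x)" for u \<psi>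
  define J where "J u = ereal (1/2 * norm (K u - f)) + TGV2 \<phi> \<Omega> \<alpha>1 \<alpha>2 u" for u
  have TGV_le: "TGV2 \<phi> \<Omega> \<alpha>1 \<alpha>2 u \<le> ereal c \<longleftrightarrow> (\<forall>\<psi>. Adm \<psi> \<longrightarrow> I u \<psi> \<le> c)" for u c
    unfolding TGV2_def I_def Adm_def Sup_le_iff by auto
  \<comment> \<open>J is a supremum over admissible fields. Both midpoint convexity and lower
    semicontinuity are checked for one field at a time through this equivalence.\<close>
  have J_le: "J u \<le> ereal c \<longleftrightarrow> (\<forall>\<psi>. Adm \<psi> \<longrightarrow> 1/2 * norm (K u - f) + I u \<psi> \<le> c)" for u c
  proof -
    have "J u \<le> ereal c \<longleftrightarrow> TGV2 \<phi> \<Omega> \<alpha>1 \<alpha>2 u \<le> ereal (c - 1/2 * norm (K u - f))"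
      unfolding J_def by (cases "TGV2 \<phi> \<Omega> \<alpha>1 \<alpha>2 u") auto
    then show ?thesis unfolding TGV_le by (auto simp: algebra_simps)
  qed
  \<comment> \<open>The zero field shows that TGV is nonnegative, so J bounds the data term.\<close>
  have Adm0: "Adm (\<lambda>_. 0)"
  proof -
    have C1: "C1_fun (\<lambda>_::(real, 'n) vec. 0::real)" "partial_deriv i (\<lambda>_::(real, 'n) vec. 0::real) = (\<lambda>_. 0)" for i
      using C1_funI[of "\<lambda>_. 0" "\<lambda>_ _. 0"] by simp_all
    have z: "(\<lambda>y::(real, 'n) vec. (0 :: ((real, 'n) vec, 'n) vec) $ i $ j) = (\<lambda>_. 0)" for i j by simp
    have "admissible_field \<Omega> (\<lambda>_. 0)" by (simp add: admissible_field_def C2_fun_def C1)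
    moreover have "lux_norm \<phi> \<Omega> (\<lambda>_. 0 :: ((real, 'n) vec, 'n) vec) \<le> ereal \<alpha>1"
      using lux_norm_le_of_bounded[OF Phi A0 \<Omega> \<alpha>(1), where 'v="((real, 'n) vec, 'n) vec"] by force
    moreover have "div_field (\<lambda>_. 0) = (\<lambda>_::(real, 'n) vec. 0)"
      by (rule ext) (simp add: div_field_def z C1(2) vec_eq_iff)
    moreover have "lux_norm \<phi> \<Omega> (\<lambda>_. 0 :: (real, 'n) vec) \<le> ereal \<alpha>2"
      using lux_norm_le_of_bounded[OF Phi A0 \<Omega> \<alpha>(2), where 'v="(real, 'n) vec"] by force
    ultimately show ?thesis by (simp add: Adm_def)
  qed
  have I0: "I u (\<lambda>_. 0) = 0" for u
  proof -
    have C1: "partial_deriv i (\<lambda>_::(real, 'n) vec. 0::real) = (\<lambda>_. 0)" for i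
      using C1_funI(2)[of "\<lambda>_. 0" "\<lambda>_ _. 0"] by simp
    have z: "(\<lambda>y::(real, 'n) vec. (0 :: ((real, 'n) vec, 'n) vec) $ i $ j) = (\<lambda>_. 0)" for i j by simp
    show ?thesis by (simp add: I_def div2_field_def z C1)
  qed
  \<comment> \<open>A bounded second divergence makes the pairing with a fixed field continuous in
    L1, hence along the minimising sequence.\<close>
  have d2_bounded: "\<exists>B\<ge>0. \<forall>x. \<bar>div2_field \<psi> x\<bar> \<le> B" and d2_meas: "div2_field \<psi> \<in> borel_measurable (lebesgue_on \<Omega>)"
    if adm: "admissible_field \<Omega> \<psi>" for \<psi>
  proof -
    have C2c: "C2c (\<lambda>y. \<psi> y $ i $ j)" for i j
    proof -
      have "{y. \<psi> y $ i $ j \<noteq> 0} \<subseteq> {y. \<psi> y \<noteq> 0}" by auto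
      moreover have "bounded {y. \<psi> y \<noteq> 0}"
        by (rule bounded_subset[OF compact_imp_bounded closure_subset]) (use adm in \<open>simp add: admissible_field_def\<close>)
      ultimately show ?thesis using adm by (auto simp: C2c_def admissible_field_def intro: bounded_subset)
    qed
    note pc = C2c_partial_C1c[OF C2c]
    define Q where "Q i j k l b \<longleftrightarrow> b > 0 \<and> (\<forall>x. \<bar>partial_deriv k (partial_deriv l (\<lambda>y. \<psi> y $ i $ j)) x\<bar> \<le> b)" for i j k l b
    have "\<exists>b. Q i j k l b" for i j k l unfolding Q_def
      by (rule bounded_support_uniform(1)[OF C1c_partial_continuous[OF pc] C1c_partial_bounded_support[OF pc]])
    then obtain B where "\<And>i j k l. Q i j k l (B i j k l)" by metis
    then have B: "\<And>i j k l. B i j k l > 0" "\<And>i j k l x. \<bar>partial_deriv k (partial_deriv l (\<lambda>y. \<psi> y $ i $ j)) x\<bar> \<le> B i j k l"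
      unfolding Q_def by blast+
    define B' where "B' = (\<Sum>i\<in>UNIV. B i i i i) + 2 * (\<Sum>i\<in>UNIV. \<Sum>j\<in>{j. i < j}. B i j i j)"
    have "\<bar>div2_field \<psi> x\<bar> \<le> B'" for x
    proof -
      have "\<bar>div2_field \<psi> x\<bar> \<le> \<bar>\<Sum>i\<in>UNIV. partial_deriv i (partial_deriv i (\<lambda>y. \<psi> y $ i $ i)) x\<bar>
         + 2 * \<bar>\<Sum>i\<in>UNIV. \<Sum>j\<in>{j. i < j}. partial_deriv i (partial_deriv j (\<lambda>y. \<psi> y $ i $ j)) x\<bar>"
        unfolding div2_field_def by linarith
      also have "\<dots> \<le> B'" unfolding B'_def
        by (intro add_mono mult_left_mono order_trans[OF sum_abs] sum_mono B(2)) auto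
      finally show ?thesis .
    qed
    moreover have "0 \<le> B'" unfolding B'_def using B(1) by (intro add_nonneg_nonneg mult_nonneg_nonneg sum_nonneg) (auto intro: less_imp_le)
    ultimately show "\<exists>B\<ge>0. \<forall>x. \<bar>div2_field \<psi> x\<bar> \<le> B" by blast
    have "continuous_on UNIV (div2_field \<psi>)" unfolding div2_field_def
      by (intro continuous_intros C1c_partial_continuous pc)
    then show "div2_field \<psi> \<in> borel_measurable (lebesgue_on \<Omega>)"
      by (intro continuous_imp_measurable_on_sets_lebesgue[OF _ \<Omega>m(2)]) (rule continuous_on_subset, auto)
  qed
  have I_int: "integrable (lebesgue_on \<Omega>) (\<lambda>x. u x * div2_field \<psi> x)" if u: "u \<in> Lp" and adm: "admissible_field \<Omega> \<psi>" for u \<psi>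
  proof -
    obtain B where B: "B \<ge> 0" "\<And>x. \<bar>div2_field \<psi> x\<bar> \<le> B" using d2_bounded[OF adm] by blast
    show ?thesis
    proof (rule Bochner_Integration.integrable_bound)
      show "integrable (lebesgue_on \<Omega>) (\<lambda>x. B * u x)" using Lp_integrable[OF u] by simp
      show "(\<lambda>x. u x * div2_field \<psi> x) \<in> borel_measurable (lebesgue_on \<Omega>)"
        by (rule borel_measurable_times[OF LpD(1)[OF u] d2_meas[OF adm]])
      have "\<bar>u x\<bar> * \<bar>div2_field \<psi> x\<bar> \<le> \<bar>u x\<bar> * B" for x using B(2) by (intro mult_left_mono) auto
      then show "AE x in lebesgue_on \<Omega>. norm (u x * div2_field \<psi> x) \<le> norm (B * u x)"
        using B(1) by (intro AE_I2) (simp add: abs_mult mult.commute)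
    qed
  qed

  \<comment> \<open>Real upper bounds of J in place of its values: the infimum stays real although J
    may be infinite at some functions. The zero function shows that V is not empty.\<close>
  define V where "V = {c. \<exists>u\<in>Lp. J u \<le> ereal c}"
  have zeroL: "(\<lambda>_. 0) \<in> Lp" using affL(1)[of 0 0] by simp
  have "J (\<lambda>_. 0) \<le> ereal (1/2 * norm (K (\<lambda>_. 0) - f))" unfolding J_le by (simp add: I_def)
  then have Vne: "V \<noteq> {}" unfolding V_def using zeroL by blast
  have V0: "0 \<le> c" if "c \<in> V" for c
  proof -
    obtain u where "J u \<le> ereal c" using \<open>c \<in> V\<close> by (auto simp: V_def)
    then have "1/2 * norm (K u - f) + I u (\<lambda>_. 0) \<le> c" using Adm0 J_le by blast
    moreover have "0 \<le> 1/2 * norm (K u - f)" by simp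
    ultimately show ?thesis using I0[of u] by linarith
  qed
  define m where "m = Inf V"
  have bddV: "bdd_below V" using V0 by (auto intro: bdd_belowI[of _ 0])
  have m0: "0 \<le> m" unfolding m_def using Vne V0 by (intro cInf_greatest) auto
  define S where "S k = {u \<in> Lp. J u \<le> ereal (m + 1 / real (Suc k))}" for k
  have S_ne: "S k \<noteq> {}" for k
  proof -
    obtain c where "c \<in> V" "c < m + 1 / real (Suc k)" using cInf_lessD[OF Vne, of "m + 1 / real (Suc k)"] by (auto simp: m_def)
    then obtain u where "u \<in> Lp" "J u \<le> ereal c" by (auto simp: V_def)
    then have "u \<in> S k" using \<open>c < _\<close> by (auto simp: S_def intro: order_trans)
    then show ?thesis by blast
  qed
  have S_mono: "S k \<subseteq> S j" if "j \<le> k" for j k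
  proof -
    have "1 / real (Suc k) \<le> 1 / real (Suc j)" using that by (intro divide_left_mono) auto
    then have "ereal (m + 1 / real (Suc k)) \<le> ereal (m + 1 / real (Suc j))" by simp
    then show ?thesis unfolding S_def by (auto intro: order_trans)
  qed
  have S_mid: "(\<lambda>x. 1/2 * u x + 1/2 * v x) \<in> S k" if u: "u \<in> S k" and v: "v \<in> S k" for k u v
  proof -
    have uv: "u \<in> Lp" "v \<in> Lp" using u v by (auto simp: S_def)
    let ?w = "\<lambda>x. 1/2 * u x + 1/2 * v x" and ?c = "m + 1 / real (Suc k)"
    have "1/2 * norm (K ?w - f) + I ?w \<psi> \<le> ?c" if \<psi>: "Adm \<psi>" for \<psi>
    proof -
      have adm: "admissible_field \<Omega> \<psi>" using \<psi> by (simp add: Adm_def)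
      have "I ?w \<psi> = (LINT x|lebesgue_on \<Omega>. 1/2 * (u x * div2_field \<psi> x) + 1/2 * (v x * div2_field \<psi> x))"
        unfolding I_def by (simp add: algebra_simps)
      also have "\<dots> = 1/2 * I u \<psi> + 1/2 * I v \<psi>"
        unfolding I_def using I_int[OF uv(1) adm] I_int[OF uv(2) adm] by simp
      finally have Iw: "I ?w \<psi> = 1/2 * I u \<psi> + 1/2 * I v \<psi>" .
      have "K ?w - f = (1/2) *\<^sub>R (K u - f) + (1/2) *\<^sub>R (K v - f)"
        unfolding K_lin[OF uv] by (simp add: algebra_simps flip: scaleR_add_left)
      then have "norm (K ?w - f) \<le> 1/2 * norm (K u - f) + 1/2 * norm (K v - f)"
        using norm_triangle_ineq[of "(1/2) *\<^sub>R (K u - f)" "(1/2) *\<^sub>R (K v - f)"] by simp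
      moreover have "1/2 * norm (K u - f) + I u \<psi> \<le> ?c" "1/2 * norm (K v - f) + I v \<psi> \<le> ?c"
        using u v \<psi> unfolding S_def J_le by blast+
      ultimately show ?thesis unfolding Iw by linarith
    qed
    then show ?thesis using Lp_lincomb[OF uv, of "1/2" "1/2"] unfolding S_def J_le by simp
  qed

  have coercive: "\<exists>B. \<forall>u\<in>S 0. En u \<le> B"
  \<comment> \<open>The empty domain is set aside because an affine function is determined only by
    its values on a nonempty open set.\<close>
  proof (cases "\<Omega> = {}")
    case True
    have "En u = 0" for u
    proof -
      have "space (lebesgue_on \<Omega>) = {}" using True by simp
      then show ?thesis unfolding En_def using Bochner_Integration.integral_cong[of "lebesgue_on \<Omega>" "lebesgue_on \<Omega>" "\<lambda>x. \<bar>u x\<bar> powr p" "\<lambda>_. 0"] by auto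
    qed
    then show ?thesis by (intro exI[of _ 0]) simp
  next
    case False
    have pn: "CARD('n) \<ge> 2 \<longrightarrow> p \<le> real CARD('n) / (real CARD('n) - 1)" using assms(10) by blast
    obtain C0 where C0: "C0 \<ge> 0" "\<And>u. integrable lborel u \<Longrightarrow> tgv_dual_bound \<Omega> u \<Longrightarrow>
       \<exists>a b. (\<integral>\<^sup>+x. ennreal (\<bar>u x - (a + b \<bullet> x)\<bar> powr p) * indicator \<Omega> x \<partial>lborel) \<le> ennreal C0"
      using tgv_poincare_domain[OF \<Omega> \<open>connected \<Omega>\<close> \<open>C1_boundary \<Omega>\<close> p1 pn] unfolding tgv_poincare_def by blast
    obtain \<theta> where \<theta>: "\<theta> > 0" and dual: "\<And>u w M. M > 0 \<Longrightarrow> u \<in> borel_measurable (lebesgue_on \<Omega>) \<Longrightarrow> TGV2 \<phi> \<Omega> \<alpha>1 \<alpha>2 u \<le> ereal M \<Longrightarrow>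
        w \<in> borel_measurable borel \<Longrightarrow> (\<forall>x. x \<notin> \<Omega> \<longrightarrow> w x = 0) \<Longrightarrow> (AE x in lebesgue. x \<in> \<Omega> \<longrightarrow> u x = w x) \<Longrightarrow>
        tgv_dual_bound \<Omega> (\<lambda>x. \<theta> / M * w x)"
      using tgv_dual_bound_of_TGV2[OF Phi A0 \<Omega> \<alpha>] by blast
    \<comment> \<open>K acting on coefficient pairs. The hypothesis on K gives an affine function
      vanishing on \<Omega>; \<open>affine_coeff_bound\<close> with m = 0 then shows that the
      coefficients vanish.\<close>
    define \<Lambda> where "\<Lambda> z = K (\<lambda>x. fst z + snd z \<bullet> x)" for z :: "real \<times> (real, 'n) vec"
    have \<Lambda>lin: "linear \<Lambda>"
    proof (rule linearI)
      fix y z :: "real \<times> (real, 'n) vec" and a :: real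
      show "\<Lambda> (y + z) = \<Lambda> y + \<Lambda> z"
        using K_lin[OF affL(1)[of "fst y" "snd y"] affL(1)[of "fst z" "snd z"], of 1 1]
        by (simp add: \<Lambda>_def inner_add_left algebra_simps)
      show "\<Lambda> (a *\<^sub>R z) = a *\<^sub>R \<Lambda> z"
        using K_scale[OF affL(1)[of "fst z" "snd z"], of a] by (simp add: \<Lambda>_def distrib_left)
    qed
    have \<Lambda>inj: "z = 0" if "\<Lambda> z = 0" for z
    proof -
      have "\<Lambda> 0 = 0" using linear_0[OF \<Lambda>lin] .
      then have "K (\<lambda>x. fst z + snd z \<bullet> x) = K (\<lambda>x. 0 + 0 \<bullet> x)" using that by (simp add: \<Lambda>_def)
      from K_inj_affine[OF this] have zero: "\<And>x. x \<in> \<Omega> \<Longrightarrow> fst z + snd z \<bullet> x = 0" by simp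
      have i0: "(\<integral>\<^sup>+x. ennreal \<bar>fst z + snd z \<bullet> x\<bar> * indicator \<Omega> x \<partial>lborel) \<le> ennreal 0"
      proof -
        have "(\<integral>\<^sup>+x. ennreal \<bar>fst z + snd z \<bullet> x\<bar> * indicator \<Omega> x \<partial>lborel) = (\<integral>\<^sup>+(x :: (real, 'n) vec). 0 \<partial>lborel)"
          by (rule nn_integral_cong) (auto simp: indicator_def zero)
        then show ?thesis by simp
      qed
      have "\<bar>fst z\<bar> + norm (snd z) \<le> 0"
      proof (rule affine_coeff_bound[OF \<Omega>(1) False])
        fix C' :: real
        assume "\<And>c b m. 0 \<le> m \<Longrightarrow> (\<integral>\<^sup>+x. ennreal \<bar>c + b \<bullet> x\<bar> * indicator \<Omega> x \<partial>lborel) \<le> ennreal m \<Longrightarrow> \<bar>c\<bar> + norm b \<le> C' * m"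
        from this[OF order_refl i0] show ?thesis by simp
      qed
      then have "\<bar>fst z\<bar> = 0" "norm (snd z) = 0" using norm_ge_zero[of "snd z"] abs_ge_zero[of "fst z"] by linarith+
      then show "z = 0" by (simp add: prod_eq_iff)
    qed
    obtain \<kappa> where \<kappa>: "\<kappa> > 0" "\<And>z. \<kappa> * norm z \<le> norm (\<Lambda> z)"
      using injective_linear_bounded_below[OF \<Lambda>lin \<Lambda>inj] by blast
    \<comment> \<open>The level of \<open>S 0\<close>, since
      \<open>1 / real (Suc 0) = 1\<close>.\<close>
    define M where "M = m + 1"
    have M: "M > 0" using m0 by (simp add: M_def)
    define s where "s = \<theta> / M"
    have s: "s > 0" using \<theta> M by (simp add: s_def)
    \<comment> \<open>Bounds the image of the affine part, which is
      \<open>s *\<^sub>R K u - K g\<close>: the zero field gives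
      \<open>norm (K u) \<le> norm f + 2 * M\<close>, and the Poincare constant C0 bounds the energy
      of the remainder g.\<close>
    define B1 where "B1 = s * (norm f + 2 * M) + CK * C0 powr (1/p)"
    have B1: "0 \<le> B1" using s M CK by (simp add: B1_def)
    \<comment> \<open>Energy of an affine function whose coefficients are at most
      \<open>B1 / \<kappa>\<close> each, on a domain contained in a ball of radius R.\<close>
    define B2 where "B2 = (2 * (B1 / \<kappa>) * (1 + R)) powr p * measure (lebesgue_on \<Omega>) (space (lebesgue_on \<Omega>))"
    define B where "B = (1/s) powr p * (2 powr p * (C0 + B2))"
    have "En u \<le> B" if u: "u \<in> S 0" for u
    proof -
      have uL: "u \<in> Lp" and Ju: "\<And>\<psi>. Adm \<psi> \<Longrightarrow> 1/2 * norm (K u - f) + I u \<psi> \<le> M"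
        using u unfolding S_def J_le M_def by auto
      have K2: "norm (K u) \<le> norm f + 2 * M"
        using Ju[OF Adm0] I0[of u] norm_triangle_ineq2[of "K u" f] by simp
      have TV: "TGV2 \<phi> \<Omega> \<alpha>1 \<alpha>2 u \<le> ereal M" unfolding TGV_le
      proof (intro allI impI)
        fix \<psi> assume "Adm \<psi>"
        from Ju[OF this] norm_ge_zero[of "K u - f"] show "I u \<psi> \<le> M" by linarith
      qed
      obtain w where w: "w \<in> borel_measurable borel" "\<And>x. x \<notin> \<Omega> \<Longrightarrow> w x = 0" "AE x in lebesgue. x \<in> \<Omega> \<longrightarrow> u x = w x"
        using lebesgue_on_borel_representative[OF \<Omega>(1) LpD(1)[OF uL]] by blast
      have "integrable lborel w"
        using integral_lebesgue_on_representative(2)[OF \<Omega>(1) w LpD(1)[OF uL]] Lp_integrable[OF uL] by simp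
      then have wi: "integrable lborel (\<lambda>x. \<theta> / M * w x)" by simp
      have "tgv_dual_bound \<Omega> (\<lambda>x. \<theta> / M * w x)"
        by (rule dual[OF M LpD(1)[OF uL] TV w(1) _ w(3)]) (use w(2) in blast)
      then obtain a b where ab: "(\<integral>\<^sup>+x. ennreal (\<bar>s * w x - (a + b \<bullet> x)\<bar> powr p) * indicator \<Omega> x \<partial>lborel) \<le> ennreal C0"
        using C0(2)[OF wi] unfolding s_def by blast
      define g where "g x = s * u x - (a + b \<bullet> x)" for x
      have gL: "g \<in> Lp" unfolding g_def by (rule Lp_diff[OF Lp_scale(1)[OF uL] affL(1)])
      have Eg: "En g \<le> C0"
      proof -
        define h where "h x = indicator \<Omega> x * \<bar>s * w x - (a + b \<bullet> x)\<bar> powr p" for x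
        have \<Omega>b: "\<Omega> \<in> sets borel" using \<Omega> by simp
        have hm: "h \<in> borel_measurable borel" unfolding h_def using w(1) \<Omega>b by measurable
        have rep: "AE x in lebesgue. x \<in> \<Omega> \<longrightarrow> \<bar>g x\<bar> powr p = h x"
          using w(3) by eventually_elim (auto simp: h_def g_def)
        have gm: "(\<lambda>x. \<bar>g x\<bar> powr p) \<in> borel_measurable (lebesgue_on \<Omega>)" using LpD(2)[OF gL] by (rule borel_measurable_integrable)
        have h0: "\<And>x. x \<notin> \<Omega> \<Longrightarrow> h x = 0" by (simp add: h_def)
        note ri = integral_lebesgue_on_representative[OF \<Omega>(1) hm h0 rep gm]
        have hi: "integrable lborel h" using ri(2) LpD(2)[OF gL] by simp
        have "ennreal (En g) = ennreal (LINT x|lborel. h x)" unfolding En_def by (simp add: ri(1))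
        also have "\<dots> = (\<integral>\<^sup>+x. ennreal (h x) \<partial>lborel)" by (rule nn_integral_eq_integral[symmetric, OF hi]) (simp add: h_def)
        also have "\<dots> = (\<integral>\<^sup>+x. ennreal (\<bar>s * w x - (a + b \<bullet> x)\<bar> powr p) * indicator \<Omega> x \<partial>lborel)"
          by (rule nn_integral_cong) (auto simp: h_def indicator_def)
        also have "\<dots> \<le> ennreal C0" by (rule ab)
        finally show ?thesis using C0(1) by (subst (asm) ennreal_le_iff) auto
      qed
      have Kg: "norm (K g) \<le> CK * C0 powr (1/p)"
      proof -
        have "norm (K g) \<le> CK * En g powr (1/p)" by (rule CK(2)[OF gL])
        also have "\<dots> \<le> CK * C0 powr (1/p)" using CK(1) Eg En_nonneg p1 by (intro mult_left_mono powr_mono2) auto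
        finally show ?thesis .
      qed
      have "\<Lambda> (a, b) = s *\<^sub>R K u - K g"
        unfolding g_def K_diff[OF Lp_scale(1)[OF uL] affL(1)] K_scale[OF uL] by (simp add: \<Lambda>_def)
      then have "norm (\<Lambda> (a, b)) \<le> s * norm (K u) + norm (K g)"
        using norm_triangle_ineq4[of "s *\<^sub>R K u" "K g"] s by simp
      also have "\<dots> \<le> B1" unfolding B1_def using K2 Kg s by (intro add_mono mult_left_mono) auto
      finally have "\<kappa> * norm (a, b) \<le> B1" using \<kappa>(2)[of "(a, b)"] by linarith
      then have nab: "norm (a, b) \<le> B1 / \<kappa>" using \<kappa>(1) by (simp add: field_simps)
      have "\<bar>a\<bar> \<le> norm (a, b)" "norm b \<le> norm (a, b)" using norm_fst_le[of a b] norm_snd_le[of b a] by auto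
      then have ab2: "\<bar>a\<bar> + norm b \<le> 2 * (B1 / \<kappa>)" using nab by linarith
      have Ea: "En (\<lambda>x. a + b \<bullet> x) \<le> B2"
      proof -
        have "((\<bar>a\<bar> + norm b) * (1 + R)) powr p \<le> (2 * (B1 / \<kappa>) * (1 + R)) powr p"
          using ab2 R(1) p1 by (intro powr_mono2 mult_right_mono) auto
        then have "((\<bar>a\<bar> + norm b) * (1 + R)) powr p * measure (lebesgue_on \<Omega>) (space (lebesgue_on \<Omega>)) \<le> B2"
          unfolding B2_def by (rule mult_right_mono) simp
        then show ?thesis using affL(2)[of a b] by linarith
      qed
      have ug: "u = (\<lambda>x. 1/s * (g x + (a + b \<bullet> x)))" using s by (auto simp: g_def)
      have sumL: "(\<lambda>x. g x + (a + b \<bullet> x)) \<in> Lp" by (rule Lp_add(1)[OF gL affL(1)])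
      have "En u = En (\<lambda>x. 1/s * (g x + (a + b \<bullet> x)))" using ug by metis
      also have "\<dots> = (1/s) powr p * En (\<lambda>x. g x + (a + b \<bullet> x))" using Lp_scale(2)[OF sumL, of "1/s"] s by simp
      also have "\<dots> \<le> (1/s) powr p * (2 powr p * (En g + En (\<lambda>x. a + b \<bullet> x)))"
        by (intro mult_left_mono Lp_add(2)[OF gL affL(1)]) simp
      also have "\<dots> \<le> B" unfolding B_def by (intro mult_left_mono add_mono Eg Ea) auto
      finally show ?thesis .
    qed
    then show ?thesis by blast
  qed
  then obtain B where B: "\<And>u. u \<in> S 0 \<Longrightarrow> En u \<le> B" by blast
  have SLp: "S k \<subseteq> Lp" for k by (auto simp: S_def)
  have "\<exists>v. (\<forall>k. v k \<in> S k) \<and> (\<forall>e>0. \<exists>N. \<forall>i\<ge>N. \<forall>j\<ge>N. En (\<lambda>x. v i x - v j x) \<le> e)"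
    by (rule nested_midpoint_convex_Cauchy[OF SLp S_ne S_mono S_mid B])
  then obtain v where v: "\<And>k. v k \<in> S k" and Cauchy: "\<forall>e>0. \<exists>N. \<forall>i\<ge>N. \<forall>j\<ge>N. En (\<lambda>x. v i x - v j x) \<le> e"
    by blast
  have vL: "v k \<in> Lp" for k using v SLp by blast
  have "\<exists>w\<in>Lp. (\<lambda>k. En (\<lambda>x. v k x - w x)) \<longlonglongrightarrow> 0"
    by (rule Lp_complete[OF vL Cauchy[rule_format]])
  then obtain u where u: "u \<in> Lp" and lim: "(\<lambda>k. En (\<lambda>x. v k x - u x)) \<longlonglongrightarrow> 0"
    by blast
  have Klim: "(\<lambda>k. K (v k)) \<longlonglongrightarrow> K u"
  proof -
    have "(\<lambda>k. CK * En (\<lambda>x. v k x - u x) powr (1/p)) \<longlonglongrightarrow> CK * 0 powr (1/p)"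
      using lim p1 En_nonneg by (intro tendsto_mult tendsto_const tendsto_powr') auto
    then have z: "(\<lambda>k. CK * En (\<lambda>x. v k x - u x) powr (1/p)) \<longlonglongrightarrow> 0" by simp
    have "(\<lambda>k. K (v k) - K u) \<longlonglongrightarrow> 0"
    proof (rule Lim_null_comparison[OF _ z])
      have "norm (K (v k) - K u) \<le> CK * En (\<lambda>x. v k x - u x) powr (1/p)" for k
        using CK(2)[OF Lp_diff[OF vL u]] K_diff[OF vL u] by simp
      then show "\<forall>\<^sub>F k in sequentially. norm (K (v k) - K u) \<le> CK * En (\<lambda>x. v k x - u x) powr (1/p)" by simp
    qed
    then show ?thesis by (simp add: LIM_zero_iff)
  qed
  have L1lim: "(\<lambda>k. LINT x|lebesgue_on \<Omega>. \<bar>v k x - u x\<bar>) \<longlonglongrightarrow> 0"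
  proof (rule LIMSEQ_I)
    fix e :: real assume e: "e > 0"
    define mu where "mu = measure (lebesgue_on \<Omega>) (space (lebesgue_on \<Omega>)) + 1"
    have mu: "0 < mu" "measure (lebesgue_on \<Omega>) (space (lebesgue_on \<Omega>)) \<le> mu" by (auto simp: mu_def intro: add_nonneg_pos)
    define e1 where "e1 = e / (2 * mu)"
    have e1: "e1 > 0" using e mu by (simp add: e1_def)
    have "\<forall>\<^sub>F k in sequentially. En (\<lambda>x. v k x - u x) < e / 2 / e1 powr (1 - p)"
      using lim e e1 by (intro order_tendstoD) auto
    then obtain N where N: "\<And>k. k \<ge> N \<Longrightarrow> En (\<lambda>x. v k x - u x) < e / 2 / e1 powr (1 - p)" by (auto simp: eventually_sequentially)
    have "norm ((LINT x|lebesgue_on \<Omega>. \<bar>v k x - u x\<bar>) - 0) < e" if "k \<ge> N" for k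
    proof -
      have "(LINT x|lebesgue_on \<Omega>. \<bar>v k x - u x\<bar>) \<le> e1 * measure (lebesgue_on \<Omega>) (space (lebesgue_on \<Omega>)) + e1 powr (1 - p) * En (\<lambda>x. v k x - u x)"
        by (rule L1_le_En[OF Lp_diff[OF vL u] e1])
      also have "\<dots> < e1 * mu + e1 powr (1 - p) * (e / 2 / e1 powr (1 - p))"
        using N[OF that] e1 mu by (intro add_le_less_mono mult_left_mono mult_strict_left_mono) auto
      also have "\<dots> = e" using e1 mu by (simp add: e1_def)
      finally show ?thesis by simp
    qed
    then show "\<exists>N. \<forall>k\<ge>N. norm ((LINT x|lebesgue_on \<Omega>. \<bar>v k x - u x\<bar>) - 0) < e" by blast
  qed
  have Ilim: "(\<lambda>k. I (v k) \<psi>) \<longlonglongrightarrow> I u \<psi>" if adm: "admissible_field \<Omega> \<psi>" for \<psi>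
  proof -
    obtain B where B: "B \<ge> 0" "\<And>x. \<bar>div2_field \<psi> x\<bar> \<le> B" using d2_bounded[OF adm] by blast
    have z: "(\<lambda>k. B * (LINT x|lebesgue_on \<Omega>. \<bar>v k x - u x\<bar>)) \<longlonglongrightarrow> 0" using tendsto_mult_left[OF L1lim, of B] by simp
    have "(\<lambda>k. I (v k) \<psi> - I u \<psi>) \<longlonglongrightarrow> 0"
    proof (rule Lim_null_comparison[OF _ z])
      have "norm (I (v k) \<psi> - I u \<psi>) \<le> B * (LINT x|lebesgue_on \<Omega>. \<bar>v k x - u x\<bar>)" for k
      proof -
        have "I (v k) \<psi> - I u \<psi> = (LINT x|lebesgue_on \<Omega>. (v k x - u x) * div2_field \<psi> x)"
          unfolding I_def using I_int[OF vL adm] I_int[OF u adm] by (simp add: left_diff_distrib)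
        also have "\<bar>\<dots>\<bar> \<le> (LINT x|lebesgue_on \<Omega>. B * \<bar>v k x - u x\<bar>)"
        proof (rule abs_integral_le_integral)
          show "integrable (lebesgue_on \<Omega>) (\<lambda>x. (v k x - u x) * div2_field \<psi> x)" by (rule I_int[OF Lp_diff[OF vL u] adm])
          show "integrable (lebesgue_on \<Omega>) (\<lambda>x. B * \<bar>v k x - u x\<bar>)" using Lp_integrable[OF Lp_diff[OF vL u]] by simp
          show "\<bar>(v k x - u x) * div2_field \<psi> x\<bar> \<le> B * \<bar>v k x - u x\<bar>" for x
            using mult_left_mono[OF B(2)[of x], of "\<bar>v k x - u x\<bar>"] by (simp add: abs_mult mult.commute)
        qed
        finally show ?thesis by simp
      qed
      then show "\<forall>\<^sub>F k in sequentially. norm (I (v k) \<psi> - I u \<psi>) \<le> B * (LINT x|lebesgue_on \<Omega>. \<bar>v k x - u x\<bar>)" by simp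
    qed
    then show ?thesis by (simp add: LIM_zero_iff)
  qed
  \<comment> \<open>Lower semicontinuity: the limit is taken for each fixed field, the supremum over
    the fields afterwards.\<close>
  have Ju: "J u \<le> ereal m"
    unfolding J_le
  proof (intro allI impI)
    fix \<psi> assume \<psi>: "Adm \<psi>"
    have l: "(\<lambda>k. 1/2 * norm (K (v k) - f) + I (v k) \<psi>) \<longlonglongrightarrow> 1/2 * norm (K u - f) + I u \<psi>"
      using \<psi> by (intro tendsto_intros Klim Ilim) (simp add: Adm_def)
    have r: "(\<lambda>k. m + 1 / real (Suc k)) \<longlonglongrightarrow> m + 0" by (intro tendsto_intros LIMSEQ_Suc[OF lim_1_over_n])
    have "1/2 * norm (K (v k) - f) + I (v k) \<psi> \<le> m + 1 / real (Suc k)" for k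
      using v[of k] \<psi> unfolding S_def J_le by blast
    then show "1/2 * norm (K u - f) + I u \<psi> \<le> m" using LIMSEQ_le[OF l r] by auto
  qed
  have "J u \<le> J v'" if v': "v' \<in> Lp" for v'
  proof (rule ccontr)
    assume "\<not> J u \<le> J v'"
    \<comment> \<open>A value below m would leave room for a real number c in between, which would
      belong to V and contradict the choice of m.\<close>
    then have "J v' < ereal m" using Ju by (meson not_le less_le_trans)
    then obtain c where c: "J v' < ereal c" "ereal c < ereal m" using ereal_dense2 by blast
    then have "c \<in> V" using v' by (auto simp: V_def intro: less_imp_le)
    then have "m \<le> c" unfolding m_def using bddV by (intro cInf_lower)
    then show False using c by simp
  qed
  then show ?thesis using u unfolding Lp_eq J_def by blast
qed

end
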